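(* Let $\mathsf{T}$ be a rigidly-compactly generated tensor-triangulated category and let $\mathcal{B}\in\mathsf{Spc}^{\mathsf{h}}(\mathsf{T}^{\mathrm{c}})$ be a homological prime. Then $\mathsf{Def}^{\otimes}(E_{\mathcal{B}})=\mathscr{D}(\mathcal{B})$. In particular, $\mathsf{Def}^{\otimes}(E_{\mathcal{B}})$ is a simple $\otimes$-closed definable subcategory of $\mathsf{T}$.
   Context: A rigidly-compactly generated tensor-triangulated category is a compactly generated triangulated category $\mathsf{T}$ with a closed symmetric monoidal structure ($\otimes$, internal hom $\underline{\mathrm{Hom}}$, unit $\mathbb{1}$), with $\otimes$ and $\underline{\mathrm{Hom}}$ exact in both variables, in which compact objects coincide with rigid objects ($X$ is rigid if $\underline{\mathrm{Hom}}(X,\mathbb{1})\otimes Y\to\underline{\mathrm{Hom}}(X,Y)$ is an isomorphism for all $Y$). $\mathsf{T}^{\mathrm{c}}$ is the full subcategory of compact objects; $\mathrm{Mod}(\mathsf{T}^{\mathrm{c}})$ is the category of additive functors $(\mathsf{T}^{\mathrm{c}})^{\mathrm{op}}\to\mathsf{Ab}$, with the Day convolution tensor product (cocontinuous in each variable, $\boldsymbol{y}(X\otimes Y)=\boldsymbol{y}X\otimes\boldsymbol{y}Y$ for compact $X,Y$), $\mathrm{mod}(\mathsf{T}^{\mathrm{c}})$ its full subcategory of finitely presented objects, and $\boldsymbol{y}X=\mathrm{Hom}_{\mathsf{T}}(-,X)|_{\mathsf{T}^{\mathrm{c}}}$ the restricted Yoneda functor. $X\in\mathsf{T}$ is pure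 injective if $\boldsymbol{y}X$ is injective; $\boldsymbol{y}$ restricts to an equivalence from pure injectives of $\mathsf{T}$ to injectives of $\mathrm{Mod}(\mathsf{T}^{\mathrm{c}})$. A functor $\mathsf{T}\to\mathsf{Ab}$ is coherent if it is the cokernel of $\mathrm{Hom}_{\mathsf{T}}(A,-)\to\mathrm{Hom}_{\mathsf{T}}(B,-)$ with $A,B$ compact. A full subcategory of $\mathsf{T}$ is definable if it is the class of objects on which a set of coherent functors vanishes; a definable $\mathcal{D}$ is $\otimes$-closed if $Y\otimes X\in\mathcal{D}$ for all $X\in\mathcal{D}$, $Y\in\mathsf{T}$. $\mathsf{Def}^{\otimes}(X)$ is the smallest $\otimes$-closed definable subcategory containing $X$. A $\otimes$-closed definable subcategory is simple if it contains no nonzero proper $\otimes$-closed definable subcategories. A homological prime is a maximal proper Serre $\otimes$-ideal $\mathcal{B}$ of $\mathrm{mod}(\mathsf{T}^{\mathrm{c}})$; $\mathsf{Spc}^{\mathsf{h}}(\mathsf{T}^{\mathrm{c}})$ is the set of these. Let $\varinjlim\mathcal{B}$ be the class of filtered colimits in $\mathrm{Mod}(\mathsf{T}^{\mathrm{c}})$ of objects of $\mathcal{B}$, $Q\colon\mathrm{Mod}(\mathsf{T}^{\mathrm{c}})\to\mathrm{Mod}(\mathsf{T}^{\mathrm{c}})/\varinjlim\mathcal{B}$ the Gabriel localisation, $R$ its right adjoint. $E_{\mathcal{B}}$ is the pure injective object of $\mathsf{T}$, unique up to isomorphism, with $\boldsymbol{y}E_{\mathcal{B}}\simeq R(E(Q\boldsymbol{y}\mathbb{1}))$,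 where $E(-)$ is the injective hull. For a Serre subcategory $\mathcal{S}$ of $\mathrm{mod}(\mathsf{T}^{\mathrm{c}})$, $\mathscr{D}(\mathcal{S})=\{X\in\mathsf{T}:\mathrm{Hom}(f,\boldsymbol{y}X)=0\text{ for all }f\in\mathcal{S}\}$. *)

theory Defs
  imports "HOL-Algebra.Free_Abelian_Groups" "HOL.Hull"
begin

section \<open>Size\<close>

text \<open>
  A type of class universe has strongly inaccessible cardinality, so that it plays the role of
  the class of all sets: up to bijection, its subsets are the classes, and its subsets of strictly
  smaller cardinality are the sets.  The triangulated category has its arrows in such a type;
  "set-indexed", "locally small", "a set of" all refer to it.
\<close>

class universe =
  assumes universe_uncountable: "(UNIV :: nat set) \<prec> (UNIV :: 'a set)"
    and universe_power: "(A :: 'a set) \<prec> (UNIV :: 'a set) \<Longrightarrow> Pow A \<prec> (UNIV :: 'a set)"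
    and universe_union:
      "\<lbrakk>(A :: 'a set) \<prec> (UNIV :: 'a set); \<And>a. a \<in> A \<Longrightarrow> (F a :: 'a set) \<prec> (UNIV :: 'a set)\<rbrakk>
        \<Longrightarrow> (\<Union>a\<in>A. F a) \<prec> (UNIV :: 'a set)"

definition small :: "'v::universe itself \<Rightarrow> 'a set \<Rightarrow> bool" where
  "small _ A \<longleftrightarrow> A \<prec> (UNIV :: 'v set)"


section \<open>Categories\<close>

record ('o, 'm) category =
  Ob :: "'o set"
  Hom :: "'o \<Rightarrow> 'o \<Rightarrow> 'm set"
  Comp :: "'m \<Rightarrow> 'm \<Rightarrow> 'm" (infixl "\<cdot>\<index>" 70)
  Ident :: "'o \<Rightarrow> 'm"

locale category =
  fixes C :: "('o, 'm, 'z) category_scheme" (structure)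
  assumes hom_objects: "f \<in> Hom C A B \<Longrightarrow> A \<in> Ob C \<and> B \<in> Ob C"
    and hom_disjoint: "\<lbrakk>f \<in> Hom C A B; f \<in> Hom C A' B'\<rbrakk> \<Longrightarrow> A = A' \<and> B = B'"
    and ident_hom: "A \<in> Ob C \<Longrightarrow> Ident C A \<in> Hom C A A"
    and comp_hom: "\<lbrakk>f \<in> Hom C A B; g \<in> Hom C B D\<rbrakk> \<Longrightarrow> g \<cdot> f \<in> Hom C A D"
    and comp_ident: "f \<in> Hom C A B \<Longrightarrow> f \<cdot> Ident C A = f"
    and ident_comp: "f \<in> Hom C A B \<Longrightarrow> Ident C B \<cdot> f = f"
    and comp_assoc: "\<lbrakk>f \<in> Hom C A B; g \<in> Hom C B D; h \<in> Hom C D E\<rbrakk>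
          \<Longrightarrow> (h \<cdot> g) \<cdot> f = h \<cdot> (g \<cdot> f)"

definition dom_of :: "('o, 'm, 'z) category_scheme \<Rightarrow> 'm \<Rightarrow> 'o" where
  "dom_of C f = (THE A. \<exists>B. f \<in> Hom C A B)"

definition cod_of :: "('o, 'm, 'z) category_scheme \<Rightarrow> 'm \<Rightarrow> 'o" where
  "cod_of C f = (THE B. \<exists>A. f \<in> Hom C A B)"

definition inverse_arrs :: "('o, 'm, 'z) category_scheme \<Rightarrow> 'o \<Rightarrow> 'o \<Rightarrow> 'm \<Rightarrow> 'm \<Rightarrow> bool" where
  "inverse_arrs C A B f g \<longleftrightarrow> f \<in> Hom C A B \<and> g \<in> Hom C B A \<and>
     g \<cdot>\<^bsub>C\<^esub> f = Ident C A \<and> f \<cdot>\<^bsub>C\<^esub> g = Ident C B"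

definition iso_arr :: "('o, 'm, 'z) category_scheme \<Rightarrow> 'o \<Rightarrow> 'o \<Rightarrow> 'm \<Rightarrow> bool" where
  "iso_arr C A B f \<longleftrightarrow> (\<exists>g. inverse_arrs C A B f g)"

definition inv_arr :: "('o, 'm, 'z) category_scheme \<Rightarrow> 'm \<Rightarrow> 'm" where
  "inv_arr C f = (THE g. \<exists>A B. inverse_arrs C A B f g)"

definition isomorphic :: "('o, 'm, 'z) category_scheme \<Rightarrow> 'o \<Rightarrow> 'o \<Rightarrow> bool" where
  "isomorphic C A B \<longleftrightarrow> (\<exists>f. iso_arr C A B f)"

definition monic :: "('o, 'm, 'z) category_scheme \<Rightarrow> 'o \<Rightarrow> 'o \<Rightarrow> 'm \<Rightarrow> bool" where
  "monic C A B f \<longleftrightarrow> f \<in> Hom C A B \<and>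
     (\<forall>X. \<forall>g\<in>Hom C X A. \<forall>h\<in>Hom C X A. f \<cdot>\<^bsub>C\<^esub> g = f \<cdot>\<^bsub>C\<^esub> h \<longrightarrow> g = h)"

definition zero_obj :: "('o, 'm, 'z) category_scheme \<Rightarrow> 'o \<Rightarrow> bool" where
  "zero_obj C Z \<longleftrightarrow> Z \<in> Ob C \<and> (\<forall>X\<in>Ob C. (\<exists>!f. f \<in> Hom C X Z) \<and> (\<exists>!f. f \<in> Hom C Z X))"

definition zero_arr :: "('o, 'm, 'z) category_scheme \<Rightarrow> 'o \<Rightarrow> 'o \<Rightarrow> 'm \<Rightarrow> bool" where
  "zero_arr C A B f \<longleftrightarrow>
     (\<exists>Z. zero_obj C Z \<and> (\<exists>g\<in>Hom C A Z. \<exists>h\<in>Hom C Z B. f = h \<cdot>\<^bsub>C\<^esub> g))"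

definition is_kernel ::
  "('o, 'm, 'z) category_scheme \<Rightarrow> 'o \<Rightarrow> 'm \<Rightarrow> 'o \<Rightarrow> 'o \<Rightarrow> 'm \<Rightarrow> bool" where
  "is_kernel C K k A B f \<longleftrightarrow> k \<in> Hom C K A \<and> f \<in> Hom C A B \<and> zero_arr C K B (f \<cdot>\<^bsub>C\<^esub> k) \<and>
     (\<forall>X. \<forall>g\<in>Hom C X A. zero_arr C X B (f \<cdot>\<^bsub>C\<^esub> g) \<longrightarrow> (\<exists>!u. u \<in> Hom C X K \<and> k \<cdot>\<^bsub>C\<^esub> u = g))"

definition is_cokernel ::
  "('o, 'm, 'z) category_scheme \<Rightarrow> 'o \<Rightarrow> 'o \<Rightarrow> 'm \<Rightarrow> 'o \<Rightarrow> 'm \<Rightarrow> bool" where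
  "is_cokernel C A B f Q q \<longleftrightarrow> f \<in> Hom C A B \<and> q \<in> Hom C B Q \<and> zero_arr C A Q (q \<cdot>\<^bsub>C\<^esub> f) \<and>
     (\<forall>X. \<forall>g\<in>Hom C B X. zero_arr C A X (g \<cdot>\<^bsub>C\<^esub> f) \<longrightarrow> (\<exists>!u. u \<in> Hom C Q X \<and> u \<cdot>\<^bsub>C\<^esub> q = g))"

definition short_exact ::
  "('o, 'm, 'z) category_scheme \<Rightarrow> 'o \<Rightarrow> 'm \<Rightarrow> 'o \<Rightarrow> 'm \<Rightarrow> 'o \<Rightarrow> bool" where
  "short_exact C A f B g D \<longleftrightarrow> is_kernel C A f B D g \<and> is_cokernel C A B f D g"

definition is_coproduct ::
  "('o, 'm, 'z) category_scheme \<Rightarrow> 'i set \<Rightarrow> ('i \<Rightarrow> 'o) \<Rightarrow> 'o \<Rightarrow> ('i \<Rightarrow> 'm) \<Rightarrow> bool" where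
  "is_coproduct C I X P \<iota> \<longleftrightarrow> P \<in> Ob C \<and> (\<forall>i\<in>I. \<iota> i \<in> Hom C (X i) P) \<and>
     (\<forall>Y\<in>Ob C. \<forall>f. (\<forall>i\<in>I. f i \<in> Hom C (X i) Y) \<longrightarrow>
        (\<exists>!h. h \<in> Hom C P Y \<and> (\<forall>i\<in>I. h \<cdot>\<^bsub>C\<^esub> \<iota> i = f i)))"

definition injective_obj :: "('o, 'm, 'z) category_scheme \<Rightarrow> 'o \<Rightarrow> bool" where
  "injective_obj C J \<longleftrightarrow> J \<in> Ob C \<and>
     (\<forall>A B i. monic C A B i \<longrightarrow> (\<forall>f\<in>Hom C A J. \<exists>g\<in>Hom C B J. g \<cdot>\<^bsub>C\<^esub> i = f))"

definition essential_monic :: "('o, 'm, 'z) category_scheme \<Rightarrow> 'o \<Rightarrow> 'o \<Rightarrow> 'm \<Rightarrow> bool" where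
  "essential_monic C A B i \<longleftrightarrow> monic C A B i \<and>
     (\<forall>X. \<forall>g\<in>Hom C B X. monic C A X (g \<cdot>\<^bsub>C\<^esub> i) \<longrightarrow> monic C B X g)"

definition injective_hull :: "('o, 'm, 'z) category_scheme \<Rightarrow> 'o \<Rightarrow> 'o \<Rightarrow> bool" where
  "injective_hull C A J \<longleftrightarrow> injective_obj C J \<and> (\<exists>i. essential_monic C A J i)"

definition full_sub :: "('o, 'm, 'z) category_scheme \<Rightarrow> 'o set \<Rightarrow> ('o, 'm, 'z) category_scheme" where
  "full_sub C S = C\<lparr>Ob := Ob C \<inter> S, Hom := \<lambda>A B. if A \<in> S \<and> B \<in> S then Hom C A B else {}\<rparr>"


subsection \<open>Functors and adjunctions\<close>

record ('o, 'm, 'p, 'n) ftr =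
  FOb :: "'o \<Rightarrow> 'p"
  FMor :: "'m \<Rightarrow> 'n"

definition is_functor ::
  "('o, 'm, 'z) category_scheme \<Rightarrow> ('p, 'n, 'y) category_scheme \<Rightarrow> ('o, 'm, 'p, 'n) ftr \<Rightarrow> bool"
  where
  "is_functor C D F \<longleftrightarrow>
     (\<forall>A\<in>Ob C. FOb F A \<in> Ob D \<and> FMor F (Ident C A) = Ident D (FOb F A)) \<and>
     (\<forall>A B. \<forall>f\<in>Hom C A B. FMor F f \<in> Hom D (FOb F A) (FOb F B)) \<and>
     (\<forall>A B E. \<forall>f\<in>Hom C A B. \<forall>g\<in>Hom C B E. FMor F (g \<cdot>\<^bsub>C\<^esub> f) = FMor F g \<cdot>\<^bsub>D\<^esub> FMor F f)"

definition is_right_adjoint ::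
  "('o, 'm, 'z) category_scheme \<Rightarrow> ('p, 'n, 'y) category_scheme \<Rightarrow>
   ('o, 'm, 'p, 'n) ftr \<Rightarrow> ('p, 'n, 'o, 'm) ftr \<Rightarrow> bool" where
  "is_right_adjoint C D Q R \<longleftrightarrow> is_functor C D Q \<and> is_functor D C R \<and>
     (\<exists>\<Phi>. (\<forall>X\<in>Ob C. \<forall>Y\<in>Ob D. bij_betw (\<Phi> X Y) (Hom D (FOb Q X) Y) (Hom C X (FOb R Y))) \<and>
       (\<forall>X X' Y Y'. \<forall>h\<in>Hom C X' X. \<forall>k\<in>Hom D Y Y'. \<forall>g\<in>Hom D (FOb Q X) Y.
          \<Phi> X' Y' (k \<cdot>\<^bsub>D\<^esub> g \<cdot>\<^bsub>D\<^esub> FMor Q h) = FMor R k \<cdot>\<^bsub>C\<^esub> \<Phi> X Y g \<cdot>\<^bsub>C\<^esub> h))"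


subsection \<open>Filtered colimits\<close>

definition small_filtered :: "('v::universe, 'v) category \<Rightarrow> bool" where
  "small_filtered J \<longleftrightarrow> category J \<and> small TYPE('v) (Ob J) \<and>
     (\<forall>i j. small TYPE('v) (Hom J i j)) \<and> Ob J \<noteq> {} \<and>
     (\<forall>i\<in>Ob J. \<forall>j\<in>Ob J. \<exists>k. Hom J i k \<noteq> {} \<and> Hom J j k \<noteq> {}) \<and>
     (\<forall>i j. \<forall>f\<in>Hom J i j. \<forall>g\<in>Hom J i j. \<exists>k. \<exists>h\<in>Hom J j k. h \<cdot>\<^bsub>J\<^esub> f = h \<cdot>\<^bsub>J\<^esub> g)"

definition is_cocone ::
  "('j, 'k, 'y) category_scheme \<Rightarrow> ('o, 'm, 'z) category_scheme \<Rightarrow> ('j, 'k, 'o, 'm) ftr \<Rightarrow>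
   'o \<Rightarrow> ('j \<Rightarrow> 'm) \<Rightarrow> bool" where
  "is_cocone J C D X \<kappa> \<longleftrightarrow> X \<in> Ob C \<and> (\<forall>j\<in>Ob J. \<kappa> j \<in> Hom C (FOb D j) X) \<and>
     (\<forall>i j. \<forall>f\<in>Hom J i j. \<kappa> j \<cdot>\<^bsub>C\<^esub> FMor D f = \<kappa> i)"

definition is_colimit ::
  "('j, 'k, 'y) category_scheme \<Rightarrow> ('o, 'm, 'z) category_scheme \<Rightarrow> ('j, 'k, 'o, 'm) ftr \<Rightarrow>
   'o \<Rightarrow> ('j \<Rightarrow> 'm) \<Rightarrow> bool" where
  "is_colimit J C D X \<kappa> \<longleftrightarrow> is_cocone J C D X \<kappa> \<and>
     (\<forall>Y \<mu>. is_cocone J C D Y \<mu> \<longrightarrow> (\<exists>!u. u \<in> Hom C X Y \<and> (\<forall>j\<in>Ob J. u \<cdot>\<^bsub>C\<^esub> \<kappa> j = \<mu> j)))"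

definition filtered_colims ::
  "'v::universe itself \<Rightarrow> ('o, 'm, 'z) category_scheme \<Rightarrow> 'o set \<Rightarrow> 'o set" where
  "filtered_colims _ C S = {X. \<exists>(J :: ('v, 'v) category) D \<kappa>.
     small_filtered J \<and> is_functor J C D \<and> (\<forall>j\<in>Ob J. FOb D j \<in> S) \<and> is_colimit J C D X \<kappa>}"


subsection \<open>Serre subcategories and Gabriel localisation\<close>

text \<open>Kernels, cokernels and exactness only refer to zero objects, so no enrichment is needed.\<close>

definition serre :: "('o, 'm, 'z) category_scheme \<Rightarrow> 'o set \<Rightarrow> bool" where
  "serre C S \<longleftrightarrow> S \<subseteq> Ob C \<and> S \<noteq> {} \<and>
     (\<forall>A f B g D. short_exact C A f B g D \<longrightarrow> (B \<in> S \<longleftrightarrow> A \<in> S \<and> D \<in> S))"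

text \<open>
  The category of right fractions of C with respect to W.  An arrow from X to Y is an
  equivalence class of roofs, a roof being a pair (s, f) of arrows with common domain Z, where
  s goes from Z to X and lies in W, and f goes from Z to Y.
\<close>

definition roofs :: "('o, 'm, 'z) category_scheme \<Rightarrow> 'm set \<Rightarrow> 'o \<Rightarrow> 'o \<Rightarrow> ('m \<times> 'm) set" where
  "roofs C W X Y = {(s, f). \<exists>Z. s \<in> Hom C Z X \<and> s \<in> W \<and> f \<in> Hom C Z Y}"

definition roof_rel ::
  "('o, 'm, 'z) category_scheme \<Rightarrow> 'm set \<Rightarrow> 'o \<Rightarrow> 'o \<Rightarrow> (('m \<times> 'm) \<times> ('m \<times> 'm)) set" where
  "roof_rel C W X Y = {((s, f), (s', f')). (s, f) \<in> roofs C W X Y \<and> (s', f') \<in> roofs C W X Y \<and>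
     (\<exists>P. \<exists>u\<in>Hom C P (dom_of C s). \<exists>u'\<in>Hom C P (dom_of C s').
        s \<cdot>\<^bsub>C\<^esub> u \<in> W \<and> s \<cdot>\<^bsub>C\<^esub> u = s' \<cdot>\<^bsub>C\<^esub> u' \<and> f \<cdot>\<^bsub>C\<^esub> u = f' \<cdot>\<^bsub>C\<^esub> u')}"

definition fractions ::
  "('o, 'm, 'z) category_scheme \<Rightarrow> 'm set \<Rightarrow> ('o, 'o \<times> 'o \<times> ('m \<times> 'm) set) category" where
  "fractions C W = \<lparr>
     Ob = Ob C,
     Hom = \<lambda>X Y. if X \<in> Ob C \<and> Y \<in> Ob C
       then {(X, Y, \<phi>) | \<phi>. \<phi> \<in> roofs C W X Y // roof_rel C W X Y} else {},
     Comp = \<lambda>(_, Z, \<psi>) (X, _, \<phi>). (X, Z, {r. \<exists>(s, f)\<in>\<phi>. \<exists>(t, g)\<in>\<psi>.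
       \<exists>P. \<exists>t'\<in>Hom C P (dom_of C f). \<exists>f'\<in>Hom C P (dom_of C g).
         t' \<in> W \<and> f \<cdot>\<^bsub>C\<^esub> t' = t \<cdot>\<^bsub>C\<^esub> f' \<and> (r, (s \<cdot>\<^bsub>C\<^esub> t', g \<cdot>\<^bsub>C\<^esub> f')) \<in> roof_rel C W X Z}),
     Ident = \<lambda>X. (X, X, roof_rel C W X X `` {(Ident C X, Ident C X)})\<rparr>"

definition fractions_ftr ::
  "('o, 'm, 'z) category_scheme \<Rightarrow> 'm set \<Rightarrow> ('o, 'm, 'o, 'o \<times> 'o \<times> ('m \<times> 'm) set) ftr" where
  "fractions_ftr C W = \<lparr>
     FOb = \<lambda>X. X,
     FMor = \<lambda>f. (dom_of C f, cod_of C f,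
       roof_rel C W (dom_of C f) (cod_of C f) `` {(Ident C (dom_of C f), f)})\<rparr>"

definition iso_modulo :: "('o, 'm, 'z) category_scheme \<Rightarrow> 'o set \<Rightarrow> 'm set" where
  "iso_modulo C L = {f. \<exists>A B K k Q q. is_kernel C K k A B f \<and> is_cokernel C A B f Q q \<and>
     K \<in> L \<and> Q \<in> L}"

definition gabriel_quotient ::
  "('o, 'm, 'z) category_scheme \<Rightarrow> 'o set \<Rightarrow> ('o, 'o \<times> 'o \<times> ('m \<times> 'm) set) category" where
  "gabriel_quotient C L = fractions C (iso_modulo C L)"

definition gabriel_localisation ::
  "('o, 'm, 'z) category_scheme \<Rightarrow> 'o set \<Rightarrow> ('o, 'm, 'o, 'o \<times> 'o \<times> ('m \<times> 'm) set) ftr" where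
  "gabriel_localisation C L = fractions_ftr C (iso_modulo C L)"


section \<open>Additive categories and additive functors to abelian groups\<close>

record ('o, 'm) preadd = "('o, 'm) category" +
  PlusM :: "'m \<Rightarrow> 'm \<Rightarrow> 'm"
  ZeroM :: "'o \<Rightarrow> 'o \<Rightarrow> 'm"

definition hom_grp :: "('o, 'm, 'z) preadd_scheme \<Rightarrow> 'o \<Rightarrow> 'o \<Rightarrow> 'm monoid" where
  "hom_grp C A B = \<lparr>carrier = Hom C A B, monoid.mult = PlusM C, one = ZeroM C A B\<rparr>"

locale preadditive = category C for C :: "('o, 'm, 'z) preadd_scheme" (structure) +
  assumes hom_comm_group: "\<lbrakk>A \<in> Ob C; B \<in> Ob C\<rbrakk> \<Longrightarrow> comm_group (hom_grp C A B)"
    and comp_plus_left: "\<lbrakk>f \<in> Hom C A B; g \<in> Hom C B D; g' \<in> Hom C B D\<rbrakk>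
          \<Longrightarrow> PlusM C g g' \<cdot> f = PlusM C (g \<cdot> f) (g' \<cdot> f)"
    and comp_plus_right: "\<lbrakk>f \<in> Hom C A B; f' \<in> Hom C A B; g \<in> Hom C B D\<rbrakk>
          \<Longrightarrow> g \<cdot> PlusM C f f' = PlusM C (g \<cdot> f) (g \<cdot> f')"

locale additive = preadditive C for C :: "('o, 'm, 'z) preadd_scheme" (structure) +
  assumes ex_zero_obj: "\<exists>Z. zero_obj C Z"
    and ex_binary_coproduct: "\<lbrakk>A \<in> Ob C; B \<in> Ob C\<rbrakk>
          \<Longrightarrow> \<exists>P \<iota>. is_coproduct C (UNIV :: bool set) (\<lambda>b. if b then A else B) P \<iota>"

definition opp_cat :: "('o, 'm, 'z) preadd_scheme \<Rightarrow> ('o, 'm) preadd" where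
  "opp_cat C = \<lparr>Ob = Ob C, Hom = \<lambda>A B. Hom C B A, Comp = \<lambda>g f. f \<cdot>\<^bsub>C\<^esub> g, Ident = Ident C,
     PlusM = PlusM C, ZeroM = \<lambda>A B. ZeroM C B A\<rparr>"

definition additive_on ::
  "('o, 'm, 'z) preadd_scheme \<Rightarrow> ('p, 'n, 'y) preadd_scheme \<Rightarrow> ('o, 'm, 'p, 'n) ftr \<Rightarrow> bool" where
  "additive_on C D F \<longleftrightarrow> (\<forall>A B. \<forall>f\<in>Hom C A B. \<forall>g\<in>Hom C A B.
     FMor F (PlusM C f g) = PlusM D (FMor F f) (FMor F g))"

text \<open>
  An additive functor from C to small abelian groups; every small abelian group is isomorphic to
  one whose carrier is contained in the universe 'v.  Arrows are sent to functions of which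
  only the restriction to the carrier matters.
\<close>

type_synonym ('o, 'v) abfun = "('o, 'v, 'v monoid, 'v \<Rightarrow> 'v) ftr"

definition is_abfun :: "('o, 'v::universe, 'z) preadd_scheme \<Rightarrow> ('o, 'v) abfun \<Rightarrow> bool" where
  "is_abfun C F \<longleftrightarrow>
     (\<forall>A\<in>Ob C. comm_group (FOb F A) \<and> small TYPE('v) (carrier (FOb F A)) \<and>
        (\<forall>x\<in>carrier (FOb F A). FMor F (Ident C A) x = x)) \<and>
     (\<forall>A B. \<forall>f\<in>Hom C A B. FMor F f \<in> hom (FOb F A) (FOb F B)) \<and>
     (\<forall>A B D. \<forall>f\<in>Hom C A B. \<forall>g\<in>Hom C B D. \<forall>x\<in>carrier (FOb F A).
        FMor F (g \<cdot>\<^bsub>C\<^esub> f) x = FMor F g (FMor F f x)) \<and>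
     (\<forall>A B. \<forall>f\<in>Hom C A B. \<forall>g\<in>Hom C A B. \<forall>x\<in>carrier (FOb F A).
        FMor F (PlusM C f g) x = FMor F f x \<otimes>\<^bsub>FOb F B\<^esub> FMor F g x)"

text \<open>
  The category of additive functors from C to abelian groups.  An arrow is a triple of source,
  target and natural transformation, the components of the latter being extensional so that
  equality of arrows is equality of natural transformations.
\<close>

type_synonym ('o, 'v) abnat = "('o, 'v) abfun \<times> ('o, 'v) abfun \<times> ('o \<Rightarrow> 'v \<Rightarrow> 'v)"

definition is_abnat ::
  "('o, 'v::universe, 'z) preadd_scheme \<Rightarrow> ('o, 'v) abfun \<Rightarrow> ('o, 'v) abfun \<Rightarrow>
   ('o \<Rightarrow> 'v \<Rightarrow> 'v) \<Rightarrow> bool" where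
  "is_abnat C F G \<eta> \<longleftrightarrow> \<eta> \<in> extensional (Ob C) \<and>
     (\<forall>A\<in>Ob C. \<eta> A \<in> hom (FOb F A) (FOb G A) \<and> \<eta> A \<in> extensional (carrier (FOb F A))) \<and>
     (\<forall>A B. \<forall>f\<in>Hom C A B. \<forall>x\<in>carrier (FOb F A). \<eta> B (FMor F f x) = FMor G f (\<eta> A x))"

definition add_fun ::
  "('o, 'v::universe, 'z) preadd_scheme \<Rightarrow> (('o, 'v) abfun, ('o, 'v) abnat) category" where
  "add_fun C = \<lparr>
     Ob = {F. is_abfun C F},
     Hom = \<lambda>F G. if is_abfun C F \<and> is_abfun C G then {(F, G, \<eta>) | \<eta>. is_abnat C F G \<eta>} else {},
     Comp = \<lambda>(_, H, \<theta>) (F, _, \<eta>). (F, H, \<lambda>A\<in>Ob C. compose (carrier (FOb F A)) (\<theta> A) (\<eta> A)),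
     Ident = \<lambda>F. (F, F, \<lambda>A\<in>Ob C. \<lambda>x\<in>carrier (FOb F A). x)\<rparr>"

definition corep :: "('o, 'v, 'z) preadd_scheme \<Rightarrow> 'o \<Rightarrow> ('o, 'v) abfun" where
  "corep C A = \<lparr>FOb = \<lambda>X. hom_grp C A X, FMor = \<lambda>f g. f \<cdot>\<^bsub>C\<^esub> g\<rparr>"


section \<open>Triangulated categories\<close>

text \<open>
  An element (f, g, h) of Tri is a distinguished triangle X, Y, Z, Shift X; the objects are
  determined by the arrows.
\<close>

record ('o, 'm) tri_cat = "('o, 'm) preadd" +
  Shift :: "('o, 'm, 'o, 'm) ftr"
  Tri :: "('m \<times> 'm \<times> 'm) set"

locale triangulated = additive T for T :: "('o, 'm, 'z) tri_cat_scheme" (structure) +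
  assumes shift_functor: "is_functor T T (Shift T)"
    and shift_additive: "additive_on T T (Shift T)"
    and shift_fully_faithful: "\<lbrakk>A \<in> Ob T; B \<in> Ob T\<rbrakk> \<Longrightarrow>
          bij_betw (FMor (Shift T)) (Hom T A B) (Hom T (FOb (Shift T) A) (FOb (Shift T) B))"
    and shift_ess_surj: "B \<in> Ob T \<Longrightarrow> \<exists>A\<in>Ob T. isomorphic T (FOb (Shift T) A) B"
    and tri_shape: "(f, g, h) \<in> Tri T \<Longrightarrow>
          \<exists>X Y Z. f \<in> Hom T X Y \<and> g \<in> Hom T Y Z \<and> h \<in> Hom T Z (FOb (Shift T) X)"
    and tri_iso:
      "\<lbrakk>(f, g, h) \<in> Tri T;
        f \<in> Hom T X Y; g \<in> Hom T Y Z; h \<in> Hom T Z (FOb (Shift T) X);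
        f' \<in> Hom T X' Y'; g' \<in> Hom T Y' Z'; h' \<in> Hom T Z' (FOb (Shift T) X');
        iso_arr T X X' a; iso_arr T Y Y' b; iso_arr T Z Z' c;
        f' \<cdot> a = b \<cdot> f; g' \<cdot> b = c \<cdot> g; h' \<cdot> c = FMor (Shift T) a \<cdot> h\<rbrakk>
       \<Longrightarrow> (f', g', h') \<in> Tri T"
    and tri_ident: "\<lbrakk>X \<in> Ob T; zero_obj T Z\<rbrakk> \<Longrightarrow>
          (Ident T X, ZeroM T X Z, ZeroM T Z (FOb (Shift T) X)) \<in> Tri T"
    and tri_cone: "f \<in> Hom T X Y \<Longrightarrow> \<exists>g h. (f, g, h) \<in> Tri T"
    and tri_rotate:
      "\<lbrakk>f \<in> Hom T X Y; g \<in> Hom T Y Z; h \<in> Hom T Z (FOb (Shift T) X)\<rbrakk> \<Longrightarrow>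
        (f, g, h) \<in> Tri T \<longleftrightarrow>
        (g, h, inv\<^bsub>hom_grp T (FOb (Shift T) X) (FOb (Shift T) Y)\<^esub> (FMor (Shift T) f)) \<in> Tri T"
    and tri_morphism:
      "\<lbrakk>(f, g, h) \<in> Tri T; (f', g', h') \<in> Tri T;
        f \<in> Hom T X Y; g \<in> Hom T Y Z; f' \<in> Hom T X' Y'; g' \<in> Hom T Y' Z';
        a \<in> Hom T X X'; b \<in> Hom T Y Y'; f' \<cdot> a = b \<cdot> f\<rbrakk>
       \<Longrightarrow> \<exists>c\<in>Hom T Z Z'. g' \<cdot> b = c \<cdot> g \<and> h' \<cdot> c = FMor (Shift T) a \<cdot> h"
    and tri_octahedral:
      "\<lbrakk>f \<in> Hom T X Y; g \<in> Hom T Y Z;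
        (f, f1, f2) \<in> Tri T; (g, g1, g2) \<in> Tri T; (g \<cdot> f, h1, h2) \<in> Tri T;
        f1 \<in> Hom T Y U; h1 \<in> Hom T Z V; g1 \<in> Hom T Z W\<rbrakk>
       \<Longrightarrow> \<exists>a\<in>Hom T U V. \<exists>b\<in>Hom T V W.
             (a, b, FMor (Shift T) f1 \<cdot> g2) \<in> Tri T \<and>
             a \<cdot> f1 = h1 \<cdot> g \<and> h2 \<cdot> a = f2 \<and> b \<cdot> h1 = g1 \<and> g2 \<cdot> b = FMor (Shift T) f \<cdot> h2"

definition exact_functor ::
  "('o, 'm, 'z) tri_cat_scheme \<Rightarrow> ('o, 'm, 'o, 'm) ftr \<Rightarrow> bool" where
  "exact_functor T F \<longleftrightarrow> is_functor T T F \<and> additive_on T T F \<and>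
     (\<exists>\<theta>. (\<forall>X\<in>Ob T. iso_arr T (FOb F (FOb (Shift T) X)) (FOb (Shift T) (FOb F X)) (\<theta> X)) \<and>
       (\<forall>X Y. \<forall>f\<in>Hom T X Y.
          \<theta> Y \<cdot>\<^bsub>T\<^esub> FMor F (FMor (Shift T) f) = FMor (Shift T) (FMor F f) \<cdot>\<^bsub>T\<^esub> \<theta> X) \<and>
       (\<forall>(f, g, h)\<in>Tri T. (FMor F f, FMor F g, \<theta> (dom_of T f) \<cdot>\<^bsub>T\<^esub> FMor F h) \<in> Tri T))"

text \<open>
  For contravariant F the triangle X, Y, Z, Shift X yields F Z, F Y, F X, Shift (F Z), whose
  last arrow is Shift (F h) after an isomorphism of F X with Shift (F (Shift X)).  The sign
  that depends on the choice of triangulation of the opposite category is absorbed by that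
  isomorphism.
\<close>

definition exact_contra_functor ::
  "('o, 'm, 'z) tri_cat_scheme \<Rightarrow> ('o, 'm, 'o, 'm) ftr \<Rightarrow> bool" where
  "exact_contra_functor T F \<longleftrightarrow> is_functor (opp_cat T) T F \<and> additive_on (opp_cat T) T F \<and>
     (\<exists>\<theta>. (\<forall>X\<in>Ob T. iso_arr T (FOb F X) (FOb (Shift T) (FOb F (FOb (Shift T) X))) (\<theta> X)) \<and>
       (\<forall>X Y. \<forall>f\<in>Hom T X Y.
          \<theta> X \<cdot>\<^bsub>T\<^esub> FMor F f = FMor (Shift T) (FMor F (FMor (Shift T) f)) \<cdot>\<^bsub>T\<^esub> \<theta> Y) \<and>
       (\<forall>(f, g, h)\<in>Tri T.
          (FMor F g, FMor F f, FMor (Shift T) (FMor F h) \<cdot>\<^bsub>T\<^esub> \<theta> (dom_of T f)) \<in> Tri T))"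


section \<open>Tensor-triangulated categories\<close>

text \<open>
  IHom B C is the internal hom from B to C, with evaluation Ev B C from the tensor product
  of IHom B C and B to C.
\<close>

record ('o, 'm) tt_cat = "('o, 'm) tri_cat" +
  Ten :: "'o \<Rightarrow> 'o \<Rightarrow> 'o" (infixr "\<odot>\<index>" 75)
  TenM :: "'m \<Rightarrow> 'm \<Rightarrow> 'm" (infixr "\<boxtimes>\<index>" 75)
  Unit :: "'o"
  Assoc :: "'o \<Rightarrow> 'o \<Rightarrow> 'o \<Rightarrow> 'm"
  LUnit :: "'o \<Rightarrow> 'm"
  RUnit :: "'o \<Rightarrow> 'm"
  Braid :: "'o \<Rightarrow> 'o \<Rightarrow> 'm"
  IHom :: "'o \<Rightarrow> 'o \<Rightarrow> 'o"
  Ev :: "'o \<Rightarrow> 'o \<Rightarrow> 'm"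

locale symmetric_monoidal = category T for T :: "('o, 'm, 'z) tt_cat_scheme" (structure) +
  assumes ten_ob: "\<lbrakk>A \<in> Ob T; B \<in> Ob T\<rbrakk> \<Longrightarrow> A \<odot> B \<in> Ob T"
    and ten_hom: "\<lbrakk>f \<in> Hom T A A'; g \<in> Hom T B B'\<rbrakk> \<Longrightarrow> f \<boxtimes> g \<in> Hom T (A \<odot> B) (A' \<odot> B')"
    and ten_ident: "\<lbrakk>A \<in> Ob T; B \<in> Ob T\<rbrakk> \<Longrightarrow> Ident T A \<boxtimes> Ident T B = Ident T (A \<odot> B)"
    and ten_comp: "\<lbrakk>f \<in> Hom T A A'; f' \<in> Hom T A' A''; g \<in> Hom T B B'; g' \<in> Hom T B' B''\<rbrakk>
          \<Longrightarrow> (f' \<cdot> f) \<boxtimes> (g' \<cdot> g) = (f' \<boxtimes> g') \<cdot> (f \<boxtimes> g)"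
    and unit_ob: "Unit T \<in> Ob T"
    and assoc_iso: "\<lbrakk>A \<in> Ob T; B \<in> Ob T; D \<in> Ob T\<rbrakk>
          \<Longrightarrow> iso_arr T ((A \<odot> B) \<odot> D) (A \<odot> (B \<odot> D)) (Assoc T A B D)"
    and assoc_natural: "\<lbrakk>f \<in> Hom T A A'; g \<in> Hom T B B'; h \<in> Hom T D D'\<rbrakk>
          \<Longrightarrow> Assoc T A' B' D' \<cdot> ((f \<boxtimes> g) \<boxtimes> h) = (f \<boxtimes> (g \<boxtimes> h)) \<cdot> Assoc T A B D"
    and lunit_iso: "A \<in> Ob T \<Longrightarrow> iso_arr T (Unit T \<odot> A) A (LUnit T A)"
    and lunit_natural: "f \<in> Hom T A B \<Longrightarrow>
          LUnit T B \<cdot> (Ident T (Unit T) \<boxtimes> f) = f \<cdot> LUnit T A"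
    and runit_iso: "A \<in> Ob T \<Longrightarrow> iso_arr T (A \<odot> Unit T) A (RUnit T A)"
    and runit_natural: "f \<in> Hom T A B \<Longrightarrow>
          RUnit T B \<cdot> (f \<boxtimes> Ident T (Unit T)) = f \<cdot> RUnit T A"
    and braid_hom: "\<lbrakk>A \<in> Ob T; B \<in> Ob T\<rbrakk> \<Longrightarrow> Braid T A B \<in> Hom T (A \<odot> B) (B \<odot> A)"
    and braid_natural: "\<lbrakk>f \<in> Hom T A A'; g \<in> Hom T B B'\<rbrakk>
          \<Longrightarrow> Braid T A' B' \<cdot> (f \<boxtimes> g) = (g \<boxtimes> f) \<cdot> Braid T A B"
    and braid_symmetric: "\<lbrakk>A \<in> Ob T; B \<in> Ob T\<rbrakk>
          \<Longrightarrow> Braid T B A \<cdot> Braid T A B = Ident T (A \<odot> B)"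
    and pentagon: "\<lbrakk>A \<in> Ob T; B \<in> Ob T; D \<in> Ob T; E \<in> Ob T\<rbrakk> \<Longrightarrow>
          Assoc T A B (D \<odot> E) \<cdot> Assoc T (A \<odot> B) D E =
          (Ident T A \<boxtimes> Assoc T B D E) \<cdot> Assoc T A (B \<odot> D) E \<cdot> (Assoc T A B D \<boxtimes> Ident T E)"
    and triangle: "\<lbrakk>A \<in> Ob T; B \<in> Ob T\<rbrakk> \<Longrightarrow>
          (Ident T A \<boxtimes> LUnit T B) \<cdot> Assoc T A (Unit T) B = RUnit T A \<boxtimes> Ident T B"
    and hexagon: "\<lbrakk>A \<in> Ob T; B \<in> Ob T; D \<in> Ob T\<rbrakk> \<Longrightarrow>
          Assoc T B D A \<cdot> Braid T A (B \<odot> D) \<cdot> Assoc T A B D =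
          (Ident T B \<boxtimes> Braid T A D) \<cdot> Assoc T B A D \<cdot> (Braid T A B \<boxtimes> Ident T D)"

definition is_transpose ::
  "('o, 'm, 'z) tt_cat_scheme \<Rightarrow> 'o \<Rightarrow> 'o \<Rightarrow> 'o \<Rightarrow> 'm \<Rightarrow> 'm \<Rightarrow> bool" where
  "is_transpose T A B D f g \<longleftrightarrow> g \<in> Hom T A (IHom T B D) \<and>
     Ev T B D \<cdot>\<^bsub>T\<^esub> (g \<boxtimes>\<^bsub>T\<^esub> Ident T B) = f"

definition transpose_arr ::
  "('o, 'm, 'z) tt_cat_scheme \<Rightarrow> 'o \<Rightarrow> 'o \<Rightarrow> 'o \<Rightarrow> 'm \<Rightarrow> 'm" where
  "transpose_arr T A B D f = (THE g. is_transpose T A B D f g)"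

locale closed_symmetric_monoidal =
  symmetric_monoidal T for T :: "('o, 'm, 'z) tt_cat_scheme" (structure) +
  assumes ihom_ob: "\<lbrakk>B \<in> Ob T; D \<in> Ob T\<rbrakk> \<Longrightarrow> IHom T B D \<in> Ob T"
    and ev_hom: "\<lbrakk>B \<in> Ob T; D \<in> Ob T\<rbrakk> \<Longrightarrow> Ev T B D \<in> Hom T (IHom T B D \<odot> B) D"
    and ev_universal: "\<lbrakk>A \<in> Ob T; B \<in> Ob T; D \<in> Ob T; f \<in> Hom T (A \<odot> B) D\<rbrakk>
          \<Longrightarrow> \<exists>!g. is_transpose T A B D f g"

definition ihom_arr :: "('o, 'm, 'z) tt_cat_scheme \<Rightarrow> 'm \<Rightarrow> 'm \<Rightarrow> 'm" where
  "ihom_arr T f g =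
     (let B' = dom_of T f; B = cod_of T f; D = dom_of T g; D' = cod_of T g
      in transpose_arr T (IHom T B D) B' D'
           (g \<cdot>\<^bsub>T\<^esub> Ev T B D \<cdot>\<^bsub>T\<^esub> (Ident T (IHom T B D) \<boxtimes>\<^bsub>T\<^esub> f)))"

locale tensor_triangulated = triangulated T + closed_symmetric_monoidal T
  for T :: "('o, 'm, 'z) tt_cat_scheme" (structure) +
  assumes ten_exact_right: "X \<in> Ob T \<Longrightarrow>
        exact_functor T \<lparr>FOb = \<lambda>Y. X \<odot> Y, FMor = \<lambda>f. Ident T X \<boxtimes> f\<rparr>"
    and ten_exact_left: "X \<in> Ob T \<Longrightarrow>
        exact_functor T \<lparr>FOb = \<lambda>Y. Y \<odot> X, FMor = \<lambda>f. f \<boxtimes> Ident T X\<rparr>"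
    and ihom_exact_right: "X \<in> Ob T \<Longrightarrow>
        exact_functor T \<lparr>FOb = \<lambda>Y. IHom T X Y, FMor = \<lambda>f. ihom_arr T (Ident T X) f\<rparr>"
    and ihom_exact_left: "X \<in> Ob T \<Longrightarrow>
        exact_contra_functor T \<lparr>FOb = \<lambda>Y. IHom T Y X, FMor = \<lambda>f. ihom_arr T f (Ident T X)\<rparr>"

text \<open>
  X is compact if, for every coproduct P of a small family Y with injections \<iota>, the canonical
  map from the direct sum of the groups Hom(X, Y i) to Hom(X, P) is an isomorphism.
\<close>

definition compacts :: "('o, 'v::universe, 'z) preadd_scheme \<Rightarrow> 'o set" where
  "compacts T = {X \<in> Ob T. \<forall>(I :: 'v set) Y P \<iota>.
     small TYPE('v) I \<and> Y \<in> I \<rightarrow> Ob T \<and> is_coproduct T I Y P \<iota> \<longrightarrow>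
     (\<lambda>\<phi>. gfinprod (hom_grp T X P) (\<lambda>i. \<iota> i \<cdot>\<^bsub>T\<^esub> \<phi> i) I)
       \<in> iso (sum_group I (\<lambda>i. hom_grp T X (Y i))) (hom_grp T X P)}"

definition dual :: "('o, 'm, 'z) tt_cat_scheme \<Rightarrow> 'o \<Rightarrow> 'o" where
  "dual T X = IHom T X (Unit T)"

text \<open>
  The canonical arrow from the tensor product of dual X and Y to IHom X Y; it corresponds to
  d, y, x being sent to d(x) y.
\<close>

definition rigidity_arr :: "('o, 'm, 'z) tt_cat_scheme \<Rightarrow> 'o \<Rightarrow> 'o \<Rightarrow> 'm" where
  "rigidity_arr T X Y = transpose_arr T (dual T X \<odot>\<^bsub>T\<^esub> Y) X Y
     (LUnit T Y
      \<cdot>\<^bsub>T\<^esub> (Ev T X (Unit T) \<boxtimes>\<^bsub>T\<^esub> Ident T Y)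
      \<cdot>\<^bsub>T\<^esub> inv_arr T (Assoc T (dual T X) X Y)
      \<cdot>\<^bsub>T\<^esub> (Ident T (dual T X) \<boxtimes>\<^bsub>T\<^esub> Braid T Y X)
      \<cdot>\<^bsub>T\<^esub> Assoc T (dual T X) Y X)"

definition rigids :: "('o, 'm, 'z) tt_cat_scheme \<Rightarrow> 'o set" where
  "rigids T = {X \<in> Ob T. \<forall>Y\<in>Ob T. iso_arr T (dual T X \<odot>\<^bsub>T\<^esub> Y) (IHom T X Y) (rigidity_arr T X Y)}"

locale rigidly_compactly_generated_tt = tensor_triangulated T
  for T :: "('o, 'v::universe, 'z) tt_cat_scheme" (structure) +
  assumes locally_small: "small TYPE('v) (Hom T A B)"
    and ex_coproduct: "\<lbrakk>small TYPE('v) (I :: 'v set); Y \<in> I \<rightarrow> Ob T\<rbrakk>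
          \<Longrightarrow> \<exists>P \<iota>. is_coproduct T I Y P \<iota>"
    and compactly_generated: "\<exists>G. small TYPE('v) G \<and> G \<subseteq> compacts T \<and>
          (\<forall>X\<in>Ob T. (\<forall>A\<in>G. Hom T A X = {ZeroM T A X}) \<longrightarrow> zero_obj T X)"
    and compact_eq_rigid: "compacts T = rigids T"


section \<open>Modules over the compact objects\<close>

definition Tc :: "('o, 'v::universe, 'z) preadd_scheme \<Rightarrow> ('o, 'v, 'z) preadd_scheme" where
  "Tc T = full_sub T (compacts T)"

definition ModTc ::
  "('o, 'v::universe, 'z) preadd_scheme \<Rightarrow> (('o, 'v) abfun, ('o, 'v) abnat) category" where
  "ModTc T = add_fun (opp_cat (Tc T))"

definition yoneda :: "('o, 'v, 'z) preadd_scheme \<Rightarrow> 'o \<Rightarrow> ('o, 'v) abfun" where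
  "yoneda T X = \<lparr>FOb = \<lambda>A. hom_grp T A X, FMor = \<lambda>f g. g \<cdot>\<^bsub>T\<^esub> f\<rparr>"

definition fin_pres :: "('o, 'v::universe, 'z) preadd_scheme \<Rightarrow> ('o, 'v) abfun set" where
  "fin_pres T = {F. \<exists>A\<in>compacts T. \<exists>B\<in>compacts T. \<exists>\<alpha> q.
     is_cokernel (ModTc T) (yoneda T A) (yoneda T B) \<alpha> F q}"

definition modTc ::
  "('o, 'v::universe, 'z) preadd_scheme \<Rightarrow> (('o, 'v) abfun, ('o, 'v) abnat) category" where
  "modTc T = full_sub (ModTc T) (fin_pres T)"

definition pure_injective :: "('o, 'v::universe, 'z) preadd_scheme \<Rightarrow> 'o \<Rightarrow> bool" where
  "pure_injective T X \<longleftrightarrow> X \<in> Ob T \<and> injective_obj (ModTc T) (yoneda T X)"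

text \<open>
  The Day convolution of F and G is the coend over compact A, B of
  F A \<otimes> G B \<otimes> Hom(-, A \<odot> B).  By its universal property, arrows from it to K are the families of
  biadditive maps from F A, G B to K(A \<odot> B) natural in A and B, so a Day convolution is an object
  H with a universal such family.  It is determined up to isomorphism.
\<close>

definition day_bilinear ::
  "('o, 'v::universe, 'z) tt_cat_scheme \<Rightarrow> ('o, 'v) abfun \<Rightarrow> ('o, 'v) abfun \<Rightarrow> ('o, 'v) abfun \<Rightarrow>
   ('o \<Rightarrow> 'o \<Rightarrow> 'v \<Rightarrow> 'v \<Rightarrow> 'v) \<Rightarrow> bool" where
  "day_bilinear T F G H \<beta> \<longleftrightarrow>
     (\<forall>A\<in>compacts T. \<forall>B\<in>compacts T.
        (\<forall>x\<in>carrier (FOb F A). (\<lambda>y. \<beta> A B x y) \<in> hom (FOb G B) (FOb H (A \<odot>\<^bsub>T\<^esub> B))) \<and>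
        (\<forall>y\<in>carrier (FOb G B). (\<lambda>x. \<beta> A B x y) \<in> hom (FOb F A) (FOb H (A \<odot>\<^bsub>T\<^esub> B)))) \<and>
     (\<forall>A\<in>compacts T. \<forall>A'\<in>compacts T. \<forall>B\<in>compacts T. \<forall>B'\<in>compacts T.
        \<forall>f\<in>Hom T A' A. \<forall>g\<in>Hom T B' B. \<forall>x\<in>carrier (FOb F A). \<forall>y\<in>carrier (FOb G B).
          \<beta> A' B' (FMor F f x) (FMor G g y) = FMor H (f \<boxtimes>\<^bsub>T\<^esub> g) (\<beta> A B x y))"

definition is_day_tensor ::
  "('o, 'v::universe, 'z) tt_cat_scheme \<Rightarrow> ('o, 'v) abfun \<Rightarrow> ('o, 'v) abfun \<Rightarrow> ('o, 'v) abfun \<Rightarrow>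
   bool" where
  "is_day_tensor T F G H \<longleftrightarrow> H \<in> Ob (ModTc T) \<and>
     (\<exists>\<beta>. day_bilinear T F G H \<beta> \<and>
       (\<forall>K\<in>Ob (ModTc T). \<forall>\<gamma>. day_bilinear T F G K \<gamma> \<longrightarrow>
          (\<exists>!\<phi>. \<phi> \<in> Hom (ModTc T) H K \<and>
             (\<forall>A\<in>compacts T. \<forall>B\<in>compacts T. \<forall>x\<in>carrier (FOb F A). \<forall>y\<in>carrier (FOb G B).
                snd (snd \<phi>) (A \<odot>\<^bsub>T\<^esub> B) (\<beta> A B x y) = \<gamma> A B x y))))"

definition serre_ideal :: "('o, 'v::universe, 'z) tt_cat_scheme \<Rightarrow> ('o, 'v) abfun set \<Rightarrow> bool" where
  "serre_ideal T S \<longleftrightarrow> serre (modTc T) S \<and>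
     (\<forall>F\<in>S. \<forall>G\<in>Ob (modTc T). \<forall>H. is_day_tensor T F G H \<longrightarrow> H \<in> S)"

definition homological_primes :: "('o, 'v::universe, 'z) tt_cat_scheme \<Rightarrow> ('o, 'v) abfun set set" where
  "homological_primes T = {\<B>. serre_ideal T \<B> \<and> \<B> \<noteq> Ob (modTc T) \<and>
     (\<forall>S. serre_ideal T S \<and> S \<noteq> Ob (modTc T) \<and> \<B> \<subseteq> S \<longrightarrow> S = \<B>)}"

text \<open>The object E attached to a homological prime is only determined up to isomorphism.\<close>

definition is_E_object ::
  "('o, 'v::universe, 'z) tt_cat_scheme \<Rightarrow> ('o, 'v) abfun set \<Rightarrow> 'o \<Rightarrow> bool" where
  "is_E_object T \<B> E \<longleftrightarrow> pure_injective T E \<and>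
     (let L = filtered_colims TYPE('v) (ModTc T) \<B>;
          Q = gabriel_localisation (ModTc T) L
      in \<exists>R J. is_right_adjoint (ModTc T) (gabriel_quotient (ModTc T) L) Q R \<and>
           injective_hull (gabriel_quotient (ModTc T) L) (FOb Q (yoneda T (Unit T))) J \<and>
           isomorphic (ModTc T) (yoneda T E) (FOb R J))"


section \<open>Definable subcategories\<close>

definition coherent :: "('o, 'v::universe, 'z) preadd_scheme \<Rightarrow> ('o, 'v) abfun \<Rightarrow> bool" where
  "coherent T F \<longleftrightarrow> (\<exists>A\<in>compacts T. \<exists>B\<in>compacts T. \<exists>\<alpha> q.
     is_cokernel (add_fun T) (corep T A) (corep T B) \<alpha> F q)"

definition definable :: "('o, 'v::universe, 'z) preadd_scheme \<Rightarrow> 'o set \<Rightarrow> bool" where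
  "definable T D \<longleftrightarrow> (\<exists>\<Phi>. small TYPE('v) \<Phi> \<and> (\<forall>F\<in>\<Phi>. coherent T F) \<and>
     D = {X \<in> Ob T. \<forall>F\<in>\<Phi>. trivial_group (FOb F X)})"

definition tensor_closed_definable :: "('o, 'v::universe, 'z) tt_cat_scheme \<Rightarrow> 'o set \<Rightarrow> bool" where
  "tensor_closed_definable T D \<longleftrightarrow> definable T D \<and> (\<forall>X\<in>D. \<forall>Y\<in>Ob T. Y \<odot>\<^bsub>T\<^esub> X \<in> D)"

definition Def_tensor :: "('o, 'v::universe, 'z) tt_cat_scheme \<Rightarrow> 'o \<Rightarrow> 'o set" where
  "Def_tensor T X = tensor_closed_definable T hull {X}"

definition simple_tensor_closed_definable ::
  "('o, 'v::universe, 'z) tt_cat_scheme \<Rightarrow> 'o set \<Rightarrow> bool" where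
  "simple_tensor_closed_definable T D \<longleftrightarrow> tensor_closed_definable T D \<and>
     \<not> (\<exists>D'. tensor_closed_definable T D' \<and> D' \<subset> D \<and> (\<exists>X\<in>D'. \<not> zero_obj T X))"

definition definable_of :: "('o, 'v::universe, 'z) preadd_scheme \<Rightarrow> ('o, 'v) abfun set \<Rightarrow> 'o set" where
  "definable_of T S = {X \<in> Ob T. \<forall>F\<in>S. \<forall>\<phi>\<in>Hom (ModTc T) F (yoneda T X).
     zero_arr (ModTc T) F (yoneda T X) \<phi>}"

end

theory Submission
  imports Defs
begin

text \<open>
  A coherent functor is of the form \<open>Hom(F, -)\<close> with \<open>F\<close> a finitely presented module, because the
  restricted Yoneda modules are absolutely pure.  Hence the definable subcategories are the classes
  \<open>definable_of T S\<close>, and the modules orthogonal to a definable class that is closed under tensor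
  products form a Serre ideal, by rigidity of the compact objects.  A nonzero \<open>\<otimes>\<close>-closed definable
  subcategory of \<open>definable_of T \<B>\<close> gives a proper Serre ideal that contains \<open>\<B>\<close>; by maximality it is
  \<open>\<B>\<close>, so the two subcategories are equal.

  It remains to see that the object \<open>E\<close> attached to \<open>\<B>\<close> is a nonzero object of \<open>definable_of T \<B>\<close>.
  By adjunction, \<open>Hom(X, yoneda T E)\<close> is the set of arrows of the Gabriel quotient from \<open>X\<close> to an injective
  hull of the unit.  It is trivial for \<open>X\<close> in \<open>\<B>\<close>.  If it were trivial for the unit, then the unit would be
  a retract of a filtered colimit of objects of \<open>\<B>\<close>, hence an object of \<open>\<B>\<close> as it is finitely presented,
  and \<open>\<B>\<close> would not be proper.
\<close>

section \<open>Small sets\<close>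

text \<open>The bookkeeping runs on single arrows \<open>g\<close> between compact objects. Cones
  and fibres of compact objects are compact, and triangles give weak kernels and weak cokernels, so
  a finitely presented module is the image of some
  \<open>yoneda T B \<rightarrow> yoneda T D\<close>. The condition that it has no nonzero arrow to
  \<open>yoneda T X\<close> and the vanishing at \<open>X\<close> of a coherent functor then take
  the same form \<open>kills X g\<close>. Two obstacles shape the rest. One is size: definability
  asks for a small set of functors and tensor closure concerns arbitrary \<open>Y\<close>, while the
  compact objects may form a proper class. A small set \<open>K\<close> of cells, together with the
  fact that an arrow from a compact object to \<open>Y \<odot> X\<close> factors through some
  \<open>A \<odot> X\<close> with \<open>A\<close> in \<open>K\<close>, answers both; for
  \<open>X\<close> the unit it makes every compact object a retract of one in \<open>K\<close>. The
  other is duality: rigidity is given as invertibility of one canonical arrow, so the zigzag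
  relations and the compactness of duals have to be derived from the coherence axioms.\<close>

lemma small_image: "small V A \<Longrightarrow> small V (f ` A)"
  unfolding small_def using image_lepoll lesspoll_trans1 by blast

lemma small_subset: "small V A \<Longrightarrow> B \<subseteq> A \<Longrightarrow> small V B"
  unfolding small_def using subset_imp_lepoll lesspoll_trans1 by blast

lemma infinite_universe: "infinite (UNIV :: 'v::universe set)"
  using universe_uncountable by (metis infinite_le_lepoll lesspoll_imp_lepoll)

lemma small_finite: "finite A \<Longrightarrow> small TYPE('v::universe) A"
  unfolding small_def using finite_lesspoll_infinite infinite_universe by blast

lemma small_nat: "small TYPE('v::universe) (A :: nat set)"
  unfolding small_def using universe_uncountable
  by (meson lesspoll_trans1 subset_UNIV subset_imp_lepoll)

text \<open>\<open>universe_union\<close> speaks only of subsets of the universe indexed by subsets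
  of the universe. So the index set is coded by \<open>e\<close>, each member by \<open>g a\<close>,
  and an injection \<open>p\<close> of pairs keeps the codes of different members apart; the union
  is then an image of the coded union.\<close>

lemma small_UN:
  assumes A: "small TYPE('v::universe) A" and F: "\<And>a. a \<in> A \<Longrightarrow> small TYPE('v) (F a)"
  shows "small TYPE('v) (\<Union>a\<in>A. F a)"
proof -
  obtain e :: "'a \<Rightarrow> 'v" where e: "inj_on e A"
    using A unfolding small_def lesspoll_def lepoll_def by blast
  have "\<forall>a\<in>A. \<exists>g::'b \<Rightarrow> 'v. inj_on g (F a)"
    using F unfolding small_def lesspoll_def lepoll_def by blast
  then obtain g :: "'a \<Rightarrow> 'b \<Rightarrow> 'v" where g: "\<And>a. a \<in> A \<Longrightarrow> inj_on (g a) (F a)"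
    by metis
  obtain p :: "'v \<times> 'v \<Rightarrow> 'v" where p: "inj p"
    using card_of_Times_same_infinite[OF infinite_universe[where 'v='v]]
    unfolding card_of_ordIso[symmetric] bij_betw_def by auto
  define G where "G a' = p ` ({a'} \<times> g (inv_into A e a') ` F (inv_into A e a'))" for a'
  have "small TYPE('v) (\<Union>a'\<in>e ` A. G a')"
    unfolding small_def
  proof (rule universe_union)
    show "e ` A \<prec> (UNIV :: 'v set)"
      using small_image[OF A] by (simp add: small_def)
    fix a' assume "a' \<in> e ` A"
    then obtain a where a: "a \<in> A" "a' = e a" by blast
    have "G a' = (\<lambda>x. p (a', g a x)) ` F a"
      using a e by (auto simp: G_def)
    then show "G a' \<prec> (UNIV :: 'v set)"
      using small_image[OF F[OF a(1)], of "\<lambda>x. p (a', g a x)"] by (simp add: small_def)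
  qed
  moreover have "(\<Union>a\<in>A. F a) \<subseteq>
      (\<lambda>v. THE x. \<exists>a\<in>A. x \<in> F a \<and> (v = p (e a, g a x))) ` (\<Union>a'\<in>e ` A. G a')"
  proof
    fix x assume "x \<in> (\<Union>a\<in>A. F a)"
    then obtain a where a: "a \<in> A" "x \<in> F a" by blast
    have mem: "p (e a, g a x) \<in> G (e a)"
      using a e by (auto simp: G_def)
    have "(THE x'. \<exists>b\<in>A. x' \<in> F b \<and> p (e a, g a x) = p (e b, g b x')) = x"
    proof (rule the_equality)
      fix x' assume "\<exists>b\<in>A. x' \<in> F b \<and> p (e a, g a x) = p (e b, g b x')"
      then obtain b where b: "b \<in> A" "x' \<in> F b" "e a = e b" "g a x = g b x'"
        using injD[OF p] by blast
      then have "a = b" using inj_onD[OF e b(3) a(1) b(1)] by simp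
      then show "x' = x" using inj_onD[OF g[OF a(1)] b(4)[folded \<open>a = b\<close>] a(2)] b(2) by simp
    qed (use a in blast)
    then show "x \<in> (\<lambda>v. THE x. \<exists>a\<in>A. x \<in> F a \<and> (v = p (e a, g a x))) ` (\<Union>a'\<in>e ` A. G a')"
      using mem by (intro image_eqI[of _ _ "p (e a, g a x)"]) (use mem a(1) in auto)
  qed
  ultimately show ?thesis
    by (blast intro: small_subset[OF small_image])
qed

lemma small_Un: "small TYPE('v::universe) A \<Longrightarrow> small TYPE('v) B \<Longrightarrow> small TYPE('v) (A \<union> B)"
  using small_UN[of "{True, False}" "\<lambda>b. if b then A else B", where 'v='v]
    small_finite[of "{True, False}", where 'v='v]
  by (simp add: Un_commute)

lemma small_Times:
  assumes "small TYPE('v::universe) A" "small TYPE('v) B"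
  shows "small TYPE('v) (A \<times> B)"
proof -
  have "A \<times> B = (\<Union>a\<in>A. Pair a ` B)" by auto
  then show ?thesis using small_UN[OF assms(1) small_image[OF assms(2)], of "\<lambda>a. Pair a"] by simp
qed

section \<open>Categories\<close>

context category
begin

text \<open>Source and target become terms computed by rewriting instead of parameters of a
  membership, so that the typing conditions of long composites are solved by \<open>simp\<close>
  with \<open>arr_simps\<close>.\<close>

definition arr :: "'m \<Rightarrow> bool" where
  "arr f \<longleftrightarrow> (\<exists>A B. f \<in> Hom C A B)"

lemma dom_of_eq: "f \<in> Hom C A B \<Longrightarrow> dom_of C f = A"
  unfolding dom_of_def using hom_disjoint by blast

lemma cod_of_eq: "f \<in> Hom C A B \<Longrightarrow> cod_of C f = B"
  unfolding cod_of_def using hom_disjoint by blast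

lemma hom_char: "f \<in> Hom C A B \<longleftrightarrow> arr f \<and> dom_of C f = A \<and> cod_of C f = B"
  using dom_of_eq cod_of_eq unfolding arr_def by blast

lemma arr_hom: "arr f \<Longrightarrow> f \<in> Hom C (dom_of C f) (cod_of C f)"
  by (simp add: hom_char)

lemma arr_comp:
  assumes "arr f" "arr g" "cod_of C f = dom_of C g"
  shows "arr (g \<cdot> f)" "dom_of C (g \<cdot> f) = dom_of C f" "cod_of C (g \<cdot> f) = cod_of C g"
  using comp_hom[of f "dom_of C f" "cod_of C f" g "cod_of C g"] assms arr_hom hom_char by auto

lemma arr_ident:
  "A \<in> Ob C \<Longrightarrow> arr (Ident C A)" "A \<in> Ob C \<Longrightarrow> dom_of C (Ident C A) = A"
  "A \<in> Ob C \<Longrightarrow> cod_of C (Ident C A) = A"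
  using ident_hom hom_char by blast+

lemma arr_comp_assoc:
  "\<lbrakk>arr f; arr g; arr h; cod_of C f = dom_of C g; cod_of C g = dom_of C h\<rbrakk>
    \<Longrightarrow> (h \<cdot> g) \<cdot> f = h \<cdot> (g \<cdot> f)"
  by (metis comp_assoc arr_hom)

lemma arr_comp_ident: "\<lbrakk>arr f; dom_of C f = A\<rbrakk> \<Longrightarrow> f \<cdot> Ident C A = f"
  and arr_ident_comp: "\<lbrakk>arr f; cod_of C f = A\<rbrakk> \<Longrightarrow> Ident C A \<cdot> f = f"
  using comp_ident ident_comp arr_hom by blast+

lemmas arr_simps = arr_comp arr_ident arr_comp_assoc arr_comp_ident arr_ident_comp

lemma iso_arrE:
  assumes "iso_arr C A B f"
  obtains g where "f \<in> Hom C A B" "g \<in> Hom C B A" "g \<cdot> f = Ident C A" "f \<cdot> g = Ident C B"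
  using assms unfolding iso_arr_def inverse_arrs_def by blast

lemma iso_arrI:
  "\<lbrakk>f \<in> Hom C A B; g \<in> Hom C B A; g \<cdot> f = Ident C A; f \<cdot> g = Ident C B\<rbrakk> \<Longrightarrow> iso_arr C A B f"
  unfolding iso_arr_def inverse_arrs_def by blast

lemma iso_arr_hom: "iso_arr C A B f \<Longrightarrow> f \<in> Hom C A B"
  unfolding iso_arr_def inverse_arrs_def by blast

lemma inverse_unique:
  assumes "inverse_arrs C A B f g" "inverse_arrs C A' B' f g'"
  shows "g = g'"
proof -
  have "A = A'" "B = B'"
    using assms hom_disjoint unfolding inverse_arrs_def by blast+
  then have "g = g \<cdot> (f \<cdot> g')"
    using assms comp_ident unfolding inverse_arrs_def by metis
  also have "\<dots> = (g \<cdot> f) \<cdot> g'"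
    using assms \<open>A = A'\<close> \<open>B = B'\<close> comp_assoc unfolding inverse_arrs_def by metis
  also have "\<dots> = g'"
    using assms \<open>A = A'\<close> \<open>B = B'\<close> ident_comp unfolding inverse_arrs_def by metis
  finally show ?thesis .
qed

lemma inv_arr_inverse:
  assumes "iso_arr C A B f"
  shows "inverse_arrs C A B f (inv_arr C f)"
proof -
  obtain g where g: "inverse_arrs C A B f g"
    using assms by (auto simp: iso_arr_def)
  then have "inv_arr C f = g"
    unfolding inv_arr_def by (blast intro: the_equality inverse_unique)
  then show ?thesis using g by simp
qed

lemma inv_arr:
  assumes "iso_arr C A B f"
  shows "inv_arr C f \<in> Hom C B A" "inv_arr C f \<cdot> f = Ident C A" "f \<cdot> inv_arr C f = Ident C B"
    "iso_arr C B A (inv_arr C f)"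
  using inv_arr_inverse[OF assms] unfolding inverse_arrs_def iso_arr_def by blast+

lemma iso_comp:
  assumes f: "iso_arr C A B f" and g: "iso_arr C B D g"
  shows "iso_arr C A D (g \<cdot> f)"
proof -
  obtain f' where f': "f \<in> Hom C A B" "f' \<in> Hom C B A" "f' \<cdot> f = Ident C A" "f \<cdot> f' = Ident C B"
    using f by (rule iso_arrE)
  obtain g' where g': "g \<in> Hom C B D" "g' \<in> Hom C D B" "g' \<cdot> g = Ident C B" "g \<cdot> g' = Ident C D"
    using g by (rule iso_arrE)
  have "(f' \<cdot> g') \<cdot> (g \<cdot> f) = Ident C A"
    using comp_assoc[OF comp_hom[OF f'(1) g'(1)] g'(2) f'(2)] comp_assoc[OF f'(1) g'(1,2)]
      f' g' ident_comp[OF f'(1)] by simp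
  moreover have "(g \<cdot> f) \<cdot> (f' \<cdot> g') = Ident C D"
    using comp_assoc[OF comp_hom[OF g'(2) f'(2)] f'(1) g'(1)] comp_assoc[OF g'(2) f'(2,1)]
      f' g' ident_comp[OF g'(2)] by simp
  ultimately show ?thesis
    using f' g' by (intro iso_arrI[where g="f' \<cdot> g'"]) (auto simp: hom_char arr_simps)
qed

lemma iso_ident: "A \<in> Ob C \<Longrightarrow> iso_arr C A A (Ident C A)"
  using iso_arrI ident_hom comp_ident by metis

lemma iso_cancel_left:
  assumes "iso_arr C B D i" "f \<in> Hom C A B" "g \<in> Hom C A B" "i \<cdot> f = i \<cdot> g"
  shows "f = g"
proof -
  obtain j where j: "i \<in> Hom C B D" "j \<in> Hom C D B" "j \<cdot> i = Ident C B"
    using assms(1) by (rule iso_arrE)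
  have "(j \<cdot> i) \<cdot> f = (j \<cdot> i) \<cdot> g"
    unfolding comp_assoc[OF assms(2) j(1,2)] comp_assoc[OF assms(3) j(1,2)] assms(4) ..
  then show ?thesis
    using j(3) assms by (simp add: ident_comp)
qed

lemma iso_cancel_right:
  assumes "iso_arr C D A i" "f \<in> Hom C A B" "g \<in> Hom C A B" "f \<cdot> i = g \<cdot> i"
  shows "f = g"
proof -
  obtain j where j: "i \<in> Hom C D A" "j \<in> Hom C A D" "i \<cdot> j = Ident C A"
    using assms(1) by (rule iso_arrE)
  have "f \<cdot> (i \<cdot> j) = g \<cdot> (i \<cdot> j)"
    unfolding comp_assoc[OF j(2,1) assms(2), symmetric] comp_assoc[OF j(2,1) assms(3), symmetric]
      assms(4) ..
  then show ?thesis
    using j(3) assms by (simp add: comp_ident)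
qed

end

section \<open>Preadditive categories\<close>

context preadditive
begin

abbreviation plus_arr (infixl \<open>\<^bold>+\<close> 65) where
  "f \<^bold>+ g \<equiv> PlusM C f g"

text \<open>The inverse is taken in a hom group that depends on two objects; these are read off from
  \<open>f\<close>, so that subtraction can be a binary operation on arrows.\<close>

definition minus_arr (infixl \<open>\<^bold>-\<close> 65) where
  "f \<^bold>- g = f \<^bold>+ inv\<^bsub>hom_grp C (dom_of C f) (cod_of C f)\<^esub> g"

lemma hom_group: "\<lbrakk>A \<in> Ob C; B \<in> Ob C\<rbrakk> \<Longrightarrow> group (hom_grp C A B)"
  using hom_comm_group comm_group.axioms(2) by blast

lemma hom_grp_simps [simp]:
  "carrier (hom_grp C A B) = Hom C A B" "monoid.mult (hom_grp C A B) = PlusM C"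
  "one (hom_grp C A B) = ZeroM C A B"
  by (simp_all add: hom_grp_def)

lemma comm_group_of_hom:
  "f \<in> Hom C A B \<Longrightarrow> comm_group (hom_grp C A B)"
  using hom_comm_group hom_objects by blast

lemma plus_hom: "\<lbrakk>f \<in> Hom C A B; g \<in> Hom C A B\<rbrakk> \<Longrightarrow> f \<^bold>+ g \<in> Hom C A B"
  using comm_group_of_hom[of f A B] comm_groupE(1) by fastforce

lemma zero_hom: "\<lbrakk>A \<in> Ob C; B \<in> Ob C\<rbrakk> \<Longrightarrow> ZeroM C A B \<in> Hom C A B"
  using hom_comm_group[of A B] comm_groupE(2) by fastforce

lemma plus_zero: "f \<in> Hom C A B \<Longrightarrow> f \<^bold>+ ZeroM C A B = f"
  and zero_plus: "f \<in> Hom C A B \<Longrightarrow> ZeroM C A B \<^bold>+ f = f"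
  using comm_group_of_hom[of f A B] monoid.r_one[of "hom_grp C A B" f]
    monoid.l_one[of "hom_grp C A B" f]
  by (auto simp: comm_group_def comm_monoid_def)

lemma plus_assoc:
  "\<lbrakk>f \<in> Hom C A B; g \<in> Hom C A B; h \<in> Hom C A B\<rbrakk> \<Longrightarrow> f \<^bold>+ g \<^bold>+ h = f \<^bold>+ (g \<^bold>+ h)"
  using comm_group_of_hom[of f A B] monoid.m_assoc[of "hom_grp C A B" f g h]
  by (auto simp: comm_group_def comm_monoid_def)

lemma plus_commute: "\<lbrakk>f \<in> Hom C A B; g \<in> Hom C A B\<rbrakk> \<Longrightarrow> f \<^bold>+ g = g \<^bold>+ f"
  using comm_group_of_hom[of f A B] comm_groupE(4) by fastforce

text \<open>An idempotent of a group is the neutral element. This is how additivity of composition,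
  of the shift and of exact functors yields preservation of zero arrows.\<close>

lemma idem_zero:
  assumes "f \<in> Hom C A B" "f \<^bold>+ f = f"
  shows "f = ZeroM C A B"
proof -
  interpret G: comm_group "hom_grp C A B" using assms comm_group_of_hom by blast
  show ?thesis
    using G.l_cancel_one[of f f] assms by simp
qed

lemma comp_zero:
  assumes "g \<in> Hom C B D" "A \<in> Ob C"
  shows "g \<cdot> ZeroM C A B = ZeroM C A D"
proof (rule idem_zero)
  have z: "ZeroM C A B \<in> Hom C A B"
    using assms hom_objects zero_hom by blast
  show "g \<cdot> ZeroM C A B \<in> Hom C A D"
    using z assms comp_hom by blast
  show "g \<cdot> ZeroM C A B \<^bold>+ g \<cdot> ZeroM C A B = g \<cdot> ZeroM C A B"
    using comp_plus_right[OF z z assms(1)] plus_zero[OF z] by simp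
qed

lemma zero_comp:
  assumes "f \<in> Hom C A B" "D \<in> Ob C"
  shows "ZeroM C B D \<cdot> f = ZeroM C A D"
proof (rule idem_zero)
  have z: "ZeroM C B D \<in> Hom C B D"
    using assms hom_objects zero_hom by blast
  show "ZeroM C B D \<cdot> f \<in> Hom C A D"
    using z assms comp_hom by blast
  show "ZeroM C B D \<cdot> f \<^bold>+ ZeroM C B D \<cdot> f = ZeroM C B D \<cdot> f"
    using comp_plus_left[OF assms(1) z z] plus_zero[OF z] by simp
qed

lemma minus_hom:
  assumes "f \<in> Hom C A B" "g \<in> Hom C A B"
  shows "f \<^bold>- g \<in> Hom C A B"
proof -
  interpret G: comm_group "hom_grp C A B" using assms comm_group_of_hom by blast
  show ?thesis
    using G.inv_closed[of g] assms by (auto simp: minus_arr_def dom_of_eq cod_of_eq intro: plus_hom)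
qed

lemma minus_plus:
  assumes "f \<in> Hom C A B" "g \<in> Hom C A B"
  shows "(f \<^bold>- g) \<^bold>+ g = f"
proof -
  interpret G: comm_group "hom_grp C A B" using assms comm_group_of_hom by blast
  show ?thesis
    using G.inv_closed[of g] assms G.m_assoc[of f "inv\<^bsub>hom_grp C A B\<^esub> g" g]
    using G.l_inv[of g] by (simp add: minus_arr_def dom_of_eq cod_of_eq plus_zero)
qed

lemma plus_right_cancel:
  assumes "f \<in> Hom C A B" "g \<in> Hom C A B" "h \<in> Hom C A B" "f \<^bold>+ h = g \<^bold>+ h"
  shows "f = g"
proof -
  interpret G: comm_group "hom_grp C A B" using assms comm_group_of_hom by blast
  show ?thesis using assms G.right_cancel[of h f g] by simp
qed

lemma minus_eqI: "\<lbrakk>h \<in> Hom C A B; g \<in> Hom C A B; h \<^bold>+ g = f\<rbrakk> \<Longrightarrow> f \<^bold>- g = h"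
  by (metis minus_hom minus_plus plus_hom plus_right_cancel)

lemma minus_self: "f \<in> Hom C A B \<Longrightarrow> f \<^bold>- f = ZeroM C A B"
  using minus_eqI zero_hom zero_plus hom_objects by blast

lemma minus_zero: "f \<in> Hom C A B \<Longrightarrow> f \<^bold>- ZeroM C A B = f"
  using minus_eqI[of f A B] zero_hom[of A B] plus_zero hom_objects by blast

lemma minus_eq_zero:
  "\<lbrakk>f \<in> Hom C A B; g \<in> Hom C A B\<rbrakk> \<Longrightarrow> f \<^bold>- g = ZeroM C A B \<longleftrightarrow> f = g"
  by (metis minus_plus minus_self zero_plus)

lemma comp_minus:
  assumes "f \<in> Hom C A B" "f' \<in> Hom C A B" "g \<in> Hom C B D"
  shows "g \<cdot> (f \<^bold>- f') = g \<cdot> f \<^bold>- g \<cdot> f'"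
  using comp_plus_right[OF minus_hom[OF assms(1,2)] assms(2,3)] minus_plus[OF assms(1,2)]
  by (simp add: minus_eqI[OF comp_hom[OF minus_hom[OF assms(1,2)] assms(3)] comp_hom[OF assms(2,3)]])

lemma minus_comp:
  assumes "f \<in> Hom C A B" "g \<in> Hom C B D" "g' \<in> Hom C B D"
  shows "(g \<^bold>- g') \<cdot> f = g \<cdot> f \<^bold>- g' \<cdot> f"
  using comp_plus_left[OF assms(1) minus_hom[OF assms(2,3)] assms(3)] minus_plus[OF assms(2,3)]
  by (simp add: minus_eqI[OF comp_hom[OF assms(1) minus_hom[OF assms(2,3)]] comp_hom[OF assms(1,3)]])

lemma neg_eq_minus:
  assumes "f \<in> Hom C A B"
  shows "inv\<^bsub>hom_grp C A B\<^esub> f = ZeroM C A B \<^bold>- f"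
proof -
  interpret G: comm_group "hom_grp C A B" using assms comm_group_of_hom by blast
  have "ZeroM C A B \<in> Hom C A B" using assms hom_objects zero_hom by blast
  then show ?thesis
    using G.inv_closed[of f] assms
    by (simp add: minus_arr_def dom_of_eq cod_of_eq zero_plus)
qed

text \<open>Every arrow at \<open>Z\<close> is its own composite with the identity of
  \<open>Z\<close>. The condition on the right is an equation, which additive functors visibly
  preserve.\<close>

lemma zero_obj_iff: "zero_obj C Z \<longleftrightarrow> Z \<in> Ob C \<and> Ident C Z = ZeroM C Z Z"
proof
  assume "zero_obj C Z"
  then show "Z \<in> Ob C \<and> Ident C Z = ZeroM C Z Z"
    unfolding zero_obj_def using ident_hom zero_hom by metis
next
  assume Z: "Z \<in> Ob C \<and> Ident C Z = ZeroM C Z Z"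
  have "f = ZeroM C X Z" if "f \<in> Hom C X Z" for X f
    using that Z by (metis ident_comp zero_comp)
  moreover have "f = ZeroM C Z X" if "f \<in> Hom C Z X" for X f
    using that Z by (metis comp_ident comp_zero)
  ultimately show "zero_obj C Z"
    unfolding zero_obj_def using Z zero_hom by metis
qed

lemma zero_obj_hom:
  assumes "zero_obj C Z"
  shows "f \<in> Hom C X Z \<Longrightarrow> f = ZeroM C X Z" "f \<in> Hom C Z X \<Longrightarrow> f = ZeroM C Z X"
  using assms hom_objects zero_hom unfolding zero_obj_def by metis+

end

subsection \<open>Coproducts\<close>

locale coproduct_in = preadditive C for C :: "('o, 'm, 'z) preadd_scheme" (structure) +
  fixes I :: "'i set" and X :: "'i \<Rightarrow> 'o" and P :: 'o and \<iota> :: "'i \<Rightarrow> 'm"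
  assumes cop: "is_coproduct C I X P \<iota>"
begin

lemma P_ob: "P \<in> Ob C"
  using cop by (simp add: is_coproduct_def)

lemma \<iota>_hom: "i \<in> I \<Longrightarrow> \<iota> i \<in> Hom C (X i) P"
  using cop by (simp add: is_coproduct_def)

lemma X_ob: "i \<in> I \<Longrightarrow> X i \<in> Ob C"
  using \<iota>_hom hom_objects by blast

lemma copair_ex1:
  "\<lbrakk>Y \<in> Ob C; \<And>i. i \<in> I \<Longrightarrow> f i \<in> Hom C (X i) Y\<rbrakk>
    \<Longrightarrow> \<exists>!h. h \<in> Hom C P Y \<and> (\<forall>i\<in>I. h \<cdot> \<iota> i = f i)"
  using cop by (simp add: is_coproduct_def)

lemma cop_ext:
  "\<lbrakk>h \<in> Hom C P Y; h' \<in> Hom C P Y; \<And>i. i \<in> I \<Longrightarrow> h \<cdot> \<iota> i = h' \<cdot> \<iota> i\<rbrakk> \<Longrightarrow> h = h'"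
  using copair_ex1[of Y "\<lambda>i. h' \<cdot> \<iota> i"] comp_hom \<iota>_hom hom_objects by metis

definition pr :: "'i \<Rightarrow> 'm" where
  "pr i = (THE h. h \<in> Hom C P (X i) \<and>
     (\<forall>j\<in>I. h \<cdot> \<iota> j = (if j = i then Ident C (X i) else ZeroM C (X j) (X i))))"

text \<open>The idempotent of \<open>P\<close> that keeps the summands in \<open>F\<close> and
  annihilates the others. The universal property defines it for every \<open>F\<close>; for finite
  \<open>F\<close> it is the sum of the \<open>\<iota> i \<cdot> pr i\<close> by
  \<open>cut_insert\<close>, so \<open>cut F \<cdot> h = h\<close> says that \<open>h\<close> comes
  from finitely many summands.\<close>

definition cut :: "'i set \<Rightarrow> 'm" where
  "cut F = (THE h. h \<in> Hom C P P \<and> (\<forall>j\<in>I. h \<cdot> \<iota> j = (if j \<in> F then \<iota> j else ZeroM C (X j) P)))"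

lemma pr:
  assumes "i \<in> I"
  shows "pr i \<in> Hom C P (X i) \<and>
    (\<forall>j\<in>I. pr i \<cdot> \<iota> j = (if j = i then Ident C (X i) else ZeroM C (X j) (X i)))"
  unfolding pr_def
  by (rule theI', rule copair_ex1) (use assms X_ob ident_hom zero_hom in auto)

lemma pr_hom: "i \<in> I \<Longrightarrow> pr i \<in> Hom C P (X i)"
  and pr_\<iota>: "i \<in> I \<Longrightarrow> pr i \<cdot> \<iota> i = Ident C (X i)"
  and pr_\<iota>_other: "\<lbrakk>i \<in> I; j \<in> I; i \<noteq> j\<rbrakk> \<Longrightarrow> pr i \<cdot> \<iota> j = ZeroM C (X j) (X i)"
  using pr by auto

lemma cut: "cut F \<in> Hom C P P \<and> (\<forall>j\<in>I. cut F \<cdot> \<iota> j = (if j \<in> F then \<iota> j else ZeroM C (X j) P))"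
  unfolding cut_def
  by (rule theI', rule copair_ex1) (use X_ob P_ob \<iota>_hom zero_hom in auto)

lemma cut_hom: "cut F \<in> Hom C P P"
  and cut_\<iota>: "j \<in> I \<Longrightarrow> cut F \<cdot> \<iota> j = (if j \<in> F then \<iota> j else ZeroM C (X j) P)"
  using cut by auto

lemma cut_cut: "cut F \<cdot> cut G = cut (F \<inter> G)"
proof (rule cop_ext)
  show "(cut F \<cdot> cut G) \<cdot> \<iota> i = cut (F \<inter> G) \<cdot> \<iota> i" if "i \<in> I" for i
    using that comp_assoc[OF \<iota>_hom cut_hom cut_hom, of i F G] comp_zero[OF cut_hom, of "X i" F]
    by (auto simp: cut_\<iota> X_ob)
qed (use cut_hom comp_hom in blast)+

text \<open>Two finite sets of summands that were found separately may thus be replaced by their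
  union.\<close>

lemma cut_absorb:
  assumes "F \<subseteq> G" "f \<in> Hom C A P" "cut F \<cdot> f = f"
  shows "cut G \<cdot> f = f"
  using assms comp_assoc[OF assms(2) cut_hom cut_hom, of G F]
  by (simp add: cut_cut Int_absorb1)

lemma cut_empty: "cut {} = ZeroM C P P"
  by (rule cop_ext) (use cut_\<iota> cut_hom zero_hom P_ob zero_comp[OF \<iota>_hom P_ob] in auto)

lemma cut_insert:
  assumes "i \<in> I" "i \<notin> F"
  shows "cut (insert i F) = \<iota> i \<cdot> pr i \<^bold>+ cut F"
proof (rule cop_ext)
  show "\<iota> i \<cdot> pr i \<^bold>+ cut F \<in> Hom C P P"
    using assms plus_hom comp_hom pr_hom \<iota>_hom cut_hom by metis
  show "cut (insert i F) \<cdot> \<iota> j = (\<iota> i \<cdot> pr i \<^bold>+ cut F) \<cdot> \<iota> j" if j: "j \<in> I" for j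
  proof -
    have "(\<iota> i \<cdot> pr i \<^bold>+ cut F) \<cdot> \<iota> j = (\<iota> i \<cdot> pr i) \<cdot> \<iota> j \<^bold>+ cut F \<cdot> \<iota> j"
      using assms j comp_plus_left comp_hom pr_hom \<iota>_hom cut_hom by metis
    also have "(\<iota> i \<cdot> pr i) \<cdot> \<iota> j = (if i = j then \<iota> i else ZeroM C (X j) P)"
      using assms j comp_assoc[OF \<iota>_hom[OF j] pr_hom \<iota>_hom]
      by (auto simp: pr_\<iota> pr_\<iota>_other intro: comp_ident comp_zero \<iota>_hom X_ob)
    finally show ?thesis
      using assms j \<iota>_hom[OF j] by (auto simp: cut_\<iota> plus_zero zero_plus zero_hom X_ob P_ob)
  qed
qed (rule cut_hom)

text \<open>On a finite set the cut is a sum of the \<open>\<iota> i \<cdot> pr i\<close>, so one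
  summand can be treated at a time.\<close>

lemma cut_zeroI:
  assumes "finite F" "F \<subseteq> I" and f: "f \<in> Hom C A P" and k: "k \<in> Hom C P Q"
    and "\<And>i. i \<in> F \<Longrightarrow> k \<cdot> (\<iota> i \<cdot> (pr i \<cdot> f)) = ZeroM C A Q"
  shows "k \<cdot> (cut F \<cdot> f) = ZeroM C A Q"
  using assms(1,2,5)
proof (induction F rule: finite_induct)
  case empty
  then show ?case using f k hom_objects by (auto simp: cut_empty zero_comp comp_zero)
next
  case (insert i F)
  have i: "i \<in> I" using insert by blast
  have "cut (insert i F) \<cdot> f = \<iota> i \<cdot> (pr i \<cdot> f) \<^bold>+ cut F \<cdot> f"
    using comp_plus_left[OF f comp_hom[OF pr_hom \<iota>_hom] cut_hom, OF i i]
      comp_assoc[OF f pr_hom \<iota>_hom, OF i i] cut_insert[OF i] insert by simp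
  then have "k \<cdot> (cut (insert i F) \<cdot> f) = k \<cdot> (\<iota> i \<cdot> (pr i \<cdot> f)) \<^bold>+ k \<cdot> (cut F \<cdot> f)"
    using comp_plus_right[OF comp_hom[OF comp_hom[OF f pr_hom] \<iota>_hom] comp_hom[OF f cut_hom] k, OF i i]
    by simp
  then show ?case
    using insert f k hom_objects zero_hom plus_zero by auto
qed

end

section \<open>Compactness as finite support of arrows into coproducts\<close>

lemma (in comm_monoid) finprod_closed_induct:
  assumes "finite A" "f \<in> A \<rightarrow> carrier G" "Q \<one>"
    and "\<And>x y. \<lbrakk>x \<in> carrier G; y \<in> carrier G; Q x; Q y\<rbrakk> \<Longrightarrow> Q (x \<otimes> y)"
    and "\<And>i. i \<in> A \<Longrightarrow> Q (f i)"
  shows "Q (finprod G f A)"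
  using assms(1,2,5)
proof (induction A rule: finite_induct)
  case (insert i A)
  then show ?case by (auto simp: Pi_iff intro!: assms(4) finprod_closed)
qed (use assms in simp)

text \<open>Injectivity of the canonical map is automatic, because the projections recover the
  components of a finite sum. Surjectivity says that each \<open>h\<close> is a finite sum of
  components, that is, fixed by a finite cut. In this form compactness can be transported along
  functors without sums in hom groups.\<close>

lemma compacts_iff:
  fixes T :: "('o, 'v::universe, 'z) preadd_scheme"
  assumes "preadditive T"
  shows "X \<in> compacts T \<longleftrightarrow> X \<in> Ob T \<and> (\<forall>(I :: 'v set) Y P \<iota> h.
    small TYPE('v) I \<and> is_coproduct T I Y P \<iota> \<and> h \<in> Hom T X P \<longrightarrow>
    (\<exists>F. finite F \<and> F \<subseteq> I \<and> coproduct_in.cut T I Y P \<iota> F \<cdot>\<^bsub>T\<^esub> h = h))"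
proof -
  interpret preadditive T by fact
  have main: "(\<lambda>\<phi>. gfinprod (hom_grp T X P) (\<lambda>i. \<iota> i \<cdot>\<^bsub>T\<^esub> \<phi> i) I)
       \<in> iso (sum_group I (\<lambda>i. hom_grp T X (Y i))) (hom_grp T X P) \<longleftrightarrow>
      (\<forall>h\<in>Hom T X P. \<exists>F. finite F \<and> F \<subseteq> I \<and> coproduct_in.cut T I Y P \<iota> F \<cdot>\<^bsub>T\<^esub> h = h)"
    (is "?m \<in> iso ?S ?H \<longleftrightarrow> _")
    if X: "X \<in> Ob T" and cop: "is_coproduct T I Y P \<iota>" for I :: "'v set" and Y P \<iota>
  proof -
    interpret coproduct_in T I Y P \<iota> by unfold_locales fact
    interpret G: comm_group ?H using hom_comm_group X P_ob by blast
    have grp: "group (hom_grp T X (Y i))" if "i \<in> I" for i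
      using hom_group X X_ob that by blast
    have hom: "?m \<in> hom ?S ?H"
    proof (rule G.hom_group_sum)
      show "(\<lambda>x. \<iota> i \<cdot>\<^bsub>T\<^esub> x) \<in> hom (hom_grp T X (Y i)) ?H" if "i \<in> I" for i
        using that by (auto simp: hom_def comp_plus_right[OF _ _ \<iota>_hom] comp_hom[OF _ \<iota>_hom])
    qed (use grp in auto)
    have carr: "carrier ?S = {x \<in> \<Pi>\<^sub>E i\<in>I. Hom T X (Y i). finite {i \<in> I. x i \<noteq> ZeroM T X (Y i)}}"
      using carrier_sum_group[of I "\<lambda>i. hom_grp T X (Y i)"] grp by simp
    have terms: "(\<lambda>i. \<iota> i \<cdot>\<^bsub>T\<^esub> \<phi> i) \<in> I \<rightarrow> carrier ?H" if "\<phi> \<in> carrier ?S" for \<phi>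
      using that comp_hom \<iota>_hom by (fastforce simp: carr)
    have supp: "{i \<in> I. \<iota> i \<cdot>\<^bsub>T\<^esub> \<phi> i \<noteq> ZeroM T X P} \<subseteq> {i \<in> I. \<phi> i \<noteq> ZeroM T X (Y i)}" for \<phi>
      using comp_zero \<iota>_hom X by fastforce
    have m_eq: "?m \<phi> = finprod ?H (\<lambda>i. \<iota> i \<cdot>\<^bsub>T\<^esub> \<phi> i) {i \<in> I. \<phi> i \<noteq> ZeroM T X (Y i)}"
      if "\<phi> \<in> carrier ?S" for \<phi>
    proof -
      have "?m \<phi> = gfinprod ?H (\<lambda>i. \<iota> i \<cdot>\<^bsub>T\<^esub> \<phi> i) {i \<in> I. \<phi> i \<noteq> ZeroM T X (Y i)}"
        by (rule G.gfinprod_mono_neutral_cong_right) (use supp terms[OF that] comp_zero[OF \<iota>_hom X] in auto)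
      then show ?thesis
        using that terms[OF that] by (subst (asm) G.gfinprod_eq_finprod) (auto simp: carr)
    qed
    have pr_fin: "pr j \<cdot>\<^bsub>T\<^esub> finprod ?H (\<lambda>i. \<iota> i \<cdot>\<^bsub>T\<^esub> \<phi> i) A =
        (if j \<in> A then \<phi> j else ZeroM T X (Y j))"
      if "finite A" "A \<subseteq> I" "j \<in> I" and \<phi>: "\<And>i. i \<in> I \<Longrightarrow> \<phi> i \<in> Hom T X (Y i)" for \<phi> j A
      using that(1,2)
    proof (induction A rule: finite_induct)
      case empty
      then show ?case using comp_zero[OF pr_hom[OF \<open>j \<in> I\<close>] X] by simp
    next
      case (insert i A)
      have i: "i \<in> I" using insert by blast
      have c: "\<iota> k \<cdot>\<^bsub>T\<^esub> \<phi> k \<in> Hom T X P" if "k \<in> I" for k using that comp_hom \<iota>_hom \<phi> by blast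
      have fc: "finprod ?H (\<lambda>i. \<iota> i \<cdot>\<^bsub>T\<^esub> \<phi> i) A \<in> Hom T X P"
        using insert c G.finprod_closed[of "\<lambda>i. \<iota> i \<cdot>\<^bsub>T\<^esub> \<phi> i" A] by auto
      have "pr j \<cdot>\<^bsub>T\<^esub> (\<iota> i \<cdot>\<^bsub>T\<^esub> \<phi> i) = (if j = i then \<phi> j else ZeroM T X (Y j))"
        using comp_assoc[OF \<phi> \<iota>_hom pr_hom, OF i i \<open>j \<in> I\<close>] i \<open>j \<in> I\<close> \<phi>[OF i]
          ident_comp[OF \<phi>[OF i]] zero_comp[OF \<phi>[OF i], of "Y j"] X_ob
        by (auto simp: pr_\<iota> pr_\<iota>_other)
      moreover have "finprod ?H (\<lambda>i. \<iota> i \<cdot>\<^bsub>T\<^esub> \<phi> i) (insert i A) =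
          PlusM T (\<iota> i \<cdot>\<^bsub>T\<^esub> \<phi> i) (finprod ?H (\<lambda>i. \<iota> i \<cdot>\<^bsub>T\<^esub> \<phi> i) A)"
        using insert c by (subst G.finprod_insert) auto
      ultimately show ?case
        using insert comp_plus_right[OF c[OF i] fc pr_hom[OF \<open>j \<in> I\<close>]] \<open>j \<in> I\<close> \<phi>[OF \<open>j \<in> I\<close>] X X_ob
        by (auto simp: plus_zero zero_plus zero_hom)
    qed
    have inj: "inj_on ?m (carrier ?S)"
    proof -
      interpret gh: group_hom ?S ?H ?m
        using hom grp by (simp add: group_hom_def group_hom_axioms_def)
      have "\<phi> = \<one>\<^bsub>?S\<^esub>" if "\<phi> \<in> carrier ?S" "?m \<phi> = ZeroM T X P" for \<phi>
      proof -
        have "\<phi> j = ZeroM T X (Y j)" if j: "j \<in> I" for j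
        proof (rule ccontr)
          assume "\<phi> j \<noteq> ZeroM T X (Y j)"
          moreover have "pr j \<cdot>\<^bsub>T\<^esub> ?m \<phi> = (if \<phi> j \<noteq> ZeroM T X (Y j) then \<phi> j else ZeroM T X (Y j))"
            using pr_fin[of "{i \<in> I. \<phi> i \<noteq> ZeroM T X (Y i)}" j \<phi>] \<open>\<phi> \<in> carrier ?S\<close> m_eq j
            by (simp add: carr PiE_iff)
          ultimately show False
            using \<open>?m \<phi> = ZeroM T X P\<close> comp_zero[OF pr_hom[OF j] X] by simp
        qed
        then show ?thesis using that by (auto simp: carr PiE_def extensional_def)
      qed
      then show ?thesis
        by (subst gh.inj_on_one_iff) auto
    qed
    show ?thesis
    proof
      assume iso: "?m \<in> iso ?S ?H"
      show "\<forall>h\<in>Hom T X P. \<exists>F. finite F \<and> F \<subseteq> I \<and> cut F \<cdot>\<^bsub>T\<^esub> h = h"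
      proof
        fix h assume "h \<in> Hom T X P"
        then obtain \<phi> where \<phi>: "\<phi> \<in> carrier ?S" "h = ?m \<phi>"
          using iso by (fastforce simp: iso_def bij_betw_def)
        let ?F = "{i \<in> I. \<phi> i \<noteq> ZeroM T X (Y i)}"
        have fin: "finite ?F" using \<phi> by (simp add: carr)
        have "cut ?F \<cdot>\<^bsub>T\<^esub> finprod ?H (\<lambda>i. \<iota> i \<cdot>\<^bsub>T\<^esub> \<phi> i) ?F = finprod ?H (\<lambda>i. \<iota> i \<cdot>\<^bsub>T\<^esub> \<phi> i) ?F"
        proof (rule G.finprod_closed_induct[OF fin])
          show "cut ?F \<cdot>\<^bsub>T\<^esub> (\<iota> i \<cdot>\<^bsub>T\<^esub> \<phi> i) = \<iota> i \<cdot>\<^bsub>T\<^esub> \<phi> i" if "i \<in> ?F" for i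
            using that \<phi>(1) comp_assoc[OF _ \<iota>_hom cut_hom, of "\<phi> i" X i ?F]
            by (auto simp: cut_\<iota> carr PiE_def Pi_def)
        qed (use terms[OF \<phi>(1)] comp_zero[OF cut_hom X] comp_plus_right[OF _ _ cut_hom] in auto)
        then show "\<exists>F. finite F \<and> F \<subseteq> I \<and> cut F \<cdot>\<^bsub>T\<^esub> h = h"
          using fin \<phi> m_eq by (intro exI[of _ ?F]) auto
      qed
    next
      assume *: "\<forall>h\<in>Hom T X P. \<exists>F. finite F \<and> F \<subseteq> I \<and> cut F \<cdot>\<^bsub>T\<^esub> h = h"
      have "h \<in> ?m ` carrier ?S" if h: "h \<in> Hom T X P" for h
      proof -
        obtain F where F: "finite F" "F \<subseteq> I" "cut F \<cdot>\<^bsub>T\<^esub> h = h" using * h by blast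
        \<comment> \<open>Candidate preimage of \<open>h\<close>: its components are the projections
          of \<open>h\<close>, cut off outside of \<open>F\<close>.\<close>
        let ?\<phi> = "\<lambda>i\<in>I. if i \<in> F then pr i \<cdot>\<^bsub>T\<^esub> h else ZeroM T X (Y i)"
        have \<phi>: "?\<phi> \<in> carrier ?S"
          unfolding carr using F h X_ob X
          by (auto intro!: comp_hom[OF h] pr_hom zero_hom split: if_splits
              intro: finite_subset[OF _ F(1)])
        have t: "\<iota> i \<cdot>\<^bsub>T\<^esub> (pr i \<cdot>\<^bsub>T\<^esub> h) \<in> Hom T X P" if "i \<in> I" for i
          using that comp_hom h \<iota>_hom pr_hom by blast
        have "finprod ?H (\<lambda>i. \<iota> i \<cdot>\<^bsub>T\<^esub> (pr i \<cdot>\<^bsub>T\<^esub> h)) A = cut A \<cdot>\<^bsub>T\<^esub> h" if "finite A" "A \<subseteq> I" for A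
          using that
        proof (induction A rule: finite_induct)
          case empty
          then show ?case using h P_ob by (simp add: cut_empty zero_comp)
        next
          case (insert i A)
          then have i: "i \<in> I" by blast
          have "cut (insert i A) \<cdot>\<^bsub>T\<^esub> h = PlusM T (\<iota> i \<cdot>\<^bsub>T\<^esub> (pr i \<cdot>\<^bsub>T\<^esub> h)) (cut A \<cdot>\<^bsub>T\<^esub> h)"
            using comp_plus_left[OF h comp_hom[OF pr_hom \<iota>_hom] cut_hom, OF i i]
              comp_assoc[OF h pr_hom \<iota>_hom, OF i i] cut_insert[OF i] insert by simp
          then show ?case using insert t by (subst G.finprod_insert) (auto simp: Pi_iff)
        qed
        then have "finprod ?H (\<lambda>i. \<iota> i \<cdot>\<^bsub>T\<^esub> (pr i \<cdot>\<^bsub>T\<^esub> h)) F = h" using F by simp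
        moreover have "?m ?\<phi> = gfinprod ?H (\<lambda>i. \<iota> i \<cdot>\<^bsub>T\<^esub> (pr i \<cdot>\<^bsub>T\<^esub> h)) F"
          by (rule G.gfinprod_mono_neutral_cong_right)
            (use F terms[OF \<phi>] comp_zero \<iota>_hom X in auto)
        moreover have "\<dots> = finprod ?H (\<lambda>i. \<iota> i \<cdot>\<^bsub>T\<^esub> (pr i \<cdot>\<^bsub>T\<^esub> h)) F"
          by (rule G.gfinprod_eq_finprod) (use F t in auto)
        ultimately show ?thesis using \<phi> by force
      qed
      then show "?m \<in> iso ?S ?H"
        using inj hom by (auto simp: iso_def bij_betw_def hom_def)
    qed
  qed
  have fam: "\<And>(I :: 'v set) Y P \<iota>. is_coproduct T I Y P \<iota> \<Longrightarrow> Y \<in> I \<rightarrow> Ob T"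
    using hom_objects by (fastforce simp: is_coproduct_def)
  show ?thesis
    unfolding compacts_def using main fam by (auto 0 4)
qed

section \<open>Triangulated categories\<close>

text \<open>Rotation of triangles puts a sign on an arrow; the vanishing of a composite does not see
  it.\<close>

lemma (in preadditive) neg_comp_eq_zero:
  assumes "f \<in> Hom C A B" "g \<in> Hom C B D"
  shows "(ZeroM C B D \<^bold>- g) \<cdot> f = ZeroM C A D \<longleftrightarrow> g \<cdot> f = ZeroM C A D"
proof -
  have "(ZeroM C B D \<^bold>- g) \<cdot> f = ZeroM C A D \<^bold>- g \<cdot> f"
    using assms minus_comp[OF assms(1) zero_hom assms(2)] zero_comp[OF assms(1)] hom_objects by metis
  then show ?thesis
    using assms minus_eq_zero[OF zero_hom comp_hom[OF assms]] hom_objects by metis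
qed

lemma (in preadditive) zero_minus_inj:
  assumes "f \<in> Hom C A B" "g \<in> Hom C A B" "ZeroM C A B \<^bold>- f = ZeroM C A B \<^bold>- g"
  shows "f = g"
proof -
  have z: "ZeroM C A B \<in> Hom C A B" using assms hom_objects zero_hom by blast
  note n = minus_hom[OF z assms(1)]
  have "f \<^bold>+ (ZeroM C A B \<^bold>- f) = g \<^bold>+ (ZeroM C A B \<^bold>- f)"
    using minus_plus[OF z assms(1)] minus_plus[OF z assms(2)] assms(3)
      plus_commute[OF n assms(1)] plus_commute[OF n assms(2)] by simp
  then show ?thesis using plus_right_cancel[OF assms(1,2) n] by simp
qed

context triangulated
begin

notation plus_arr (infixl \<open>\<^bold>+\<close> 65)
notation minus_arr (infixl \<open>\<^bold>-\<close> 65)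

abbreviation sh :: "'o \<Rightarrow> 'o" where
  "sh X \<equiv> FOb (Shift T) X"

abbreviation shm :: "'m \<Rightarrow> 'm" where
  "shm f \<equiv> FMor (Shift T) f"

definition triangle :: "'o \<Rightarrow> 'o \<Rightarrow> 'o \<Rightarrow> 'm \<Rightarrow> 'm \<Rightarrow> 'm \<Rightarrow> bool" where
  "triangle X Y Z f g h \<longleftrightarrow> f \<in> Hom T X Y \<and> g \<in> Hom T Y Z \<and> h \<in> Hom T Z (sh X) \<and> (f, g, h) \<in> Tri T"

lemma triangle_hom:
  "triangle X Y Z f g h \<Longrightarrow> f \<in> Hom T X Y" "triangle X Y Z f g h \<Longrightarrow> g \<in> Hom T Y Z"
  "triangle X Y Z f g h \<Longrightarrow> h \<in> Hom T Z (sh X)" "triangle X Y Z f g h \<Longrightarrow> (f, g, h) \<in> Tri T"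
  by (simp_all add: triangle_def)

lemma shm_hom: "f \<in> Hom T A B \<Longrightarrow> shm f \<in> Hom T (sh A) (sh B)"
  and shm_comp: "\<lbrakk>f \<in> Hom T A B; g \<in> Hom T B D\<rbrakk> \<Longrightarrow> shm (g \<cdot> f) = shm g \<cdot> shm f"
  and shm_ident: "A \<in> Ob T \<Longrightarrow> shm (Ident T A) = Ident T (sh A)"
  and sh_ob: "A \<in> Ob T \<Longrightarrow> sh A \<in> Ob T"
  using shift_functor unfolding is_functor_def by blast+

lemma shm_plus: "\<lbrakk>f \<in> Hom T A B; g \<in> Hom T A B\<rbrakk> \<Longrightarrow> shm (f \<^bold>+ g) = shm f \<^bold>+ shm g"
  using shift_additive unfolding additive_on_def by blast

lemma shm_zero:
  assumes "A \<in> Ob T" "B \<in> Ob T"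
  shows "shm (ZeroM T A B) = ZeroM T (sh A) (sh B)"
proof (rule idem_zero)
  show "shm (ZeroM T A B) \<in> Hom T (sh A) (sh B)"
    using zero_hom[OF assms] shm_hom by blast
  show "shm (ZeroM T A B) \<^bold>+ shm (ZeroM T A B) = shm (ZeroM T A B)"
    using shm_plus[OF zero_hom zero_hom] assms plus_zero[OF zero_hom] by metis
qed

lemma shm_inj: "\<lbrakk>f \<in> Hom T A B; g \<in> Hom T A B; shm f = shm g\<rbrakk> \<Longrightarrow> f = g"
  using shift_fully_faithful[of A B] hom_objects[of f A B] by (auto simp: bij_betw_def dest: inj_onD)

lemma shm_surj:
  assumes "A \<in> Ob T" "B \<in> Ob T" "f \<in> Hom T (sh A) (sh B)"
  obtains g where "g \<in> Hom T A B" "shm g = f"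
proof -
  have "f \<in> shm ` Hom T A B" using shift_fully_faithful[OF assms(1,2)] assms(3) by (simp add: bij_betw_def)
  then show thesis using that by blast
qed

lemma sh_zero_obj: "zero_obj T Z \<Longrightarrow> zero_obj T (sh Z)"
  using shm_ident[of Z] shm_zero[of Z Z] by (auto simp: zero_obj_iff sh_ob)

lemma desusp_ex:
  assumes "B \<in> Ob T"
  obtains A i where "A \<in> Ob T" "iso_arr T (sh A) B i"
  using shift_ess_surj[OF assms] unfolding isomorphic_def by blast

lemma cone_ex:
  assumes "f \<in> Hom T X Y"
  obtains Z g h where "triangle X Y Z f g h"
proof -
  obtain g h where gh: "(f, g, h) \<in> Tri T"
    using tri_cone[OF assms] by blast
  then obtain X' Y' Z where Z: "f \<in> Hom T X' Y'" "g \<in> Hom T Y' Z" "h \<in> Hom T Z (sh X')"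
    using tri_shape by blast
  then have "X' = X" "Y' = Y"
    using hom_disjoint assms by blast+
  then show thesis
    using that Z gh by (auto simp: triangle_def)
qed

lemma rotate:
  assumes "triangle X Y Z f g h"
  shows "triangle Y Z (sh X) g h (ZeroM T (sh X) (sh Y) \<^bold>- shm f)"
proof -
  have "ZeroM T (sh X) (sh Y) \<^bold>- shm f \<in> Hom T (sh X) (sh Y)"
    using minus_hom[OF zero_hom shm_hom] triangle_hom(1)[OF assms] hom_objects sh_ob by metis
  then show ?thesis
    using triangle_hom[OF assms] tri_rotate[OF triangle_hom(1-3)[OF assms]]
      neg_eq_minus[OF shm_hom[OF triangle_hom(1)[OF assms]]]
    by (simp add: triangle_def)
qed

text \<open>The pair \<open>Ident T X\<close>, \<open>f\<close> maps the identity triangle of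
  \<open>X\<close> to the given one, and the resulting third arrow starts at a zero object.\<close>

lemma triangle_comp_zero:
  assumes t: "triangle X Y Z f g h"
  shows "g \<cdot> f = ZeroM T X Z"
proof -
  obtain O' where O': "zero_obj T O'" using ex_zero_obj by blast
  note f = triangle_hom(1)[OF t]
  have X: "X \<in> Ob T" and Z: "Z \<in> Ob T"
    using triangle_hom[OF t] hom_objects by blast+
  have O'o: "O' \<in> Ob T" using O' by (simp add: zero_obj_def)
  obtain c where c: "c \<in> Hom T O' Z" "g \<cdot> f = c \<cdot> ZeroM T X O'"
    using tri_morphism[OF tri_ident[OF X O'] triangle_hom(4)[OF t] ident_hom[OF X] zero_hom[OF X O'o]
        f triangle_hom(2)[OF t] ident_hom[OF X] f] by blast
  then show ?thesis using comp_zero X by simp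
qed

text \<open>The triangle from which \<open>g\<close> to \<open>k\<close> is mapped is the rotated identity triangle of \<open>W\<close>.\<close>

lemma weak_cokernel:
  assumes t: "triangle X Y Z f g h" and k: "k \<in> Hom T Y W" "k \<cdot> f = ZeroM T X W"
  obtains k' where "k' \<in> Hom T Z W" "k = k' \<cdot> g"
proof -
  obtain O' where O': "zero_obj T O'" using ex_zero_obj by blast
  have W: "W \<in> Ob T" and X: "X \<in> Ob T"
    using k triangle_hom[OF t] hom_objects by blast+
  have O'o: "O' \<in> Ob T" using O' by (simp add: zero_obj_def)
  have z: "ZeroM T O' W \<in> Hom T O' W" "ZeroM T W (sh O') \<in> Hom T W (sh O')"
    "ZeroM T (sh O') (sh W) \<in> Hom T (sh O') (sh W)"
    using zero_hom W O'o sh_ob by auto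
  have "(Ident T W, ZeroM T W (sh O'), ZeroM T (sh O') (sh W)) \<in> Tri T"
    using tri_ident[OF W sh_zero_obj[OF O']] .
  moreover have "inv\<^bsub>hom_grp T (sh O') (sh W)\<^esub> (shm (ZeroM T O' W)) = ZeroM T (sh O') (sh W)"
    using neg_eq_minus[OF z(3)] minus_self[OF z(3)] shm_zero[OF O'o W] by simp
  ultimately have "(ZeroM T O' W, Ident T W, ZeroM T W (sh O')) \<in> Tri T"
    using tri_rotate[OF z(1) ident_hom[OF W] z(2)] by simp
  moreover have "ZeroM T O' W \<cdot> ZeroM T X O' = k \<cdot> f"
    using zero_comp[OF zero_hom[OF X O'o] W] k by simp
  ultimately obtain c where c: "c \<in> Hom T Z W" "Ident T W \<cdot> k = c \<cdot> g"
    using tri_morphism[OF triangle_hom(4)[OF t] _ triangle_hom(1,2)[OF t] z(1) ident_hom[OF W]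
        zero_hom[OF X O'o] k(1)] by blast
  then show thesis using that ident_comp[OF k(1)] by simp
qed

text \<open>The rotated identity triangle of \<open>W\<close> is mapped to the once rotated given
  triangle, starting from \<open>k\<close> and the arrow from a zero object to \<open>Z\<close>. The
  third arrow goes from \<open>sh W\<close> to \<open>sh X\<close>; as the shift is fully faithful
  it is the shift of some \<open>k'\<close>, and the signs on the two sides of the square
  cancel.\<close>

lemma weak_kernel:
  assumes t: "triangle X Y Z f g h" and k: "k \<in> Hom T W Y" "g \<cdot> k = ZeroM T W Z"
  obtains k' where "k' \<in> Hom T W X" "k = f \<cdot> k'"
proof -
  obtain O' where O': "zero_obj T O'" using ex_zero_obj by blast
  have W: "W \<in> Ob T" and X: "X \<in> Ob T" and Z: "Z \<in> Ob T" and Y: "Y \<in> Ob T"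
    using k triangle_hom[OF t] hom_objects by blast+
  have O'o: "O' \<in> Ob T" using O' by (simp add: zero_obj_def)
  let ?n = "\<lambda>f A B. ZeroM T A B \<^bold>- f"
  have "triangle W W O' (Ident T W) (ZeroM T W O') (ZeroM T O' (sh W))"
    using tri_ident[OF W O'] W O'o sh_ob zero_hom ident_hom by (simp add: triangle_def)
  then have tw: "triangle W O' (sh W) (ZeroM T W O') (ZeroM T O' (sh W)) (?n (Ident T (sh W)) (sh W) (sh W))"
    using rotate shm_ident[OF W] by metis
  note rt = rotate[OF t]
  have "g \<cdot> k = ZeroM T O' Z \<cdot> ZeroM T W O'"
    using zero_comp[OF zero_hom[OF W O'o] Z] k by simp
  then obtain c where c: "c \<in> Hom T (sh W) (sh X)"
    "?n (shm f) (sh X) (sh Y) \<cdot> c = shm k \<cdot> ?n (Ident T (sh W)) (sh W) (sh W)"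
    using tri_morphism[OF triangle_hom(4)[OF tw] triangle_hom(4)[OF rt] triangle_hom(1,2)[OF tw]
        triangle_hom(1,2)[OF rt] k(1) zero_hom[OF O'o Z]] by blast
  obtain k' where k': "k' \<in> Hom T W X" "shm k' = c"
    using shm_surj[OF W X c(1)] .
  have s: "shm f \<in> Hom T (sh X) (sh Y)" "shm k \<in> Hom T (sh W) (sh Y)" "Ident T (sh W) \<in> Hom T (sh W) (sh W)"
    using shm_hom triangle_hom(1)[OF t] k(1) ident_hom sh_ob W by auto
  have "?n (shm f \<cdot> c) (sh W) (sh Y) = ?n (shm k) (sh W) (sh Y)"
    using c(2) minus_comp[OF c(1) zero_hom s(1)] comp_minus[OF zero_hom s(3,2)] sh_ob X Y W
      zero_comp[OF c(1)] comp_zero[OF s(2)] comp_ident[OF s(2)] by simp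
  then have "shm f \<cdot> c = shm k"
    by (rule zero_minus_inj[OF comp_hom[OF c(1) s(1)] s(2)])
  then have "f \<cdot> k' = k"
    using shm_comp[OF k'(1) triangle_hom(1)[OF t]] k'
      shm_inj[OF comp_hom[OF k'(1) triangle_hom(1)[OF t]] k(1)] by simp
  then show thesis using that k' by blast
qed

lemma weak_kernel2:
  assumes t: "triangle X Y Z f g h" and k: "k \<in> Hom T W Z" "h \<cdot> k = ZeroM T W (sh X)"
  obtains k' where "k' \<in> Hom T W Y" "k = g \<cdot> k'"
  using weak_kernel[OF rotate[OF t] k] .

lemma triangle_comp_zero2: "triangle X Y Z f g h \<Longrightarrow> h \<cdot> g = ZeroM T Y (sh X)"
  using triangle_comp_zero rotate by blast

lemma triangle_comp_zero3:
  assumes t: "triangle X Y Z f g h"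
  shows "shm f \<cdot> h = ZeroM T Z (sh Y)"
  using triangle_comp_zero[OF rotate[OF rotate[OF t]]]
    neg_comp_eq_zero[OF triangle_hom(3)[OF t] shm_hom[OF triangle_hom(1)[OF t]]] by simp

lemma weak_cokernel2:
  assumes t: "triangle X Y Z f g h" and k: "k \<in> Hom T Z W" "k \<cdot> g = ZeroM T Y W"
  obtains k' where "k' \<in> Hom T (sh X) W" "k = k' \<cdot> h"
  using weak_cokernel[OF rotate[OF t] k] .

text \<open>Rotating backwards needs the third object to be a suspension, which holds up to
  isomorphism. After \<open>Z\<close> is replaced by \<open>sh W\<close> along \<open>i\<close>, the
  arrow \<open>f'\<close> is a desuspension of the negative of \<open>h \<cdot> i\<close>, the sign
  being the one that \<open>tri_rotate\<close> introduces.\<close>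

lemma fibre_ex_of_cone:
  assumes t: "triangle X Y Z f g h" and W: "W \<in> Ob T" "iso_arr T (sh W) Z i"
  obtains f' h' where "triangle W X Y f' f h'"
proof -
  note f = triangle_hom(1)[OF t] and g = triangle_hom(2)[OF t] and h = triangle_hom(3)[OF t]
  have X: "X \<in> Ob T" and Y: "Y \<in> Ob T" using f hom_objects by blast+
  obtain j where j: "i \<in> Hom T (sh W) Z" "j \<in> Hom T Z (sh W)" "j \<cdot> i = Ident T (sh W)" "i \<cdot> j = Ident T Z"
    using W(2) by (rule iso_arrE)
  have ij: "iso_arr T Z (sh W) j" using j iso_arrI by blast
  have hi: "h \<cdot> i \<in> Hom T (sh W) (sh X)" using j h comp_hom by blast
  have "(h \<cdot> i) \<cdot> j = h"
    using comp_assoc[OF j(2,1) h] j comp_ident[OF h] by simp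
  then have tri: "(f, j \<cdot> g, h \<cdot> i) \<in> Tri T"
    using tri_iso[OF triangle_hom(4)[OF t] f g h f comp_hom[OF g j(2)] hi iso_ident[OF X]
        iso_ident[OF Y] ij] comp_ident[OF f] ident_comp[OF f] comp_ident[OF comp_hom[OF g j(2)]]
      shm_ident[OF X] ident_comp[OF h] by simp
  have z: "ZeroM T (sh W) (sh X) \<in> Hom T (sh W) (sh X)"
    using zero_hom sh_ob W X by blast
  obtain f' where f': "f' \<in> Hom T W X" "shm f' = ZeroM T (sh W) (sh X) \<^bold>- h \<cdot> i"
    using shm_surj[OF W(1) X minus_hom[OF z hi]] .
  have "ZeroM T (sh W) (sh X) \<^bold>- shm f' = h \<cdot> i"
    unfolding f'(2) by (rule minus_eqI[OF hi minus_hom[OF z hi]])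
      (use minus_plus[OF z hi] plus_commute[OF hi minus_hom[OF z hi]] in simp)
  then have "inv\<^bsub>hom_grp T (sh W) (sh X)\<^esub> (shm f') = h \<cdot> i"
    using neg_eq_minus[OF shm_hom[OF f'(1)]] by simp
  then have "(f', f, j \<cdot> g) \<in> Tri T"
    using tri_rotate[OF f'(1) f comp_hom[OF g j(2)]] tri by simp
  then show thesis
    using that f' f comp_hom[OF g j(2)] by (simp add: triangle_def)
qed

end

subsection \<open>Exact functors\<close>

locale exact_ftr = triangulated T for T :: "('o, 'm, 'z) tri_cat_scheme" (structure) +
  fixes \<Phi> :: "('o, 'm, 'o, 'm) ftr"
  assumes exact: "exact_functor T \<Phi>"
begin

lemma F_ob: "A \<in> Ob T \<Longrightarrow> FOb \<Phi> A \<in> Ob T"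
  and F_ident: "A \<in> Ob T \<Longrightarrow> FMor \<Phi> (Ident T A) = Ident T (FOb \<Phi> A)"
  and F_hom: "f \<in> Hom T A B \<Longrightarrow> FMor \<Phi> f \<in> Hom T (FOb \<Phi> A) (FOb \<Phi> B)"
  and F_comp: "\<lbrakk>f \<in> Hom T A B; g \<in> Hom T B D\<rbrakk> \<Longrightarrow> FMor \<Phi> (g \<cdot> f) = FMor \<Phi> g \<cdot> FMor \<Phi> f"
  and F_plus: "\<lbrakk>f \<in> Hom T A B; g \<in> Hom T A B\<rbrakk> \<Longrightarrow> FMor \<Phi> (f \<^bold>+ g) = FMor \<Phi> f \<^bold>+ FMor \<Phi> g"
  using exact unfolding exact_functor_def is_functor_def additive_on_def by blast+

lemma F_zero:
  assumes "A \<in> Ob T" "B \<in> Ob T"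
  shows "FMor \<Phi> (ZeroM T A B) = ZeroM T (FOb \<Phi> A) (FOb \<Phi> B)"
proof (rule idem_zero)
  show "FMor \<Phi> (ZeroM T A B) \<in> Hom T (FOb \<Phi> A) (FOb \<Phi> B)"
    using zero_hom[OF assms] F_hom by blast
  show "FMor \<Phi> (ZeroM T A B) \<^bold>+ FMor \<Phi> (ZeroM T A B) = FMor \<Phi> (ZeroM T A B)"
    using F_plus[OF zero_hom zero_hom] assms plus_zero[OF zero_hom] by metis
qed

lemma F_minus:
  assumes "f \<in> Hom T A B" "g \<in> Hom T A B"
  shows "FMor \<Phi> (f \<^bold>- g) = FMor \<Phi> f \<^bold>- FMor \<Phi> g"
  using minus_eqI[OF F_hom[OF minus_hom[OF assms]] F_hom[OF assms(2)] refl]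
    F_plus[OF minus_hom[OF assms] assms(2)] minus_plus[OF assms] by simp

lemma F_zero_obj: "zero_obj T Z \<Longrightarrow> zero_obj T (FOb \<Phi> Z)"
  using F_ident[of Z] F_zero[of Z Z] by (auto simp: zero_obj_iff F_ob)

lemma F_triangle:
  assumes t: "triangle X Y Z f g h"
  obtains h' where "triangle (FOb \<Phi> X) (FOb \<Phi> Y) (FOb \<Phi> Z) (FMor \<Phi> f) (FMor \<Phi> g) h'"
proof -
  obtain \<theta> where \<theta>: "\<And>X. X \<in> Ob T \<Longrightarrow> iso_arr T (FOb \<Phi> (sh X)) (sh (FOb \<Phi> X)) (\<theta> X)"
    "\<forall>(f, g, h)\<in>Tri T. (FMor \<Phi> f, FMor \<Phi> g, \<theta> (dom_of T f) \<cdot> FMor \<Phi> h) \<in> Tri T"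
    using exact unfolding exact_functor_def by blast
  note f = triangle_hom(1)[OF t]
  have "\<theta> X \<cdot> FMor \<Phi> h \<in> Hom T (FOb \<Phi> Z) (sh (FOb \<Phi> X))"
    using \<theta>(1) iso_arr_hom comp_hom F_hom[OF triangle_hom(3)[OF t]] hom_objects f by blast
  moreover have "(FMor \<Phi> f, FMor \<Phi> g, \<theta> X \<cdot> FMor \<Phi> h) \<in> Tri T"
    using \<theta>(2) triangle_hom(4)[OF t] dom_of_eq[OF f] by auto
  ultimately show thesis
    using that F_hom triangle_hom[OF t] by (auto simp: triangle_def)
qed

lemma F_weak_kernel:
  assumes t: "triangle X Y Z f g h"
    and k: "k \<in> Hom T W (FOb \<Phi> Y)" "FMor \<Phi> g \<cdot> k = ZeroM T W (FOb \<Phi> Z)"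
  obtains k' where "k' \<in> Hom T W (FOb \<Phi> X)" "k = FMor \<Phi> f \<cdot> k'"
  using F_triangle[OF t] weak_kernel[OF _ k] by metis

text \<open>After two rotations the second arrow is the negative of \<open>shm f\<close>; the sign
  is dropped by \<open>neg_comp_eq_zero\<close>.\<close>

lemma F_weak_kernel3:
  assumes t: "triangle X Y Z f g h"
    and k: "k \<in> Hom T W (FOb \<Phi> (sh X))" "FMor \<Phi> (shm f) \<cdot> k = ZeroM T W (FOb \<Phi> (sh Y))"
  obtains k' where "k' \<in> Hom T W (FOb \<Phi> Z)" "k = FMor \<Phi> h \<cdot> k'"
proof -
  note s = shm_hom[OF triangle_hom(1)[OF t]]
  have o: "sh X \<in> Ob T" "sh Y \<in> Ob T" using s hom_objects by blast+
  have "FMor \<Phi> (ZeroM T (sh X) (sh Y) \<^bold>- shm f) \<cdot> k = ZeroM T W (FOb \<Phi> (sh Y))"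
    using F_minus[OF zero_hom[OF o] s] F_zero[OF o] neg_comp_eq_zero[OF k(1) F_hom[OF s]] k(2) by simp
  then show thesis
    using F_weak_kernel[OF rotate[OF rotate[OF t]] k(1)] that by blast
qed

end

section \<open>Compact objects\<close>

context rigidly_compactly_generated_tt
begin

lemma preadditive_T: "preadditive T"
  by unfold_locales

lemma compact_ob: "X \<in> compacts T \<Longrightarrow> X \<in> Ob T"
  by (simp add: compacts_def)

lemma compact_cut:
  assumes "X \<in> compacts T" "small TYPE('v) (I :: 'v set)" "is_coproduct T I Y P \<iota>" "h \<in> Hom T X P"
  obtains F where "finite F" "F \<subseteq> I" "coproduct_in.cut T I Y P \<iota> F \<cdot> h = h"
  using iffD1[OF compacts_iff[OF preadditive_T] assms(1), THEN conjunct2, rule_format, of I Y P \<iota> h]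
    assms(2-4) that by blast

lemma compactI:
  assumes "X \<in> Ob T"
    and "\<And>(I :: 'v set) Y P \<iota> h. \<lbrakk>small TYPE('v) I; is_coproduct T I Y P \<iota>; h \<in> Hom T X P\<rbrakk>
      \<Longrightarrow> \<exists>F. finite F \<and> F \<subseteq> I \<and> coproduct_in.cut T I Y P \<iota> F \<cdot> h = h"
  shows "X \<in> compacts T"
proof (rule iffD2[OF compacts_iff[OF preadditive_T]], intro conjI allI impI)
qed (use assms in blast)+

lemma coproduct_inI: "is_coproduct T I Y P \<iota> \<Longrightarrow> coproduct_in T I Y P \<iota>"
  by unfold_locales

lemma compact_retract:
  assumes A: "A \<in> compacts T" and i: "i \<in> Hom T X A" and p: "p \<in> Hom T A X"
    and pi: "p \<cdot> i = Ident T X"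
  shows "X \<in> compacts T"
proof (rule compactI)
  show "X \<in> Ob T" using i hom_objects by blast
  fix I :: "'v set" and Y P \<iota> h
  assume I: "small TYPE('v) I" and cop: "is_coproduct T I Y P \<iota>" and h: "h \<in> Hom T X P"
  interpret coproduct_in T I Y P \<iota> using cop by (rule coproduct_inI)
  note hp = comp_hom[OF p h]
  obtain F where F: "finite F" "F \<subseteq> I" "cut F \<cdot> (h \<cdot> p) = h \<cdot> p"
    using compact_cut[OF A I cop hp] .
  have "(h \<cdot> p) \<cdot> i = h" using comp_assoc[OF i p h] pi comp_ident[OF h] by simp
  then have "cut F \<cdot> h = h"
    using F(3) comp_assoc[OF i hp cut_hom[of F]] by simp
  then show "\<exists>F. finite F \<and> F \<subseteq> I \<and> cut F \<cdot> h = h" using F by blast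
qed

lemma compact_iso: "B \<in> compacts T \<Longrightarrow> iso_arr T A B i \<Longrightarrow> A \<in> compacts T"
  by (elim iso_arrE) (rule compact_retract)

text \<open>The shift is an equivalence: a cocone with vertex \<open>W\<close> desuspends once
  \<open>W\<close> is replaced by an isomorphic suspension \<open>sh W'\<close>.\<close>

lemma shift_coproduct:
  assumes cop: "is_coproduct T I Y P \<iota>"
  shows "is_coproduct T I (\<lambda>i. sh (Y i)) (sh P) (\<lambda>i. shm (\<iota> i))"
  unfolding is_coproduct_def
proof (intro conjI ballI allI impI)
  interpret coproduct_in T I Y P \<iota> using cop by (rule coproduct_inI)
  show "sh P \<in> Ob T" using sh_ob P_ob by blast
  show "shm (\<iota> i) \<in> Hom T (sh (Y i)) (sh P)" if "i \<in> I" for i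
    using that shm_hom \<iota>_hom by blast
  fix W f
  assume W: "W \<in> Ob T" and f: "\<forall>i\<in>I. f i \<in> Hom T (sh (Y i)) W"
  obtain W' j where W': "W' \<in> Ob T" "iso_arr T (sh W') W j"
    using desusp_ex[OF W] .
  obtain j' where j: "j \<in> Hom T (sh W') W" "j' \<in> Hom T W (sh W')" "j' \<cdot> j = Ident T (sh W')"
    "j \<cdot> j' = Ident T W"
    using W'(2) by (rule iso_arrE)
  have "\<forall>i\<in>I. \<exists>g\<in>Hom T (Y i) W'. shm g = j' \<cdot> f i"
    using f X_ob W'(1) shm_surj comp_hom j(2) by metis
  then obtain g where g: "\<And>i. i \<in> I \<Longrightarrow> g i \<in> Hom T (Y i) W'" "\<And>i. i \<in> I \<Longrightarrow> shm (g i) = j' \<cdot> f i"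
    by metis
  obtain k where k: "k \<in> Hom T P W'" "\<And>i. i \<in> I \<Longrightarrow> k \<cdot> \<iota> i = g i"
    using copair_ex1[OF W'(1), of g] g by blast
  show "\<exists>!h. h \<in> Hom T (sh P) W \<and> (\<forall>i\<in>I. h \<cdot> shm (\<iota> i) = f i)"
  proof (rule ex1I[of _ "j \<cdot> shm k"], intro conjI ballI)
    show "j \<cdot> shm k \<in> Hom T (sh P) W" using shm_hom k comp_hom j by blast
    show "(j \<cdot> shm k) \<cdot> shm (\<iota> i) = f i" if i: "i \<in> I" for i
      using comp_assoc[OF shm_hom[OF \<iota>_hom[OF i]] shm_hom[OF k(1)] j(1)] i k(2) g(2)
        shm_comp[OF \<iota>_hom[OF i] k(1)] comp_assoc[OF f[rule_format, OF i] j(2,1)] j(4)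
        ident_comp[OF f[rule_format, OF i]] by simp
  next
    fix h assume h: "h \<in> Hom T (sh P) W \<and> (\<forall>i\<in>I. h \<cdot> shm (\<iota> i) = f i)"
    then have h1: "h \<in> Hom T (sh P) W" by blast
    obtain h' where h': "h' \<in> Hom T P W'" "shm h' = j' \<cdot> h"
      using shm_surj[OF P_ob W'(1) comp_hom[OF h1 j(2)]] .
    have "h' = k"
    proof (rule cop_ext[OF h'(1) k(1)])
      fix i assume i: "i \<in> I"
      have "shm (h' \<cdot> \<iota> i) = shm (g i)"
        using shm_comp[OF \<iota>_hom[OF i] h'(1)] h'(2) comp_assoc[OF shm_hom[OF \<iota>_hom[OF i]] h1 j(2)]
          h i g(2) by simp
      then show "h' \<cdot> \<iota> i = k \<cdot> \<iota> i"
        using shm_inj[OF comp_hom[OF \<iota>_hom[OF i] h'(1)] g(1)[OF i]] k(2) i by simp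
    qed
    then show "h = j \<cdot> shm k"
      using h'(2) comp_assoc[OF h1 j(2,1)] j(4) ident_comp[OF h1] by simp
  qed
qed

lemma additive_cut:
  assumes cop: "is_coproduct T I Y P \<iota>"
    and cop': "is_coproduct T I (\<lambda>i. FOb \<Phi> (Y i)) (FOb \<Phi> P) (\<lambda>i. FMor \<Phi> (\<iota> i))"
    and fct: "is_functor T T \<Phi>"
    and zero: "\<And>A B. \<lbrakk>A \<in> Ob T; B \<in> Ob T\<rbrakk> \<Longrightarrow> FMor \<Phi> (ZeroM T A B) = ZeroM T (FOb \<Phi> A) (FOb \<Phi> B)"
  shows "coproduct_in.cut T I (\<lambda>i. FOb \<Phi> (Y i)) (FOb \<Phi> P) (\<lambda>i. FMor \<Phi> (\<iota> i)) F
    = FMor \<Phi> (coproduct_in.cut T I Y P \<iota> F)"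
proof -
  interpret A: coproduct_in T I Y P \<iota> using cop by (rule coproduct_inI)
  interpret B: coproduct_in T I "\<lambda>i. FOb \<Phi> (Y i)" "FOb \<Phi> P" "\<lambda>i. FMor \<Phi> (\<iota> i)"
    using cop' by (rule coproduct_inI)
  have comp: "FMor \<Phi> (A.cut F) \<cdot> FMor \<Phi> (\<iota> i) = FMor \<Phi> (A.cut F \<cdot> \<iota> i)" if "i \<in> I" for i
    using fct A.\<iota>_hom[OF that] A.cut_hom unfolding is_functor_def by metis
  show ?thesis
  proof (rule B.cop_ext[OF B.cut_hom])
    show "FMor \<Phi> (A.cut F) \<in> Hom T (FOb \<Phi> P) (FOb \<Phi> P)"
      using fct A.cut_hom unfolding is_functor_def by blast
    show "B.cut F \<cdot> FMor \<Phi> (\<iota> i) = FMor \<Phi> (A.cut F) \<cdot> FMor \<Phi> (\<iota> i)" if "i \<in> I" for i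
      using that comp A.cut_\<iota> B.cut_\<iota> zero[OF A.X_ob[OF that] A.P_ob] by simp
  qed
qed

lemma compact_desusp:
  assumes "sh X \<in> compacts T" "X \<in> Ob T"
  shows "X \<in> compacts T"
proof (rule compactI)
  fix I :: "'v set" and Y P \<iota> h
  assume I: "small TYPE('v) I" and cop: "is_coproduct T I Y P \<iota>" and h: "h \<in> Hom T X P"
  interpret coproduct_in T I Y P \<iota> using cop by (rule coproduct_inI)
  obtain F where F: "finite F" "F \<subseteq> I" "shm (cut F) \<cdot> shm h = shm h"
    using compact_cut[OF assms(1) I shift_coproduct[OF cop] shm_hom[OF h]]
      additive_cut[OF cop shift_coproduct[OF cop] shift_functor shm_zero] by metis
  then have "cut F \<cdot> h = h"
    using shm_inj[OF comp_hom[OF h cut_hom] h] shm_comp[OF h cut_hom] by metis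
  then show "\<exists>F. finite F \<and> F \<subseteq> I \<and> cut F \<cdot> h = h" using F by blast
qed fact

text \<open>An arrow out of \<open>sh X\<close> desuspends when its target is a suspension. So each
  summand \<open>Y i\<close> is replaced by an isomorphic \<open>sh (A i)\<close>, and
  \<open>q\<close>, \<open>r\<close> compare \<open>P\<close> with the suspension of the coproduct
  \<open>Q\<close> of the \<open>A i\<close>; the finite support of the desuspended arrow is then
  carried back.\<close>

lemma compact_shift:
  assumes "X \<in> compacts T"
  shows "sh X \<in> compacts T"
proof (rule compactI)
  show "sh X \<in> Ob T" using assms compact_ob sh_ob by blast
  fix I :: "'v set" and Y P \<iota> h
  assume I: "small TYPE('v) I" and cop: "is_coproduct T I Y P \<iota>" and h: "h \<in> Hom T (sh X) P"
  interpret coproduct_in T I Y P \<iota> using cop by (rule coproduct_inI)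
  have "\<forall>i\<in>I. \<exists>A j. A \<in> Ob T \<and> iso_arr T (sh A) (Y i) j"
    using desusp_ex X_ob by metis
  then obtain A j where Aj: "\<And>i. i \<in> I \<Longrightarrow> A i \<in> Ob T" "\<And>i. i \<in> I \<Longrightarrow> iso_arr T (sh (A i)) (Y i) (j i)"
    by metis
  let ?j' = "\<lambda>i. inv_arr T (j i)"
  note jh = iso_arr_hom[OF Aj(2)] and j'h = inv_arr(1)[OF Aj(2)]
  obtain Q \<kappa> where Q: "is_coproduct T I A Q \<kappa>"
    using ex_coproduct[OF I, of A] Aj(1) by blast
  interpret Q: coproduct_in T I A Q \<kappa> using Q by (rule coproduct_inI)
  interpret S: coproduct_in T I "\<lambda>i. sh (A i)" "sh Q" "\<lambda>i. shm (\<kappa> i)"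
    using shift_coproduct[OF Q] by (rule coproduct_inI)
  obtain q where q: "q \<in> Hom T P (sh Q)" "\<And>i. i \<in> I \<Longrightarrow> q \<cdot> \<iota> i = shm (\<kappa> i) \<cdot> ?j' i"
    using copair_ex1[OF S.P_ob, of "\<lambda>i. shm (\<kappa> i) \<cdot> ?j' i"] comp_hom[OF j'h S.\<iota>_hom] by blast
  obtain r where r: "r \<in> Hom T (sh Q) P" "\<And>i. i \<in> I \<Longrightarrow> r \<cdot> shm (\<kappa> i) = \<iota> i \<cdot> j i"
    using S.copair_ex1[OF P_ob, of "\<lambda>i. \<iota> i \<cdot> j i"] comp_hom[OF jh \<iota>_hom] by blast
  have Xo: "X \<in> Ob T" using assms compact_ob by blast
  obtain h' where h': "h' \<in> Hom T X Q" "shm h' = q \<cdot> h"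
    using shm_surj[OF Xo Q.P_ob comp_hom[OF h q(1)]] .
  obtain F where F: "finite F" "F \<subseteq> I" "Q.cut F \<cdot> h' = h'"
    using compact_cut[OF assms I Q h'(1)] .
  let ?c = "shm (Q.cut F)"
  note c = shm_hom[OF Q.cut_hom, of F]
  have rcq: "r \<cdot> (s \<cdot> q) \<cdot> \<iota> i = r \<cdot> ((s \<cdot> shm (\<kappa> i)) \<cdot> ?j' i)"
    if i: "i \<in> I" and s: "s \<in> Hom T (sh Q) (sh Q)" for i s
    using comp_assoc[OF \<iota>_hom[OF i] comp_hom[OF q(1) s] r(1)] comp_assoc[OF \<iota>_hom[OF i] q(1) s]
      q(2)[OF i] comp_assoc[OF j'h[OF i] S.\<iota>_hom[OF i] s] by simp
  have rkj: "r \<cdot> (shm (\<kappa> i) \<cdot> ?j' i) = \<iota> i" if i: "i \<in> I" for i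
    using comp_assoc[OF j'h[OF i] S.\<iota>_hom[OF i] r(1)] r(2)[OF i]
      comp_assoc[OF j'h[OF i] jh[OF i] \<iota>_hom[OF i]] inv_arr(3)[OF Aj(2)[OF i]] comp_ident[OF \<iota>_hom[OF i]]
    by simp
  have "r \<cdot> (Ident T (sh Q) \<cdot> q) = Ident T P"
  proof (rule cop_ext)
    show "r \<cdot> (Ident T (sh Q) \<cdot> q) \<in> Hom T P P" using q r ident_comp comp_hom by metis
    show "Ident T P \<in> Hom T P P" using ident_hom P_ob by blast
    show "r \<cdot> (Ident T (sh Q) \<cdot> q) \<cdot> \<iota> i = Ident T P \<cdot> \<iota> i" if i: "i \<in> I" for i
      using rcq[OF i ident_hom[OF S.P_ob]] rkj[OF i] ident_comp[OF S.\<iota>_hom[OF i]] ident_comp[OF \<iota>_hom[OF i]]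
      by simp
  qed
  then have rq: "r \<cdot> q = Ident T P" using ident_comp[OF q(1)] by simp
  have rc: "r \<cdot> (?c \<cdot> q) = cut F"
  proof (rule cop_ext[OF _ cut_hom])
    show "r \<cdot> (?c \<cdot> q) \<in> Hom T P P" using q r c comp_hom by blast
    fix i assume i: "i \<in> I"
    have "?c \<cdot> shm (\<kappa> i) = (if i \<in> F then shm (\<kappa> i) else ZeroM T (sh (A i)) (sh Q))"
      using shm_comp[OF Q.\<iota>_hom[OF i] Q.cut_hom[of F]] Q.cut_\<iota>[OF i] shm_zero[OF Aj(1)[OF i] Q.P_ob] by (simp split: if_splits)
    then show "r \<cdot> (?c \<cdot> q) \<cdot> \<iota> i = cut F \<cdot> \<iota> i"
      using rcq[OF i c] rkj[OF i] cut_\<iota>[OF i] zero_comp[OF j'h[OF i] S.P_ob] comp_zero[OF r(1) X_ob[OF i]]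
      by simp
  qed
  have "cut F \<cdot> h = r \<cdot> (?c \<cdot> (q \<cdot> h))"
    using rc comp_assoc[OF h comp_hom[OF q(1) c] r(1)] comp_assoc[OF h q(1) c] by simp
  also have "?c \<cdot> (q \<cdot> h) = q \<cdot> h"
    using F(3) h'(2) shm_comp[OF h'(1) Q.cut_hom[of F]] by simp
  also have "r \<cdot> (q \<cdot> h) = h"
    using comp_assoc[OF h q(1) r(1)] rq ident_comp[OF h] by simp
  finally show "\<exists>F. finite F \<and> F \<subseteq> I \<and> cut F \<cdot> h = h" using F by blast
qed

text \<open>The restriction of \<open>k\<close> to \<open>B\<close> has finite support
  \<open>F\<close>. The difference of \<open>k\<close> and \<open>cut F \<cdot> k\<close> vanishes
  on \<open>B\<close>, so it factors over the compact object \<open>sh A\<close> and has finite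
  support \<open>F'\<close>; the union of both sets serves \<open>k\<close>.\<close>

lemma compact_cone:
  assumes t: "triangle A B Z f g h" and A: "A \<in> compacts T" and B: "B \<in> compacts T"
  shows "Z \<in> compacts T"
proof (rule compactI)
  note g = triangle_hom(2)[OF t] and h = triangle_hom(3)[OF t]
  show Z: "Z \<in> Ob T" using g hom_objects by blast
  fix I :: "'v set" and Y P \<iota> k
  assume I: "small TYPE('v) I" and cop: "is_coproduct T I Y P \<iota>" and k: "k \<in> Hom T Z P"
  interpret coproduct_in T I Y P \<iota> using cop by (rule coproduct_inI)
  obtain F where F: "finite F" "F \<subseteq> I" "cut F \<cdot> (k \<cdot> g) = k \<cdot> g"
    using compact_cut[OF B I cop comp_hom[OF g k]] .
  note ck = comp_hom[OF k cut_hom[of F]]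
  have "(k \<^bold>- cut F \<cdot> k) \<cdot> g = ZeroM T B P"
    using minus_comp[OF g k ck] comp_assoc[OF g k cut_hom[of F]] F(3) minus_self[OF comp_hom[OF g k]]
    by simp
  then obtain m where m: "m \<in> Hom T (sh A) P" "k \<^bold>- cut F \<cdot> k = m \<cdot> h"
    using weak_cokernel2[OF t minus_hom[OF k ck]] by blast
  obtain F' where F': "finite F'" "F' \<subseteq> I" "cut F' \<cdot> m = m"
    using compact_cut[OF compact_shift[OF A] I cop m(1)] .
  let ?c = "cut (F \<union> F')"
  have "?c \<cdot> m = m" using cut_absorb[OF _ m(1) F'(3)] by blast
  then have "?c \<cdot> (m \<cdot> h) = m \<cdot> h" using comp_assoc[OF h m(1) cut_hom, of "F \<union> F'"] by simp
  moreover have "?c \<cdot> (cut F \<cdot> k) = cut F \<cdot> k"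
    by (rule cut_absorb[OF _ ck]) (use comp_assoc[OF k cut_hom cut_hom, of F F] cut_cut in auto)
  moreover have "k = m \<cdot> h \<^bold>+ cut F \<cdot> k" using minus_plus[OF k ck] m(2) by simp
  ultimately have "?c \<cdot> k = k"
    using comp_plus_right[OF comp_hom[OF h m(1)] ck cut_hom[of "F \<union> F'"]] by metis
  then show "\<exists>F. finite F \<and> F \<subseteq> I \<and> cut F \<cdot> k = k"
    using F F' by (intro exI[of _ "F \<union> F'"]) auto
qed

lemma compact_fibre_ex:
  assumes f: "f \<in> Hom T B A" and "A \<in> compacts T" "B \<in> compacts T"
  obtains W g h where "W \<in> compacts T" "triangle W B A g f h"
proof -
  obtain Z g h where t: "triangle B A Z f g h" using cone_ex[OF f] .
  have Z: "Z \<in> compacts T" using compact_cone[OF t] assms by blast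
  obtain W i where W: "W \<in> Ob T" "iso_arr T (sh W) Z i" using desusp_ex[OF compact_ob[OF Z]] .
  have "W \<in> compacts T" using compact_desusp compact_iso[OF Z W(2)] W(1) by blast
  then show thesis using fibre_ex_of_cone[OF t W] that by blast
qed

lemma compact_cone_ex:
  assumes f: "f \<in> Hom T A B" and "A \<in> compacts T" "B \<in> compacts T"
  obtains Z g h where "Z \<in> compacts T" "triangle A B Z f g h"
  using cone_ex[OF f] compact_cone assms by metis

lemma compact_bicoproduct:
  assumes bc: "is_coproduct T (UNIV :: bool set) (\<lambda>b. if b then A else B) S \<sigma>"
    and A: "A \<in> compacts T" and B: "B \<in> compacts T"
  shows "S \<in> compacts T"
proof (rule compactI)
  interpret S: coproduct_in T UNIV "\<lambda>b. if b then A else B" S \<sigma> using bc by (rule coproduct_inI)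
  show "S \<in> Ob T" by (rule S.P_ob)
  fix I :: "'v set" and Y P \<iota> k
  assume I: "small TYPE('v) I" and cop: "is_coproduct T I Y P \<iota>" and k: "k \<in> Hom T S P"
  interpret coproduct_in T I Y P \<iota> using cop by (rule coproduct_inI)
  have s: "\<sigma> True \<in> Hom T A S" "\<sigma> False \<in> Hom T B S"
    using S.\<iota>_hom[of True] S.\<iota>_hom[of False] by auto
  obtain F where F: "finite F" "F \<subseteq> I" "cut F \<cdot> (k \<cdot> \<sigma> True) = k \<cdot> \<sigma> True"
    using compact_cut[OF A I cop comp_hom[OF s(1) k]] .
  obtain F' where F': "finite F'" "F' \<subseteq> I" "cut F' \<cdot> (k \<cdot> \<sigma> False) = k \<cdot> \<sigma> False"
    using compact_cut[OF B I cop comp_hom[OF s(2) k]] .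
  let ?c = "cut (F \<union> F')"
  have "?c \<cdot> k = k"
  proof (rule S.cop_ext[OF comp_hom[OF k cut_hom] k])
    fix b :: bool
    show "?c \<cdot> k \<cdot> \<sigma> b = k \<cdot> \<sigma> b"
    proof (cases b)
      case True
      then show ?thesis
        using cut_absorb[OF _ comp_hom[OF s(1) k] F(3), of "F \<union> F'"] comp_assoc[OF s(1) k cut_hom] by simp
    next
      case False
      then show ?thesis
        using cut_absorb[OF _ comp_hom[OF s(2) k] F'(3), of "F \<union> F'"] comp_assoc[OF s(2) k cut_hom] by simp
    qed
  qed
  then show "\<exists>F. finite F \<and> F \<subseteq> I \<and> cut F \<cdot> k = k"
    using F F' by (intro exI[of _ "F \<union> F'"]) auto
qed

lemma compact_zero: "zero_obj T Z \<Longrightarrow> Z \<in> compacts T"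
proof (rule compactI)
  assume Z: "zero_obj T Z"
  show "Z \<in> Ob T" using Z by (simp add: zero_obj_def)
  fix I :: "'v set" and Y P \<iota> h
  assume cop: "is_coproduct T I Y P \<iota>" and h: "h \<in> Hom T Z P"
  interpret coproduct_in T I Y P \<iota> using cop by (rule coproduct_inI)
  have "cut {} \<cdot> h = h"
    using zero_obj_hom(2)[OF Z h] zero_obj_hom(2)[OF Z comp_hom[OF h cut_hom]] by simp
  then show "\<exists>F. finite F \<and> F \<subseteq> I \<and> cut F \<cdot> h = h"
    by (intro exI[of _ "{}"]) simp
qed

end

section \<open>Cellular approximation\<close>

lemma (in rigidly_compactly_generated_tt) bicoproduct_ex:
  assumes "A \<in> compacts T" "B \<in> compacts T"
  obtains S \<sigma> where "S \<in> compacts T" "is_coproduct T (UNIV :: bool set) (\<lambda>b. if b then A else B) S \<sigma>"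
proof -
  obtain S \<sigma> where s: "is_coproduct T (UNIV :: bool set) (\<lambda>b. if b then A else B) S \<sigma>"
    using ex_binary_coproduct compact_ob assms by blast
  then show thesis using that compact_bicoproduct assms by blast
qed

lemma (in rigidly_compactly_generated_tt) compact_desusp_ex:
  assumes "A \<in> compacts T"
  obtains B i where "B \<in> compacts T" "iso_arr T (sh B) A i"
proof -
  obtain B i where B: "B \<in> Ob T" "iso_arr T (sh B) A i"
    using desusp_ex[OF compact_ob[OF assms]] .
  then show thesis using that compact_desusp compact_iso[OF assms B(2)] by blast
qed

text \<open>A small substitute for the class of compact objects: it still generates and is closed,
  up to isomorphism or for one choice of cone and sum, under the operations that build cells.
  Smallness allows coproducts over all arrows from \<open>K\<close> to a given object.\<close>

locale cells = rigidly_compactly_generated_tt T for T :: "('o, 'v::universe, 'z) tt_cat_scheme" (structure) +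
  fixes K :: "'o set"
  assumes K_small: "small TYPE('v) K"
    and K_compact: "K \<subseteq> compacts T"
    and K_generates: "\<lbrakk>X \<in> Ob T; \<And>A. A \<in> K \<Longrightarrow> Hom T A X = {ZeroM T A X}\<rbrakk> \<Longrightarrow> zero_obj T X"
    and K_zero: "\<exists>Z\<in>K. zero_obj T Z"
    and K_desusp: "A \<in> K \<Longrightarrow> \<exists>B\<in>K. \<exists>i. iso_arr T (sh B) A i"
    and K_cone: "\<lbrakk>A \<in> K; B \<in> K; f \<in> Hom T A B\<rbrakk> \<Longrightarrow> \<exists>Z\<in>K. \<exists>g h. triangle A B Z f g h"
    and K_coproduct: "\<lbrakk>A \<in> K; B \<in> K\<rbrakk>
      \<Longrightarrow> \<exists>S\<in>K. \<exists>\<sigma>. is_coproduct T (UNIV :: bool set) (\<lambda>b. if b then A else B) S \<sigma>"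

lemma (in rigidly_compactly_generated_tt) cells_ex: "\<exists>K. cells T K"
proof -
  obtain G where G: "small TYPE('v) G" "G \<subseteq> compacts T"
    "\<And>X. X \<in> Ob T \<Longrightarrow> (\<forall>A\<in>G. Hom T A X = {ZeroM T A X}) \<Longrightarrow> zero_obj T X"
    using compactly_generated by blast
  obtain Z where Z: "zero_obj T Z" using ex_zero_obj by blast
  have "\<forall>A\<in>compacts T. \<exists>B. B \<in> compacts T \<and> (\<exists>i. iso_arr T (sh B) A i)"
    using compact_desusp_ex by blast
  then obtain ds where ds: "\<And>A. A \<in> compacts T \<Longrightarrow> ds A \<in> compacts T \<and> (\<exists>i. iso_arr T (sh (ds A)) A i)"
    using bchoice[of "compacts T"] by metis
  \<comment> \<open>The cone is chosen as a function of the arrow alone, which determines its source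
    and target; so closing up under cones adds an image of a small set.\<close>
  have "\<exists>Z. \<forall>A\<in>compacts T. \<forall>B\<in>compacts T. f \<in> Hom T A B \<longrightarrow>
      Z \<in> compacts T \<and> (\<exists>g h. triangle A B Z f g h)" for f
  proof (cases "\<exists>A\<in>compacts T. \<exists>B\<in>compacts T. f \<in> Hom T A B")
    case True
    then obtain A B where AB: "A \<in> compacts T" "B \<in> compacts T" "f \<in> Hom T A B" by blast
    obtain Z g h where Z: "Z \<in> compacts T" "triangle A B Z f g h" using compact_cone_ex[OF AB(3,1,2)] .
    show ?thesis
    proof (intro exI[of _ Z] ballI impI)
      fix A' B' assume "f \<in> Hom T A' B'"
      then have "A' = A" "B' = B" using AB(3) hom_disjoint by blast+
      then show "Z \<in> compacts T \<and> (\<exists>g h. triangle A' B' Z f g h)" using Z by blast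
    qed
  qed blast
  then obtain cn where cn: "\<And>f A B. \<lbrakk>A \<in> compacts T; B \<in> compacts T; f \<in> Hom T A B\<rbrakk> \<Longrightarrow>
      cn f \<in> compacts T \<and> (\<exists>g h. triangle A B (cn f) f g h)"
    using choice[of "\<lambda>f Z. \<forall>A\<in>compacts T. \<forall>B\<in>compacts T. f \<in> Hom T A B \<longrightarrow>
      Z \<in> compacts T \<and> (\<exists>g h. triangle A B Z f g h)"] by blast
  have "\<exists>S. p \<in> compacts T \<times> compacts T \<longrightarrow> S \<in> compacts T \<and>
      (\<exists>\<sigma>. is_coproduct T (UNIV :: bool set) (\<lambda>b. if b then fst p else snd p) S \<sigma>)" for p
  proof (cases "p \<in> compacts T \<times> compacts T")
    case True
    then obtain S \<sigma> where "S \<in> compacts T"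
      "is_coproduct T (UNIV :: bool set) (\<lambda>b. if b then fst p else snd p) S \<sigma>"
      using bicoproduct_ex[of "fst p" "snd p"] by (auto simp: mem_Times_iff)
    then show ?thesis by blast
  qed simp
  then obtain bc where bc': "\<And>p. p \<in> compacts T \<times> compacts T \<longrightarrow> bc p \<in> compacts T \<and>
      (\<exists>\<sigma>. is_coproduct T (UNIV :: bool set) (\<lambda>b. if b then fst p else snd p) (bc p) \<sigma>)"
    by metis
  have bc: "bc (A, B) \<in> compacts T \<and>
      (\<exists>\<sigma>. is_coproduct T (UNIV :: bool set) (\<lambda>b. if b then A else B) (bc (A, B)) \<sigma>)"
    if "A \<in> compacts T" "B \<in> compacts T" for A B
    using bc'[of "(A, B)"] that by (simp cong: if_cong)
  \<comment> \<open>One round of all chosen operations. Each involves at most two objects, and two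
    objects of the increasing union of the \<open>L n\<close> lie in a common \<open>L n\<close>, so
    countably many rounds give a closed set.\<close>
  define st where "st S = S \<union> ds ` S \<union> cn ` (\<Union>p\<in>S \<times> S. Hom T (fst p) (snd p)) \<union> bc ` (S \<times> S)" for S
  define L where "L n = (st ^^ n) (insert Z G)" for n :: nat
  have L_Suc: "L (Suc n) = st (L n)" for n by (simp add: L_def)
  have L_sub: "L n \<subseteq> compacts T" for n
  proof (induction n)
    case 0
    then show ?case using G(2) compact_zero[OF Z] by (simp add: L_def)
  next
    case (Suc n)
    show ?case
    proof
      fix x assume "x \<in> L (Suc n)"
      then consider "x \<in> L n" | A where "A \<in> L n" "x = ds A"
        | A B f where "A \<in> L n" "B \<in> L n" "f \<in> Hom T A B" "x = cn f"
        | A B where "A \<in> L n" "B \<in> L n" "x = bc (A, B)"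
        by (auto simp: L_Suc st_def)
      then show "x \<in> compacts T" using Suc.IH ds cn bc by cases blast+
    qed
  qed
  have L_small: "small TYPE('v) (L n)" for n
  proof (induction n)
    case 0
    then show ?case
      using small_Un[OF small_finite[of "{Z}"] G(1)] by (simp add: L_def)
  next
    case (Suc n)
    have "small TYPE('v) (\<Union>p\<in>L n \<times> L n. Hom T (fst p) (snd p))"
      by (intro small_UN small_Times Suc locally_small)
    then show ?case
      unfolding L_Suc st_def by (intro small_Un small_image small_Times Suc)
  qed
  have L_step: "L n \<subseteq> L (Suc n)" for n by (auto simp: L_Suc st_def)
  have L_mono: "n \<le> m \<Longrightarrow> L n \<subseteq> L m" for n m using lift_Suc_mono_le[of L] L_step by blast
  define K where "K = (\<Union>n. L n)"
  have K2: "\<exists>n. A \<in> L n \<and> B \<in> L n" if AB: "A \<in> K" "B \<in> K" for A B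
  proof -
    obtain n m where "A \<in> L n" "B \<in> L m" using AB unfolding K_def by blast
    then have "A \<in> L (max n m)" "B \<in> L (max n m)"
      using L_mono[of n "max n m"] L_mono[of m "max n m"] by auto
    then show ?thesis by blast
  qed
  have LK: "st (L n) \<subseteq> K" for n using L_Suc[of n] unfolding K_def by blast
  have KC: "K \<subseteq> compacts T" using L_sub by (auto simp: K_def)
  have G0: "insert Z G \<subseteq> K" unfolding K_def using L_def[of 0] by auto
  have "cells T K"
  proof unfold_locales
    show "small TYPE('v) K" unfolding K_def by (rule small_UN[OF small_nat L_small])
    show "K \<subseteq> compacts T" by (rule KC)
    show "\<exists>Z\<in>K. zero_obj T Z" using Z G0 by blast
    show "zero_obj T X" if "X \<in> Ob T" "\<And>A. A \<in> K \<Longrightarrow> Hom T A X = {ZeroM T A X}" for X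
      using that G(3) G0 by blast
    show "\<exists>B\<in>K. \<exists>i. iso_arr T (sh B) A i" if A: "A \<in> K" for A
    proof -
      obtain n where "A \<in> L n" using A by (auto simp: K_def)
      then have "ds A \<in> K" using LK[of n] by (auto simp: st_def)
      then show ?thesis using ds KC A by blast
    qed
    show "\<exists>Z\<in>K. \<exists>g h. triangle A B Z f g h" if AB: "A \<in> K" "B \<in> K" "f \<in> Hom T A B" for A B f
    proof -
      obtain n where n: "A \<in> L n" "B \<in> L n" using K2 AB by blast
      then have "cn f \<in> st (L n)" using AB(3) by (force simp: st_def)
      then show ?thesis using cn[OF _ _ AB(3)] KC AB LK by blast
    qed
    show "\<exists>S\<in>K. \<exists>\<sigma>. is_coproduct T (UNIV :: bool set) (\<lambda>b. if b then A else B) S \<sigma>"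
      if AB: "A \<in> K" "B \<in> K" for A B
    proof -
      obtain n where n: "A \<in> L n" "B \<in> L n" using K2 AB by blast
      then have "bc (A, B) \<in> st (L n)" by (auto simp: st_def)
      then show ?thesis using bc[of A B] KC AB LK by blast
    qed
  qed
  then show ?thesis by blast
qed

text \<open>
  Arrows \<open>h\<close> from a compact \<open>C\<close> to \<open>\<Phi> Y\<close> are shown to come from \<open>\<Phi> A\<close> with \<open>A\<close> in \<open>K\<close>.  The
  tower \<open>Y = Y\<^sub>0 \<rightarrow> Y\<^sub>1 \<rightarrow> \<dots>\<close> obtained by killing all arrows from \<open>K\<close> has contractible telescope, so
  \<open>h\<close> dies at some finite stage, and being cellular descends along each stage.
\<close>

locale cellular_functor = cells T K + exact_ftr T \<Phi>
  for T :: "('o, 'v::universe, 'z) tt_cat_scheme" (structure) and K and \<Phi> +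
  assumes preserves_coproduct: "\<And>(I :: 'v set) Y P \<iota>. is_coproduct T I Y P \<iota> \<Longrightarrow>
      is_coproduct T I (\<lambda>i. FOb \<Phi> (Y i)) (FOb \<Phi> P) (\<lambda>i. FMor \<Phi> (\<iota> i))"
begin

definition cellular :: "'o \<Rightarrow> 'o \<Rightarrow> 'v \<Rightarrow> bool" where
  "cellular C Y h \<longleftrightarrow> (\<exists>A\<in>K. \<exists>m\<in>Hom T A Y. \<exists>c\<in>Hom T C (FOb \<Phi> A). h = FMor \<Phi> m \<cdot> c)"

lemma bicoproduct_factor:
  assumes A: "A \<in> K" and B: "B \<in> K"
    and m: "m \<in> Hom T A Y" and n: "n \<in> Hom T B Y"
  obtains S a b k where "S \<in> K" "a \<in> Hom T A S" "b \<in> Hom T B S" "k \<in> Hom T S Y" "k \<cdot> a = m" "k \<cdot> b = n"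
proof -
  obtain S \<sigma> where S: "S \<in> K" "is_coproduct T (UNIV :: bool set) (\<lambda>b. if b then A else B) S \<sigma>"
    using K_coproduct[OF A B] by blast
  interpret S: coproduct_in T UNIV "\<lambda>b. if b then A else B" S \<sigma> using S(2) by (rule coproduct_inI)
  have Y: "Y \<in> Ob T" using m hom_objects by blast
  obtain k where k: "k \<in> Hom T S Y" "\<And>b. k \<cdot> \<sigma> b = (if b then m else n)"
  proof -
    have "(if b then m else n) \<in> Hom T (if b then A else B) Y" for b
      using m n by simp
    then have "\<exists>!k. k \<in> Hom T S Y \<and> (\<forall>b\<in>UNIV. k \<cdot> \<sigma> b = (if b then m else n))"
      by (rule S.copair_ex1[OF Y])
    then show thesis using that by blast
  qed
  show thesis
    using that[OF S(1) _ _ k(1), of "\<sigma> True" "\<sigma> False"] S.\<iota>_hom[of True] S.\<iota>_hom[of False] k(2) by simp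
qed

lemma cellular_plus:
  assumes "cellular C Y h" "cellular C Y h'"
  shows "cellular C Y (h \<^bold>+ h')"
proof -
  obtain A m c where 1: "A \<in> K" "m \<in> Hom T A Y" "c \<in> Hom T C (FOb \<Phi> A)" "h = FMor \<Phi> m \<cdot> c"
    using assms(1) by (auto simp: cellular_def)
  obtain B n d where 2: "B \<in> K" "n \<in> Hom T B Y" "d \<in> Hom T C (FOb \<Phi> B)" "h' = FMor \<Phi> n \<cdot> d"
    using assms(2) by (auto simp: cellular_def)
  obtain S a b k where k: "S \<in> K" "a \<in> Hom T A S" "b \<in> Hom T B S" "k \<in> Hom T S Y" "k \<cdot> a = m" "k \<cdot> b = n"
    using bicoproduct_factor[OF 1(1) 2(1) 1(2) 2(2)] .
  note ac = comp_hom[OF 1(3) F_hom[OF k(2)]] and bd = comp_hom[OF 2(3) F_hom[OF k(3)]]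
  have "FMor \<Phi> k \<cdot> (FMor \<Phi> a \<cdot> c \<^bold>+ FMor \<Phi> b \<cdot> d) = h \<^bold>+ h'"
    using comp_plus_right[OF ac bd F_hom[OF k(4)]] comp_assoc[OF 1(3) F_hom[OF k(2)] F_hom[OF k(4)]]
      comp_assoc[OF 2(3) F_hom[OF k(3)] F_hom[OF k(4)]] F_comp[OF k(2,4)] F_comp[OF k(3,4)] k(5,6) 1(4) 2(4)
    by simp
  then show ?thesis
    unfolding cellular_def using k(1,4) plus_hom[OF ac bd] by force
qed

text \<open>A finite sum of objects of \<open>K\<close> is replaced by one object of
  \<open>K\<close>, adding a summand at a time; the empty sum is the zero object of
  \<open>K\<close>.\<close>

lemma cut_factor:
  assumes cop: "is_coproduct T I X N \<iota>" and X: "\<And>i. i \<in> I \<Longrightarrow> X i \<in> K"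
    and "finite F" "F \<subseteq> I"
  shows "\<exists>S\<in>K. \<exists>r\<in>Hom T N S. \<exists>t\<in>Hom T S N. coproduct_in.cut T I X N \<iota> F = t \<cdot> r"
proof -
  interpret coproduct_in T I X N \<iota> using cop by (rule coproduct_inI)
  show ?thesis
    using assms(3,4)
  proof (induction F rule: finite_induct)
    case empty
    obtain Z where Z: "Z \<in> K" "zero_obj T Z" using K_zero by blast
    then have Zo: "Z \<in> Ob T" by (simp add: zero_obj_def)
    show ?case
      using Z(1) cut_empty zero_comp[OF zero_hom[OF P_ob Zo] P_ob] zero_hom[OF P_ob Zo] zero_hom[OF Zo P_ob]
      by force
  next
    case (insert i F)
    then have i: "i \<in> I" by blast
    obtain S r t where S: "S \<in> K" "r \<in> Hom T N S" "t \<in> Hom T S N" "cut F = t \<cdot> r"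
      using insert by auto
    obtain S' a b k where k: "S' \<in> K" "a \<in> Hom T (X i) S'" "b \<in> Hom T S S'" "k \<in> Hom T S' N"
      "k \<cdot> a = \<iota> i" "k \<cdot> b = t"
      using bicoproduct_factor[OF X[OF i] S(1) \<iota>_hom[OF i] S(3)] .
    note ap = comp_hom[OF pr_hom[OF i] k(2)] and br = comp_hom[OF S(2) k(3)]
    have "cut (insert i F) = \<iota> i \<cdot> pr i \<^bold>+ t \<cdot> r"
      using cut_insert[OF i] insert S(4) by simp
    also have "\<dots> = k \<cdot> (a \<cdot> pr i \<^bold>+ b \<cdot> r)"
      using comp_plus_right[OF ap br k(4)] comp_assoc[OF pr_hom[OF i] k(2,4)] comp_assoc[OF S(2) k(3,4)] k(5,6)
      by simp
    finally show ?case using k(1,4) plus_hom[OF ap br] by blast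
  qed
qed

lemma F_cut:
  fixes I :: "'v set"
  assumes "is_coproduct T I Y P \<iota>"
  shows "coproduct_in.cut T I (\<lambda>i. FOb \<Phi> (Y i)) (FOb \<Phi> P) (\<lambda>i. FMor \<Phi> (\<iota> i)) F
    = FMor \<Phi> (coproduct_in.cut T I Y P \<iota> F)"
proof (rule additive_cut[OF assms preserves_coproduct[OF assms] _ F_zero])
  show "is_functor T T \<Phi>" using exact by (simp add: exact_functor_def)
qed

lemma F_compact_cut:
  assumes "C \<in> compacts T" "small TYPE('v) (I :: 'v set)" "is_coproduct T I Y P \<iota>"
    "h \<in> Hom T C (FOb \<Phi> P)"
  obtains F where "finite F" "F \<subseteq> I" "FMor \<Phi> (coproduct_in.cut T I Y P \<iota> F) \<cdot> h = h"
  using compact_cut[OF assms(1,2) preserves_coproduct[OF assms(3)] assms(4)] F_cut[OF assms(3)] by metis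

text \<open>\<open>Y1\<close> arises from \<open>Y\<close> by killing a coproduct \<open>N\<close>
  of objects of \<open>K\<close>. A cell \<open>m\<close> from \<open>A\<close> to \<open>Y1\<close>
  through which the image of \<open>h\<close> factors need not lift to \<open>Y\<close>; its
  obstruction, the composite to \<open>sh N\<close>, lives on a finite part \<open>S\<close> of
  \<open>N\<close>. Correcting \<open>A\<close> by \<open>S\<close> gives a cell \<open>Z\<close>
  over \<open>Y\<close> and an arrow \<open>h2\<close> through it with the same image as
  \<open>h\<close>, and the difference of \<open>h\<close> and \<open>h2\<close> comes from
  \<open>N\<close>, hence from finitely many summands.\<close>

lemma cellular_descend:
  fixes I :: "'v set"
  assumes cop: "is_coproduct T I X N \<iota>" and I: "small TYPE('v) I" and X: "\<And>i. i \<in> I \<Longrightarrow> X i \<in> K"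
    and t: "triangle N Y Y1 e u w" and C: "C \<in> compacts T"
    and h: "h \<in> Hom T C (FOb \<Phi> Y)" and cell: "cellular C Y1 (FMor \<Phi> u \<cdot> h)"
  shows "cellular C Y h"
proof -
  interpret coproduct_in T I X N \<iota> using cop by (rule coproduct_inI)
  note e = triangle_hom(1)[OF t] and u = triangle_hom(2)[OF t] and w = triangle_hom(3)[OF t]
  obtain A m c where A: "A \<in> K" "m \<in> Hom T A Y1" "c \<in> Hom T C (FOb \<Phi> A)" "FMor \<Phi> u \<cdot> h = FMor \<Phi> m \<cdot> c"
    using cell by (auto simp: cellular_def)
  obtain B i where B: "B \<in> K" "iso_arr T (sh B) A i" using K_desusp[OF A(1)] by blast
  obtain i' where i: "i \<in> Hom T (sh B) A" "i' \<in> Hom T A (sh B)" "i' \<cdot> i = Ident T (sh B)" "i \<cdot> i' = Ident T A"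
    using B(2) by (rule iso_arrE)
  have Bc: "B \<in> compacts T" and Bo: "B \<in> Ob T" using B K_compact compact_ob by blast+
  note mi = comp_hom[OF i(1) A(2)]
  note wmi = comp_hom[OF mi w]
  obtain n where n: "n \<in> Hom T B N" "shm n = w \<cdot> (m \<cdot> i)"
    using shm_surj[OF Bo P_ob wmi] .
  obtain F where F: "finite F" "F \<subseteq> I" "cut F \<cdot> n = n" using compact_cut[OF Bc I cop n(1)] .
  obtain S r v where S: "S \<in> K" "r \<in> Hom T N S" "v \<in> Hom T S N" "cut F = v \<cdot> r"
    using cut_factor[OF cop X F(1,2)] by blast
  note rn = comp_hom[OF n(1) S(2)]
  \<comment> \<open>\<open>Z\<close> is an extension of \<open>sh B\<close>, that is of
    \<open>A\<close>, by \<open>S\<close>: it is the cone of the desuspended obstruction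
    \<open>r \<cdot> n\<close>, so that the obstruction vanishes on \<open>Z\<close>.\<close>
  obtain Z p q where Z: "Z \<in> K" "triangle B S Z (r \<cdot> n) p q" using K_cone[OF B(1) S(1) rn] by blast
  note q = triangle_hom(3)[OF Z(2)]
  have vrn: "v \<cdot> (r \<cdot> n) = n" using comp_assoc[OF n(1) S(2,3)] F(3) S(4) by simp
  have mi_q: "m \<cdot> i \<cdot> q \<in> Hom T Z Y1" using comp_hom[OF q mi] .
  have "w \<cdot> (m \<cdot> i \<cdot> q) = shm n \<cdot> q" using comp_assoc[OF q mi w] n(2) by simp
  also have "\<dots> = shm v \<cdot> (shm (r \<cdot> n) \<cdot> q)"
    using shm_comp[OF rn S(3)] vrn comp_assoc[OF q shm_hom[OF rn] shm_hom[OF S(3)]] by simp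
  also have "\<dots> = ZeroM T Z (sh N)"
    using triangle_comp_zero3[OF Z(2)] comp_zero[OF shm_hom[OF S(3)]] q hom_objects by auto
  finally obtain z where z: "z \<in> Hom T Z Y" "m \<cdot> i \<cdot> q = u \<cdot> z"
    using weak_kernel2[OF t mi_q] by blast
  define c1 where "c1 = FMor \<Phi> i' \<cdot> c"
  have c1: "c1 \<in> Hom T C (FOb \<Phi> (sh B))" unfolding c1_def using comp_hom[OF A(3) F_hom[OF i(2)]] .
  have mic: "FMor \<Phi> (m \<cdot> i) \<cdot> c1 = FMor \<Phi> u \<cdot> h"
  proof -
    have "FMor \<Phi> (m \<cdot> i) \<cdot> c1 = FMor \<Phi> m \<cdot> (FMor \<Phi> i \<cdot> c1)"
      using F_comp[OF i(1) A(2)] comp_assoc[OF c1 F_hom[OF i(1)] F_hom[OF A(2)]] by simp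
    also have "FMor \<Phi> i \<cdot> c1 = c"
      unfolding c1_def
      using comp_assoc[OF A(3) F_hom[OF i(2)] F_hom[OF i(1)]] F_comp[OF i(2,1)] i(4) F_ident
        ident_comp[OF A(3)] hom_objects[OF i(1)] by simp
    finally show ?thesis using A(4) by simp
  qed
  have Co: "C \<in> Ob T" using h hom_objects by blast
  have wu: "FMor \<Phi> w \<cdot> (FMor \<Phi> u \<cdot> h) = ZeroM T C (FOb \<Phi> (sh N))"
    using comp_assoc[OF h F_hom[OF u] F_hom[OF w]] F_comp[OF u w, symmetric] triangle_comp_zero2[OF t]
      F_zero zero_comp[OF h] hom_objects[OF u] sh_ob[OF P_ob] F_ob by simp
  \<comment> \<open>The factorization through \<open>A\<close> lifts to \<open>Z\<close> because the
    obstruction applied to it contains the composite of \<open>\<Phi> u\<close> and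
    \<open>\<Phi> w\<close>, which is zero.\<close>
  have "FMor \<Phi> (shm n) \<cdot> c1 = FMor \<Phi> w \<cdot> (FMor \<Phi> (m \<cdot> i) \<cdot> c1)"
    using n(2) F_comp[OF mi w] comp_assoc[OF c1 F_hom[OF mi] F_hom[OF w]] by simp
  then have nc1: "FMor \<Phi> (shm n) \<cdot> c1 = ZeroM T C (FOb \<Phi> (sh N))" using wu mic by simp
  have "FMor \<Phi> (shm (r \<cdot> n)) \<cdot> c1 = FMor \<Phi> (shm r) \<cdot> (FMor \<Phi> (shm n) \<cdot> c1)"
    using shm_comp[OF n(1) S(2)] F_comp[OF shm_hom[OF n(1)] shm_hom[OF S(2)]]
      comp_assoc[OF c1 F_hom[OF shm_hom[OF n(1)]] F_hom[OF shm_hom[OF S(2)]]] by simp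
  then have "FMor \<Phi> (shm (r \<cdot> n)) \<cdot> c1 = ZeroM T C (FOb \<Phi> (sh S))"
    using nc1 comp_zero[OF F_hom[OF shm_hom[OF S(2)]] Co] by simp
  then obtain c2 where c2: "c2 \<in> Hom T C (FOb \<Phi> Z)" "c1 = FMor \<Phi> q \<cdot> c2"
    using F_weak_kernel3[OF Z(2) c1] by blast
  define h2 where "h2 = FMor \<Phi> z \<cdot> c2"
  have h2: "h2 \<in> Hom T C (FOb \<Phi> Y)" unfolding h2_def using comp_hom[OF c2(1) F_hom[OF z(1)]] .
  have "FMor \<Phi> u \<cdot> h2 = FMor \<Phi> (m \<cdot> i \<cdot> q) \<cdot> c2"
    unfolding h2_def using comp_assoc[OF c2(1) F_hom[OF z(1)] F_hom[OF u]] F_comp[OF z(1) u] z(2) by simp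
  also have "\<dots> = FMor \<Phi> u \<cdot> h"
    using F_comp[OF q mi] comp_assoc[OF c2(1) F_hom[OF q] F_hom[OF mi]] c2(2) mic by simp
  finally have "FMor \<Phi> u \<cdot> (h \<^bold>- h2) = ZeroM T C (FOb \<Phi> Y1)"
    using comp_minus[OF h h2 F_hom[OF u]] minus_self[OF comp_hom[OF h F_hom[OF u]]] by simp
  then obtain n' where n': "n' \<in> Hom T C (FOb \<Phi> N)" "h \<^bold>- h2 = FMor \<Phi> e \<cdot> n'"
    using F_weak_kernel[OF t minus_hom[OF h h2]] by blast
  obtain F' where F': "finite F'" "F' \<subseteq> I" "FMor \<Phi> (cut F') \<cdot> n' = n'"
    using F_compact_cut[OF C I cop n'(1)] .
  obtain S' r' v' where S': "S' \<in> K" "r' \<in> Hom T N S'" "v' \<in> Hom T S' N" "cut F' = v' \<cdot> r'"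
    using cut_factor[OF cop X F'(1,2)] by blast
  note rn' = comp_hom[OF n'(1) F_hom[OF S'(2)]]
  have "FMor \<Phi> (e \<cdot> v') \<cdot> (FMor \<Phi> r' \<cdot> n') = FMor \<Phi> e \<cdot> n'"
    using F_comp[OF S'(3) e] comp_assoc[OF rn' F_hom[OF S'(3)] F_hom[OF e]]
      comp_assoc[OF n'(1) F_hom[OF S'(2)] F_hom[OF S'(3)]] F_comp[OF S'(2,3)] S'(4) F'(3) by simp
  then have "cellular C Y (h \<^bold>- h2)"
    unfolding cellular_def using n'(2) S'(1) comp_hom[OF S'(3) e] rn' by metis
  moreover have "cellular C Y h2"
    unfolding cellular_def h2_def using Z(1) z(1) c2(1) by blast
  ultimately show ?thesis using cellular_plus minus_plus[OF h h2] by metis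
qed

text \<open>The arrows from \<open>K\<close> to \<open>Y\<close> are indexed by themselves: the
  summand at \<open>f\<close> is the source of \<open>f\<close>, and the arrow \<open>e\<close> from
  the coproduct restricts to \<open>f\<close> there. There is only a small set of them, as
  \<open>K\<close> and the hom sets are small. \<open>Y1\<close> is the cone of
  \<open>e\<close>.\<close>

lemma kill_step:
  assumes Y: "Y \<in> Ob T" and C: "C \<in> compacts T"
  shows "\<exists>Y1 u. u \<in> Hom T Y Y1 \<and> (\<forall>A\<in>K. \<forall>f\<in>Hom T A Y. u \<cdot> f = ZeroM T A Y1) \<and>
    (\<forall>h\<in>Hom T C (FOb \<Phi> Y). cellular C Y1 (FMor \<Phi> u \<cdot> h) \<longrightarrow> cellular C Y h)"
proof -
  define I where "I = (\<Union>A\<in>K. Hom T A Y)"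
  have I: "small TYPE('v) I" unfolding I_def by (intro small_UN K_small locally_small)
  have X: "dom_of T f \<in> K" "f \<in> Hom T (dom_of T f) Y" if "f \<in> I" for f
    using that dom_of_eq by (auto simp: I_def)
  obtain N \<iota> where cop: "is_coproduct T I (dom_of T) N \<iota>"
    using ex_coproduct[OF I, of "dom_of T"] X(1) K_compact compact_ob by blast
  interpret coproduct_in T I "dom_of T" N \<iota> using cop by (rule coproduct_inI)
  obtain e where e: "e \<in> Hom T N Y" "\<And>f. f \<in> I \<Longrightarrow> e \<cdot> \<iota> f = f"
    using copair_ex1[OF Y, of "\<lambda>f. f", OF X(2)] by blast
  obtain Y1 u w where t: "triangle N Y Y1 e u w" using cone_ex[OF e(1)] .
  note u = triangle_hom(2)[OF t]
  have "u \<cdot> f = ZeroM T A Y1" if "A \<in> K" "f \<in> Hom T A Y" for A f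
  proof -
    have f: "f \<in> I" "dom_of T f = A" using that dom_of_eq by (auto simp: I_def)
    have "u \<cdot> f = (u \<cdot> e) \<cdot> \<iota> f" using comp_assoc[OF \<iota>_hom[OF f(1)] e(1) u] e(2)[OF f(1)] by simp
    then show ?thesis
      using triangle_comp_zero[OF t] zero_comp[OF \<iota>_hom[OF f(1)]] f(2) u hom_objects by auto
  qed
  moreover have "cellular C Y h" if "h \<in> Hom T C (FOb \<Phi> Y)" "cellular C Y1 (FMor \<Phi> u \<cdot> h)" for h
    using cellular_descend[OF cop I X(1) t C that] .
  ultimately show ?thesis using u by blast
qed

text \<open>Let \<open>s\<close> move the summand \<open>Y n\<close> of the coproduct to
  \<open>Y (Suc n)\<close> and let \<open>d\<close> be the identity minus \<open>s\<close>. An arrow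
  from \<open>K\<close> to the coproduct has finite support and is killed by \<open>s\<close>, so
  \<open>d\<close> fixes it; hence the cone of \<open>d\<close> receives no nonzero arrow from
  \<open>K\<close> and is zero. So \<open>h 0\<close>, placed in the summand 0, is
  \<open>\<Phi> d\<close> applied to some \<open>a\<close>; comparing components, \<open>a\<close>
  has the components \<open>h n\<close>, and finite support of \<open>a\<close> makes one of them
  zero.\<close>

lemma telescope:
  fixes Y :: "nat \<Rightarrow> 'o"
  assumes u: "\<And>n. u n \<in> Hom T (Y n) (Y (Suc n))"
    and kill: "\<And>n A f. \<lbrakk>A \<in> K; f \<in> Hom T A (Y n)\<rbrakk> \<Longrightarrow> u n \<cdot> f = ZeroM T A (Y (Suc n))"
    and C: "C \<in> compacts T" and h0: "h 0 \<in> Hom T C (FOb \<Phi> (Y 0))"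
    and h: "\<And>n. h (Suc n) = FMor \<Phi> (u n) \<cdot> h n"
  shows "\<exists>n. h n = ZeroM T C (FOb \<Phi> (Y n))"
proof -
  have Yo: "Y n \<in> Ob T" for n using u hom_objects by blast
  \<comment> \<open>Coproducts are indexed by subsets of the universe, so the natural numbers are
    embedded in it.\<close>
  obtain j :: "nat \<Rightarrow> 'v" where j: "inj j"
    using universe_uncountable unfolding lesspoll_def lepoll_def by blast
  have I: "small TYPE('v) (range j)" by (rule small_image[OF small_nat])
  have ij[simp]: "inv_into UNIV j (j n) = n" for n using j by (rule inv_f_f)
  obtain P \<iota> where cop: "is_coproduct T (range j) (\<lambda>i. Y (inv_into UNIV j i)) P \<iota>"
    using ex_coproduct[OF I, of "\<lambda>i. Y (inv_into UNIV j i)"] Yo by blast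
  interpret coproduct_in T "range j" "\<lambda>i. Y (inv_into UNIV j i)" P \<iota> using cop by (rule coproduct_inI)
  have io: "\<iota> (j n) \<in> Hom T (Y n) P" and pi: "pr (j n) \<in> Hom T P (Y n)" for n
    using \<iota>_hom[of "j n"] pr_hom[of "j n"] by auto
  have prio: "pr (j n) \<cdot> \<iota> (j m) = (if n = m then Ident T (Y n) else ZeroM T (Y m) (Y n))" for n m
    using pr[of "j n"] j by (auto simp: inj_eq)
  note iou = comp_hom[OF u io]
  obtain s where s: "s \<in> Hom T P P" "\<And>n. s \<cdot> \<iota> (j n) = \<iota> (j (Suc n)) \<cdot> u n"
    using copair_ex1[OF P_ob, of "\<lambda>i. \<iota> (j (Suc (inv_into UNIV j i))) \<cdot> u (inv_into UNIV j i)"] iou by auto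
  have pr0: "pr (j 0) \<cdot> s = ZeroM T P (Y 0)"
  proof (rule cop_ext[OF comp_hom[OF s(1) pi] zero_hom[OF P_ob Yo]])
    fix i assume "i \<in> range j"
    then obtain n where n: "i = j n" by blast
    show "pr (j 0) \<cdot> s \<cdot> \<iota> i = ZeroM T P (Y 0) \<cdot> \<iota> i"
      unfolding n comp_assoc[OF io s(1) pi] s(2) comp_assoc[OF u io pi, symmetric] prio
      using zero_comp[OF u Yo] zero_comp[OF io Yo] by simp
  qed
  have prS: "pr (j (Suc m)) \<cdot> s = u m \<cdot> pr (j m)" for m
  proof (rule cop_ext[OF comp_hom[OF s(1) pi] comp_hom[OF pi u]])
    fix i assume "i \<in> range j"
    then obtain n where n: "i = j n" by blast
    show "pr (j (Suc m)) \<cdot> s \<cdot> \<iota> i = u m \<cdot> pr (j m) \<cdot> \<iota> i"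
      unfolding n comp_assoc[OF io s(1) pi] s(2) comp_assoc[OF u io pi, symmetric] prio
        comp_assoc[OF io pi u]
      using zero_comp[OF u Yo] comp_zero[OF u Yo] comp_ident[OF u] ident_comp[OF u] by auto
  qed
  define d where "d = Ident T P \<^bold>- s"
  note idP = ident_hom[OF P_ob]
  have d: "d \<in> Hom T P P" unfolding d_def by (rule minus_hom[OF idP s(1)])
  have df: "d \<cdot> f = f" if A: "A \<in> K" and f: "f \<in> Hom T A P" for A f
  proof -
    have Ao: "A \<in> Ob T" using f hom_objects by blast
    obtain F where F: "finite F" "F \<subseteq> range j" "cut F \<cdot> f = f"
      using compact_cut[OF _ I cop f] A K_compact by blast
    have "s \<cdot> (cut F \<cdot> f) = ZeroM T A P"
    proof (rule cut_zeroI[OF F(1,2) f s(1)])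
      fix i assume "i \<in> F"
      then obtain n where n: "i = j n" using F(2) by blast
      note pf = comp_hom[OF f pi[of n]]
      show "s \<cdot> (\<iota> i \<cdot> (pr i \<cdot> f)) = ZeroM T A P"
        unfolding n using comp_assoc[OF pf io s(1)] s(2) comp_assoc[OF pf u io] kill[OF A pf]
          comp_zero[OF io Ao] by simp
    qed
    then have "s \<cdot> f = ZeroM T A P" using F(3) by simp
    then show ?thesis
      unfolding d_def using minus_comp[OF f idP s(1)] ident_comp[OF f] minus_zero[OF f] by simp
  qed
  obtain Z q r where t: "triangle P P Z d q r" using cone_ex[OF d] .
  note q = triangle_hom(2)[OF t] and r = triangle_hom(3)[OF t]
  have Zo: "Z \<in> Ob T" using q hom_objects by blast
  have Z: "zero_obj T Z"
  proof (rule K_generates[OF Zo])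
    fix A assume A: "A \<in> K"
    then have Ao: "A \<in> Ob T" using K_compact compact_ob by blast
    have "f = ZeroM T A Z" if f: "f \<in> Hom T A Z" for f
    proof -
      obtain B i where B: "B \<in> K" "iso_arr T (sh B) A i" using K_desusp[OF A] by blast
      have Bo: "B \<in> Ob T" using B K_compact compact_ob by blast
      note i = iso_arr_hom[OF B(2)] and rf = comp_hom[OF f r]
      obtain f' where f': "f' \<in> Hom T B P" "shm f' = r \<cdot> f \<cdot> i"
        using shm_surj[OF Bo P_ob comp_hom[OF i rf]] .
      have "shm (d \<cdot> f') = shm d \<cdot> (r \<cdot> f \<cdot> i)" using shm_comp[OF f'(1) d] f'(2) by simp
      also have "\<dots> = shm d \<cdot> r \<cdot> (f \<cdot> i)"
        using comp_assoc[OF comp_hom[OF i f] r shm_hom[OF d]] comp_assoc[OF i f r] by simp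
      also have "\<dots> = ZeroM T (sh B) (sh P)"
        using triangle_comp_zero3[OF t] zero_comp[OF comp_hom[OF i f]] sh_ob[OF P_ob] by simp
      finally have "r \<cdot> f \<cdot> i = ZeroM T (sh B) (sh P)" using df[OF B(1) f'(1)] f'(2) by simp
      then have "r \<cdot> f = ZeroM T A (sh P)"
        using iso_cancel_right[OF B(2) rf zero_hom[OF Ao sh_ob[OF P_ob]]] zero_comp[OF i sh_ob[OF P_ob]]
        by simp
      then obtain g where g: "g \<in> Hom T A P" "f = q \<cdot> g" using weak_kernel2[OF t f] by blast
      then have "f = (q \<cdot> d) \<cdot> g" using df[OF A g(1)] comp_assoc[OF g(1) d q] by simp
      then show ?thesis using triangle_comp_zero[OF t] zero_comp[OF g(1) Zo] by simp
    qed
    then show "Hom T A Z = {ZeroM T A Z}" using zero_hom[OF Ao Zo] by blast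
  qed
  note F_io = F_hom[OF io] and F_pi = F_hom[OF pi]
  note ih = comp_hom[OF h0 F_io]
  have "FMor \<Phi> q \<cdot> (FMor \<Phi> (\<iota> (j 0)) \<cdot> h 0) = ZeroM T C (FOb \<Phi> Z)"
    using zero_obj_hom(1)[OF F_zero_obj[OF Z] comp_hom[OF ih F_hom[OF q]]] .
  then obtain a where a: "a \<in> Hom T C (FOb \<Phi> P)" "FMor \<Phi> (\<iota> (j 0)) \<cdot> h 0 = FMor \<Phi> d \<cdot> a"
    using F_weak_kernel[OF t ih] by blast
  have Co: "C \<in> Ob T" using h0 hom_objects by blast
  have pd: "FMor \<Phi> (pr (j n)) \<cdot> (FMor \<Phi> d \<cdot> a) = FMor \<Phi> (pr (j n)) \<cdot> a \<^bold>- FMor \<Phi> (pr (j n) \<cdot> s) \<cdot> a" for n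
  proof -
    have "pr (j n) \<cdot> d = pr (j n) \<^bold>- pr (j n) \<cdot> s"
      unfolding d_def using comp_minus[OF idP s(1) pi] comp_ident[OF pi] by simp
    then have "FMor \<Phi> (pr (j n) \<cdot> d) = FMor \<Phi> (pr (j n)) \<^bold>- FMor \<Phi> (pr (j n) \<cdot> s)"
      using F_minus[OF pi comp_hom[OF s(1) pi]] by simp
    then show ?thesis
      unfolding comp_assoc[OF a(1) F_hom[OF d] F_pi, symmetric] F_comp[OF d pi, symmetric]
      using minus_comp[OF a(1) F_pi F_hom[OF comp_hom[OF s(1) pi]]] by simp
  qed
  have pih: "FMor \<Phi> (pr (j n)) \<cdot> (FMor \<Phi> (\<iota> (j 0)) \<cdot> h 0) =
      (if n = 0 then h 0 else ZeroM T C (FOb \<Phi> (Y n)))" for n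
    unfolding comp_assoc[OF h0 F_io F_pi, symmetric] F_comp[OF io pi, symmetric] prio
    using F_ident[OF Yo] ident_comp[OF h0]
      F_zero[OF Yo Yo] zero_comp[OF h0 F_ob[OF Yo]] by simp
  \<comment> \<open>The component 0 receives nothing from \<open>s\<close>, and the component
    \<open>Suc n\<close> of \<open>a\<close> is \<open>u n\<close> applied to the component
    \<open>n\<close>: the recursion that defines \<open>h\<close>.\<close>
  have ha: "h n = FMor \<Phi> (pr (j n)) \<cdot> a" for n
  proof (induction n)
    case 0
    have "FMor \<Phi> (pr (j 0) \<cdot> s) \<cdot> a = ZeroM T C (FOb \<Phi> (Y 0))"
      unfolding pr0 using F_zero[OF P_ob Yo] zero_comp[OF a(1) F_ob[OF Yo]] by simp
    then show ?case
      using pd[of 0] pih[of 0] a(2) minus_zero[OF comp_hom[OF a(1) F_pi]] by simp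
  next
    case (Suc n)
    have pa: "FMor \<Phi> (pr (j (Suc n))) \<cdot> a \<in> Hom T C (FOb \<Phi> (Y (Suc n)))"
      using comp_hom[OF a(1) F_pi] .
    have eq: "FMor \<Phi> (pr (j (Suc n)) \<cdot> s) \<cdot> a = FMor \<Phi> (u n) \<cdot> (FMor \<Phi> (pr (j n)) \<cdot> a)"
      unfolding prS using F_comp[OF pi u] comp_assoc[OF a(1) F_pi F_hom[OF u]] by simp
    have m: "FMor \<Phi> (u n) \<cdot> (FMor \<Phi> (pr (j n)) \<cdot> a) \<in> Hom T C (FOb \<Phi> (Y (Suc n)))"
      using comp_hom[OF comp_hom[OF a(1) F_pi] F_hom[OF u]] .
    have "FMor \<Phi> (pr (j (Suc n))) \<cdot> a \<^bold>- FMor \<Phi> (u n) \<cdot> (FMor \<Phi> (pr (j n)) \<cdot> a) = ZeroM T C (FOb \<Phi> (Y (Suc n)))"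
      using pd[of "Suc n"] pih[of "Suc n"] a(2) eq by simp
    then show ?case using minus_eq_zero[OF pa m] h[of n] Suc.IH by simp
  qed
  obtain F where F: "finite F" "F \<subseteq> range j" "FMor \<Phi> (cut F) \<cdot> a = a"
    using F_compact_cut[OF C I cop a(1)] .
  obtain n where n: "j n \<notin> F"
    using F(1) finite_vimageI[OF _ j] infinite_UNIV_nat by (metis UNIV_eq_I vimage_eq)
  have "pr (j n) \<cdot> cut F = ZeroM T P (Y n)"
  proof (rule cop_ext[OF comp_hom[OF cut_hom pi] zero_hom[OF P_ob Yo]])
    fix i assume "i \<in> range j"
    then obtain m where m: "i = j m" by blast
    show "pr (j n) \<cdot> cut F \<cdot> \<iota> i = ZeroM T P (Y n) \<cdot> \<iota> i"
      unfolding m comp_assoc[OF io cut_hom pi] cut_\<iota>[OF rangeI]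
      using prio n comp_zero[OF pi Yo] zero_comp[OF io Yo] by auto
  qed
  then have "FMor \<Phi> (pr (j n)) \<cdot> (FMor \<Phi> (cut F) \<cdot> a) = ZeroM T C (FOb \<Phi> (Y n))"
    using comp_assoc[OF a(1) F_hom[OF cut_hom] F_pi, symmetric] F_comp[OF cut_hom pi, symmetric]
      F_zero[OF P_ob Yo]
      zero_comp[OF a(1) F_ob[OF Yo]] by simp
  then show ?thesis using ha F(3) by auto
qed

theorem cellular_approximation:
  assumes C: "C \<in> compacts T" and Y: "Y \<in> Ob T" and h: "h \<in> Hom T C (FOb \<Phi> Y)"
  shows "cellular C Y h"
proof -
  obtain nx u where nu: "\<And>Y. Y \<in> Ob T \<Longrightarrow> u Y \<in> Hom T Y (nx Y)"
    "\<And>Y A f. \<lbrakk>Y \<in> Ob T; A \<in> K; f \<in> Hom T A Y\<rbrakk> \<Longrightarrow> u Y \<cdot> f = ZeroM T A (nx Y)"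
    "\<And>Y h. \<lbrakk>Y \<in> Ob T; h \<in> Hom T C (FOb \<Phi> Y); cellular C (nx Y) (FMor \<Phi> (u Y) \<cdot> h)\<rbrakk> \<Longrightarrow> cellular C Y h"
  proof -
    have "\<forall>Y\<in>Ob T. \<exists>Y1 u. u \<in> Hom T Y Y1 \<and> (\<forall>A\<in>K. \<forall>f\<in>Hom T A Y. u \<cdot> f = ZeroM T A Y1) \<and>
      (\<forall>h\<in>Hom T C (FOb \<Phi> Y). cellular C Y1 (FMor \<Phi> u \<cdot> h) \<longrightarrow> cellular C Y h)"
      using kill_step[OF _ C] by simp
    from bchoice[OF this] obtain nx where nx: "\<forall>Y\<in>Ob T. \<exists>u. u \<in> Hom T Y (nx Y) \<and> (\<forall>A\<in>K. \<forall>f\<in>Hom T A Y. u \<cdot> f = ZeroM T A (nx Y)) \<and>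
      (\<forall>h\<in>Hom T C (FOb \<Phi> Y). cellular C (nx Y) (FMor \<Phi> u \<cdot> h) \<longrightarrow> cellular C Y h)"
      by blast
    from bchoice[OF nx] show thesis using that by blast
  qed
  define Yn where "Yn n = (nx ^^ n) Y" for n
  define hn where "hn n = rec_nat h (\<lambda>n g. FMor \<Phi> (u (Yn n)) \<cdot> g) n" for n
  have Yo: "Yn n \<in> Ob T" for n
  proof (induction n)
    case (Suc n)
    then show ?case using nu(1)[of "Yn n"] hom_objects by (simp add: Yn_def)
  qed (simp add: Yn_def Y)
  have un: "u (Yn n) \<in> Hom T (Yn n) (Yn (Suc n))" for n
    using nu(1)[OF Yo[of n]] by (simp add: Yn_def)
  have hS: "hn (Suc n) = FMor \<Phi> (u (Yn n)) \<cdot> hn n" for n by (simp add: hn_def)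
  have hn: "hn n \<in> Hom T C (FOb \<Phi> (Yn n))" for n
  proof (induction n)
    case (Suc n)
    then show ?case unfolding hS using comp_hom F_hom un by blast
  qed (simp add: hn_def Yn_def h)
  obtain n where n: "hn n = ZeroM T C (FOb \<Phi> (Yn n))"
    using telescope[of "\<lambda>n. u (Yn n)" Yn C hn] un nu(2)[OF Yo] C hn[of 0] hS by (auto simp: Yn_def)
  obtain Z where Z: "Z \<in> K" "zero_obj T Z" using K_zero by blast
  then have Zo: "Z \<in> Ob T" by (simp add: zero_obj_def)
  have Co: "C \<in> Ob T" using h hom_objects by blast
  \<comment> \<open>A zero arrow factors through the zero object of \<open>K\<close>. From here the
    property descends the tower, and \<open>k = n\<close> reaches \<open>Yn 0 = Y\<close>.\<close>
  have "cellular C (Yn n) (hn n)"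
    unfolding cellular_def n
    using Z(1) zero_hom[OF Zo Yo] zero_hom[OF Co F_ob[OF Zo]] comp_zero[OF F_hom[OF zero_hom[OF Zo Yo]] Co]
    by metis
  then have "cellular C (Yn (n - k)) (hn (n - k))" for k
  proof (induction k)
    case (Suc k)
    show ?case
    proof (cases "n - k = 0")
      case False
      then have s: "n - k = Suc (n - Suc k)" by simp
      have "cellular C (Yn (Suc (n - Suc k))) (hn (Suc (n - Suc k)))" using Suc.IH[OF Suc.prems] s by simp
      then show ?thesis using nu(3)[OF Yo hn, of "n - Suc k"] hS by (simp add: Yn_def)
    qed (use Suc in simp)
  qed simp
  from this[of n] show ?thesis by (simp add: Yn_def hn_def)
qed

end

section \<open>Duality\<close>

context category
begin

text \<open>Composites are normalized to nest to the right, so an equation for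
  \<open>g \<cdot> f\<close> has to be applied together with the rest \<open>x\<close> of the
  composite; the diagram chases below use it as a rewrite rule.\<close>

lemma arr_reduce2:
  "\<lbrakk>g \<cdot> f = k; arr f; arr g; cod_of C f = dom_of C g; arr x; cod_of C x = dom_of C f\<rbrakk>
    \<Longrightarrow> g \<cdot> (f \<cdot> x) = k \<cdot> x"
  using arr_comp_assoc by metis

lemma arr_reduce3:
  "\<lbrakk>h \<cdot> (g \<cdot> f) = k; arr f; arr g; arr h; cod_of C f = dom_of C g; cod_of C g = dom_of C h;
    arr x; cod_of C x = dom_of C f\<rbrakk> \<Longrightarrow> h \<cdot> (g \<cdot> (f \<cdot> x)) = k \<cdot> x"
  by (metis arr_comp arr_comp_assoc)

lemma arr_inv:
  assumes "iso_arr C A B f"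
  shows "arr f" "dom_of C f = A" "cod_of C f = B" "arr (inv_arr C f)" "dom_of C (inv_arr C f) = B"
    "cod_of C (inv_arr C f) = A"
  using iso_arr_hom[OF assms] inv_arr(1)[OF assms] by (auto simp: hom_char)

lemma inv_cancel:
  assumes "iso_arr C A B f"
  shows "\<lbrakk>arr x; cod_of C x = A\<rbrakk> \<Longrightarrow> inv_arr C f \<cdot> (f \<cdot> x) = x"
    and "\<lbrakk>arr y; cod_of C y = B\<rbrakk> \<Longrightarrow> f \<cdot> (inv_arr C f \<cdot> y) = y"
  using inv_arr(2,3)[OF assms] arr_inv[OF assms]
    arr_reduce2[of "inv_arr C f" f "Ident C A" x] arr_reduce2[of f "inv_arr C f" "Ident C B" y]
  by (simp_all add: arr_ident_comp)

end

section \<open>Calculations in a symmetric monoidal category\<close>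

context symmetric_monoidal
begin

lemma arr_ten:
  assumes "arr f" "arr g"
  shows "arr (f \<boxtimes> g)" "dom_of T (f \<boxtimes> g) = dom_of T f \<odot> dom_of T g"
    "cod_of T (f \<boxtimes> g) = cod_of T f \<odot> cod_of T g"
  using ten_hom[OF arr_hom arr_hom, OF assms] by (auto simp: hom_char)

lemma interchange:
  "\<lbrakk>arr f; arr f'; arr g; arr g'; cod_of T f = dom_of T f'; cod_of T g = dom_of T g'\<rbrakk>
    \<Longrightarrow> (f' \<boxtimes> g') \<cdot> (f \<boxtimes> g) = (f' \<cdot> f) \<boxtimes> (g' \<cdot> g)"
  by (metis ten_comp arr_hom)

lemma arr_assoc:
  assumes "A \<in> Ob T" "B \<in> Ob T" "D \<in> Ob T"
  shows "arr (Assoc T A B D)" "dom_of T (Assoc T A B D) = (A \<odot> B) \<odot> D"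
    "cod_of T (Assoc T A B D) = A \<odot> (B \<odot> D)"
  using arr_inv[OF assoc_iso[OF assms]] by auto

lemma arr_braid:
  assumes "A \<in> Ob T" "B \<in> Ob T"
  shows "arr (Braid T A B)" "dom_of T (Braid T A B) = A \<odot> B" "cod_of T (Braid T A B) = B \<odot> A"
  using braid_hom[OF assms] by (auto simp: hom_char)

lemma arr_lunit:
  assumes "A \<in> Ob T"
  shows "arr (LUnit T A)" "dom_of T (LUnit T A) = Unit T \<odot> A" "cod_of T (LUnit T A) = A"
  using arr_inv[OF lunit_iso[OF assms]] by auto

lemmas ten_simps = arr_simps arr_ten arr_assoc arr_braid arr_lunit ten_ob unit_ob

lemma assoc_natural_arr:
  "\<lbrakk>arr f; arr g; arr h\<rbrakk> \<Longrightarrow>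
    Assoc T (cod_of T f) (cod_of T g) (cod_of T h) \<cdot> ((f \<boxtimes> g) \<boxtimes> h) =
    (f \<boxtimes> (g \<boxtimes> h)) \<cdot> Assoc T (dom_of T f) (dom_of T g) (dom_of T h)"
  using assoc_natural arr_hom by blast

lemma braid_iso: "\<lbrakk>A \<in> Ob T; B \<in> Ob T\<rbrakk> \<Longrightarrow> iso_arr T (A \<odot> B) (B \<odot> A) (Braid T A B)"
  using iso_arrI[OF braid_hom braid_hom] braid_symmetric by blast

lemma ten_iso:
  assumes "iso_arr T A A' f" "iso_arr T B B' g"
  shows "iso_arr T (A \<odot> B) (A' \<odot> B') (f \<boxtimes> g)"
proof -
  obtain f' where f: "f \<in> Hom T A A'" "f' \<in> Hom T A' A" "f' \<cdot> f = Ident T A" "f \<cdot> f' = Ident T A'"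
    using assms(1) by (rule iso_arrE)
  obtain g' where g: "g \<in> Hom T B B'" "g' \<in> Hom T B' B" "g' \<cdot> g = Ident T B" "g \<cdot> g' = Ident T B'"
    using assms(2) by (rule iso_arrE)
  show ?thesis
    using iso_arrI[OF ten_hom[OF f(1) g(1)] ten_hom[OF f(2) g(2)]] ten_comp[OF f(1,2) g(1,2)]
      ten_comp[OF f(2,1) g(2,1)] f g hom_objects ten_ident by metis
qed

lemma braid_iso_arr: "\<lbrakk>arr f; arr g\<rbrakk> \<Longrightarrow>
    Braid T (cod_of T f) (cod_of T g) \<cdot> (f \<boxtimes> g) = (g \<boxtimes> f) \<cdot> Braid T (dom_of T f) (dom_of T g)"
  using braid_natural arr_hom by blast

text \<open>Naturality of \<open>LUnit\<close> makes tensoring with the unit isomorphic to the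
  identity functor, hence full; \<open>unit_tensor_inj\<close> is its faithfulness.\<close>

lemma unit_tensor_eq:
  assumes g: "g \<in> Hom T (Unit T \<odot> A) (Unit T \<odot> B)" and A: "A \<in> Ob T" and B: "B \<in> Ob T"
  obtains g' where "g' \<in> Hom T A B" "g = Ident T (Unit T) \<boxtimes> g'"
proof -
  note l = lunit_iso[OF A]
  let ?g = "LUnit T B \<cdot> (g \<cdot> inv_arr T (LUnit T A))"
  note gi = comp_hom[OF inv_arr(1)[OF l] g]
  have g': "?g \<in> Hom T A B" using comp_hom[OF gi iso_arr_hom[OF lunit_iso[OF B]]] .
  have "LUnit T B \<cdot> (Ident T (Unit T) \<boxtimes> ?g) = ?g \<cdot> LUnit T A"
    using lunit_natural[OF g'] .
  also have "\<dots> = LUnit T B \<cdot> g"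
    using comp_assoc[OF iso_arr_hom[OF l] gi iso_arr_hom[OF lunit_iso[OF B]]]
      comp_assoc[OF iso_arr_hom[OF l] inv_arr(1)[OF l] g] inv_arr(2)[OF l] comp_ident[OF g] by simp
  finally have "Ident T (Unit T) \<boxtimes> ?g = g"
    using iso_cancel_left[OF lunit_iso[OF B] ten_hom[OF ident_hom[OF unit_ob] g'] g] by blast
  then show thesis using that[OF g'] by simp
qed

lemma unit_tensor_inj:
  assumes "f \<in> Hom T A B" "g \<in> Hom T A B" "Ident T (Unit T) \<boxtimes> f = Ident T (Unit T) \<boxtimes> g"
  shows "f = g"
  using iso_cancel_right[OF lunit_iso assms(1,2)] lunit_natural[OF assms(1)] lunit_natural[OF assms(2)]
    assms(3) hom_objects[OF assms(1)] by simp

end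

section \<open>Transposes and the counit of duality\<close>

context closed_symmetric_monoidal
begin

lemma transpose_ex:
  assumes "A \<in> Ob T" "B \<in> Ob T" "D \<in> Ob T" "f \<in> Hom T (A \<odot> B) D"
  obtains g where "g \<in> Hom T A (IHom T B D)" "Ev T B D \<cdot> (g \<boxtimes> Ident T B) = f"
  using ev_universal[OF assms] unfolding is_transpose_def by blast

lemma transpose_unique:
  assumes B: "B \<in> Ob T" and D: "D \<in> Ob T"
    and g: "g \<in> Hom T A (IHom T B D)" and g': "g' \<in> Hom T A (IHom T B D)"
    and eq: "Ev T B D \<cdot> (g \<boxtimes> Ident T B) = Ev T B D \<cdot> (g' \<boxtimes> Ident T B)"
  shows "g = g'"
proof -
  have A: "A \<in> Ob T" using g hom_objects by blast
  have "Ev T B D \<cdot> (g \<boxtimes> Ident T B) \<in> Hom T (A \<odot> B) D"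
    using comp_hom[OF ten_hom[OF g ident_hom[OF B]] ev_hom[OF B D]] .
  then show ?thesis
    using ev_universal[OF A B D] g g' eq unfolding is_transpose_def by metis
qed

lemma transpose_arr:
  assumes "A \<in> Ob T" "B \<in> Ob T" "D \<in> Ob T" "f \<in> Hom T (A \<odot> B) D"
  shows "transpose_arr T A B D f \<in> Hom T A (IHom T B D)"
    "Ev T B D \<cdot> (transpose_arr T A B D f \<boxtimes> Ident T B) = f"
  using theI'[OF ev_universal[OF assms]] unfolding transpose_arr_def is_transpose_def by blast+

text \<open>The counit \<open>d, y, x \<mapsto> d(x) y\<close> whose transpose is the rigidity arrow.\<close>

definition dual_eval :: "'o \<Rightarrow> 'o \<Rightarrow> 'm" where
  "dual_eval K Y = LUnit T Y
      \<cdot> (Ev T K (Unit T) \<boxtimes> Ident T Y)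
      \<cdot> inv_arr T (Assoc T (dual T K) K Y)
      \<cdot> (Ident T (dual T K) \<boxtimes> Braid T Y K)
      \<cdot> Assoc T (dual T K) Y K"

lemma dual_ob: "K \<in> Ob T \<Longrightarrow> dual T K \<in> Ob T"
  by (simp add: dual_def ihom_ob unit_ob)

lemma arr_ev:
  assumes "K \<in> Ob T"
  shows "arr (Ev T K (Unit T))" "dom_of T (Ev T K (Unit T)) = dual T K \<odot> K"
    "cod_of T (Ev T K (Unit T)) = Unit T"
  using ev_hom[OF assms unit_ob] by (auto simp: hom_char dual_def)

lemma dual_eval_arr:
  assumes K: "K \<in> Ob T" and Y: "Y \<in> Ob T"
  shows "arr (dual_eval K Y)" "dom_of T (dual_eval K Y) = (dual T K \<odot> Y) \<odot> K"
    "cod_of T (dual_eval K Y) = Y"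
  using K Y dual_ob[OF K] arr_inv[OF assoc_iso[OF dual_ob[OF K] K Y]]
  by (simp_all add: dual_eval_def ten_simps arr_ev)

lemma dual_eval_hom: "\<lbrakk>K \<in> Ob T; Y \<in> Ob T\<rbrakk> \<Longrightarrow> dual_eval K Y \<in> Hom T ((dual T K \<odot> Y) \<odot> K) Y"
  by (simp add: hom_char dual_eval_arr)

lemma inv_natural:
  assumes "iso_arr T A B i" "iso_arr T A' B' i'" "f \<in> Hom T A A'" "g \<in> Hom T B B'" "i' \<cdot> f = g \<cdot> i"
  shows "f \<cdot> inv_arr T i = inv_arr T i' \<cdot> g"
proof (rule iso_cancel_left[OF assms(2)])
  note ai = arr_inv[OF assms(1)] arr_inv[OF assms(2)] assms(3,4)[unfolded hom_char]
  show "f \<cdot> inv_arr T i \<in> Hom T B A'" "inv_arr T i' \<cdot> g \<in> Hom T B A'"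
    using ai by (simp_all add: hom_char arr_simps)
  have "i' \<cdot> (f \<cdot> inv_arr T i) = (g \<cdot> i) \<cdot> inv_arr T i"
    using ai arr_comp_assoc[of "inv_arr T i" f i'] assms(5) by simp
  also have "\<dots> = g"
    using ai arr_comp_assoc[of "inv_arr T i" i g] inv_arr(3)[OF assms(1)] arr_comp_ident[of g] by simp
  also have "\<dots> = i' \<cdot> (inv_arr T i' \<cdot> g)"
    using ai inv_cancel(2)[OF assms(2)] by simp
  finally show "i' \<cdot> (f \<cdot> inv_arr T i) = i' \<cdot> (inv_arr T i' \<cdot> g)" .
qed

lemma dual_eval_natural:
  assumes K: "K \<in> Ob T" and e: "e \<in> Hom T Y Y'"
  shows "dual_eval K Y' \<cdot> ((Ident T (dual T K) \<boxtimes> e) \<boxtimes> Ident T K) = e \<cdot> dual_eval K Y"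
proof -
  let ?D = "dual T K" and ?ev = "Ev T K (Unit T)" and ?U = "Unit T"
  have Y: "Y \<in> Ob T" "Y' \<in> Ob T" and D: "?D \<in> Ob T"
    using e hom_objects dual_ob K by blast+
  note ob = K Y D
  note ai = arr_inv[OF assoc_iso[OF D K Y(1)]] arr_inv[OF assoc_iso[OF D K Y(2)]]
  note at = e[unfolded hom_char] ai arr_ev[OF K] ten_simps
  have n1: "Assoc T ?D Y' K \<cdot> ((Ident T ?D \<boxtimes> e) \<boxtimes> Ident T K) =
      (Ident T ?D \<boxtimes> (e \<boxtimes> Ident T K)) \<cdot> Assoc T ?D Y K"
    by (rule assoc_natural) (use ob e ident_hom in auto)
  have n2: "(Ident T ?D \<boxtimes> Braid T Y' K) \<cdot> (Ident T ?D \<boxtimes> (e \<boxtimes> Ident T K)) =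
      (Ident T ?D \<boxtimes> (Ident T K \<boxtimes> e)) \<cdot> (Ident T ?D \<boxtimes> Braid T Y K)"
    using braid_natural[OF e ident_hom[OF K]] ob by (simp add: at interchange)
  have n3: "inv_arr T (Assoc T ?D K Y') \<cdot> (Ident T ?D \<boxtimes> (Ident T K \<boxtimes> e)) =
      (Ident T (?D \<odot> K) \<boxtimes> e) \<cdot> inv_arr T (Assoc T ?D K Y)"
    by (rule inv_natural[symmetric, OF assoc_iso[OF D K Y(1)] assoc_iso[OF D K Y(2)]])
      (use ob e ident_hom ten_ob ten_hom assoc_natural[OF ident_hom[OF D] ident_hom[OF K] e] ten_ident
        in \<open>simp_all add: hom_char ten_simps\<close>)
  have n4: "(?ev \<boxtimes> Ident T Y') \<cdot> (Ident T (?D \<odot> K) \<boxtimes> e) = (Ident T ?U \<boxtimes> e) \<cdot> (?ev \<boxtimes> Ident T Y)"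
    using ob by (simp add: at interchange)
  have n5: "LUnit T Y' \<cdot> (Ident T ?U \<boxtimes> e) = e \<cdot> LUnit T Y"
    by (rule lunit_natural[OF e])
  show ?thesis
    unfolding dual_eval_def
    using ob by (simp add: at n1 arr_reduce2[OF n2] arr_reduce2[OF n3] arr_reduce2[OF n4] arr_reduce2[OF n5])
qed

end

context rigidly_compactly_generated_tt
begin

lemma rigid_iso: "\<lbrakk>K \<in> compacts T; Y \<in> Ob T\<rbrakk> \<Longrightarrow>
    iso_arr T (dual T K \<odot> Y) (IHom T K Y) (rigidity_arr T K Y)"
  using compact_eq_rigid by (auto simp: rigids_def)

lemma rigidity_arr_eval:
  assumes K: "K \<in> Ob T" and Y: "Y \<in> Ob T"
  shows "rigidity_arr T K Y \<in> Hom T (dual T K \<odot> Y) (IHom T K Y)"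
    "Ev T K Y \<cdot> (rigidity_arr T K Y \<boxtimes> Ident T K) = dual_eval K Y"
proof -
  have r: "rigidity_arr T K Y = transpose_arr T (dual T K \<odot> Y) K Y (dual_eval K Y)"
    by (simp add: rigidity_arr_def dual_eval_def)
  note t = transpose_arr[OF ten_ob[OF dual_ob[OF K] Y] K Y dual_eval_hom[OF K Y]]
  show "rigidity_arr T K Y \<in> Hom T (dual T K \<odot> Y) (IHom T K Y)"
    "Ev T K Y \<cdot> (rigidity_arr T K Y \<boxtimes> Ident T K) = dual_eval K Y"
    unfolding r by (fact t)+
qed

text \<open>For compact \<open>K\<close> the rigidity isomorphism replaces the internal hom by
  \<open>dual T K \<odot> Y\<close> and the evaluation by \<open>dual_eval\<close>: tensoring with
  \<open>K\<close> is left adjoint to tensoring with its dual.\<close>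

lemma rigid_adjunct:
  assumes K: "K \<in> compacts T" and A: "A \<in> Ob T" and Y: "Y \<in> Ob T" and f: "f \<in> Hom T (A \<odot> K) Y"
  obtains t where "t \<in> Hom T A (dual T K \<odot> Y)" "dual_eval K Y \<cdot> (t \<boxtimes> Ident T K) = f"
proof -
  note Ko = compact_ob[OF K]
  note r = rigid_iso[OF K Y]
  obtain g where g: "g \<in> Hom T A (IHom T K Y)" "Ev T K Y \<cdot> (g \<boxtimes> Ident T K) = f"
    using transpose_ex[OF A Ko Y f] .
  let ?t = "inv_arr T (rigidity_arr T K Y) \<cdot> g"
  have t: "?t \<in> Hom T A (dual T K \<odot> Y)" using comp_hom[OF g(1) inv_arr(1)[OF r]] .
  have "rigidity_arr T K Y \<cdot> ?t = g"
    using inv_cancel(2)[OF r] g(1) by (simp add: hom_char)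
  then have "dual_eval K Y \<cdot> (?t \<boxtimes> Ident T K) = f"
    using rigidity_arr_eval[OF Ko Y] comp_assoc[OF ten_hom[OF t ident_hom[OF Ko]]
        ten_hom[OF rigidity_arr_eval(1)[OF Ko Y] ident_hom[OF Ko]] ev_hom[OF Ko Y]]
      ten_comp[OF t rigidity_arr_eval(1)[OF Ko Y] ident_hom[OF Ko] ident_hom[OF Ko]] comp_ident[OF ident_hom[OF Ko]] g(2)
    by simp
  then show thesis using that t by blast
qed

lemma rigid_adjunct_unique:
  assumes K: "K \<in> compacts T" and Y: "Y \<in> Ob T"
    and t: "t \<in> Hom T A (dual T K \<odot> Y)" "t' \<in> Hom T A (dual T K \<odot> Y)"
    and eq: "dual_eval K Y \<cdot> (t \<boxtimes> Ident T K) = dual_eval K Y \<cdot> (t' \<boxtimes> Ident T K)"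
  shows "t = t'"
proof -
  note Ko = compact_ob[OF K]
  note r = rigidity_arr_eval[OF Ko Y]
  have e: "Ev T K Y \<cdot> ((rigidity_arr T K Y \<cdot> s) \<boxtimes> Ident T K) = dual_eval K Y \<cdot> (s \<boxtimes> Ident T K)"
    if s: "s \<in> Hom T A (dual T K \<odot> Y)" for s
    using r(2) comp_assoc[OF ten_hom[OF s ident_hom[OF Ko]] ten_hom[OF r(1) ident_hom[OF Ko]] ev_hom[OF Ko Y]]
      ten_comp[OF s r(1) ident_hom[OF Ko] ident_hom[OF Ko]] comp_ident[OF ident_hom[OF Ko]] by simp
  have "rigidity_arr T K Y \<cdot> t = rigidity_arr T K Y \<cdot> t'"
    using transpose_unique[OF Ko Y comp_hom[OF t(1) r(1)] comp_hom[OF t(2) r(1)]] e t eq by simp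
  then show ?thesis using iso_cancel_left[OF rigid_iso[OF K Y] t] by blast
qed

subsection \<open>Tensor products and coproducts\<close>

lemma exact_ftr_tensor: "X \<in> Ob T \<Longrightarrow> exact_ftr T \<lparr>FOb = \<lambda>Y. Y \<odot> X, FMor = \<lambda>f. f \<boxtimes> Ident T X\<rparr>"
  using ten_exact_left by unfold_locales

lemma exact_ftr_tensor': "X \<in> Ob T \<Longrightarrow> exact_ftr T \<lparr>FOb = \<lambda>Y. X \<odot> Y, FMor = \<lambda>f. Ident T X \<boxtimes> f\<rparr>"
  using ten_exact_right by unfold_locales

lemma tensor_zero: "\<lbrakk>X \<in> Ob T; A \<in> Ob T; B \<in> Ob T\<rbrakk> \<Longrightarrow> Ident T X \<boxtimes> ZeroM T A B = ZeroM T (X \<odot> A) (X \<odot> B)"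
  and zero_tensor: "\<lbrakk>X \<in> Ob T; A \<in> Ob T; B \<in> Ob T\<rbrakk> \<Longrightarrow> ZeroM T A B \<boxtimes> Ident T X = ZeroM T (A \<odot> X) (B \<odot> X)"
  using exact_ftr.F_zero[OF exact_ftr_tensor'] exact_ftr.F_zero[OF exact_ftr_tensor] by fastforce+

text \<open>A functor with a right adjoint preserves coproducts: cocones out of the
  \<open>Y i \<odot> X\<close> are transposed to cocones with vertex
  \<open>IHom T X W\<close>.\<close>

lemma tensor_coproduct:
  assumes cop: "is_coproduct T I Y P \<iota>" and X: "X \<in> Ob T"
  shows "is_coproduct T I (\<lambda>i. Y i \<odot> X) (P \<odot> X) (\<lambda>i. \<iota> i \<boxtimes> Ident T X)"
  unfolding is_coproduct_def
proof (intro conjI ballI allI impI)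
  interpret coproduct_in T I Y P \<iota> using cop by (rule coproduct_inI)
  note idX = ident_hom[OF X]
  show "P \<odot> X \<in> Ob T" using ten_ob P_ob X by blast
  show "\<iota> i \<boxtimes> Ident T X \<in> Hom T (Y i \<odot> X) (P \<odot> X)" if "i \<in> I" for i
    using ten_hom[OF \<iota>_hom[OF that] idX] .
  fix W f
  assume W: "W \<in> Ob T" and f: "\<forall>i\<in>I. f i \<in> Hom T (Y i \<odot> X) W"
  have "\<exists>g. g \<in> Hom T (Y i) (IHom T X W) \<and> Ev T X W \<cdot> (g \<boxtimes> Ident T X) = f i" if "i \<in> I" for i
    using transpose_ex[OF X_ob[OF that] X W] f that by metis
  then obtain g where g: "\<And>i. i \<in> I \<Longrightarrow> g i \<in> Hom T (Y i) (IHom T X W)"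
    "\<And>i. i \<in> I \<Longrightarrow> Ev T X W \<cdot> (g i \<boxtimes> Ident T X) = f i"
    by metis
  obtain k where k: "k \<in> Hom T P (IHom T X W)" "\<And>i. i \<in> I \<Longrightarrow> k \<cdot> \<iota> i = g i"
    using copair_ex1[OF ihom_ob[OF X W], of g] g(1) by blast
  note ev = ev_hom[OF X W]
  have comp: "Ev T X W \<cdot> (s \<boxtimes> Ident T X) \<cdot> (\<iota> i \<boxtimes> Ident T X) = Ev T X W \<cdot> ((s \<cdot> \<iota> i) \<boxtimes> Ident T X)"
    if "i \<in> I" "s \<in> Hom T P (IHom T X W)" for s i
    using comp_assoc[OF ten_hom[OF \<iota>_hom[OF that(1)] idX] ten_hom[OF that(2) idX] ev]
      ten_comp[OF \<iota>_hom[OF that(1)] that(2) idX idX] comp_ident[OF idX] by simp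
  show "\<exists>!h. h \<in> Hom T (P \<odot> X) W \<and> (\<forall>i\<in>I. h \<cdot> (\<iota> i \<boxtimes> Ident T X) = f i)"
  proof (rule ex1I[of _ "Ev T X W \<cdot> (k \<boxtimes> Ident T X)"], intro conjI ballI)
    show "Ev T X W \<cdot> (k \<boxtimes> Ident T X) \<in> Hom T (P \<odot> X) W" using comp_hom[OF ten_hom[OF k(1) idX] ev] .
    show "Ev T X W \<cdot> (k \<boxtimes> Ident T X) \<cdot> (\<iota> i \<boxtimes> Ident T X) = f i" if "i \<in> I" for i
      using comp[OF that k(1)] k(2) g(2) that by simp
  next
    fix h assume h: "h \<in> Hom T (P \<odot> X) W \<and> (\<forall>i\<in>I. h \<cdot> (\<iota> i \<boxtimes> Ident T X) = f i)"
    obtain k' where k': "k' \<in> Hom T P (IHom T X W)" "Ev T X W \<cdot> (k' \<boxtimes> Ident T X) = h"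
      using transpose_ex[OF P_ob X W] h by blast
    have "k' = k"
    proof (rule cop_ext[OF k'(1) k(1)])
      fix i assume i: "i \<in> I"
      show "k' \<cdot> \<iota> i = k \<cdot> \<iota> i"
        using transpose_unique[OF X W comp_hom[OF \<iota>_hom[OF i] k'(1)] comp_hom[OF \<iota>_hom[OF i] k(1)]]
          comp[OF i k'(1)] comp[OF i k(1)] k(2) k'(2) g(2) h i by simp
    qed
    then show "h = Ev T X W \<cdot> (k \<boxtimes> Ident T X)" using k'(2) by simp
  qed
qed

lemma coproduct_iso:
  assumes cop: "is_coproduct T I Y P \<iota>"
    and b: "\<And>i. i \<in> I \<Longrightarrow> iso_arr T (Y i) (Y' i) (b i)" and p: "iso_arr T P P' p"
    and sq: "\<And>i. i \<in> I \<Longrightarrow> \<iota>' i \<in> Hom T (Y' i) P'" "\<And>i. i \<in> I \<Longrightarrow> \<iota>' i \<cdot> b i = p \<cdot> \<iota> i"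
  shows "is_coproduct T I Y' P' \<iota>'"
  unfolding is_coproduct_def
proof (intro conjI ballI allI impI)
  interpret coproduct_in T I Y P \<iota> using cop by (rule coproduct_inI)
  note ph = iso_arr_hom[OF p] and bh = iso_arr_hom[OF b]
  show "P' \<in> Ob T" using ph hom_objects by blast
  show "\<iota>' i \<in> Hom T (Y' i) P'" if "i \<in> I" for i using sq that by blast
  fix W f
  assume W: "W \<in> Ob T" and f: "\<forall>i\<in>I. f i \<in> Hom T (Y' i) W"
  obtain k where k: "k \<in> Hom T P W" "\<And>i. i \<in> I \<Longrightarrow> k \<cdot> \<iota> i = f i \<cdot> b i"
    using copair_ex1[OF W, of "\<lambda>i. f i \<cdot> b i"] f comp_hom bh by blast
  note kp = comp_hom[OF inv_arr(1)[OF p] k(1)]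
  have key: "s \<cdot> \<iota>' i = f i \<longleftrightarrow> (s \<cdot> p) \<cdot> \<iota> i = f i \<cdot> b i" if i: "i \<in> I" and s: "s \<in> Hom T P' W" for s i
    using comp_assoc[OF \<iota>_hom[OF i] ph s] sq(2)[OF i] comp_assoc[OF bh[OF i] sq(1)[OF i] s]
      iso_cancel_right[OF b[OF i] comp_hom[OF sq(1)[OF i] s] f[rule_format, OF i]] by metis
  have kpp: "k \<cdot> inv_arr T p \<cdot> p = k"
    using comp_assoc[OF ph inv_arr(1)[OF p] k(1)] inv_arr(2)[OF p] comp_ident[OF k(1)] by simp
  show "\<exists>!h. h \<in> Hom T P' W \<and> (\<forall>i\<in>I. h \<cdot> \<iota>' i = f i)"
  proof (rule ex1I[of _ "k \<cdot> inv_arr T p"], intro conjI ballI)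
    show "k \<cdot> inv_arr T p \<in> Hom T P' W" by (rule kp)
    show "k \<cdot> inv_arr T p \<cdot> \<iota>' i = f i" if "i \<in> I" for i using key[OF that kp] kpp k(2) that by simp
  next
    fix h assume h: "h \<in> Hom T P' W \<and> (\<forall>i\<in>I. h \<cdot> \<iota>' i = f i)"
    then have h1: "h \<in> Hom T P' W" by blast
    have "h \<cdot> p = k"
    proof (rule cop_ext[OF comp_hom[OF ph h1] k(1)])
      show "h \<cdot> p \<cdot> \<iota> i = k \<cdot> \<iota> i" if "i \<in> I" for i
        using key[OF that h1] h k(2) that by simp
    qed
    then show "h = k \<cdot> inv_arr T p"
      using iso_cancel_right[OF p _ kp] kpp h by simp
  qed
qed

lemma tensor_coproduct':
  assumes cop: "is_coproduct T I Y P \<iota>" and X: "X \<in> Ob T"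
  shows "is_coproduct T I (\<lambda>i. X \<odot> Y i) (X \<odot> P) (\<lambda>i. Ident T X \<boxtimes> \<iota> i)"
proof -
  interpret coproduct_in T I Y P \<iota> using cop by (rule coproduct_inI)
  show ?thesis
    by (rule coproduct_iso[OF tensor_coproduct[OF cop X], where b="\<lambda>i. Braid T (Y i) X" and p="Braid T P X"])
      (use braid_iso X_ob P_ob X ten_hom ident_hom \<iota>_hom braid_natural[OF \<iota>_hom ident_hom[OF X]] in auto)
qed

lemma tensor_cut:
  fixes I :: "'v set"
  assumes cop: "is_coproduct T I Y P \<iota>" and X: "X \<in> Ob T" and C: "C \<in> compacts T"
    and I: "small TYPE('v) I" and h: "h \<in> Hom T C (X \<odot> P)"
  obtains F where "finite F" "F \<subseteq> I" "(Ident T X \<boxtimes> coproduct_in.cut T I Y P \<iota> F) \<cdot> h = h"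
proof -
  let ?F = "\<lparr>FOb = \<lambda>Y. X \<odot> Y, FMor = \<lambda>f. Ident T X \<boxtimes> f\<rparr>"
  interpret exact_ftr T ?F using exact_ftr_tensor'[OF X] .
  have "is_functor T T ?F" using exact by (simp add: exact_functor_def)
  then show thesis
    using compact_cut[OF C I tensor_coproduct'[OF cop X] h] additive_cut[OF cop, of ?F]
      tensor_coproduct'[OF cop X] F_zero that by auto
qed

text \<open>By adjunction \<open>h\<close> corresponds to an arrow from the compact object
  \<open>A\<close> to \<open>dual T K \<odot> P\<close>, which is again a coproduct; naturality of
  \<open>dual_eval\<close> carries the finite cut back.\<close>

lemma compact_tensor:
  assumes A: "A \<in> compacts T" and K: "K \<in> compacts T"
  shows "A \<odot> K \<in> compacts T"
proof (rule compactI)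
  note Ao = compact_ob[OF A] and Ko = compact_ob[OF K]
  show "A \<odot> K \<in> Ob T" using ten_ob Ao Ko by blast
  fix I :: "'v set" and Y P \<iota> h
  assume I: "small TYPE('v) I" and cop: "is_coproduct T I Y P \<iota>" and h: "h \<in> Hom T (A \<odot> K) P"
  interpret coproduct_in T I Y P \<iota> using cop by (rule coproduct_inI)
  let ?D = "dual T K"
  obtain t where t: "t \<in> Hom T A (?D \<odot> P)" "dual_eval K P \<cdot> (t \<boxtimes> Ident T K) = h"
    using rigid_adjunct[OF K Ao P_ob h] .
  obtain F where F: "finite F" "F \<subseteq> I" "(Ident T ?D \<boxtimes> cut F) \<cdot> t = t"
    using tensor_cut[OF cop dual_ob[OF Ko] A I t(1)] .
  note at = cut_hom[of F, unfolded hom_char] t(1)[unfolded hom_char] dual_eval_arr[OF Ko P_ob] ten_simps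
  have "cut F \<cdot> h = (cut F \<cdot> dual_eval K P) \<cdot> (t \<boxtimes> Ident T K)"
    using t(2) Ko Ao P_ob dual_ob[OF Ko] by (auto simp: at)
  also have "\<dots> = dual_eval K P \<cdot> (((Ident T ?D \<boxtimes> cut F) \<cdot> t) \<boxtimes> Ident T K)"
    unfolding dual_eval_natural[OF Ko cut_hom, symmetric]
    using Ko Ao P_ob dual_ob[OF Ko] by (simp add: at interchange)
  finally show "\<exists>F. finite F \<and> F \<subseteq> I \<and> cut F \<cdot> h = h" using F t(2) by auto
qed

text \<open>The compact objects are the rigid ones, so the rigidity arrow of the unit has to be
  inverted. All factors of \<open>dual_eval\<close> are invertible for the unit, since the
  evaluation is; so the rigidity arrow tensored with the unit is invertible, and the right unit
  constraint removes the tensor factor.\<close>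

lemma unit_compact: "Unit T \<in> compacts T"
proof -
  let ?U = "Unit T"
  note U = unit_ob
  have ev_iso: "iso_arr T (IHom T ?U Y \<odot> ?U) Y (Ev T ?U Y)" if Y: "Y \<in> Ob T" for Y
  proof -
    note J = ihom_ob[OF U Y] and ev = ev_hom[OF U Y]
    note rJ = runit_iso[OF J] and rY = runit_iso[OF Y]
    \<comment> \<open>Up to the right unit constraint, the inverse of the evaluation is the
      transpose of \<open>RUnit T Y\<close>.\<close>
    obtain g where g: "g \<in> Hom T Y (IHom T ?U Y)" "Ev T ?U Y \<cdot> (g \<boxtimes> Ident T ?U) = RUnit T Y"
      using transpose_ex[OF Y U Y iso_arr_hom[OF rY]] .
    let ?e = "Ev T ?U Y \<cdot> inv_arr T (RUnit T (IHom T ?U Y))"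
    have e: "?e \<in> Hom T (IHom T ?U Y) Y" using comp_hom[OF inv_arr(1)[OF rJ] ev] .
    have eg: "?e \<cdot> g = Ident T Y"
    proof (rule iso_cancel_right[OF rY comp_hom[OF g(1) e] ident_hom[OF Y]])
      have "?e \<cdot> g \<cdot> RUnit T Y = Ev T ?U Y \<cdot> (inv_arr T (RUnit T (IHom T ?U Y)) \<cdot> (RUnit T (IHom T ?U Y) \<cdot> (g \<boxtimes> Ident T ?U)))"
        using runit_natural[OF g(1)] g(1)[unfolded hom_char] arr_inv[OF rJ] arr_inv[OF rY] ev[unfolded hom_char]
        by (simp add: arr_simps)
      also have "\<dots> = Ident T Y \<cdot> RUnit T Y"
        using inv_cancel(1)[OF rJ, of "g \<boxtimes> Ident T ?U"] ten_hom[OF g(1) ident_hom[OF U]] g(2)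
          ident_comp[OF iso_arr_hom[OF rY]] by (simp add: hom_char)
      finally show "?e \<cdot> g \<cdot> RUnit T Y = Ident T Y \<cdot> RUnit T Y" .
    qed
    have "g \<cdot> ?e = Ident T (IHom T ?U Y)"
    proof (rule transpose_unique[OF U Y comp_hom[OF e g(1)] ident_hom[OF J]])
      have "Ev T ?U Y \<cdot> ((g \<cdot> ?e) \<boxtimes> Ident T ?U) = Ev T ?U Y \<cdot> (g \<boxtimes> Ident T ?U) \<cdot> (?e \<boxtimes> Ident T ?U)"
        using comp_assoc[OF ten_hom[OF e ident_hom[OF U]] ten_hom[OF g(1) ident_hom[OF U]] ev]
          ten_comp[OF e g(1) ident_hom[OF U] ident_hom[OF U]] comp_ident[OF ident_hom[OF U]] by simp
      also have "\<dots> = ?e \<cdot> RUnit T (IHom T ?U Y)"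
        using g(2) runit_natural[OF e] by simp
      also have "\<dots> = Ev T ?U Y"
        using comp_assoc[OF iso_arr_hom[OF rJ] inv_arr(1)[OF rJ] ev] inv_arr(2)[OF rJ] comp_ident[OF ev] by simp
      also have "\<dots> = Ev T ?U Y \<cdot> (Ident T (IHom T ?U Y) \<boxtimes> Ident T ?U)"
        using ten_ident[OF J U] comp_ident[OF ev] by simp
      finally show "Ev T ?U Y \<cdot> ((g \<cdot> ?e) \<boxtimes> Ident T ?U) = Ev T ?U Y \<cdot> (Ident T (IHom T ?U Y) \<boxtimes> Ident T ?U)" .
    qed
    then have "iso_arr T (IHom T ?U Y) Y ?e" using iso_arrI[OF e g(1) _ eg] by blast
    then have "iso_arr T (IHom T ?U Y \<odot> ?U) Y (?e \<cdot> RUnit T (IHom T ?U Y))"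
      using iso_comp[OF rJ] by blast
    then show ?thesis
      using comp_assoc[OF iso_arr_hom[OF rJ] inv_arr(1)[OF rJ] ev] inv_arr(2)[OF rJ] comp_ident[OF ev] by simp
  qed
  have "iso_arr T (dual T ?U \<odot> Y) (IHom T ?U Y) (rigidity_arr T ?U Y)" if Y: "Y \<in> Ob T" for Y
  proof -
    let ?D = "dual T ?U"
    note D = dual_ob[OF U]
    have "iso_arr T ((?D \<odot> Y) \<odot> ?U) Y (dual_eval ?U Y)"
      unfolding dual_eval_def
      by (rule iso_comp[OF assoc_iso[OF D Y U]], rule iso_comp[OF ten_iso[OF iso_ident[OF D] braid_iso[OF Y U]]],
          rule iso_comp[OF inv_arr(4)[OF assoc_iso[OF D U Y]]],
          rule iso_comp[OF ten_iso[OF ev_iso[OF U, folded dual_def] iso_ident[OF Y]] lunit_iso[OF Y]])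
    then have "iso_arr T ((?D \<odot> Y) \<odot> ?U) (IHom T ?U Y \<odot> ?U) (inv_arr T (Ev T ?U Y) \<cdot> dual_eval ?U Y)"
      using iso_comp inv_arr(4)[OF ev_iso[OF Y]] by blast
    moreover note r = rigidity_arr_eval[OF U Y]
    have "inv_arr T (Ev T ?U Y) \<cdot> dual_eval ?U Y = rigidity_arr T ?U Y \<boxtimes> Ident T ?U"
      using r(2) inv_cancel(1)[OF ev_iso[OF Y], of "rigidity_arr T ?U Y \<boxtimes> Ident T ?U"]
        ten_hom[OF r(1) ident_hom[OF U]] by (simp add: hom_char)
    ultimately have "iso_arr T ((?D \<odot> Y) \<odot> ?U) (IHom T ?U Y \<odot> ?U) (rigidity_arr T ?U Y \<boxtimes> Ident T ?U)" by simp
    then have "iso_arr T ((?D \<odot> Y) \<odot> ?U) (IHom T ?U Y) (RUnit T (IHom T ?U Y) \<cdot> (rigidity_arr T ?U Y \<boxtimes> Ident T ?U))"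
      using iso_comp runit_iso[OF ihom_ob[OF U Y]] by blast
    then have i: "iso_arr T ((?D \<odot> Y) \<odot> ?U) (IHom T ?U Y) (rigidity_arr T ?U Y \<cdot> RUnit T (?D \<odot> Y))"
      using runit_natural[OF r(1)] by simp
    note rr = runit_iso[OF ten_ob[OF D Y]]
    have "rigidity_arr T ?U Y \<cdot> RUnit T (?D \<odot> Y) \<cdot> inv_arr T (RUnit T (?D \<odot> Y)) = rigidity_arr T ?U Y"
      using comp_assoc[OF inv_arr(1)[OF rr] iso_arr_hom[OF rr] r(1)] inv_arr(3)[OF rr] comp_ident[OF r(1)] by simp
    then show ?thesis using iso_comp[OF inv_arr(4)[OF rr] i] by simp
  qed
  then show ?thesis using compact_eq_rigid U by (auto simp: rigids_def)
qed

end

text \<open>\<open>\<eta>\<close> is the coevaluation in the form that \<open>rigid_adjunct\<close>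
  yields: it corresponds to \<open>LUnit T K\<close>. Both zigzag relations are derived from this,
  the second one in the weaker form of an isomorphism.\<close>

locale dual_pair = rigidly_compactly_generated_tt T
  for T :: "('o, 'v::universe, 'z) tt_cat_scheme" (structure) +
  fixes K :: 'o and \<eta> :: 'v
  assumes K: "K \<in> compacts T"
    and \<eta>: "\<eta> \<in> Hom T (Unit T) (dual T K \<odot> K)" "dual_eval K K \<cdot> (\<eta> \<boxtimes> Ident T K) = LUnit T K"
begin

abbreviation "U \<equiv> Unit T"
abbreviation "D \<equiv> dual T K"
abbreviation "ev \<equiv> Ev T K (Unit T)"
abbreviation "\<alpha> \<equiv> Assoc T"
abbreviation "\<sigma> \<equiv> Braid T"
abbreviation "idn \<equiv> Ident T"

definition coev :: 'v where
  "coev = \<sigma> D K \<cdot> \<eta>"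

lemma ob: "K \<in> Ob T" "D \<in> Ob T" "U \<in> Ob T"
  using compact_ob[OF K] dual_ob unit_ob by auto

lemma ev: "arr ev" "dom_of T ev = D \<odot> K" "cod_of T ev = U"
  by (rule arr_ev[OF ob(1)])+

lemma ev_hom': "ev \<in> Hom T (D \<odot> K) U"
  using ev by (simp add: hom_char)

lemma eta: "arr \<eta>" "dom_of T \<eta> = U" "cod_of T \<eta> = D \<odot> K"
  using \<eta>(1) by (auto simp: hom_char)

lemma coev: "arr coev" "dom_of T coev = U" "cod_of T coev = K \<odot> D"
  unfolding coev_def using ob eta by (simp_all add: ten_simps)

lemma coev_hom: "coev \<in> Hom T U (K \<odot> D)"
  using coev by (simp add: hom_char)

lemmas at = ob ev eta coev ten_simps

lemma braid_cancel: "\<lbrakk>A \<in> Ob T; B \<in> Ob T; arr x; cod_of T x = A \<odot> B\<rbrakk> \<Longrightarrow> \<sigma> B A \<cdot> (\<sigma> A B \<cdot> x) = x"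
  using arr_reduce2[OF braid_symmetric[of A B], of x] by (simp add: ten_simps)

definition zigzag :: 'v where
  "zigzag = (idn K \<boxtimes> ev) \<cdot> (\<alpha> K D K \<cdot> (coev \<boxtimes> idn K))"

text \<open>The hexagon turns the defining property of \<open>\<eta>\<close> into a zigzag identity.\<close>

lemma zigzag: "zigzag = \<sigma> U K"
proof -
  note ai = arr_inv[OF assoc_iso[OF ob(2,1,1)]]
  let ?ai = "inv_arr T (\<alpha> D K K)"
  let ?r = "(ev \<boxtimes> idn K) \<cdot> (?ai \<cdot> ((idn D \<boxtimes> \<sigma> K K) \<cdot> (\<alpha> D K K \<cdot> (\<eta> \<boxtimes> idn K))))"
  have r: "?r \<in> Hom T (U \<odot> K) (U \<odot> K)" by (simp add: hom_char at ai)
  have "LUnit T K \<cdot> ?r = LUnit T K \<cdot> idn (U \<odot> K)"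
    using \<eta>(2) unfolding dual_eval_def by (simp add: at ai)
  then have r1: "?r = idn (U \<odot> K)"
    using iso_cancel_left[OF lunit_iso[OF ob(1)] r ident_hom[OF ten_ob[OF ob(3,1)]]] by blast
  have hex: "\<alpha> D K K \<cdot> (\<sigma> K (D \<odot> K) \<cdot> \<alpha> K D K) = (idn D \<boxtimes> \<sigma> K K) \<cdot> (\<alpha> D K K \<cdot> (\<sigma> K D \<boxtimes> idn K))"
    using hexagon[OF ob(1,2,1)] by (simp add: at)
  have s: "(\<sigma> K D \<boxtimes> idn K) \<cdot> (coev \<boxtimes> idn K) = \<eta> \<boxtimes> idn K"
    using braid_cancel[OF ob(2,1), of \<eta>] by (simp add: at interchange coev_def)
  have "\<sigma> U K \<cdot> ?r = \<sigma> U K \<cdot> ((ev \<boxtimes> idn K) \<cdot> (?ai \<cdot> ((idn D \<boxtimes> \<sigma> K K) \<cdot> (\<alpha> D K K \<cdot> ((\<sigma> K D \<boxtimes> idn K) \<cdot> (coev \<boxtimes> idn K))))))"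
    unfolding s ..
  also have "\<dots> = \<sigma> U K \<cdot> ((ev \<boxtimes> idn K) \<cdot> (?ai \<cdot> (\<alpha> D K K \<cdot> (\<sigma> K (D \<odot> K) \<cdot> (\<alpha> K D K \<cdot> (coev \<boxtimes> idn K))))))"
    using arr_reduce3[OF hex[symmetric], of "coev \<boxtimes> idn K"] by (simp add: at ai)
  also have "\<dots> = \<sigma> U K \<cdot> ((ev \<boxtimes> idn K) \<cdot> (\<sigma> K (D \<odot> K) \<cdot> (\<alpha> K D K \<cdot> (coev \<boxtimes> idn K))))"
    using inv_cancel(1)[OF assoc_iso[OF ob(2,1,1)]] by (simp add: at ai)
  also have "\<dots> = (idn K \<boxtimes> ev) \<cdot> (\<sigma> (D \<odot> K) K \<cdot> (\<sigma> K (D \<odot> K) \<cdot> (\<alpha> K D K \<cdot> (coev \<boxtimes> idn K))))"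
    using arr_reduce2[OF braid_iso_arr[of ev "idn K"]] by (simp add: at)
  also have "\<dots> = zigzag"
    unfolding zigzag_def using braid_cancel by (simp add: at)
  finally show ?thesis unfolding r1 by (simp add: at)
qed

lemma assoc_cancel: "\<lbrakk>A \<in> Ob T; B \<in> Ob T; X \<in> Ob T; x \<in> Hom T Y ((A \<odot> B) \<odot> X); y \<in> Hom T Y ((A \<odot> B) \<odot> X);
    \<alpha> A B X \<cdot> x = \<alpha> A B X \<cdot> y\<rbrakk> \<Longrightarrow> x = y"
  using iso_cancel_left[OF assoc_iso] by blast

lemma assoc_lift:
  assumes "A \<in> Ob T" "B \<in> Ob T" "X \<in> Ob T" "x \<in> Hom T Y (A \<odot> (B \<odot> X))"
  obtains y where "y \<in> Hom T Y ((A \<odot> B) \<odot> X)" "\<alpha> A B X \<cdot> y = x"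
  using that[of "inv_arr T (\<alpha> A B X) \<cdot> x"] inv_cancel(2)[OF assoc_iso[OF assms(1-3)], of x]
    comp_hom[OF assms(4) inv_arr(1)[OF assoc_iso[OF assms(1-3)]]] assms(4) by (auto simp: hom_char)

text \<open>Here \<open>r\<close> is \<open>idn D \<boxtimes> t\<close> with its target reassociated
  so that \<open>ev\<close> applies. Tensoring \<open>(ev \<boxtimes> idn X) \<cdot> r\<close> with
  \<open>K\<close> and inserting \<open>coev\<close> gives back \<open>t\<close> up to the
  constraints and the braiding, by the zigzag identity.\<close>

lemma eval_detects_zero:
  assumes X: "X \<in> Ob T" and t: "t \<in> Hom T A (K \<odot> X)"
    and r: "r \<in> Hom T (D \<odot> A) ((D \<odot> K) \<odot> X)" "\<alpha> D K X \<cdot> r = idn D \<boxtimes> t"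
    and z: "(ev \<boxtimes> idn X) \<cdot> r = ZeroM T (D \<odot> A) (U \<odot> X)"
  shows "t = ZeroM T A (K \<odot> X)"
proof -
  have A: "A \<in> Ob T" using t hom_objects by blast
  note at' = at t[unfolded hom_char] r(1)[unfolded hom_char] X A
  have Ut: "idn U \<boxtimes> t \<in> Hom T (U \<odot> A) (U \<odot> (K \<odot> X))" using ten_hom[OF ident_hom t] ob by blast
  obtain s where s: "s \<in> Hom T (U \<odot> A) ((U \<odot> K) \<odot> X)" "\<alpha> U K X \<cdot> s = idn U \<boxtimes> t"
    using assoc_lift[OF ob(3,1) X Ut] .
  note at' = at' s(1)[unfolded hom_char]
  have pent: "\<alpha> K D (K \<odot> X) \<cdot> \<alpha> (K \<odot> D) K X = (idn K \<boxtimes> \<alpha> D K X) \<cdot> (\<alpha> K (D \<odot> K) X \<cdot> (\<alpha> K D K \<boxtimes> idn X))"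
    using pentagon[OF ob(1,2,1) X] by (simp add: at')
  \<comment> \<open>\<open>?l\<close> applies \<open>t\<close> first and then \<open>coev\<close>,
    \<open>?r\<close> the other way round; the pentagon and naturality identify them.\<close>
  let ?l = "\<alpha> K (D \<odot> K) X \<cdot> ((\<alpha> K D K \<boxtimes> idn X) \<cdot> (((coev \<boxtimes> idn K) \<boxtimes> idn X) \<cdot> s))"
  let ?r = "(idn K \<boxtimes> r) \<cdot> (\<alpha> K D A \<cdot> (coev \<boxtimes> idn A))"
  have e1: "\<alpha> (K \<odot> D) K X \<cdot> ((coev \<boxtimes> idn K) \<boxtimes> idn X) = (coev \<boxtimes> idn (K \<odot> X)) \<cdot> \<alpha> U K X"
    using assoc_natural_arr[of coev "idn K" "idn X"] by (simp add: at' ten_ident)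
  have e2: "(coev \<boxtimes> idn (K \<odot> X)) \<cdot> (idn U \<boxtimes> t) = (idn (K \<odot> D) \<boxtimes> t) \<cdot> (coev \<boxtimes> idn A)"
    by (simp add: at' interchange)
  have e3: "\<alpha> K D (K \<odot> X) \<cdot> (idn (K \<odot> D) \<boxtimes> t) = (idn K \<boxtimes> (idn D \<boxtimes> t)) \<cdot> \<alpha> K D A"
    using assoc_natural_arr[of "idn K" "idn D" t] by (simp add: at' ten_ident)
  have "(idn K \<boxtimes> \<alpha> D K X) \<cdot> ?l = \<alpha> K D (K \<odot> X) \<cdot> (\<alpha> (K \<odot> D) K X \<cdot> (((coev \<boxtimes> idn K) \<boxtimes> idn X) \<cdot> s))"
    using arr_reduce3[OF pent[symmetric], of "((coev \<boxtimes> idn K) \<boxtimes> idn X) \<cdot> s"] by (simp add: at')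
  also have "\<dots> = \<alpha> K D (K \<odot> X) \<cdot> ((coev \<boxtimes> idn (K \<odot> X)) \<cdot> (idn U \<boxtimes> t))"
    using arr_reduce2[OF e1, of s] s(2) by (simp add: at')
  also have "\<dots> = (idn K \<boxtimes> (idn D \<boxtimes> t)) \<cdot> (\<alpha> K D A \<cdot> (coev \<boxtimes> idn A))"
    unfolding e2 using arr_reduce2[OF e3, of "coev \<boxtimes> idn A"] by (simp add: at')
  also have "\<dots> = (idn K \<boxtimes> \<alpha> D K X) \<cdot> ?r"
    using arr_reduce2[of "idn K \<boxtimes> \<alpha> D K X" "idn K \<boxtimes> r" "idn K \<boxtimes> (idn D \<boxtimes> t)" "\<alpha> K D A \<cdot> (coev \<boxtimes> idn A)"] r(2)
    by (simp add: at' interchange)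
  finally have lr: "?l = ?r"
    by (rule iso_cancel_left[OF ten_iso[OF iso_ident[OF ob(1)] assoc_iso[OF ob(2,1) X]], rotated 2])
      (simp_all add: hom_char at')
  have e4: "\<alpha> K U X \<cdot> ((idn K \<boxtimes> ev) \<boxtimes> idn X) = (idn K \<boxtimes> (ev \<boxtimes> idn X)) \<cdot> \<alpha> K (D \<odot> K) X"
    using assoc_natural_arr[of "idn K" ev "idn X"] by (simp add: at')
  have zz: "zigzag \<boxtimes> idn X = ((idn K \<boxtimes> ev) \<boxtimes> idn X) \<cdot> ((\<alpha> K D K \<boxtimes> idn X) \<cdot> ((coev \<boxtimes> idn K) \<boxtimes> idn X))"
    unfolding zigzag_def by (simp add: at' interchange)
  have "\<alpha> K U X \<cdot> ((zigzag \<boxtimes> idn X) \<cdot> s) = (idn K \<boxtimes> (ev \<boxtimes> idn X)) \<cdot> ?l"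
    unfolding zz by (simp add: at' arr_reduce2[OF e4])
  also have "\<dots> = (idn K \<boxtimes> ((ev \<boxtimes> idn X) \<cdot> r)) \<cdot> (\<alpha> K D A \<cdot> (coev \<boxtimes> idn A))"
    unfolding lr
    using arr_reduce2[of "idn K \<boxtimes> (ev \<boxtimes> idn X)" "idn K \<boxtimes> r" "idn K \<boxtimes> ((ev \<boxtimes> idn X) \<cdot> r)" "\<alpha> K D A \<cdot> (coev \<boxtimes> idn A)"]
    by (simp add: at' interchange)
  also have "\<dots> = ZeroM T (U \<odot> A) (K \<odot> (U \<odot> X))"
    unfolding z using tensor_zero[of K "D \<odot> A" "U \<odot> X"]
      zero_comp[of "\<alpha> K D A \<cdot> (coev \<boxtimes> idn A)" "U \<odot> A" "K \<odot> (D \<odot> A)" "K \<odot> (U \<odot> X)"]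
    by (simp add: at' hom_char)
  finally have zero: "\<alpha> K U X \<cdot> ((\<sigma> U K \<boxtimes> idn X) \<cdot> s) = ZeroM T (U \<odot> A) (K \<odot> (U \<odot> X))"
    unfolding zigzag .
  have iso: "iso_arr T ((U \<odot> K) \<odot> X) (K \<odot> (U \<odot> X)) (\<alpha> K U X \<cdot> (\<sigma> U K \<boxtimes> idn X))"
    using iso_comp[OF ten_iso[OF braid_iso[OF ob(3,1)] iso_ident[OF X]] assoc_iso[OF ob(1,3) X]] .
  have obs: "U \<odot> A \<in> Ob T" "(U \<odot> K) \<odot> X \<in> Ob T" by (simp_all add: at')
  have "s = ZeroM T (U \<odot> A) ((U \<odot> K) \<odot> X)"
    by (rule iso_cancel_left[OF iso s(1) zero_hom[OF obs]])
      (use zero comp_zero[OF iso_arr_hom[OF iso] obs(1)] in \<open>simp add: at'\<close>)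
  then have "idn U \<boxtimes> t = ZeroM T (U \<odot> A) (U \<odot> (K \<odot> X))"
    using s(2) comp_zero[OF iso_arr_hom[OF assoc_iso[OF ob(3,1) X]] obs(1)] by simp
  then have "idn U \<boxtimes> t = idn U \<boxtimes> ZeroM T A (K \<odot> X)"
    using tensor_zero[OF ob(3) A, of "K \<odot> X"] by (simp add: at')
  then show ?thesis
    using unit_tensor_inj[OF t zero_hom[OF A]] ten_ob[OF ob(1) X] by blast
qed

text \<open>The evaluation as a pairing, with a unit factor carried along: \<open>x\<close> from
  \<open>B\<close> to \<open>U \<odot> D\<close> gives an arrow from \<open>B \<odot> K\<close> to
  \<open>U \<odot> U\<close>. Keeping the unit factor leaves room for the symmetry of
  \<open>U \<odot> U\<close>.\<close>

definition pair :: "'v \<Rightarrow> 'v" where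
  "pair x = (idn U \<boxtimes> ev) \<cdot> (\<alpha> U D K \<cdot> (x \<boxtimes> idn K))"

lemma pair_comp:
  assumes "x \<in> Hom T B (U \<odot> D)" "y \<in> Hom T A B"
  shows "pair (x \<cdot> y) = pair x \<cdot> (y \<boxtimes> idn K)"
proof -
  have "(x \<cdot> y) \<boxtimes> idn K = (x \<boxtimes> idn K) \<cdot> (y \<boxtimes> idn K)"
    using assms by (simp add: hom_char at interchange)
  then show ?thesis unfolding pair_def using assms by (simp add: hom_char at)
qed

lemma pair_hom: "x \<in> Hom T B (U \<odot> D) \<Longrightarrow> pair x \<in> Hom T (B \<odot> K) (U \<odot> U)"
  unfolding pair_def by (auto simp add: hom_char at)

lemma pair_unit:
  assumes "g \<in> Hom T B D"
  shows "pair (idn U \<boxtimes> g) = (idn U \<boxtimes> (ev \<cdot> (g \<boxtimes> idn K))) \<cdot> \<alpha> U B K"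
proof -
  have B: "B \<in> Ob T" using assms hom_objects by blast
  note at' = at assms[unfolded hom_char] B
  have "\<alpha> U D K \<cdot> ((idn U \<boxtimes> g) \<boxtimes> idn K) = (idn U \<boxtimes> (g \<boxtimes> idn K)) \<cdot> \<alpha> U B K"
    using assoc_natural_arr[of "idn U" g "idn K"] by (simp add: at')
  moreover have "idn U \<boxtimes> (ev \<cdot> (g \<boxtimes> idn K)) = (idn U \<boxtimes> ev) \<cdot> (idn U \<boxtimes> (g \<boxtimes> idn K))"
    by (simp add: at' interchange)
  ultimately show ?thesis unfolding pair_def by (simp add: at')
qed

text \<open>Composed with \<open>LUnit T B\<close>, both arrows become tensors of the unit with some
  \<open>x'\<close> and \<open>y'\<close>, whose pairings are given by evaluation; there uniqueness
  of transposes applies.\<close>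

lemma pair_inj:
  assumes x: "x \<in> Hom T B (U \<odot> D)" and y: "y \<in> Hom T B (U \<odot> D)" and eq: "pair x = pair y"
  shows "x = y"
proof -
  have B: "B \<in> Ob T" using x hom_objects by blast
  note l = iso_arr_hom[OF lunit_iso[OF B]]
  obtain x' where x': "x' \<in> Hom T B D" "x \<cdot> LUnit T B = idn U \<boxtimes> x'"
    using unit_tensor_eq[OF comp_hom[OF l x] B ob(2)] .
  obtain y' where y': "y' \<in> Hom T B D" "y \<cdot> LUnit T B = idn U \<boxtimes> y'"
    using unit_tensor_eq[OF comp_hom[OF l y] B ob(2)] .
  have "pair (idn U \<boxtimes> x') = pair (idn U \<boxtimes> y')"
    using pair_comp[OF x l] pair_comp[OF y l] eq x' y' by simp
  then have "(idn U \<boxtimes> (ev \<cdot> (x' \<boxtimes> idn K))) \<cdot> \<alpha> U B K = (idn U \<boxtimes> (ev \<cdot> (y' \<boxtimes> idn K))) \<cdot> \<alpha> U B K"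
    using pair_unit x'(1) y'(1) by simp
  then have "idn U \<boxtimes> (ev \<cdot> (x' \<boxtimes> idn K)) = idn U \<boxtimes> (ev \<cdot> (y' \<boxtimes> idn K))"
    by (rule iso_cancel_right[OF assoc_iso[OF ob(3) B ob(1)], rotated 2])
      (use x'(1) y'(1) B in \<open>simp_all add: hom_char at\<close>)
  then have "ev \<cdot> (x' \<boxtimes> idn K) = ev \<cdot> (y' \<boxtimes> idn K)"
    by (rule unit_tensor_inj[rotated 2]) (use x'(1) y'(1) B in \<open>simp_all add: hom_char at\<close>)
  then have "x' = y'"
    using transpose_unique[OF ob(1,3)] x'(1) y'(1) unfolding dual_def by blast
  then show ?thesis
    using iso_cancel_right[OF lunit_iso[OF B] x y] x'(2) y'(2) by simp
qed

lemma pair_surj: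
  assumes f: "f \<in> Hom T ((U \<odot> D) \<odot> K) (U \<odot> U)"
  obtains g where "g \<in> Hom T (U \<odot> D) (U \<odot> D)" "pair g = f"
proof -
  note a = assoc_iso[OF ob(3,2,1)]
  obtain f' where f': "f' \<in> Hom T (D \<odot> K) U" "f \<cdot> inv_arr T (\<alpha> U D K) = idn U \<boxtimes> f'"
    using unit_tensor_eq[OF comp_hom[OF inv_arr(1)[OF a] f] ten_ob[OF ob(2,1)] ob(3)] .
  obtain g' where g': "g' \<in> Hom T D D" "ev \<cdot> (g' \<boxtimes> idn K) = f'"
    using transpose_ex[OF ob(2,1,3) f'(1)] unfolding dual_def by blast
  have "pair (idn U \<boxtimes> g') = f \<cdot> inv_arr T (\<alpha> U D K) \<cdot> \<alpha> U D K"
    using pair_unit[OF g'(1)] g'(2) f'(2) by simp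
  also have "\<dots> = f"
    using comp_assoc[OF iso_arr_hom[OF a] inv_arr(1)[OF a] f] inv_arr(2)[OF a] comp_ident[OF f] by simp
  finally show thesis using that[OF ten_hom[OF ident_hom[OF ob(3)] g'(1)]] by blast
qed

text \<open>
  The other zigzag \<open>\<xi>\<close> is invertible because under the universal pairing it agrees, up to the
  symmetry of \<open>U \<odot> U\<close>, with the braiding; this avoids computing with the unit constraints.
\<close>

lemma dual_zigzag_iso:
  assumes p: "p \<in> Hom T (D \<odot> U) ((D \<odot> K) \<odot> D)" "\<alpha> D K D \<cdot> p = idn D \<boxtimes> coev"
  shows "iso_arr T (D \<odot> U) (U \<odot> D) ((ev \<boxtimes> idn D) \<cdot> p)"
proof -
  let ?\<xi> = "(ev \<boxtimes> idn D) \<cdot> p"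
  note at' = at p(1)[unfolded hom_char]
  have \<xi>: "?\<xi> \<in> Hom T (D \<odot> U) (U \<odot> D)" by (simp add: hom_char at')
  let ?y = "(idn (D \<odot> K) \<boxtimes> ev) \<cdot> (\<alpha> (D \<odot> K) D K \<cdot> (p \<boxtimes> idn K))"
  have e1: "\<alpha> U D K \<cdot> ((ev \<boxtimes> idn D) \<boxtimes> idn K) = (ev \<boxtimes> idn (D \<odot> K)) \<cdot> \<alpha> (D \<odot> K) D K"
    using assoc_natural_arr[of ev "idn D" "idn K"] by (simp add: at' ten_ident)
  have e2: "(idn U \<boxtimes> ev) \<cdot> (ev \<boxtimes> idn (D \<odot> K)) = (ev \<boxtimes> idn U) \<cdot> (idn (D \<odot> K) \<boxtimes> ev)"
    by (simp add: at' interchange)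
  have "?\<xi> \<boxtimes> idn K = ((ev \<boxtimes> idn D) \<boxtimes> idn K) \<cdot> (p \<boxtimes> idn K)"
    by (simp add: at' interchange)
  then have pxi: "pair ?\<xi> = (ev \<boxtimes> idn U) \<cdot> ?y"
    unfolding pair_def by (simp add: at' arr_reduce2[OF e1] arr_reduce2[OF e2])
  have e3: "\<alpha> D K U \<cdot> (idn (D \<odot> K) \<boxtimes> ev) = (idn D \<boxtimes> (idn K \<boxtimes> ev)) \<cdot> \<alpha> D K (D \<odot> K)"
    using assoc_natural_arr[of "idn D" "idn K" ev] by (simp add: at' ten_ident)
  have pent: "\<alpha> D K (D \<odot> K) \<cdot> \<alpha> (D \<odot> K) D K = (idn D \<boxtimes> \<alpha> K D K) \<cdot> (\<alpha> D (K \<odot> D) K \<cdot> (\<alpha> D K D \<boxtimes> idn K))"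
    using pentagon[OF ob(2,1,2,1)] by (simp add: at')
  have e4: "(\<alpha> D K D \<boxtimes> idn K) \<cdot> (p \<boxtimes> idn K) = (idn D \<boxtimes> coev) \<boxtimes> idn K"
    using p(2) by (simp add: at' interchange)
  have e5: "\<alpha> D (K \<odot> D) K \<cdot> ((idn D \<boxtimes> coev) \<boxtimes> idn K) = (idn D \<boxtimes> (coev \<boxtimes> idn K)) \<cdot> \<alpha> D U K"
    using assoc_natural_arr[of "idn D" coev "idn K"] by (simp add: at')
  have zz: "idn D \<boxtimes> zigzag = (idn D \<boxtimes> (idn K \<boxtimes> ev)) \<cdot> ((idn D \<boxtimes> \<alpha> K D K) \<cdot> (idn D \<boxtimes> (coev \<boxtimes> idn K)))"
    unfolding zigzag_def by (simp add: at' interchange)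
  have "\<alpha> D K U \<cdot> ?y = (idn D \<boxtimes> (idn K \<boxtimes> ev)) \<cdot> (\<alpha> D K (D \<odot> K) \<cdot> (\<alpha> (D \<odot> K) D K \<cdot> (p \<boxtimes> idn K)))"
    by (simp add: at' arr_reduce2[OF e3])
  also have "\<dots> = (idn D \<boxtimes> (idn K \<boxtimes> ev)) \<cdot> ((idn D \<boxtimes> \<alpha> K D K) \<cdot> (\<alpha> D (K \<odot> D) K \<cdot> ((\<alpha> D K D \<boxtimes> idn K) \<cdot> (p \<boxtimes> idn K))))"
    using arr_reduce2[OF pent, of "p \<boxtimes> idn K"] by (simp add: at')
  also have "\<dots> = (idn D \<boxtimes> zigzag) \<cdot> \<alpha> D U K"
    unfolding e4 e5 zz by (simp add: at')
  also have "\<dots> = (idn D \<boxtimes> \<sigma> U K) \<cdot> (\<alpha> D U K \<cdot> ((\<sigma> U D \<boxtimes> idn K) \<cdot> (\<sigma> D U \<boxtimes> idn K)))"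
    unfolding zigzag using braid_symmetric[OF ob(2,3)] by (simp add: at' interchange ten_ident)
  also have "\<dots> = \<alpha> D K U \<cdot> (\<sigma> U (D \<odot> K) \<cdot> (\<alpha> U D K \<cdot> (\<sigma> D U \<boxtimes> idn K)))"
  proof -
    have hex: "(idn D \<boxtimes> \<sigma> U K) \<cdot> (\<alpha> D U K \<cdot> (\<sigma> U D \<boxtimes> idn K)) = \<alpha> D K U \<cdot> (\<sigma> U (D \<odot> K) \<cdot> \<alpha> U D K)"
      using hexagon[OF ob(3,2,1)] by (simp add: at')
    show ?thesis using arr_reduce3[OF hex, of "\<sigma> D U \<boxtimes> idn K"] by (simp add: at')
  qed
  finally have y: "?y = \<sigma> U (D \<odot> K) \<cdot> (\<alpha> U D K \<cdot> (\<sigma> D U \<boxtimes> idn K))"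
    by (rule assoc_cancel[OF ob(2,1,3), rotated 2]) (simp_all add: hom_char at')
  have e6: "(ev \<boxtimes> idn U) \<cdot> \<sigma> U (D \<odot> K) = \<sigma> U U \<cdot> (idn U \<boxtimes> ev)"
    using braid_iso_arr[of "idn U" ev] by (simp add: at')
  have px: "pair ?\<xi> = \<sigma> U U \<cdot> pair (\<sigma> D U)"
    unfolding pxi y unfolding pair_def by (simp add: at' arr_reduce2[OF e6])
  note N = ident_hom[OF ten_ob[OF ob(3,2)]]
  have s: "\<sigma> U U \<in> Hom T (U \<odot> U) (U \<odot> U)" using braid_hom ob by blast
  \<comment> \<open>\<open>\<kappa>\<close> is the arrow through which the symmetry of
    \<open>U \<odot> U\<close> acts on \<open>U \<odot> D\<close> under \<open>pair\<close>; it is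
    its own inverse because the symmetry is.\<close>
  obtain \<kappa> where \<kappa>: "\<kappa> \<in> Hom T (U \<odot> D) (U \<odot> D)" "pair \<kappa> = \<sigma> U U \<cdot> pair (idn (U \<odot> D))"
    using pair_surj[OF comp_hom[OF pair_hom[OF N] s]] .
  have pk: "pair (\<kappa> \<cdot> z) = \<sigma> U U \<cdot> pair z" if z: "z \<in> Hom T B (U \<odot> D)" for z B
  proof -
    have zK: "z \<boxtimes> idn K \<in> Hom T (B \<odot> K) ((U \<odot> D) \<odot> K)" using ten_hom[OF z ident_hom[OF ob(1)]] .
    show ?thesis
      using pair_comp[OF \<kappa>(1) z] pair_comp[OF N z] \<kappa>(2) ident_comp[OF z] comp_assoc[OF zK pair_hom[OF N] s]
      by simp
  qed
  have sD: "\<sigma> D U \<in> Hom T (D \<odot> U) (U \<odot> D)" using braid_hom ob by blast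
  have xi: "?\<xi> = \<kappa> \<cdot> \<sigma> D U"
    using pair_inj[OF \<xi> comp_hom[OF sD \<kappa>(1)]] px pk[OF sD] by simp
  have "pair (\<kappa> \<cdot> \<kappa>) = pair (idn (U \<odot> D))"
    using pk[OF \<kappa>(1)] \<kappa>(2) braid_cancel[OF ob(3,3)] pair_hom[OF N] by (simp add: hom_char)
  then have "\<kappa> \<cdot> \<kappa> = idn (U \<odot> D)" using pair_inj[OF comp_hom[OF \<kappa>(1,1)] N] by blast
  then have "iso_arr T (U \<odot> D) (U \<odot> D) \<kappa>" using iso_arrI \<kappa>(1) by blast
  then show ?thesis unfolding xi using iso_comp[OF braid_iso[OF ob(2,3)]] by blast
qed

text \<open>Tensoring \<open>(idn K \<boxtimes> h) \<cdot> coev\<close> with \<open>D\<close> and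
  evaluating gives the composite of \<open>idn U \<boxtimes> h\<close> with the other zigzag, which
  is invertible by \<open>dual_zigzag_iso\<close>.\<close>

lemma coev_detects_zero:
  assumes h: "h \<in> Hom T D P" and z: "(idn K \<boxtimes> h) \<cdot> coev = ZeroM T U (K \<odot> P)"
  shows "h = ZeroM T D P"
proof -
  have P: "P \<in> Ob T" using h hom_objects by blast
  have Dc: "idn D \<boxtimes> coev \<in> Hom T (D \<odot> U) (D \<odot> (K \<odot> D))" by (simp add: hom_char at)
  obtain p where p: "p \<in> Hom T (D \<odot> U) ((D \<odot> K) \<odot> D)" "\<alpha> D K D \<cdot> p = idn D \<boxtimes> coev"
    using assoc_lift[OF ob(2,1,2) Dc] .
  note at' = at P h[unfolded hom_char] p(1)[unfolded hom_char]
  have e1: "\<alpha> D K P \<cdot> (idn (D \<odot> K) \<boxtimes> h) = (idn D \<boxtimes> (idn K \<boxtimes> h)) \<cdot> \<alpha> D K D"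
    using assoc_natural_arr[of "idn D" "idn K" h] by (simp add: at' ten_ident)
  have o: "D \<odot> U \<in> Ob T" "(D \<odot> K) \<odot> P \<in> Ob T" "U \<odot> P \<in> Ob T" by (simp_all add: at')
  have "\<alpha> D K P \<cdot> ((idn (D \<odot> K) \<boxtimes> h) \<cdot> p) = idn D \<boxtimes> ((idn K \<boxtimes> h) \<cdot> coev)"
    using arr_reduce2[OF e1, of p] p(2) by (simp add: at' interchange)
  also have "\<dots> = \<alpha> D K P \<cdot> ZeroM T (D \<odot> U) ((D \<odot> K) \<odot> P)"
    unfolding z using tensor_zero[of D U "K \<odot> P"] comp_zero[OF iso_arr_hom[OF assoc_iso[OF ob(2,1) P]] o(1)]
    by (simp add: at')
  finally have "(idn (D \<odot> K) \<boxtimes> h) \<cdot> p = ZeroM T (D \<odot> U) ((D \<odot> K) \<odot> P)"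
    by (rule assoc_cancel[OF ob(2,1) P, rotated 2]) (use zero_hom[OF o(1,2)] in \<open>simp_all add: hom_char at'\<close>)
  moreover have "(idn U \<boxtimes> h) \<cdot> ((ev \<boxtimes> idn D) \<cdot> p) = (ev \<boxtimes> idn P) \<cdot> ((idn (D \<odot> K) \<boxtimes> h) \<cdot> p)"
  proof -
    have e: "(idn U \<boxtimes> h) \<cdot> (ev \<boxtimes> idn D) = (ev \<boxtimes> idn P) \<cdot> (idn (D \<odot> K) \<boxtimes> h)"
      by (simp add: at' interchange)
    show ?thesis using arr_reduce2[OF e, of p] by (simp add: at')
  qed
  moreover have "(ev \<boxtimes> idn P) \<in> Hom T ((D \<odot> K) \<odot> P) (U \<odot> P)" by (simp add: hom_char at')
  ultimately have c: "(idn U \<boxtimes> h) \<cdot> ((ev \<boxtimes> idn D) \<cdot> p) = ZeroM T (D \<odot> U) (U \<odot> P)"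
    using comp_zero o(1) by metis
  note i = dual_zigzag_iso[OF p]
  have Uh: "idn U \<boxtimes> h \<in> Hom T (U \<odot> D) (U \<odot> P)" by (simp add: hom_char at')
  have "idn U \<boxtimes> h = ZeroM T (U \<odot> D) (U \<odot> P)"
    by (rule iso_cancel_right[OF i Uh zero_hom])
      (use c zero_comp[OF iso_arr_hom[OF i] o(3)] in \<open>simp_all add: at'\<close>)
  then show ?thesis
    using unit_tensor_inj[OF h zero_hom[OF ob(2) P]] tensor_zero[OF ob(3,2) P] by simp
qed

text \<open>An arrow from \<open>D\<close> to \<open>P\<close> is determined by the corresponding
  arrow from the unit to \<open>K \<odot> P\<close>. The unit is compact and
  \<open>K \<odot> P\<close> is a coproduct, so the latter has finite support;
  \<open>coev_detects_zero\<close>, applied to the difference of \<open>h\<close> and its cut,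
  transfers this to \<open>h\<close>.\<close>

lemma dual_compact: "D \<in> compacts T"
proof (rule compactI[OF ob(2)])
  fix I :: "'v set" and Y P \<iota> h
  assume I: "small TYPE('v) I" and cop: "is_coproduct T I Y P \<iota>" and h: "h \<in> Hom T D P"
  interpret coproduct_in T I Y P \<iota> using cop by (rule coproduct_inI)
  have Kh: "idn K \<boxtimes> h \<in> Hom T (K \<odot> D) (K \<odot> P)" using ten_hom[OF ident_hom[OF ob(1)] h] .
  note Khc = comp_hom[OF coev_hom Kh]
  obtain F where F: "finite F" "F \<subseteq> I" "(idn K \<boxtimes> cut F) \<cdot> ((idn K \<boxtimes> h) \<cdot> coev) = (idn K \<boxtimes> h) \<cdot> coev"
    using tensor_cut[OF cop ob(1) unit_compact I Khc] .
  note ch = comp_hom[OF h cut_hom[of F]]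
  let ?F = "\<lparr>FOb = \<lambda>Y. K \<odot> Y, FMor = \<lambda>f. idn K \<boxtimes> f\<rparr>"
  interpret E: exact_ftr T ?F using exact_ftr_tensor'[OF ob(1)] .
  have KcF: "idn K \<boxtimes> (cut F \<cdot> h) \<in> Hom T (K \<odot> D) (K \<odot> P)" using ten_hom[OF ident_hom[OF ob(1)] ch] .
  have "(idn K \<boxtimes> (h \<^bold>- cut F \<cdot> h)) \<cdot> coev = (idn K \<boxtimes> h) \<cdot> coev \<^bold>- (idn K \<boxtimes> (cut F \<cdot> h)) \<cdot> coev"
    using E.F_minus[OF h ch] minus_comp[OF coev_hom Kh KcF] by simp
  also have "(idn K \<boxtimes> (cut F \<cdot> h)) \<cdot> coev = (idn K \<boxtimes> h) \<cdot> coev"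
    using F(3) E.F_comp[OF h cut_hom[of F]] comp_assoc[OF coev_hom Kh E.F_hom[OF cut_hom[of F], simplified]] by simp
  finally have "h \<^bold>- cut F \<cdot> h = ZeroM T D P"
    using coev_detects_zero[OF minus_hom[OF h ch]] minus_self[OF Khc] by simp
  then have "cut F \<cdot> h = h" using minus_eq_zero[OF h ch] by simp
  then show "\<exists>F. finite F \<and> F \<subseteq> I \<and> cut F \<cdot> h = h" using F by blast
qed

end

context rigidly_compactly_generated_tt
begin

lemma dual_pair_ex:
  assumes "K \<in> compacts T"
  obtains \<eta> where "dual_pair T K \<eta>"
proof -
  note Ko = compact_ob[OF assms]
  obtain \<eta> where "\<eta> \<in> Hom T (Unit T) (dual T K \<odot> K)" "dual_eval K K \<cdot> (\<eta> \<boxtimes> Ident T K) = LUnit T K"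
    using rigid_adjunct[OF assms unit_ob Ko iso_arr_hom[OF lunit_iso[OF Ko]]] .
  then show thesis
    using that dual_pair.intro[OF rigidly_compactly_generated_tt_axioms] assms
    unfolding dual_pair_axioms_def by blast
qed

lemma compact_dual: "K \<in> compacts T \<Longrightarrow> dual T K \<in> compacts T"
  using dual_pair_ex dual_pair.dual_compact by metis

end

section \<open>Additive functors\<close>

abbreviation component :: "('o, 'v) abnat \<Rightarrow> 'o \<Rightarrow> 'v \<Rightarrow> 'v" where
  "component \<phi> \<equiv> snd (snd \<phi>)"

text \<open>Interpreted twice: for the opposite of the compact objects, where the functors are
  modules, and for \<open>T\<close> itself, where the coherent functors live. Facts on presentations
  are thus proved once for both.\<close>

locale module_category = preadditive C for C :: "('o, 'v::universe, 'z) preadd_scheme" (structure) +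
  assumes hom_small: "small TYPE('v) (Hom C A B)"
begin

abbreviation M :: "(('o, 'v) abfun, ('o, 'v) abnat) category" where
  "M \<equiv> add_fun C"

lemma M_Ob: "Ob M = {F. is_abfun C F}"
  by (simp add: add_fun_def)

lemma ab_comm_group: "\<lbrakk>is_abfun C F; A \<in> Ob C\<rbrakk> \<Longrightarrow> comm_group (FOb F A)"
  and ab_small: "\<lbrakk>is_abfun C F; A \<in> Ob C\<rbrakk> \<Longrightarrow> small TYPE('v) (carrier (FOb F A))"
  and ab_ident: "\<lbrakk>is_abfun C F; A \<in> Ob C; x \<in> carrier (FOb F A)\<rbrakk> \<Longrightarrow> FMor F (Ident C A) x = x"
  and ab_hom: "\<lbrakk>is_abfun C F; f \<in> Hom C A B\<rbrakk> \<Longrightarrow> FMor F f \<in> hom (FOb F A) (FOb F B)"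
  and ab_comp: "\<lbrakk>is_abfun C F; f \<in> Hom C A B; g \<in> Hom C B D; x \<in> carrier (FOb F A)\<rbrakk>
      \<Longrightarrow> FMor F (g \<cdot> f) x = FMor F g (FMor F f x)"
  and ab_plus: "\<lbrakk>is_abfun C F; f \<in> Hom C A B; g \<in> Hom C A B; x \<in> carrier (FOb F A)\<rbrakk>
      \<Longrightarrow> FMor F (PlusM C f g) x = FMor F f x \<otimes>\<^bsub>FOb F B\<^esub> FMor F g x"
  unfolding is_abfun_def by blast+

lemma ab_group: "\<lbrakk>is_abfun C F; A \<in> Ob C\<rbrakk> \<Longrightarrow> group (FOb F A)"
  using ab_comm_group comm_group.axioms(2) by blast

lemma ab_closed: "\<lbrakk>is_abfun C F; f \<in> Hom C A B; x \<in> carrier (FOb F A)\<rbrakk> \<Longrightarrow> FMor F f x \<in> carrier (FOb F B)"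
  by (rule hom_in_carrier[OF ab_hom])

lemma ab_one_closed: "\<lbrakk>is_abfun C F; A \<in> Ob C\<rbrakk> \<Longrightarrow> \<one>\<^bsub>FOb F A\<^esub> \<in> carrier (FOb F A)"
  using ab_group group.is_monoid monoid.one_closed by blast

lemma ab_one: "\<lbrakk>is_abfun C F; f \<in> Hom C A B\<rbrakk> \<Longrightarrow> FMor F f \<one>\<^bsub>FOb F A\<^esub> = \<one>\<^bsub>FOb F B\<^esub>"
  using ab_hom ab_group hom_objects hom_one by metis

lemma ab_zero:
  assumes F: "is_abfun C F" and A: "A \<in> Ob C" and B: "B \<in> Ob C" and x: "x \<in> carrier (FOb F A)"
  shows "FMor F (ZeroM C A B) x = \<one>\<^bsub>FOb F B\<^esub>"
proof -
  interpret G: group "FOb F B" using ab_group F B by blast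
  note z = zero_hom[OF A B]
  show ?thesis
    using ab_plus[OF F z z x] plus_zero[OF z] ab_closed[OF F z x] G.l_cancel_one[of "FMor F (ZeroM C A B) x" "FMor F (ZeroM C A B) x"]
    by simp
qed

lemma ab_eq_iff:
  assumes F: "is_abfun C F" and f: "f \<in> Hom C A B" and g: "g \<in> Hom C A B" and x: "x \<in> carrier (FOb F A)"
  shows "FMor F f x = FMor F g x \<longleftrightarrow> FMor F (f \<^bold>- g) x = \<one>\<^bsub>FOb F B\<^esub>"
proof -
  interpret G: group "FOb F B" using ab_group F f hom_objects by blast
  note m = minus_hom[OF f g]
  have "FMor F f x = FMor F (f \<^bold>- g) x \<otimes>\<^bsub>FOb F B\<^esub> FMor F g x"
    using ab_plus[OF F m g x] minus_plus[OF f g] by simp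
  then show ?thesis
    using ab_closed[OF F m x] ab_closed[OF F g x] G.r_cancel_one' by metis
qed

lemma nat_iff: "\<phi> \<in> Hom M F G \<longleftrightarrow> is_abfun C F \<and> is_abfun C G \<and> fst \<phi> = F \<and> fst (snd \<phi>) = G \<and>
    is_abnat C F G (component \<phi>)"
  by (cases \<phi>) (auto simp: add_fun_def)

lemma nat_abfun: "\<phi> \<in> Hom M F G \<Longrightarrow> is_abfun C F" "\<phi> \<in> Hom M F G \<Longrightarrow> is_abfun C G"
  by (simp_all add: nat_iff)

lemma nat_hom: "\<lbrakk>\<phi> \<in> Hom M F G; A \<in> Ob C\<rbrakk> \<Longrightarrow> component \<phi> A \<in> hom (FOb F A) (FOb G A)"
  and nat_natural: "\<lbrakk>\<phi> \<in> Hom M F G; f \<in> Hom C A B; x \<in> carrier (FOb F A)\<rbrakk>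
      \<Longrightarrow> component \<phi> B (FMor F f x) = FMor G f (component \<phi> A x)"
  unfolding nat_iff is_abnat_def by blast+

lemma nat_closed: "\<lbrakk>\<phi> \<in> Hom M F G; A \<in> Ob C; x \<in> carrier (FOb F A)\<rbrakk> \<Longrightarrow> component \<phi> A x \<in> carrier (FOb G A)"
  by (rule hom_in_carrier[OF nat_hom])

lemma nat_one: "\<lbrakk>\<phi> \<in> Hom M F G; A \<in> Ob C\<rbrakk> \<Longrightarrow> component \<phi> A \<one>\<^bsub>FOb F A\<^esub> = \<one>\<^bsub>FOb G A\<^esub>"
  using nat_hom ab_group nat_abfun hom_one by metis

lemma nat_mult: "\<lbrakk>\<phi> \<in> Hom M F G; A \<in> Ob C; x \<in> carrier (FOb F A); y \<in> carrier (FOb F A)\<rbrakk> \<Longrightarrow>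
    component \<phi> A (x \<otimes>\<^bsub>FOb F A\<^esub> y) = component \<phi> A x \<otimes>\<^bsub>FOb G A\<^esub> component \<phi> A y"
  by (rule hom_mult[OF nat_hom])

lemma nat_ext:
  assumes "\<phi> \<in> Hom M F G" "\<psi> \<in> Hom M F G"
    and "\<And>A x. \<lbrakk>A \<in> Ob C; x \<in> carrier (FOb F A)\<rbrakk> \<Longrightarrow> component \<phi> A x = component \<psi> A x"
  shows "\<phi> = \<psi>"
proof -
  have "component \<phi> A = component \<psi> A" for A
  proof (cases "A \<in> Ob C")
    case True
    then have "component \<phi> A \<in> extensional (carrier (FOb F A))" "component \<psi> A \<in> extensional (carrier (FOb F A))"
      using assms(1,2) by (auto simp: nat_iff is_abnat_def)
    then show ?thesis using assms(3)[OF True] by (auto intro: extensionalityI)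
  next
    case False
    then show ?thesis using assms(1,2) by (auto simp: nat_iff is_abnat_def extensional_def)
  qed
  then have "component \<phi> = component \<psi>" by (rule ext)
  then show ?thesis
    using assms(1,2) unfolding nat_iff by (intro prod_eqI) simp_all
qed

definition nat_of :: "('o, 'v) abfun \<Rightarrow> ('o, 'v) abfun \<Rightarrow> ('o \<Rightarrow> 'v \<Rightarrow> 'v) \<Rightarrow> ('o, 'v) abnat" where
  "nat_of F G \<eta> = (F, G, \<lambda>A\<in>Ob C. \<lambda>x\<in>carrier (FOb F A). \<eta> A x)"

lemma nat_of:
  assumes F: "is_abfun C F" and G: "is_abfun C G"
    and hom: "\<And>A. A \<in> Ob C \<Longrightarrow> \<eta> A \<in> hom (FOb F A) (FOb G A)"
    and natural: "\<And>A B f x. \<lbrakk>f \<in> Hom C A B; x \<in> carrier (FOb F A)\<rbrakk> \<Longrightarrow> \<eta> B (FMor F f x) = FMor G f (\<eta> A x)"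
  shows "nat_of F G \<eta> \<in> Hom M F G"
    "\<lbrakk>A \<in> Ob C; x \<in> carrier (FOb F A)\<rbrakk> \<Longrightarrow> component (nat_of F G \<eta>) A x = \<eta> A x"
proof -
  have "(\<lambda>x\<in>carrier (FOb F A). \<eta> A x) \<in> hom (FOb F A) (FOb G A)" if "A \<in> Ob C" for A
    using hom[OF that] ab_group[OF F that]
    by (auto simp: hom_def Group.group_def monoid.m_closed)
  moreover have "FMor F f x \<in> carrier (FOb F B)" "A \<in> Ob C" "B \<in> Ob C" if "f \<in> Hom C A B" "x \<in> carrier (FOb F A)" for f A B x
    using that ab_closed[OF F] hom_objects by blast+
  ultimately show "nat_of F G \<eta> \<in> Hom M F G"
    unfolding nat_iff is_abnat_def nat_of_def using F G natural by auto
qed (simp add: nat_of_def)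

lemma comp_component:
  "\<lbrakk>\<phi> \<in> Hom M F G; A \<in> Ob C; x \<in> carrier (FOb F A)\<rbrakk> \<Longrightarrow> component (\<psi> \<cdot>\<^bsub>M\<^esub> \<phi>) A x = component \<psi> A (component \<phi> A x)"
  by (cases \<phi>; cases \<psi>) (auto simp: add_fun_def compose_def split: if_splits)

lemma ident_component: "\<lbrakk>A \<in> Ob C; x \<in> carrier (FOb F A)\<rbrakk> \<Longrightarrow> component (Ident M F) A x = x"
  by (simp add: add_fun_def)

lemma nat_comp:
  assumes \<phi>: "\<phi> \<in> Hom M F G" and \<psi>: "\<psi> \<in> Hom M G H"
  shows "\<psi> \<cdot>\<^bsub>M\<^esub> \<phi> \<in> Hom M F H"
proof -
  let ?\<eta> = "\<lambda>A x. component \<psi> A (component \<phi> A x)"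
  have "?\<eta> A \<in> hom (FOb F A) (FOb H A)" if "A \<in> Ob C" for A
    using Group.hom_compose[OF nat_hom[OF \<phi> that] nat_hom[OF \<psi> that]] by (simp add: o_def)
  then have n: "nat_of F H ?\<eta> \<in> Hom M F H"
    by (intro nat_of nat_abfun[OF \<phi>] nat_abfun[OF \<psi>])
      (use nat_natural[OF \<phi>] nat_natural[OF \<psi>] nat_closed[OF \<phi>] hom_objects in auto)
  have "\<psi> \<cdot>\<^bsub>M\<^esub> \<phi> = nat_of F H ?\<eta>"
    using \<phi> \<psi> by (cases \<phi>; cases \<psi>) (auto simp: add_fun_def nat_of_def compose_def restrict_def split: if_splits)
  then show ?thesis using n by simp
qed

lemma nat_ident: "is_abfun C F \<Longrightarrow> Ident M F \<in> Hom M F F"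
  using nat_of(1)[of F F "\<lambda>A x. x"] by (simp add: nat_of_def add_fun_def hom_def)

sublocale M: category M
proof
  fix F G H K \<phi> \<psi> \<chi>
  show "F \<in> Ob M \<and> G \<in> Ob M" if "\<phi> \<in> Hom M F G"
    using nat_abfun[OF that] by (simp add: M_Ob)
  show "F = H \<and> G = K" if "\<phi> \<in> Hom M F G" "\<phi> \<in> Hom M H K"
    using that by (simp add: nat_iff)
  show "Ident M F \<in> Hom M F F" if "F \<in> Ob M"
    using that nat_ident by (simp add: M_Ob)
  show "\<psi> \<cdot>\<^bsub>M\<^esub> \<phi> \<in> Hom M F H" if "\<phi> \<in> Hom M F G" "\<psi> \<in> Hom M G H"
    using nat_comp that .
  show "\<phi> \<cdot>\<^bsub>M\<^esub> Ident M F = \<phi>" if \<phi>: "\<phi> \<in> Hom M F G"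
  proof -
    note i = nat_ident[OF nat_abfun(1)[OF \<phi>]]
    show ?thesis by (rule nat_ext[OF nat_comp[OF i \<phi>] \<phi>]) (simp add: comp_component[OF i] ident_component)
  qed
  show "Ident M G \<cdot>\<^bsub>M\<^esub> \<phi> = \<phi>" if \<phi>: "\<phi> \<in> Hom M F G"
  proof -
    note i = nat_ident[OF nat_abfun(2)[OF \<phi>]]
    show ?thesis
      by (rule nat_ext[OF nat_comp[OF \<phi> i] \<phi>]) (simp add: comp_component[OF \<phi>] ident_component nat_closed[OF \<phi>])
  qed
  show "\<chi> \<cdot>\<^bsub>M\<^esub> \<psi> \<cdot>\<^bsub>M\<^esub> \<phi> = \<chi> \<cdot>\<^bsub>M\<^esub> (\<psi> \<cdot>\<^bsub>M\<^esub> \<phi>)"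
    if "\<phi> \<in> Hom M F G" "\<psi> \<in> Hom M G H" "\<chi> \<in> Hom M H K"
    by (rule nat_ext[OF nat_comp[OF that(1) nat_comp[OF that(2,3)]] nat_comp[OF nat_comp[OF that(1,2)] that(3)]])
      (simp add: comp_component[OF that(1)] comp_component[OF that(2)] comp_component[OF nat_comp[OF that(1,2)]]
        nat_closed[OF that(1)])
qed

subsection \<open>Zero arrows\<close>

definition zero_nat :: "('o, 'v) abfun \<Rightarrow> ('o, 'v) abfun \<Rightarrow> ('o, 'v) abnat" where
  "zero_nat F G = nat_of F G (\<lambda>A x. \<one>\<^bsub>FOb G A\<^esub>)"

lemma zero_nat:
  assumes F: "is_abfun C F" and G: "is_abfun C G"
  shows "zero_nat F G \<in> Hom M F G"
    "\<lbrakk>A \<in> Ob C; x \<in> carrier (FOb F A)\<rbrakk> \<Longrightarrow> component (zero_nat F G) A x = \<one>\<^bsub>FOb G A\<^esub>"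
proof -
  have h: "(\<lambda>x. \<one>\<^bsub>FOb G A\<^esub>) \<in> hom (FOb F A) (FOb G A)" if "A \<in> Ob C" for A
    using ab_group[OF G that] by (auto simp: hom_def Group.group_def)
  show "zero_nat F G \<in> Hom M F G"
    unfolding zero_nat_def by (rule nat_of(1)[OF F G h]) (use ab_one[OF G] in auto)
  show "\<lbrakk>A \<in> Ob C; x \<in> carrier (FOb F A)\<rbrakk> \<Longrightarrow> component (zero_nat F G) A x = \<one>\<^bsub>FOb G A\<^esub>"
    unfolding zero_nat_def by (rule nat_of(2)[OF F G h]) (use ab_one[OF G] in auto)
qed

definition trivial_abfun :: "('o, 'v) abfun" where
  "trivial_abfun = \<lparr>FOb = \<lambda>_. \<lparr>carrier = {undefined}, monoid.mult = \<lambda>_ _. undefined, one = undefined\<rparr>,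
    FMor = \<lambda>_ _. undefined\<rparr>"

lemma trivial_abfun: "is_abfun C trivial_abfun"
proof -
  have "comm_group \<lparr>carrier = {undefined :: 'v}, monoid.mult = \<lambda>_ _. undefined, one = undefined\<rparr>"
    by (rule comm_groupI) auto
  then show ?thesis
    by (auto simp: is_abfun_def trivial_abfun_def hom_def small_finite)
qed

lemma zero_obj_M:
  "zero_obj M Z \<longleftrightarrow> is_abfun C Z \<and> (\<forall>A\<in>Ob C. carrier (FOb Z A) = {\<one>\<^bsub>FOb Z A\<^esub>})"
proof
  assume Z: "zero_obj M Z"
  then have Zf: "is_abfun C Z" by (simp add: zero_obj_def M_Ob)
  then have "Ident M Z = zero_nat Z Z"
    using Z nat_ident[OF Zf] zero_nat(1)[OF Zf Zf] unfolding zero_obj_def M_Ob by blast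
  then have "x = \<one>\<^bsub>FOb Z A\<^esub>" if "A \<in> Ob C" "x \<in> carrier (FOb Z A)" for A x
    using ident_component[OF that] zero_nat(2)[OF Zf Zf that] by simp
  then show "is_abfun C Z \<and> (\<forall>A\<in>Ob C. carrier (FOb Z A) = {\<one>\<^bsub>FOb Z A\<^esub>})"
    using Zf ab_one_closed[OF Zf] by blast
next
  assume Z: "is_abfun C Z \<and> (\<forall>A\<in>Ob C. carrier (FOb Z A) = {\<one>\<^bsub>FOb Z A\<^esub>})"
  have "\<phi> = zero_nat F Z" if "\<phi> \<in> Hom M F Z" for \<phi> F
    by (rule nat_ext[OF that zero_nat(1)]) (use Z nat_abfun[OF that] nat_closed[OF that] zero_nat(2) in auto)
  moreover have "\<phi> = zero_nat Z F" if "\<phi> \<in> Hom M Z F" for \<phi> F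
    by (rule nat_ext[OF that zero_nat(1)]) (use Z nat_abfun[OF that] nat_one[OF that] zero_nat(2)[of Z F] in auto)
  ultimately show "zero_obj M Z"
    unfolding zero_obj_def M_Ob using Z zero_nat(1) by blast
qed

lemma zero_arr_M:
  assumes \<phi>: "\<phi> \<in> Hom M F G"
  shows "zero_arr M F G \<phi> \<longleftrightarrow> (\<forall>A\<in>Ob C. \<forall>x\<in>carrier (FOb F A). component \<phi> A x = \<one>\<^bsub>FOb G A\<^esub>)"
proof
  assume "zero_arr M F G \<phi>"
  then obtain Z a b where Z: "zero_obj M Z" "a \<in> Hom M F Z" "b \<in> Hom M Z G" "\<phi> = b \<cdot>\<^bsub>M\<^esub> a"
    by (auto simp: zero_arr_def)
  have one: "component a A x = \<one>\<^bsub>FOb Z A\<^esub>" if "A \<in> Ob C" "x \<in> carrier (FOb F A)" for A x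
    using Z(1) nat_closed[OF Z(2) that] that(1) unfolding zero_obj_M by blast
  show "\<forall>A\<in>Ob C. \<forall>x\<in>carrier (FOb F A). component \<phi> A x = \<one>\<^bsub>FOb G A\<^esub>"
    unfolding Z(4) using comp_component[OF Z(2)] one nat_one[OF Z(3)] by simp
next
  assume one: "\<forall>A\<in>Ob C. \<forall>x\<in>carrier (FOb F A). component \<phi> A x = \<one>\<^bsub>FOb G A\<^esub>"
  let ?Z = trivial_abfun
  note F = nat_abfun(1)[OF \<phi>] and G = nat_abfun(2)[OF \<phi>]
  have Z: "zero_obj M ?Z" unfolding zero_obj_M using trivial_abfun by (simp add: trivial_abfun_def)
  note a = zero_nat(1)[OF F trivial_abfun] and b = zero_nat(1)[OF trivial_abfun G]
  have "\<phi> = zero_nat ?Z G \<cdot>\<^bsub>M\<^esub> zero_nat F ?Z"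
    by (rule nat_ext[OF \<phi> nat_comp[OF a b]])
      (use one comp_component[OF a] zero_nat(2)[OF trivial_abfun G] nat_closed[OF a] in auto)
  then show "zero_arr M F G \<phi>" unfolding zero_arr_def using Z a b by blast
qed

lemma zero_arr_zero_nat: "\<lbrakk>is_abfun C F; is_abfun C G\<rbrakk> \<Longrightarrow> zero_arr M F G (zero_nat F G)"
  using zero_arr_M zero_nat by blast

lemma zero_arr_eq: "\<lbrakk>\<phi> \<in> Hom M F G; zero_arr M F G \<phi>\<rbrakk> \<Longrightarrow> \<phi> = zero_nat F G"
  using nat_ext zero_nat nat_abfun zero_arr_M by metis

subsection \<open>Presentations\<close>

text \<open>
  \<open>F\<close> is generated by \<open>x\<close>, with relations \<open>f x = 0 \<longleftrightarrow> f \<cdot> g = 0\<close>, so that \<open>F\<close> is the image of the map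
  between representable functors that is given by composition with \<open>g\<close>.
\<close>

definition pres :: "('o, 'v) abfun \<Rightarrow> 'o \<Rightarrow> 'v \<Rightarrow> 'o \<Rightarrow> 'v \<Rightarrow> bool" where
  "pres F B x W g \<longleftrightarrow> is_abfun C F \<and> g \<in> Hom C W B \<and> x \<in> carrier (FOb F B) \<and>
     (\<forall>X\<in>Ob C. \<forall>y\<in>carrier (FOb F X). \<exists>f\<in>Hom C B X. y = FMor F f x) \<and>
     (\<forall>X. \<forall>f\<in>Hom C B X. FMor F f x = \<one>\<^bsub>FOb F X\<^esub> \<longleftrightarrow> f \<cdot> g = ZeroM C W X)"

lemma presD:
  assumes "pres F B x W g"
  shows "is_abfun C F" "g \<in> Hom C W B" "x \<in> carrier (FOb F B)"
    "\<And>X f. f \<in> Hom C B X \<Longrightarrow> FMor F f x = \<one>\<^bsub>FOb F X\<^esub> \<longleftrightarrow> f \<cdot> g = ZeroM C W X"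
  using assms unfolding pres_def by blast+

lemma pres_gen:
  assumes "pres F B x W g" "X \<in> Ob C" "y \<in> carrier (FOb F X)"
  obtains f where "f \<in> Hom C B X" "y = FMor F f x"
  using assms unfolding pres_def by blast

lemma pres_eq_iff:
  assumes p: "pres F B x W g" and f: "f \<in> Hom C B X" "f' \<in> Hom C B X"
  shows "FMor F f x = FMor F f' x \<longleftrightarrow> f \<cdot> g = f' \<cdot> g"
  using ab_eq_iff[OF presD(1)[OF p] f presD(3)[OF p]] presD(4)[OF p minus_hom[OF f]]
    minus_comp[OF presD(2)[OF p] f] minus_eq_zero[OF comp_hom[OF presD(2)[OF p] f(1)] comp_hom[OF presD(2)[OF p] f(2)]]
  by simp

text \<open>\<open>F\<close> is the functor represented by \<open>B\<close> modulo the relations, so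
  an arrow out of it is an element \<open>y\<close> that satisfies them. In \<open>\<eta>\<close>,
  \<open>SOME\<close> picks an arrow that produces the given element from the generator;
  \<open>rel\<close>, applied to differences, shows that the choice is irrelevant.\<close>

lemma pres_arrow_ex:
  assumes p: "pres F B x W g" and K: "is_abfun C K" and y: "y \<in> carrier (FOb K B)"
    and rel: "\<And>X f. \<lbrakk>f \<in> Hom C B X; f \<cdot> g = ZeroM C W X\<rbrakk> \<Longrightarrow> FMor K f y = \<one>\<^bsub>FOb K X\<^esub>"
  obtains \<phi> where "\<phi> \<in> Hom M F K" "component \<phi> B x = y"
proof -
  note F = presD(1)[OF p] and g = presD(2)[OF p] and x = presD(3)[OF p]
  have B: "B \<in> Ob C" using g hom_objects by blast
  define \<eta> where "\<eta> X z = FMor K (SOME f. f \<in> Hom C B X \<and> z = FMor F f x) y" for X z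
  have \<eta>: "\<eta> X (FMor F f x) = FMor K f y" if f: "f \<in> Hom C B X" for X f
  proof -
    let ?f = "SOME f'. f' \<in> Hom C B X \<and> FMor F f x = FMor F f' x"
    have f': "?f \<in> Hom C B X" "FMor F f x = FMor F ?f x"
      using someI[of "\<lambda>f'. f' \<in> Hom C B X \<and> FMor F f x = FMor F f' x" f] f by blast+
    have "(?f \<^bold>- f) \<cdot> g = ZeroM C W X"
      using pres_eq_iff[OF p f f'(1)] f'(2) minus_comp[OF g f'(1) f] minus_self[OF comp_hom[OF g f]] by simp
    then show ?thesis
      unfolding \<eta>_def using rel[OF minus_hom[OF f'(1) f]] ab_eq_iff[OF K f'(1) f y] by simp
  qed
  have hom: "\<eta> X \<in> hom (FOb F X) (FOb K X)" if X: "X \<in> Ob C" for X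
  proof (rule homI)
    fix z z' assume z: "z \<in> carrier (FOb F X)" and z': "z' \<in> carrier (FOb F X)"
    obtain f where f: "f \<in> Hom C B X" "z = FMor F f x" using pres_gen[OF p X z] .
    obtain f' where f': "f' \<in> Hom C B X" "z' = FMor F f' x" using pres_gen[OF p X z'] .
    show "\<eta> X z \<in> carrier (FOb K X)" using f \<eta>[OF f(1)] ab_closed[OF K f(1) y] by simp
    show "\<eta> X (z \<otimes>\<^bsub>FOb F X\<^esub> z') = \<eta> X z \<otimes>\<^bsub>FOb K X\<^esub> \<eta> X z'"
      using \<eta>[OF f(1)] \<eta>[OF f'(1)] \<eta>[OF plus_hom[OF f(1) f'(1)]] ab_plus[OF F f(1) f'(1) x] ab_plus[OF K f(1) f'(1) y]
        f(2) f'(2) by simp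
  qed
  have natural: "\<eta> Y (FMor F h z) = FMor K h (\<eta> X z)" if h: "h \<in> Hom C X Y" and z: "z \<in> carrier (FOb F X)" for h X Y z
  proof -
    have X: "X \<in> Ob C" using h hom_objects by blast
    obtain f where f: "f \<in> Hom C B X" "z = FMor F f x" using pres_gen[OF p X z] .
    show ?thesis
      using \<eta>[OF f(1)] \<eta>[OF comp_hom[OF f(1) h]] ab_comp[OF F f(1) h x] ab_comp[OF K f(1) h y] f(2) by simp
  qed
  have n1: "nat_of F K \<eta> \<in> Hom M F K"
    by (rule nat_of(1)[OF F K]) (use hom natural in auto)
  have n2: "component (nat_of F K \<eta>) B x = \<eta> B x"
    by (rule nat_of(2)[OF F K]) (use hom natural B x in auto)
  have "component (nat_of F K \<eta>) B x = y"
    using n2 \<eta>[OF ident_hom[OF B]] ab_ident[OF F B x] ab_ident[OF K B y] by simp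
  then show thesis using that n1 by blast
qed

lemma pres_ext:
  assumes p: "pres F B x W g" and \<phi>: "\<phi> \<in> Hom M F K" and \<psi>: "\<psi> \<in> Hom M F K"
    and eq: "component \<phi> B x = component \<psi> B x"
  shows "\<phi> = \<psi>"
proof (rule nat_ext[OF \<phi> \<psi>])
  fix X z assume X: "X \<in> Ob C" and z: "z \<in> carrier (FOb F X)"
  obtain f where f: "f \<in> Hom C B X" "z = FMor F f x" using pres_gen[OF p X z] .
  show "component \<phi> X z = component \<psi> X z"
    using nat_natural[OF \<phi> f(1) presD(3)[OF p]] nat_natural[OF \<psi> f(1) presD(3)[OF p]] f(2) eq by simp
qed

lemma pres_relation:
  assumes p: "pres F B x W g" and \<phi>: "\<phi> \<in> Hom M F K" and f: "f \<in> Hom C B X" "f \<cdot> g = ZeroM C W X"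
  shows "FMor K f (component \<phi> B x) = \<one>\<^bsub>FOb K X\<^esub>"
proof -
  have X: "X \<in> Ob C" using f hom_objects by blast
  show ?thesis
    using nat_natural[OF \<phi> f(1) presD(3)[OF p]] presD(4)[OF p f(1)] f(2) nat_one[OF \<phi> X] by simp
qed

text \<open>The standard functor presented by \<open>g\<close>: the image of composition with
  \<open>g\<close> between representable functors. Its elements are themselves arrows, so no
  quotient groups have to be represented inside the universe.\<close>

definition img :: "'o \<Rightarrow> 'o \<Rightarrow> 'v \<Rightarrow> ('o, 'v) abfun" where
  "img W B g = \<lparr>FOb = \<lambda>X. \<lparr>carrier = (\<lambda>f. f \<cdot> g) ` Hom C B X, monoid.mult = PlusM C, one = ZeroM C W X\<rparr>,
    FMor = \<lambda>f u. f \<cdot> u\<rparr>"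

lemma img_abfun:
  assumes g: "g \<in> Hom C W B"
  shows "is_abfun C (img W B g)"
proof -
  define S where "S X = (\<lambda>f. f \<cdot> g) ` Hom C B X" for X
  have W: "W \<in> Ob C" and B: "B \<in> Ob C" using g hom_objects by blast+
  have sub: "S X \<subseteq> Hom C W X" for X using comp_hom[OF g] by (auto simp: S_def)
  have sub': "u \<in> Hom C W X" if "u \<in> S X" for u X using sub that by blast
  have plus: "PlusM C u v \<in> S X" if uv: "u \<in> S X" "v \<in> S X" for u v X
  proof -
    obtain f f' where f: "f \<in> Hom C B X" "u = f \<cdot> g" "f' \<in> Hom C B X" "v = f' \<cdot> g" using uv unfolding S_def by blast
    then have "PlusM C u v = PlusM C f f' \<cdot> g" using comp_plus_left[OF g f(1,3)] by simp
    then show ?thesis using plus_hom[OF f(1,3)] unfolding S_def by blast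
  qed
  have zero: "ZeroM C W X \<in> S X" if "X \<in> Ob C" for X
    using zero_comp[OF g that] zero_hom[OF B that] unfolding S_def by (metis imageI)
  have inv: "\<exists>v\<in>S X. PlusM C v u = ZeroM C W X" if u: "u \<in> S X" for u X
  proof -
    obtain f where f: "f \<in> Hom C B X" "u = f \<cdot> g" using u unfolding S_def by blast
    have X: "X \<in> Ob C" using f hom_objects by blast
    note z = zero_hom[OF B X]
    have "PlusM C ((ZeroM C B X \<^bold>- f) \<cdot> g) u = ZeroM C W X"
      using comp_plus_left[OF g minus_hom[OF z f(1)] f(1)] minus_plus[OF z f(1)] f(2) zero_comp[OF g X] by simp
    then show ?thesis using minus_hom[OF z f(1)] unfolding S_def by blast
  qed
  have grp: "comm_group \<lparr>carrier = S X, monoid.mult = PlusM C, one = ZeroM C W X\<rparr>" if "X \<in> Ob C" for X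
    by (rule comm_groupI)
      (use plus zero[OF that] inv plus_assoc[OF sub' sub' sub'] plus_commute[OF sub' sub'] zero_plus[OF sub'] plus_zero[OF sub'] in auto)
  have act: "f \<cdot> u \<in> S Y" if f: "f \<in> Hom C X Y" and u: "u \<in> S X" for f u X Y
  proof -
    obtain f' where f': "f' \<in> Hom C B X" "u = f' \<cdot> g" using u unfolding S_def by blast
    then have "f \<cdot> u = (f \<cdot> f') \<cdot> g" using comp_assoc[OF g f'(1) f] by simp
    then show ?thesis using comp_hom[OF f'(1) f] unfolding S_def by blast
  qed
  show ?thesis
    unfolding is_abfun_def img_def S_def[symmetric]
  proof (simp only: ftr.simps partial_object.simps monoid.simps, intro conjI ballI allI)
    show "small TYPE('v) (S A)" for A unfolding S_def by (rule small_image[OF hom_small])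
    show "(\<lambda>u. f \<cdot> u) \<in> hom \<lparr>carrier = S X, monoid.mult = PlusM C, one = ZeroM C W X\<rparr>
        \<lparr>carrier = S Y, monoid.mult = PlusM C, one = ZeroM C W Y\<rparr>" if "f \<in> Hom C X Y" for X Y f
      by (rule homI) (use act[OF that] comp_plus_right[OF sub' sub' that] in auto)
  qed (use grp sub' ident_comp comp_assoc comp_plus_left in blast)+
qed

lemma img_pres:
  assumes g: "g \<in> Hom C W B"
  shows "pres (img W B g) B g W g"
  unfolding pres_def using img_abfun[OF g] g ident_comp[OF g] ident_hom hom_objects[OF g]
  by (auto simp: img_def image_iff intro: bexI[of _ "Ident C B"])

text \<open>Agreement with the representable functor is required only on objects and arrows of
  \<open>C\<close>, because functors are records of total functions and \<open>yoneda T B\<close>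
  also has values outside of the compact objects.\<close>

definition rep :: "('o, 'v) abfun \<Rightarrow> 'o \<Rightarrow> bool" where
  "rep P B \<longleftrightarrow> is_abfun C P \<and> B \<in> Ob C \<and> (\<forall>X\<in>Ob C. FOb P X = hom_grp C B X) \<and>
     (\<forall>X Y. \<forall>f\<in>Hom C X Y. \<forall>h\<in>Hom C B X. FMor P f h = f \<cdot> h)"

lemma repD:
  assumes "rep P B"
  shows "is_abfun C P" "B \<in> Ob C" "\<And>X. X \<in> Ob C \<Longrightarrow> FOb P X = hom_grp C B X"
    "\<And>X Y f h. \<lbrakk>f \<in> Hom C X Y; h \<in> Hom C B X\<rbrakk> \<Longrightarrow> FMor P f h = f \<cdot> h"
  using assms unfolding rep_def by blast+

lemma rep_pres:
  assumes "rep P B"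
  shows "pres P B (Ident C B) B (Ident C B)"
  unfolding pres_def
proof (intro conjI ballI allI)
  note r = repD[OF assms]
  note i = ident_hom[OF r(2)]
  show "is_abfun C P" "Ident C B \<in> Hom C B B" by (fact r i)+
  show "Ident C B \<in> carrier (FOb P B)" using r(3)[OF r(2)] i by simp
  show "\<exists>f\<in>Hom C B X. y = FMor P f (Ident C B)" if "X \<in> Ob C" "y \<in> carrier (FOb P X)" for X y
    using that r(3) r(4)[OF _ i] comp_ident by auto
  show "FMor P f (Ident C B) = \<one>\<^bsub>FOb P X\<^esub> \<longleftrightarrow> f \<cdot> Ident C B = ZeroM C B X" if "f \<in> Hom C B X" for X f
    using r(3) r(4)[OF that i] hom_objects[OF that] by simp
qed

lemma rep_component:
  assumes P: "rep P B" and \<phi>: "\<phi> \<in> Hom M P F" and f: "f \<in> Hom C B X"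
  shows "component \<phi> X f = FMor F f (component \<phi> B (Ident C B))"
  using nat_natural[OF \<phi> f, of "Ident C B"] repD[OF P] f comp_ident[OF f] ident_hom by simp

lemma yoneda_ex:
  assumes P: "rep P B" and F: "is_abfun C F" and x: "x \<in> carrier (FOb F B)"
  obtains \<phi> where "\<phi> \<in> Hom M P F" "component \<phi> B (Ident C B) = x"
proof (rule pres_arrow_ex[OF rep_pres[OF P] F x])
  fix X f assume "f \<in> Hom C B X" "f \<cdot> Ident C B = ZeroM C B X"
  then show "FMor F f x = \<one>\<^bsub>FOb F X\<^esub>"
    using comp_ident ab_zero[OF F _ _ x] hom_objects by metis
qed (use that in blast)

text \<open>The premise \<open>weak\<close> is what two consecutive arrows of a triangle provide:
  the arrows annihilating \<open>g\<close> are those that factor over \<open>a\<close>. So the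
  relations of \<open>F\<close> are generated by \<open>a\<close>, and arrows out of
  \<open>F\<close> are arrows out of \<open>PB\<close> that vanish on \<open>a\<close>.\<close>

lemma cokernel_presI:
  assumes p: "pres F B x W g" and PA: "rep PA A" and PB: "rep PB B" and a: "a \<in> Hom C B A"
    and weak: "\<And>X f. f \<in> Hom C B X \<Longrightarrow> f \<cdot> g = ZeroM C W X \<longleftrightarrow> (\<exists>f'\<in>Hom C A X. f = f' \<cdot> a)"
    and \<alpha>: "\<alpha> \<in> Hom M PA PB" "component \<alpha> A (Ident C A) = a"
    and q: "q \<in> Hom M PB F" "component q B (Ident C B) = x"
  shows "is_cokernel M PA PB \<alpha> F q"
  unfolding is_cokernel_def
proof (intro conjI allI ballI impI)
  note A = repD(2)[OF PA] and B = repD(2)[OF PB] and F = presD(1)[OF p]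
  have acc: "component \<alpha> X f' = f' \<cdot> a" if f': "f' \<in> Hom C A X" for X f'
    using rep_component[OF PA \<alpha>(1) f'] \<alpha>(2) repD(4)[OF PB f' a] by simp
  have fa: "f' \<cdot> a \<in> Hom C B X" if "f' \<in> Hom C A X" for f' X using comp_hom[OF a that] .
  show "\<alpha> \<in> Hom M PA PB" "q \<in> Hom M PB F" by fact+
  show "zero_arr M PA F (q \<cdot>\<^bsub>M\<^esub> \<alpha>)"
    unfolding zero_arr_M[OF nat_comp[OF \<alpha>(1) q(1)]]
  proof (intro ballI)
    fix X f' assume X: "X \<in> Ob C" and f': "f' \<in> carrier (FOb PA X)"
    then have h: "f' \<in> Hom C A X" using repD(3)[OF PA X] by simp
    show "component (q \<cdot>\<^bsub>M\<^esub> \<alpha>) X f' = \<one>\<^bsub>FOb F X\<^esub>"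
      using comp_component[OF \<alpha>(1) X f'] acc[OF h] rep_component[OF PB q(1) fa[OF h]] q(2)
        presD(4)[OF p fa[OF h]] weak[OF fa[OF h]] h by auto
  qed
  fix Y \<psi> assume \<psi>: "\<psi> \<in> Hom M PB Y" and z: "zero_arr M PA Y (\<psi> \<cdot>\<^bsub>M\<^esub> \<alpha>)"
  let ?y = "component \<psi> B (Ident C B)"
  note Y = nat_abfun(2)[OF \<psi>]
  have y: "?y \<in> carrier (FOb Y B)" using nat_closed[OF \<psi> B] repD(3)[OF PB B] ident_hom[OF B] by simp
  have "FMor Y f ?y = \<one>\<^bsub>FOb Y X\<^esub>" if f: "f \<in> Hom C B X" "f \<cdot> g = ZeroM C W X" for X f
  proof -
    have X: "X \<in> Ob C" using f hom_objects by blast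
    obtain f' where f': "f' \<in> Hom C A X" "f = f' \<cdot> a" using weak[OF f(1)] f(2) by blast
    have fc: "f' \<in> carrier (FOb PA X)" using f' repD(3)[OF PA X] by simp
    have "FMor Y f ?y = component (\<psi> \<cdot>\<^bsub>M\<^esub> \<alpha>) X f'"
      using comp_component[OF \<alpha>(1) X fc] acc[OF f'(1)] rep_component[OF PB \<psi> f(1)] f'(2) by simp
    then show ?thesis using z zero_arr_M[OF nat_comp[OF \<alpha>(1) \<psi>]] X fc by simp
  qed
  then obtain u where u: "u \<in> Hom M F Y" "component u B x = ?y"
    using pres_arrow_ex[OF p Y y] by blast
  have eq: "v \<cdot>\<^bsub>M\<^esub> q = \<psi> \<longleftrightarrow> component v B x = ?y" if v: "v \<in> Hom M F Y" for v
  proof -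
    have "component (v \<cdot>\<^bsub>M\<^esub> q) B (Ident C B) = component v B x"
      using comp_component[OF q(1) B] repD(3)[OF PB B] ident_hom[OF B] q(2) by simp
    then show ?thesis using pres_ext[OF rep_pres[OF PB] nat_comp[OF q(1) v] \<psi>] by auto
  qed
  show "\<exists>!u. u \<in> Hom M F Y \<and> u \<cdot>\<^bsub>M\<^esub> q = \<psi>"
  proof (rule ex1I[of _ u])
    fix v assume v: "v \<in> Hom M F Y \<and> v \<cdot>\<^bsub>M\<^esub> q = \<psi>"
    then show "v = u" using pres_ext[OF p _ u(1)] eq u(2) by metis
  qed (use u eq in blast)
qed

text \<open>\<open>img W B g\<close> is a cokernel of the same \<open>\<alpha>\<close> by
  \<open>cokernel_presI\<close>. The comparison arrows \<open>u\<close> and \<open>v\<close> carry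
  its presentation over to \<open>F\<close>.\<close>

lemma cokernel_presD:
  assumes coker: "is_cokernel M PA PB \<alpha> F q" and PA: "rep PA A" and PB: "rep PB B"
    and g: "g \<in> Hom C W B"
    and weak: "\<And>X f. f \<in> Hom C B X \<Longrightarrow>
      f \<cdot> g = ZeroM C W X \<longleftrightarrow> (\<exists>f'\<in>Hom C A X. f = f' \<cdot> component \<alpha> A (Ident C A))"
  shows "pres F B (component q B (Ident C B)) W g"
proof -
  note A = repD(2)[OF PA] and B = repD(2)[OF PB]
  have \<alpha>: "\<alpha> \<in> Hom M PA PB" and q: "q \<in> Hom M PB F" using coker by (auto simp: is_cokernel_def)
  note F = nat_abfun(2)[OF q]
  let ?I = "img W B g" and ?a = "component \<alpha> A (Ident C A)" and ?x = "component q B (Ident C B)"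
  note I = img_pres[OF g]
  have a: "?a \<in> Hom C B A"
    using nat_closed[OF \<alpha> A] repD(3)[OF PA A] repD(3)[OF PB A] ident_hom[OF A] by simp
  obtain r where r: "r \<in> Hom M PB ?I" "component r B (Ident C B) = g"
    using yoneda_ex[OF PB img_abfun[OF g] presD(3)[OF I]] .
  note cI = cokernel_presI[OF I PA PB a weak \<alpha> refl r]
  obtain u where u: "u \<in> Hom M F ?I" "u \<cdot>\<^bsub>M\<^esub> q = r"
    using coker cI unfolding is_cokernel_def by blast
  obtain v where v: "v \<in> Hom M ?I F" "v \<cdot>\<^bsub>M\<^esub> r = q"
    using coker cI unfolding is_cokernel_def by blast
  have "(v \<cdot>\<^bsub>M\<^esub> u) \<cdot>\<^bsub>M\<^esub> q = q"
    using M.comp_assoc[OF q u(1) v(1)] u(2) v(2) by simp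
  moreover have "zero_arr M PA F (q \<cdot>\<^bsub>M\<^esub> \<alpha>)" using coker by (simp add: is_cokernel_def)
  ultimately have vu: "v \<cdot>\<^bsub>M\<^esub> u = Ident M F"
    using coker q nat_comp[OF u(1) v(1)] nat_ident[OF F] M.ident_comp[OF q] unfolding is_cokernel_def by metis
  have idB: "Ident C B \<in> carrier (FOb PB B)" using repD(3)[OF PB B] ident_hom[OF B] by simp
  have x: "?x \<in> carrier (FOb F B)" using nat_closed[OF q B idB] .
  have ux: "component u B ?x = g" using comp_component[OF q B idB, of u] u(2) r(2) by simp
  have vg: "component v B g = ?x" using comp_component[OF r(1) B idB, of v] v(2) r(2) by simp
  have vuz: "component v X (component u X z) = z" if "X \<in> Ob C" "z \<in> carrier (FOb F X)" for X z
    using comp_component[OF u(1) that, of v] vu ident_component[OF that] by simp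
  have vfg: "component v X (f \<cdot> g) = FMor F f ?x" if f: "f \<in> Hom C B X" for X f
    using nat_natural[OF v(1) f presD(3)[OF I]] vg by (simp add: img_def)
  have ufx: "component u X (FMor F f ?x) = f \<cdot> g" if f: "f \<in> Hom C B X" for X f
    using nat_natural[OF u(1) f x] ux by (simp add: img_def)
  have one: "\<one>\<^bsub>FOb ?I X\<^esub> = ZeroM C W X" for X by (simp add: img_def)
  show ?thesis
    unfolding pres_def
  proof (intro conjI ballI allI)
    fix X z assume X: "X \<in> Ob C" and z: "z \<in> carrier (FOb F X)"
    obtain f where f: "f \<in> Hom C B X" "component u X z = f \<cdot> g"
      using nat_closed[OF u(1) X z] by (auto simp: img_def)
    then show "\<exists>f\<in>Hom C B X. z = FMor F f ?x" using vuz[OF X z] vfg by auto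
  next
    fix X f assume f: "f \<in> Hom C B X"
    have X: "X \<in> Ob C" using f hom_objects by blast
    show "FMor F f ?x = \<one>\<^bsub>FOb F X\<^esub> \<longleftrightarrow> f \<cdot> g = ZeroM C W X"
      using ufx[OF f] vfg[OF f] nat_one[OF u(1) X] nat_one[OF v(1) X] one by metis
  qed fact+
qed

end

section \<open>Modules over the compact objects\<close>

context rigidly_compactly_generated_tt
begin

abbreviation "Op \<equiv> opp_cat (Tc T)"

lemma Op_simps [simp]:
  "Ob Op = compacts T"
  "Hom Op A B = (if A \<in> compacts T \<and> B \<in> compacts T then Hom T B A else {})"
  "g \<cdot>\<^bsub>Op\<^esub> f = f \<cdot> g" "Ident Op = Ident T" "PlusM Op = PlusM T" "ZeroM Op A B = ZeroM T B A"
  using compact_ob by (auto simp: opp_cat_def Tc_def full_sub_def)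

lemma Op_HomD: "f \<in> Hom Op A B \<Longrightarrow> f \<in> Hom T B A" "f \<in> Hom Op A B \<Longrightarrow> A \<in> compacts T"
  "f \<in> Hom Op A B \<Longrightarrow> B \<in> compacts T"
  by (simp_all split: if_splits)

lemma hom_grp_Op: "\<lbrakk>A \<in> compacts T; B \<in> compacts T\<rbrakk> \<Longrightarrow> hom_grp Op A B = hom_grp T B A"
  by (simp add: hom_grp_def)

lemma compact_hom: "A \<in> compacts T \<Longrightarrow> Ident T A \<in> Hom T A A"
  using ident_hom compact_ob by blast

lemma category_Op: "category Op"
  by unfold_locales
    (auto simp: comp_hom compact_hom comp_ident ident_comp comp_assoc split: if_splits dest: hom_disjoint)

lemma preadditive_Op: "preadditive Op"
proof (rule preadditive.intro[OF category_Op], rule preadditive_axioms.intro)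
  show "comm_group (hom_grp Op A B)" if "A \<in> Ob Op" "B \<in> Ob Op" for A B
    using that hom_comm_group compact_ob by (simp add: hom_grp_Op)
qed (auto simp: comp_plus_left comp_plus_right split: if_splits)

sublocale O: module_category Op
  by (rule module_category.intro[OF preadditive_Op], unfold_locales)
    (simp add: locally_small small_finite)

sublocale V: module_category T
  by unfold_locales (rule locally_small)

lemma yoneda_abfun: "X \<in> Ob T \<Longrightarrow> is_abfun Op (yoneda T X)"
  unfolding is_abfun_def yoneda_def
  using hom_comm_group compact_ob locally_small comp_ident
  by (auto simp: hom_def comp_hom comp_plus_left comp_plus_right comp_assoc split: if_splits)

lemma yoneda_simps [simp]: "FOb (yoneda T X) A = hom_grp T A X" "FMor (yoneda T X) f h = h \<cdot> f"
  by (simp_all add: yoneda_def)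

lemma yoneda_rep: "B \<in> compacts T \<Longrightarrow> O.rep (yoneda T B) B"
  unfolding O.rep_def using yoneda_abfun compact_ob by (auto simp: hom_grp_Op split: if_splits)

lemma corep_rep:
  assumes "A \<in> Ob T"
  shows "V.rep (corep T A) A"
  unfolding V.rep_def is_abfun_def corep_def
  using assms hom_comm_group locally_small ident_comp
  by (auto simp: hom_def comp_hom comp_plus_left comp_plus_right comp_assoc)

text \<open>In terms of \<open>T\<close>, where arrows are reversed: \<open>F\<close> is a copy of
  the image of the arrow \<open>yoneda T B \<rightarrow> yoneda T D\<close> induced by
  \<open>g\<close>, and \<open>x\<close> corresponds to the identity of \<open>B\<close>.\<close>

definition presents :: "('o, 'v) abfun \<Rightarrow> 'o \<Rightarrow> 'v \<Rightarrow> 'o \<Rightarrow> 'v \<Rightarrow> bool" where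
  "presents F B x D g \<longleftrightarrow> B \<in> compacts T \<and> D \<in> compacts T \<and> O.pres F B x D g"

lemma presentsD:
  assumes "presents F B x D g"
  shows "B \<in> compacts T" "D \<in> compacts T" "O.pres F B x D g" "is_abfun Op F" "g \<in> Hom T B D"
    "x \<in> carrier (FOb F B)"
  using assms O.presD[of F B x D g] by (auto simp: presents_def)

lemma presents_zero_iff: "\<lbrakk>presents F B x D g; X \<in> compacts T; f \<in> Hom T X B\<rbrakk> \<Longrightarrow>
    FMor F f x = \<one>\<^bsub>FOb F X\<^esub> \<longleftrightarrow> g \<cdot> f = ZeroM T X D"
  using O.presD(4)[of F B x D g f X] by (simp add: presents_def)

lemma presents_eq_iff: "\<lbrakk>presents F B x D g; X \<in> compacts T; f \<in> Hom T X B; f' \<in> Hom T X B\<rbrakk> \<Longrightarrow>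
    FMor F f x = FMor F f' x \<longleftrightarrow> g \<cdot> f = g \<cdot> f'"
  using O.pres_eq_iff[of F B x D g f X f'] by (simp add: presents_def)

lemma presents_gen:
  assumes "presents F B x D g" "X \<in> compacts T" "y \<in> carrier (FOb F X)"
  obtains f where "f \<in> Hom T X B" "y = FMor F f x"
  using O.pres_gen[of F B x D g X y] assms by (auto simp: presents_def split: if_splits)

lemma img_presents:
  assumes "B \<in> compacts T" "D \<in> compacts T" "g \<in> Hom T B D"
  shows "presents (O.img D B g) B g D g"
  unfolding presents_def using O.img_pres[of g D B] assms by simp

lemma yoneda_presents: "B \<in> compacts T \<Longrightarrow> presents (yoneda T B) B (Ident T B) B (Ident T B)"
  unfolding presents_def using O.rep_pres[OF yoneda_rep] by simp

text \<open>With \<open>D\<close> the cone of the presenting arrow \<open>?a\<close>, exactness of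
  triangles under Hom makes the cokernel of \<open>yoneda T A \<rightarrow> yoneda T B\<close> the
  image of \<open>yoneda T B \<rightarrow> yoneda T D\<close>. So every finitely presented module
  embeds into a representable one.\<close>

lemma fin_pres_presents:
  assumes "F \<in> fin_pres T"
  obtains B x D g where "presents F B x D g"
proof -
  obtain A B \<alpha> q where AB: "A \<in> compacts T" "B \<in> compacts T"
    and c: "is_cokernel O.M (yoneda T A) (yoneda T B) \<alpha> F q"
    using assms by (auto simp: fin_pres_def ModTc_def)
  let ?a = "component \<alpha> A (Ident T A)"
  have \<alpha>: "\<alpha> \<in> Hom O.M (yoneda T A) (yoneda T B)" using c by (simp add: is_cokernel_def)
  have a: "?a \<in> Hom T A B"
    using O.nat_closed[OF \<alpha>, of A "Ident T A"] AB compact_hom by simp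
  obtain D g h where D: "D \<in> compacts T" "triangle A B D ?a g h"
    using compact_cone_ex[OF a AB] .
  note g = triangle_hom(2)[OF D(2)]
  have "O.pres F B (component q B (Ident T B)) D g"
  proof (rule O.cokernel_presD[OF c yoneda_rep[OF AB(1)] yoneda_rep[OF AB(2)], simplified Op_simps])
    fix X f assume "f \<in> (if B \<in> compacts T \<and> X \<in> compacts T then Hom T X B else {})"
    then have X: "X \<in> compacts T" and f: "f \<in> Hom T X B" using AB by (auto split: if_splits)
    have "\<exists>f'\<in>Hom T X A. f = ?a \<cdot> f'" if "g \<cdot> f = ZeroM T X D"
      using weak_kernel[OF D(2) f that] by blast
    moreover have "g \<cdot> (?a \<cdot> f') = ZeroM T X D" if f': "f' \<in> Hom T X A" for f'
      using comp_assoc[OF f' a g] triangle_comp_zero[OF D(2)] zero_comp[OF f' compact_ob[OF D(1)]] by simp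
    ultimately show "g \<cdot> f = ZeroM T X D \<longleftrightarrow>
        (\<exists>f'\<in>(if A \<in> compacts T \<and> X \<in> compacts T then Hom T X A else {}). f = ?a \<cdot> f')"
      using X AB by auto
  qed (use g D AB in simp)
  then show thesis using that AB D by (simp add: presents_def)
qed

lemma presents_fin_pres:
  assumes p: "presents F B x D g"
  shows "F \<in> fin_pres T"
proof -
  note P = presentsD[OF p]
  obtain A a h where A: "A \<in> compacts T" "triangle A B D a g h"
    using compact_fibre_ex[OF P(5,2,1)] .
  note a = triangle_hom(1)[OF A(2)]
  obtain \<alpha> where \<alpha>: "\<alpha> \<in> Hom O.M (yoneda T A) (yoneda T B)" "component \<alpha> A (Ident T A) = a"
    using O.yoneda_ex[OF yoneda_rep[OF A(1)] yoneda_abfun[OF compact_ob[OF P(1)]], of a] a by auto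
  obtain q where q: "q \<in> Hom O.M (yoneda T B) F" "component q B (Ident T B) = x"
    using O.yoneda_ex[OF yoneda_rep[OF P(1)] P(4), of x] P(6) by auto
  have "is_cokernel O.M (yoneda T A) (yoneda T B) \<alpha> F q"
  proof (rule O.cokernel_presI[OF P(3) yoneda_rep[OF A(1)] yoneda_rep[OF P(1)], simplified Op_simps])
    fix X f assume "f \<in> (if B \<in> compacts T \<and> X \<in> compacts T then Hom T X B else {})"
    then have X: "X \<in> compacts T" and f: "f \<in> Hom T X B" using P by (auto split: if_splits)
    have "\<exists>f'\<in>Hom T X A. f = a \<cdot> f'" if "g \<cdot> f = ZeroM T X D"
      using weak_kernel[OF A(2) f that] by blast
    moreover have "g \<cdot> (a \<cdot> f') = ZeroM T X D" if f': "f' \<in> Hom T X A" for f'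
      using comp_assoc[OF f' a P(5)] triangle_comp_zero[OF A(2)] zero_comp[OF f' compact_ob[OF P(2)]] by simp
    ultimately show "g \<cdot> f = ZeroM T X D \<longleftrightarrow>
        (\<exists>f'\<in>(if A \<in> compacts T \<and> X \<in> compacts T then Hom T X A else {}). f = a \<cdot> f')"
      using X A by auto
  qed (use A P a \<alpha> q in simp_all)
  then show ?thesis using A P unfolding fin_pres_def ModTc_def by blast
qed

lemma fin_pres_abfun: "F \<in> fin_pres T \<Longrightarrow> is_abfun Op F"
  using fin_pres_presents presentsD(4) by metis

lemma yoneda_fin_pres: "B \<in> compacts T \<Longrightarrow> yoneda T B \<in> fin_pres T"
  using presents_fin_pres[OF yoneda_presents] .

text \<open>The common form of two conditions: that the module presented by \<open>g\<close> has no
  nonzero arrow to \<open>yoneda T X\<close>, by \<open>vanish_iff_kills\<close>, and that the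
  functor on \<open>T\<close> presented by \<open>g\<close> vanishes at \<open>X\<close>, by
  \<open>pres_trivial_iff\<close>.\<close>

definition kills :: "'o \<Rightarrow> 'v \<Rightarrow> bool" where
  "kills X g \<longleftrightarrow> (\<forall>k\<in>Hom T (cod_of T g) X. k \<cdot> g = ZeroM T (dom_of T g) X)"

lemma kills_iff: "g \<in> Hom T B D \<Longrightarrow> kills X g \<longleftrightarrow> (\<forall>k\<in>Hom T D X. k \<cdot> g = ZeroM T B X)"
  by (simp add: kills_def dom_of_eq cod_of_eq)

text \<open>
  A map from \<open>F\<close> to \<open>yoneda T X\<close> sends the generator to an arrow that factors through \<open>g\<close>:
  in this sense \<open>yoneda T X\<close> is absolutely pure.
\<close>

lemma to_yoneda_factor:
  assumes p: "presents F B x D g" and \<phi>: "\<phi> \<in> Hom O.M F (yoneda T X)"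
  obtains k where "k \<in> Hom T D X" "component \<phi> B x = k \<cdot> g"
proof -
  note P = presentsD[OF p]
  \<comment> \<open>The fibre \<open>a\<close> of \<open>g\<close> is a relation of the generator
    \<open>x\<close>; so the image of \<open>x\<close> vanishes on \<open>a\<close> and extends
    along \<open>g\<close>.\<close>
  obtain A a h where A: "A \<in> compacts T" "triangle A B D a g h"
    using compact_fibre_ex[OF P(5,2,1)] .
  note a = triangle_hom(1)[OF A(2)]
  have px: "component \<phi> B x \<in> Hom T B X" using O.nat_closed[OF \<phi> _ P(6)] P(1) by simp
  have "component \<phi> B x \<cdot> a = ZeroM T A X"
    using O.pres_relation[OF P(3) \<phi>, of a A] a A(1) P(1) triangle_comp_zero[OF A(2)] by simp
  then show thesis using weak_cokernel[OF A(2) px] that by blast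
qed

lemma to_yoneda_ex:
  assumes p: "presents F B x D g" and X: "X \<in> Ob T" and k: "k \<in> Hom T D X"
  obtains \<phi> where "\<phi> \<in> Hom O.M F (yoneda T X)" "component \<phi> B x = k \<cdot> g"
proof (rule O.pres_arrow_ex[OF presentsD(3)[OF p] yoneda_abfun[OF X]])
  note P = presentsD[OF p]
  show "k \<cdot> g \<in> carrier (FOb (yoneda T X) B)" using comp_hom[OF P(5) k] by simp
  show "FMor (yoneda T X) f (k \<cdot> g) = \<one>\<^bsub>FOb (yoneda T X) Y\<^esub>" if "f \<in> Hom Op B Y" "f \<cdot>\<^bsub>Op\<^esub> g = ZeroM Op D Y" for Y f
    using that comp_assoc[OF Op_HomD(1)[OF that(1)] P(5) k] comp_zero[OF k] compact_ob[OF Op_HomD(3)[OF that(1)]] by simp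
qed (use that in blast)

lemma vanish_iff_kills:
  assumes p: "presents F B x D g" and X: "X \<in> Ob T"
  shows "(\<forall>\<phi>\<in>Hom O.M F (yoneda T X). zero_arr O.M F (yoneda T X) \<phi>) \<longleftrightarrow> kills X g"
proof
  note P = presentsD[OF p]
  assume van: "\<forall>\<phi>\<in>Hom O.M F (yoneda T X). zero_arr O.M F (yoneda T X) \<phi>"
  show "kills X g"
    unfolding kills_iff[OF P(5)]
  proof
    fix k assume k: "k \<in> Hom T D X"
    obtain \<phi> where \<phi>: "\<phi> \<in> Hom O.M F (yoneda T X)" "component \<phi> B x = k \<cdot> g"
      using to_yoneda_ex[OF p X k] .
    then show "k \<cdot> g = ZeroM T B X" using van O.zero_arr_M[OF \<phi>(1)] P(1,6) by force
  qed
next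
  note P = presentsD[OF p]
  assume kills: "kills X g"
  show "\<forall>\<phi>\<in>Hom O.M F (yoneda T X). zero_arr O.M F (yoneda T X) \<phi>"
  proof
    fix \<phi> assume \<phi>: "\<phi> \<in> Hom O.M F (yoneda T X)"
    obtain k where k: "k \<in> Hom T D X" "component \<phi> B x = k \<cdot> g" using to_yoneda_factor[OF p \<phi>] .
    have "component \<phi> B x = ZeroM T B X" using kills k unfolding kills_iff[OF P(5)] by simp
    then have "\<phi> = O.zero_nat F (yoneda T X)"
      using O.pres_ext[OF P(3) \<phi> O.zero_nat(1)[OF P(4) yoneda_abfun[OF X]]]
        O.zero_nat(2)[OF P(4) yoneda_abfun[OF X] _ P(6)] P(1) by simp
    then show "zero_arr O.M F (yoneda T X) \<phi>"
      using O.zero_arr_zero_nat[OF P(4) yoneda_abfun[OF X]] by simp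
  qed
qed

subsection \<open>Exactness for finitely presented modules\<close>

lemma modTc_simps:
  "Ob (modTc T) = fin_pres T"
  "Hom (modTc T) F G = (if F \<in> fin_pres T \<and> G \<in> fin_pres T then Hom O.M F G else {})"
  "Comp (modTc T) = Comp O.M" "Ident (modTc T) = Ident O.M"
  using fin_pres_abfun by (auto simp: modTc_def full_sub_def ModTc_def O.M_Ob)

lemma modTc_HomI: "\<lbrakk>F \<in> fin_pres T; G \<in> fin_pres T; \<phi> \<in> Hom O.M F G\<rbrakk> \<Longrightarrow> \<phi> \<in> Hom (modTc T) F G"
  by (simp add: modTc_simps)

lemma modTc_HomD: "\<phi> \<in> Hom (modTc T) F G \<Longrightarrow> \<phi> \<in> Hom O.M F G"
  "\<phi> \<in> Hom (modTc T) F G \<Longrightarrow> F \<in> fin_pres T" "\<phi> \<in> Hom (modTc T) F G \<Longrightarrow> G \<in> fin_pres T"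
  by (simp_all add: modTc_simps split: if_splits)

lemma zero_module:
  obtains Z where "Z \<in> compacts T" "zero_obj O.M (yoneda T Z)"
proof -
  obtain Z where Z: "zero_obj T Z" using ex_zero_obj by blast
  have c: "Z \<in> compacts T" by (rule compact_zero[OF Z])
  have "Hom T A Z = {ZeroM T A Z}" if "A \<in> compacts T" for A
    using zero_obj_hom(1)[OF Z] zero_hom[OF compact_ob compact_ob] that c by blast
  then show thesis using that[OF c] yoneda_abfun[OF compact_ob[OF c]] by (simp add: O.zero_obj_M)
qed

lemma zero_obj_modTc: "zero_obj (modTc T) Z \<longleftrightarrow> Z \<in> fin_pres T \<and> zero_obj O.M Z"
proof
  assume Z: "zero_obj (modTc T) Z"
  then have Zf: "Z \<in> fin_pres T" by (simp add: zero_obj_def modTc_simps)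
  note Za = fin_pres_abfun[OF Zf]
  have "Ident O.M Z = O.zero_nat Z Z"
    using Z O.nat_ident[OF Za] O.zero_nat(1)[OF Za Za] Zf unfolding zero_obj_def modTc_simps by auto
  then have "x = \<one>\<^bsub>FOb Z A\<^esub>" if "A \<in> Ob Op" "x \<in> carrier (FOb Z A)" for A x
    using O.ident_component[OF that] O.zero_nat(2)[OF Za Za that] by simp
  then show "Z \<in> fin_pres T \<and> zero_obj O.M Z"
    using Zf Za O.ab_one_closed[OF Za] unfolding O.zero_obj_M by blast
next
  assume "Z \<in> fin_pres T \<and> zero_obj O.M Z"
  then show "zero_obj (modTc T) Z"
    using fin_pres_abfun unfolding zero_obj_def modTc_simps by (auto simp: O.M_Ob)
qed

lemma zero_arr_modTc:
  assumes \<phi>: "\<phi> \<in> Hom (modTc T) F G"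
  shows "zero_arr (modTc T) F G \<phi> \<longleftrightarrow> zero_arr O.M F G \<phi>"
proof
  assume "zero_arr (modTc T) F G \<phi>"
  then show "zero_arr O.M F G \<phi>"
    unfolding zero_arr_def zero_obj_modTc modTc_simps by (auto split: if_splits)
next
  note F = modTc_HomD[OF \<phi>]
  assume z: "zero_arr O.M F G \<phi>"
  obtain Z where Z: "Z \<in> compacts T" "zero_obj O.M (yoneda T Z)" by (rule zero_module)
  let ?Z = "yoneda T Z"
  note Za = yoneda_abfun[OF compact_ob[OF Z(1)]] and Zf = yoneda_fin_pres[OF Z(1)]
  note a = O.zero_nat(1)[OF fin_pres_abfun[OF F(2)] Za] and b = O.zero_nat(1)[OF Za fin_pres_abfun[OF F(3)]]
  have "\<phi> = O.zero_nat ?Z G \<cdot>\<^bsub>O.M\<^esub> O.zero_nat F ?Z"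
    by (rule O.nat_ext[OF F(1) O.nat_comp[OF a b]])
      (use z[unfolded O.zero_arr_M[OF F(1)]] O.comp_component[OF a] O.zero_nat(2)[OF Za fin_pres_abfun[OF F(3)]]
        O.nat_closed[OF a] in auto)
  moreover have "zero_obj (modTc T) ?Z" using Z Zf by (simp add: zero_obj_modTc)
  moreover have "O.zero_nat F ?Z \<in> Hom (modTc T) F ?Z" "O.zero_nat ?Z G \<in> Hom (modTc T) ?Z G"
    using modTc_HomI F Zf a b by blast+
  ultimately show "zero_arr (modTc T) F G \<phi>" unfolding zero_arr_def modTc_simps(3) by blast
qed

lemma vanish_arr: "\<phi> \<in> Hom (modTc T) F G \<Longrightarrow> zero_arr (modTc T) F G \<phi> \<longleftrightarrow>
    (\<forall>A\<in>compacts T. \<forall>x\<in>carrier (FOb F A). component \<phi> A x = \<one>\<^bsub>FOb G A\<^esub>)"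
  using zero_arr_modTc O.zero_arr_M[OF modTc_HomD(1)] by simp

lemma modTc_comp: "\<lbrakk>\<phi> \<in> Hom (modTc T) F G; \<psi> \<in> Hom (modTc T) G H\<rbrakk> \<Longrightarrow> \<psi> \<cdot>\<^bsub>O.M\<^esub> \<phi> \<in> Hom (modTc T) F H"
  using O.nat_comp modTc_HomD modTc_HomI by meson

lemma element_arrow:
  assumes F: "F \<in> fin_pres T" and A: "A \<in> compacts T" and x: "x \<in> carrier (FOb F A)"
  obtains \<phi> where "\<phi> \<in> Hom (modTc T) (yoneda T A) F" "component \<phi> A (Ident T A) = x"
proof -
  obtain \<phi> where "\<phi> \<in> Hom O.M (yoneda T A) F" "component \<phi> A (Ident T A) = x"
    using O.yoneda_ex[OF yoneda_rep[OF A] fin_pres_abfun[OF F] x] by auto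
  then show thesis using that modTc_HomI[OF yoneda_fin_pres[OF A] F] by blast
qed

lemma yoneda_arrow_component:
  assumes A: "A \<in> compacts T" and \<phi>: "\<phi> \<in> Hom O.M (yoneda T A) F" and f: "f \<in> Hom T X A" and X: "X \<in> compacts T"
  shows "component \<phi> X f = FMor F f (component \<phi> A (Ident T A))"
  using O.rep_component[OF yoneda_rep[OF A] \<phi>, of f X] f X A by simp

lemma yoneda_arrow_zero:
  assumes A: "A \<in> compacts T" and \<phi>: "\<phi> \<in> Hom (modTc T) (yoneda T A) F"
    and z: "component \<phi> A (Ident T A) = \<one>\<^bsub>FOb F A\<^esub>"
  shows "zero_arr (modTc T) (yoneda T A) F \<phi>"
proof -
  note \<phi>M = modTc_HomD(1)[OF \<phi>]
  have "component \<phi> X f = \<one>\<^bsub>FOb F X\<^esub>" if "X \<in> compacts T" "f \<in> Hom T X A" for X f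
    using yoneda_arrow_component[OF A \<phi>M that(2,1)] z O.ab_one[OF O.nat_abfun(2)[OF \<phi>M], of f A X] that A by simp
  then show ?thesis unfolding vanish_arr[OF \<phi>] by simp
qed

text \<open>Elements of a module at \<open>X\<close> are arrows from \<open>yoneda T X\<close>,
  which is finitely presented. So the universal property inside \<open>modTc T\<close> already
  decides exactness at each compact \<open>X\<close>.\<close>

lemma kernel_pointwise:
  assumes k: "is_kernel (modTc T) A f B D g"
  shows "\<lbrakk>X \<in> compacts T; z \<in> carrier (FOb A X); component f X z = \<one>\<^bsub>FOb B X\<^esub>\<rbrakk> \<Longrightarrow> z = \<one>\<^bsub>FOb A X\<^esub>"
    and "\<lbrakk>X \<in> compacts T; z \<in> carrier (FOb A X)\<rbrakk> \<Longrightarrow> component g X (component f X z) = \<one>\<^bsub>FOb D X\<^esub>"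
    and "\<lbrakk>X \<in> compacts T; z \<in> carrier (FOb B X); component g X z = \<one>\<^bsub>FOb D X\<^esub>\<rbrakk>
      \<Longrightarrow> \<exists>w\<in>carrier (FOb A X). z = component f X w"
proof -
  have f: "f \<in> Hom (modTc T) A B" and g: "g \<in> Hom (modTc T) B D"
    and z: "zero_arr (modTc T) A D (g \<cdot>\<^bsub>O.M\<^esub> f)"
    and univ: "\<And>Y h. \<lbrakk>h \<in> Hom (modTc T) Y B; zero_arr (modTc T) Y D (g \<cdot>\<^bsub>O.M\<^esub> h)\<rbrakk> \<Longrightarrow>
      \<exists>!u. u \<in> Hom (modTc T) Y A \<and> f \<cdot>\<^bsub>O.M\<^esub> u = h"
    using k by (auto simp: is_kernel_def modTc_simps(3))
  note fM = modTc_HomD[OF f] and gM = modTc_HomD[OF g]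
  have idc: "Ident T X \<in> carrier (FOb (yoneda T X) X)" if "X \<in> compacts T" for X
    using compact_hom[OF that] by simp
  show "z = \<one>\<^bsub>FOb A X\<^esub>" if X: "X \<in> compacts T" and zA: "z \<in> carrier (FOb A X)" and fz: "component f X z = \<one>\<^bsub>FOb B X\<^esub>"
  proof -
    let ?y = "yoneda T X"
    note ya = yoneda_abfun[OF compact_ob[OF X]] and yf = yoneda_fin_pres[OF X]
    obtain \<phi> where \<phi>: "\<phi> \<in> Hom (modTc T) ?y A" "component \<phi> X (Ident T X) = z"
      using element_arrow[OF fM(2) X zA] .
    have z0: "O.zero_nat ?y A \<in> Hom (modTc T) ?y A"
      using modTc_HomI[OF yf fM(2)] O.zero_nat(1)[OF ya fin_pres_abfun[OF fM(2)]] .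
    have eq: "f \<cdot>\<^bsub>O.M\<^esub> \<phi> = f \<cdot>\<^bsub>O.M\<^esub> O.zero_nat ?y A"
    proof (rule O.pres_ext[OF presentsD(3)[OF yoneda_presents[OF X]]])
      show "component (f \<cdot>\<^bsub>O.M\<^esub> \<phi>) X (Ident T X) = component (f \<cdot>\<^bsub>O.M\<^esub> O.zero_nat ?y A) X (Ident T X)"
        using O.comp_component[OF modTc_HomD(1)[OF \<phi>(1)] _ idc[OF X]] \<phi>(2) fz X
          O.comp_component[OF modTc_HomD(1)[OF z0] _ idc[OF X]] O.zero_nat(2)[OF ya fin_pres_abfun[OF fM(2)] _ idc[OF X]]
          O.nat_one[OF fM(1)] by simp
    qed (use O.nat_comp[OF modTc_HomD(1)[OF \<phi>(1)] fM(1)] O.nat_comp[OF modTc_HomD(1)[OF z0] fM(1)] in auto)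
    have h: "f \<cdot>\<^bsub>O.M\<^esub> \<phi> \<in> Hom (modTc T) ?y B" using modTc_comp[OF \<phi>(1) f] .
    have "zero_arr (modTc T) ?y D (g \<cdot>\<^bsub>O.M\<^esub> (f \<cdot>\<^bsub>O.M\<^esub> \<phi>))"
      by (rule yoneda_arrow_zero[OF X modTc_comp[OF h g]])
        (use O.comp_component[OF modTc_HomD(1)[OF h] _ idc[OF X]] O.comp_component[OF modTc_HomD(1)[OF \<phi>(1)] _ idc[OF X]]
          \<phi>(2) fz X O.nat_one[OF gM(1)] in simp)
    then have "\<phi> = O.zero_nat ?y A" using univ[OF h] \<phi>(1) z0 eq by metis
    then show ?thesis
      using \<phi>(2) O.zero_nat(2)[OF ya fin_pres_abfun[OF fM(2)] _ idc[OF X]] X by simp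
  qed
  show "component g X (component f X z) = \<one>\<^bsub>FOb D X\<^esub>" if X: "X \<in> compacts T" and zA: "z \<in> carrier (FOb A X)"
    using z[unfolded vanish_arr[OF modTc_comp[OF f g]]] O.comp_component[OF fM(1) _ zA, of g] X zA by simp
  show "\<exists>w\<in>carrier (FOb A X). z = component f X w"
    if X: "X \<in> compacts T" and zB: "z \<in> carrier (FOb B X)" and gz: "component g X z = \<one>\<^bsub>FOb D X\<^esub>"
  proof -
    obtain \<phi> where \<phi>: "\<phi> \<in> Hom (modTc T) (yoneda T X) B" "component \<phi> X (Ident T X) = z"
      using element_arrow[OF fM(3) X zB] .
    have "zero_arr (modTc T) (yoneda T X) D (g \<cdot>\<^bsub>O.M\<^esub> \<phi>)"
      by (rule yoneda_arrow_zero[OF X modTc_comp[OF \<phi>(1) g]])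
        (use O.comp_component[OF modTc_HomD(1)[OF \<phi>(1)] _ idc[OF X]] \<phi>(2) gz X in simp)
    then obtain u where u: "u \<in> Hom (modTc T) (yoneda T X) A" "f \<cdot>\<^bsub>O.M\<^esub> u = \<phi>"
      using univ[OF \<phi>(1)] by blast
    have "z = component f X (component u X (Ident T X))"
      using O.comp_component[OF modTc_HomD(1)[OF u(1)] _ idc[OF X], of f] u(2) \<phi>(2) X by simp
    moreover have "component u X (Ident T X) \<in> carrier (FOb A X)"
      using O.nat_closed[OF modTc_HomD(1)[OF u(1)] _ idc[OF X]] X by simp
    ultimately show ?thesis by blast
  qed
qed

text \<open>The cokernel of \<open>g\<close>, as the image functor of an arrow \<open>w\<close> out of the generator of \<open>D\<close>.\<close>

lemma cokernel_module:
  assumes pB: "presents B B0 b B1 \<beta>" and pD: "presents D D0 d D1 \<delta>" and g: "g \<in> Hom O.M B D"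
  obtains D2 w \<rho> where "presents (O.img D2 D0 w) D0 w D2 w" "\<rho> \<in> Hom O.M D (O.img D2 D0 w)"
    "component \<rho> D0 d = w"
    "\<forall>X z. X \<in> compacts T \<longrightarrow> z \<in> carrier (FOb B X) \<longrightarrow>
      component \<rho> X (component g X z) = \<one>\<^bsub>FOb (O.img D2 D0 w) X\<^esub>"
    "\<forall>X f. X \<in> compacts T \<longrightarrow> f \<in> Hom T X D0 \<longrightarrow> w \<cdot> f = ZeroM T X D2 \<longrightarrow>
      (\<exists>z\<in>carrier (FOb B X). FMor D f d = component g X z)"
proof -
  note B = presentsD[OF pB] and D = presentsD[OF pD]
  have gb: "component g B0 b \<in> carrier (FOb D B0)" using O.nat_closed[OF g _ B(6)] B(1) by simp
  \<comment> \<open>\<open>v\<close> lifts \<open>g\<close> to generators. With \<open>w'\<close>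
    completing \<open>\<delta> \<cdot> v\<close> to a triangle, \<open>w' \<cdot> \<delta>\<close>
    annihilates exactly the \<open>f\<close> for which \<open>\<delta> \<cdot> f\<close> factors
    over \<open>\<delta> \<cdot> v\<close>, that is, for which \<open>FMor D f d\<close> lies in the
    image of \<open>g\<close>.\<close>
  obtain v where v: "v \<in> Hom T B0 D0" "component g B0 b = FMor D v d" using presents_gen[OF pD B(1) gb] .
  note dv = comp_hom[OF v(1) D(5)]
  obtain D2 w' h where D2: "D2 \<in> compacts T" "triangle B0 D1 D2 (\<delta> \<cdot> v) w' h"
    using compact_cone_ex[OF dv B(1) D(2)] .
  note w' = triangle_hom(2)[OF D2(2)]
  let ?w = "w' \<cdot> \<delta>"
  have w: "?w \<in> Hom T D0 D2" using comp_hom[OF D(5) w'] .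
  let ?I = "O.img D2 D0 ?w"
  have pI: "presents ?I D0 ?w D2 ?w" using img_presents[OF D(1) D2(1) w] .
  note I = presentsD[OF pI]
  obtain \<rho> where \<rho>: "\<rho> \<in> Hom O.M D ?I" "component \<rho> D0 d = ?w"
  proof (rule O.pres_arrow_ex[OF D(3) I(4) I(6)])
    fix X f assume f: "f \<in> Hom Op D0 X" "f \<cdot>\<^bsub>Op\<^esub> \<delta> = ZeroM Op D1 X"
    note f' = Op_HomD[OF f(1)]
    have "?w \<cdot> f = ZeroM T X D2"
      using comp_assoc[OF f'(1) D(5) w'] f(2) comp_zero[OF w' compact_ob[OF f'(3)]] by simp
    then show "FMor ?I f ?w = \<one>\<^bsub>FOb ?I X\<^esub>" using presents_zero_iff[OF pI f'(3,1)] by simp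
  qed (use that in blast)
  have wv: "?w \<cdot> v = ZeroM T B0 D2" using comp_assoc[OF v(1) D(5) w'] triangle_comp_zero[OF D2(2)] by simp
  have gen: "component g X (FMor B f b) = FMor D (v \<cdot> f) d" if X: "X \<in> compacts T" and f: "f \<in> Hom T X B0" for X f
  proof -
    have fO: "f \<in> Hom Op B0 X" and vO: "v \<in> Hom Op D0 B0" using f X B(1) D(1) v(1) by simp_all
    show ?thesis using O.nat_natural[OF g fO B(6)] v(2) O.ab_comp[OF D(4) vO fO D(6)] by simp
  qed
  have \<rho>f: "component \<rho> X (FMor D f d) = ?w \<cdot> f" if X: "X \<in> compacts T" and f: "f \<in> Hom T X D0" for X f
    using O.nat_natural[OF \<rho>(1), of f D0 X d] D(1,6) X f \<rho>(2) by (simp add: O.img_def)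
  show thesis
  proof (rule that[OF pI \<rho>]; intro allI impI)
    fix X z assume X: "X \<in> compacts T" and z: "z \<in> carrier (FOb B X)"
    obtain f where f: "f \<in> Hom T X B0" "z = FMor B f b" using presents_gen[OF pB X z] .
    have "component \<rho> X (component g X z) = ?w \<cdot> (v \<cdot> f)"
      using gen[OF X f(1)] \<rho>f[OF X comp_hom[OF f(1) v(1)]] f(2) by simp
    then show "component \<rho> X (component g X z) = \<one>\<^bsub>FOb ?I X\<^esub>"
      using comp_assoc[OF f(1) v(1) w] wv zero_comp[OF f(1) compact_ob[OF D2(1)]] by (simp add: O.img_def)
  next
    fix X f assume X: "X \<in> compacts T" and f: "f \<in> Hom T X D0" and wf: "?w \<cdot> f = ZeroM T X D2"
    have "w' \<cdot> (\<delta> \<cdot> f) = ZeroM T X D2" using wf comp_assoc[OF f D(5) w'] by simp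
    then obtain t where t: "t \<in> Hom T X B0" "\<delta> \<cdot> f = \<delta> \<cdot> v \<cdot> t"
      using weak_kernel[OF D2(2) comp_hom[OF f D(5)]] by blast
    have "FMor D f d = FMor D (v \<cdot> t) d"
      using presents_eq_iff[OF pD X f comp_hom[OF t(1) v(1)]] t(2) comp_assoc[OF t(1) v(1) D(5)] by simp
    also have "\<dots> = component g X (FMor B t b)" using gen[OF X t(1)] by simp
    finally show "\<exists>z\<in>carrier (FOb B X). FMor D f d = component g X z"
      using O.ab_closed[OF B(4), of t B0 X b] B(1,6) X t(1) by auto
  qed
qed

text \<open>The arrow \<open>\<rho>\<close> onto the cokernel of \<open>g\<close> built by
  \<open>cokernel_module\<close> agrees with the zero arrow after \<open>g\<close>; as
  \<open>g\<close> is itself a cokernel, \<open>\<rho>\<close> is zero. Then \<open>w\<close> is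
  zero, and everything it annihilates lies in the image of \<open>g\<close>.\<close>

lemma cokernel_pointwise:
  assumes c: "is_cokernel (modTc T) A B f D g" and X: "X \<in> compacts T" and z: "z \<in> carrier (FOb D X)"
  shows "\<exists>y\<in>carrier (FOb B X). z = component g X y"
proof -
  have f: "f \<in> Hom (modTc T) A B" and g: "g \<in> Hom (modTc T) B D"
    and zero: "zero_arr (modTc T) A D (g \<cdot>\<^bsub>O.M\<^esub> f)"
    and univ: "\<And>Y h. \<lbrakk>h \<in> Hom (modTc T) B Y; zero_arr (modTc T) A Y (h \<cdot>\<^bsub>O.M\<^esub> f)\<rbrakk> \<Longrightarrow>
      \<exists>!u. u \<in> Hom (modTc T) D Y \<and> u \<cdot>\<^bsub>O.M\<^esub> g = h"
    using c by (auto simp: is_cokernel_def modTc_simps(3))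
  note fM = modTc_HomD[OF f] and gM = modTc_HomD[OF g]
  obtain B0 b B1 \<beta> where pB: "presents B B0 b B1 \<beta>" using fin_pres_presents[OF gM(2)] .
  obtain D0 d D1 \<delta> where pD: "presents D D0 d D1 \<delta>" using fin_pres_presents[OF gM(3)] .
  note D = presentsD[OF pD]
  obtain D2 w \<rho> where pI: "presents (O.img D2 D0 w) D0 w D2 w" and \<rho>: "\<rho> \<in> Hom O.M D (O.img D2 D0 w)"
    "component \<rho> D0 d = w" and
    zr: "\<forall>X z. X \<in> compacts T \<longrightarrow> z \<in> carrier (FOb B X) \<longrightarrow>
      component \<rho> X (component g X z) = \<one>\<^bsub>FOb (O.img D2 D0 w) X\<^esub>" and
    im: "\<forall>X f. X \<in> compacts T \<longrightarrow> f \<in> Hom T X D0 \<longrightarrow> w \<cdot> f = ZeroM T X D2 \<longrightarrow>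
      (\<exists>z\<in>carrier (FOb B X). FMor D f d = component g X z)"
    using cokernel_module[OF pB pD gM(1)] .
  let ?I = "O.img D2 D0 w"
  note If = presents_fin_pres[OF pI]
  note Ia = fin_pres_abfun[OF If] and Da = fin_pres_abfun[OF gM(3)] and Ba = fin_pres_abfun[OF gM(2)]
  note \<rho>m = modTc_HomI[OF gM(3) If \<rho>(1)]
  note zm = modTc_HomI[OF gM(3) If O.zero_nat(1)[OF Da Ia]]
  have e: "\<rho> \<cdot>\<^bsub>O.M\<^esub> g = O.zero_nat D ?I \<cdot>\<^bsub>O.M\<^esub> g"
    by (rule O.nat_ext[OF O.nat_comp[OF gM(1) \<rho>(1)] O.nat_comp[OF gM(1) O.zero_nat(1)[OF Da Ia]]])
      (use O.comp_component[OF gM(1)] zr O.zero_nat(2)[OF Da Ia] O.nat_closed[OF gM(1)] in simp)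
  have "zero_arr (modTc T) A ?I ((\<rho> \<cdot>\<^bsub>O.M\<^esub> g) \<cdot>\<^bsub>O.M\<^esub> f)"
    unfolding vanish_arr[OF modTc_comp[OF f modTc_comp[OF g \<rho>m]]]
    using O.comp_component[OF fM(1)] O.comp_component[OF gM(1)] zr O.nat_closed[OF fM(1)] by simp
  then have "\<rho> = O.zero_nat D ?I" using univ[OF modTc_comp[OF g \<rho>m]] e \<rho>m zm by metis
  then have w0: "w = ZeroM T D0 D2" using \<rho>(2) O.zero_nat(2)[OF Da Ia _ D(6)] D(1) by (simp add: O.img_def)
  obtain h where h: "h \<in> Hom T X D0" "z = FMor D h d" using presents_gen[OF pD X z] .
  have "w \<cdot> h = ZeroM T X D2"
    unfolding w0 using zero_comp[OF h(1) compact_ob[OF presentsD(2)[OF pI]]] .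
  then show ?thesis using im X h by auto
qed

text \<open>Together with \<open>definable_of\<close> this is the Galois correspondence between
  classes of objects and classes of finitely presented modules.\<close>

definition annihilator :: "'o set \<Rightarrow> ('o, 'v) abfun set" where
  "annihilator D = {F \<in> fin_pres T. \<forall>X\<in>D. \<forall>\<phi>\<in>Hom O.M F (yoneda T X). zero_arr O.M F (yoneda T X) \<phi>}"

lemma annihilator_iff:
  assumes "D \<subseteq> Ob T" "presents F B x C g"
  shows "F \<in> annihilator D \<longleftrightarrow> (\<forall>X\<in>D. kills X g)"
  using vanish_iff_kills[OF assms(2)] assms presents_fin_pres[OF assms(2)] unfolding annihilator_def by blast

lemma annihilator_zero:
  assumes "F \<in> annihilator D" "X \<in> D" "\<phi> \<in> Hom O.M F (yoneda T X)" "A \<in> compacts T" "x \<in> carrier (FOb F A)"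
  shows "component \<phi> A x = ZeroM T A X"
  using assms O.zero_arr_M[OF assms(3)] by (auto simp: annihilator_def)

text \<open>The modules \<open>yoneda T X\<close> are absolutely pure, so Hom into them is exact on
  short exact sequences of finitely presented modules. The implications are proved on generators,
  where extending a map along a monomorphism means factoring over an arrow of a triangle.\<close>

lemma annihilator_serre:
  assumes D: "D \<subseteq> Ob T"
  shows "serre (modTc T) (annihilator D)"
  unfolding serre_def
proof (intro conjI allI impI)
  show "annihilator D \<subseteq> Ob (modTc T)" by (auto simp: annihilator_def modTc_simps)
  obtain Z where Z: "Z \<in> compacts T" "zero_obj O.M (yoneda T Z)" by (rule zero_module)
  have "yoneda T Z \<in> annihilator D"
    unfolding annihilator_def
  proof (intro CollectI conjI ballI)
    show "yoneda T Z \<in> fin_pres T" using yoneda_fin_pres Z by blast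
    fix X \<phi> assume \<phi>: "\<phi> \<in> Hom O.M (yoneda T Z) (yoneda T X)"
    have "component \<phi> A x = \<one>\<^bsub>FOb (yoneda T X) A\<^esub>" if "A \<in> Ob Op" "x \<in> carrier (FOb (yoneda T Z) A)" for A x
      using that Z(2) O.nat_one[OF \<phi> that(1)] unfolding O.zero_obj_M by auto
    then show "zero_arr O.M (yoneda T Z) (yoneda T X) \<phi>" unfolding O.zero_arr_M[OF \<phi>] by blast
  qed
  then show "annihilator D \<noteq> {}" by blast
  fix A f B g Q assume se: "short_exact (modTc T) A f B g Q"
  then have ker: "is_kernel (modTc T) A f B Q g" and cok: "is_cokernel (modTc T) A B f Q g"
    by (simp_all add: short_exact_def)
  have f: "f \<in> Hom (modTc T) A B" and g: "g \<in> Hom (modTc T) B Q" using ker by (auto simp: is_kernel_def)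
  note fM = modTc_HomD[OF f] and gM = modTc_HomD[OF g]
  note k = kernel_pointwise[OF ker] and s = cokernel_pointwise[OF cok]
  obtain A0 a A1 \<alpha> where pA: "presents A A0 a A1 \<alpha>" using fin_pres_presents[OF fM(2)] .
  obtain B0 b B1 \<beta> where pB: "presents B B0 b B1 \<beta>" using fin_pres_presents[OF fM(3)] .
  obtain Q0 q Q1 \<kappa> where pQ: "presents Q Q0 q Q1 \<kappa>" using fin_pres_presents[OF gM(3)] .
  note A = presentsD[OF pA] and B = presentsD[OF pB] and Q = presentsD[OF pQ]
  show "B \<in> annihilator D \<longleftrightarrow> A \<in> annihilator D \<and> Q \<in> annihilator D"
  proof
    assume BD: "B \<in> annihilator D"
    \<comment> \<open>\<open>h\<close> lifts \<open>f\<close> to generators. The fibre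
      \<open>c\<close> of \<open>\<beta> \<cdot> h\<close> dies in \<open>B\<close>, hence in
      \<open>A\<close> because \<open>f\<close> is injective; so \<open>k0 \<cdot> \<alpha>\<close>
      vanishes on \<open>c\<close> and extends along \<open>\<beta> \<cdot> h\<close>, where
      membership of \<open>B\<close> in the annihilator applies.\<close>
    have "kills X \<alpha>" if X: "X \<in> D" for X
      unfolding kills_iff[OF A(5)]
    proof
      fix k0 assume k0: "k0 \<in> Hom T A1 X"
      have fa: "component f A0 a \<in> carrier (FOb B A0)" using O.nat_closed[OF fM(1) _ A(6)] A(1) by simp
      obtain h where h: "h \<in> Hom T A0 B0" "component f A0 a = FMor B h b" using presents_gen[OF pB A(1) fa] .
      note bh = comp_hom[OF h(1) B(5)]
      obtain W c l where W: "W \<in> compacts T" "triangle W A0 B1 c (\<beta> \<cdot> h) l"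
        using compact_fibre_ex[OF bh B(2) A(1)] .
      note c = triangle_hom(1)[OF W(2)]
      have cO: "c \<in> Hom Op A0 W" and hO: "h \<in> Hom Op B0 A0" using c W A(1) B(1) h(1) by simp_all
      have "component f W (FMor A c a) = FMor B (h \<cdot> c) b"
        using O.nat_natural[OF fM(1) cO A(6)] h(2) O.ab_comp[OF B(4) hO cO B(6)] by simp
      also have "\<dots> = \<one>\<^bsub>FOb B W\<^esub>"
        using presents_zero_iff[OF pB W(1) comp_hom[OF c h(1)]] comp_assoc[OF c h(1) B(5)] triangle_comp_zero[OF W(2)] by simp
      finally have "FMor A c a = \<one>\<^bsub>FOb A W\<^esub>" using k(1)[OF W(1)] O.ab_closed[OF A(4) cO A(6)] by blast
      then have "\<alpha> \<cdot> c = ZeroM T W A1" using presents_zero_iff[OF pA W(1) c] by simp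
      then have "k0 \<cdot> \<alpha> \<cdot> c = ZeroM T W X"
        using comp_assoc[OF c A(5) k0] comp_zero[OF k0 compact_ob[OF W(1)]] by simp
      then obtain m where m: "m \<in> Hom T B1 X" "k0 \<cdot> \<alpha> = m \<cdot> (\<beta> \<cdot> h)"
        using weak_cokernel[OF W(2) comp_hom[OF A(5) k0]] by blast
      have "m \<cdot> \<beta> = ZeroM T B0 X" using BD X m(1) unfolding annihilator_iff[OF D pB] kills_iff[OF B(5)] by blast
      then show "k0 \<cdot> \<alpha> = ZeroM T A0 X"
        using m(2) comp_assoc[OF h(1) B(5) m(1)] zero_comp[OF h(1)] X D by auto
    qed
    then have "A \<in> annihilator D" unfolding annihilator_iff[OF D pA] by blast
    moreover have "Q \<in> annihilator D"
      unfolding annihilator_def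
    proof (intro CollectI conjI ballI)
      show "Q \<in> fin_pres T" by (rule gM(3))
      fix X \<phi> assume X: "X \<in> D" and \<phi>: "\<phi> \<in> Hom O.M Q (yoneda T X)"
      note \<phi>g = O.nat_comp[OF gM(1) \<phi>]
      have "component \<phi> Y z = ZeroM T Y X" if Y: "Y \<in> compacts T" and z: "z \<in> carrier (FOb Q Y)" for Y z
      proof -
        obtain y where y: "y \<in> carrier (FOb B Y)" "z = component g Y y" using s[OF Y z] by blast
        then show ?thesis
          using annihilator_zero[OF BD X \<phi>g Y y(1)] O.comp_component[OF gM(1) _ y(1)] Y by simp
      qed
      then show "zero_arr O.M Q (yoneda T X) \<phi>" unfolding O.zero_arr_M[OF \<phi>] by simp
    qed
    ultimately show "A \<in> annihilator D \<and> Q \<in> annihilator D" ..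
  next
    assume AQ: "A \<in> annihilator D \<and> Q \<in> annihilator D"
    show "B \<in> annihilator D"
      unfolding annihilator_def
    proof (intro CollectI conjI ballI)
      show "B \<in> fin_pres T" by (rule fM(3))
      fix X \<phi> assume X: "X \<in> D" and \<phi>: "\<phi> \<in> Hom O.M B (yoneda T X)"
      note \<phi>f = O.nat_comp[OF fM(1) \<phi>]
      have Xo: "X \<in> Ob T" using X D by blast
      have im: "component \<phi> Y (component f Y z) = ZeroM T Y X" if Y: "Y \<in> compacts T" and z: "z \<in> carrier (FOb A Y)" for Y z
        using annihilator_zero[OF _ X \<phi>f Y z] AQ O.comp_component[OF fM(1) _ z] Y by simp
      have kerz: "component \<phi> Y z = ZeroM T Y X"
        if Y: "Y \<in> compacts T" and z: "z \<in> carrier (FOb B Y)" "component g Y z = \<one>\<^bsub>FOb Q Y\<^esub>" for Y z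
        using k(3)[OF Y z] im[OF Y] by blast
      \<comment> \<open>\<open>z\<close> lifts the generator of \<open>Q\<close> to
        \<open>B\<close>. Since \<open>\<phi>\<close> vanishes on the kernel of \<open>g\<close>,
        its value \<open>?p\<close> at \<open>z\<close> satisfies the relations of \<open>q\<close>
        and so factors over \<open>\<kappa>\<close>; then it is zero because \<open>Q\<close> is in
        the annihilator.\<close>
      obtain z where z: "z \<in> carrier (FOb B Q0)" "q = component g Q0 z" using s[OF Q(1,6)] by blast
      let ?p = "component \<phi> Q0 z"
      have p: "?p \<in> Hom T Q0 X" using O.nat_closed[OF \<phi> _ z(1)] Q(1) by simp
      obtain W c l where W: "W \<in> compacts T" "triangle W Q0 Q1 c \<kappa> l" using compact_fibre_ex[OF Q(5,2,1)] .
      note c = triangle_hom(1)[OF W(2)]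
      have cO: "c \<in> Hom Op Q0 W" using c W Q(1) by simp
      have "component g W (FMor B c z) = \<one>\<^bsub>FOb Q W\<^esub>"
        using O.nat_natural[OF gM(1) cO z(1)] z(2) presents_zero_iff[OF pQ W(1) c] triangle_comp_zero[OF W(2)] by simp
      then have "?p \<cdot> c = ZeroM T W X"
        using kerz[OF W(1) O.ab_closed[OF B(4) cO z(1)]] O.nat_natural[OF \<phi> cO z(1)] by simp
      then obtain m where m: "m \<in> Hom T Q1 X" "?p = m \<cdot> \<kappa>" using weak_cokernel[OF W(2) p] by blast
      have p0: "?p = ZeroM T Q0 X"
        using AQ X m unfolding annihilator_iff[OF D pQ] kills_iff[OF Q(5)] by simp
      have "component \<phi> Y y = ZeroM T Y X" if Y: "Y \<in> compacts T" and y: "y \<in> carrier (FOb B Y)" for Y y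
      proof -
        have YO: "Y \<in> Ob Op" using Y by simp
        interpret BY: group "FOb B Y" using O.ab_group[OF B(4) YO] .
        interpret QY: group "FOb Q Y" using O.ab_group[OF Q(4) YO] .
        obtain u where u: "u \<in> Hom T Y Q0" "component g Y y = FMor Q u q"
          using presents_gen[OF pQ Y O.nat_closed[OF gM(1) YO y]] .
        have uO: "u \<in> Hom Op Q0 Y" using u Y Q(1) by simp
        let ?z = "FMor B u z"
        have zc: "?z \<in> carrier (FOb B Y)" using O.ab_closed[OF B(4) uO z(1)] .
        have gz: "component g Y ?z = component g Y y" using O.nat_natural[OF gM(1) uO z(1)] z(2) u(2) by simp
        have ic: "inv\<^bsub>FOb B Y\<^esub> ?z \<in> carrier (FOb B Y)" using zc by simp
        \<comment> \<open>\<open>y\<close> is split into an element of the kernel of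
          \<open>g\<close> and a multiple of the lift \<open>z\<close>; \<open>\<phi>\<close>
          vanishes on both.\<close>
        let ?d = "y \<otimes>\<^bsub>FOb B Y\<^esub> inv\<^bsub>FOb B Y\<^esub> ?z"
        have dc: "?d \<in> carrier (FOb B Y)" using y ic by simp
        have y_eq: "y = ?d \<otimes>\<^bsub>FOb B Y\<^esub> ?z" using y zc by (simp add: BY.m_assoc)
        have "component g Y y = component g Y ?d \<otimes>\<^bsub>FOb Q Y\<^esub> component g Y y"
          using O.nat_mult[OF gM(1) YO dc zc] y_eq gz by simp
        then have "component g Y ?d = \<one>\<^bsub>FOb Q Y\<^esub>"
          using QY.r_cancel_one'[OF O.nat_closed[OF gM(1) YO y] O.nat_closed[OF gM(1) YO dc]] by simp
        then have d0: "component \<phi> Y ?d = ZeroM T Y X" using kerz[OF Y dc] by blast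
        have z0: "component \<phi> Y ?z = ZeroM T Y X"
          using O.nat_natural[OF \<phi> uO z(1)] p0 zero_comp[OF u(1) Xo] by simp
        show ?thesis
          using O.nat_mult[OF \<phi> YO dc zc] y_eq d0 z0 plus_zero[OF zero_hom[OF compact_ob[OF Y] Xo]] by simp
      qed
      then show "zero_arr O.M B (yoneda T X) \<phi>" unfolding O.zero_arr_M[OF \<phi>] by simp
    qed
  qed
qed

end

section \<open>Day convolution of finitely presented modules\<close>

context rigidly_compactly_generated_tt
begin

lemma ten_plus_right:
  assumes f: "f \<in> Hom T A A'" and u: "u \<in> Hom T B B'" and v: "v \<in> Hom T B B'"
  shows "f \<boxtimes> (u \<^bold>+ v) = (f \<boxtimes> u) \<^bold>+ (f \<boxtimes> v)"
proof -
  have o: "A \<in> Ob T" "B' \<in> Ob T" using f u hom_objects by blast+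
  interpret E: exact_ftr T "\<lparr>FOb = \<lambda>Y. A \<odot> Y, FMor = \<lambda>f. Ident T A \<boxtimes> f\<rparr>" using exact_ftr_tensor'[OF o(1)] .
  note idA = ident_hom[OF o(1)] and idB = ident_hom[OF o(2)]
  have s: "f \<boxtimes> w = (f \<boxtimes> Ident T B') \<cdot> (Ident T A \<boxtimes> w)" if w: "w \<in> Hom T B B'" for w
    using ten_comp[OF idA f w idB] comp_ident[OF f] ident_comp[OF w] by simp
  have h: "Ident T A \<boxtimes> w \<in> Hom T (A \<odot> B) (A \<odot> B')" if w: "w \<in> Hom T B B'" for w using ten_hom[OF idA w] .
  show ?thesis
    using s[OF u] s[OF v] s[OF plus_hom[OF u v]] E.F_plus[OF u v] comp_plus_right[OF h[OF u] h[OF v] ten_hom[OF f idB]]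
    by simp
qed

lemma ten_plus_left:
  assumes f: "f \<in> Hom T A A'" and g: "g \<in> Hom T A A'" and u: "u \<in> Hom T B B'"
  shows "(f \<^bold>+ g) \<boxtimes> u = (f \<boxtimes> u) \<^bold>+ (g \<boxtimes> u)"
proof -
  have o: "A' \<in> Ob T" "B \<in> Ob T" using f u hom_objects by blast+
  interpret E: exact_ftr T "\<lparr>FOb = \<lambda>Y. Y \<odot> B, FMor = \<lambda>f. f \<boxtimes> Ident T B\<rparr>" using exact_ftr_tensor[OF o(2)] .
  note idA = ident_hom[OF o(1)] and idB = ident_hom[OF o(2)]
  have s: "w \<boxtimes> u = (Ident T A' \<boxtimes> u) \<cdot> (w \<boxtimes> Ident T B)" if w: "w \<in> Hom T A A'" for w
    using ten_comp[OF w idA idB u] ident_comp[OF w] comp_ident[OF u] by simp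
  have h: "w \<boxtimes> Ident T B \<in> Hom T (A \<odot> B) (A' \<odot> B)" if w: "w \<in> Hom T A A'" for w using ten_hom[OF w idB] .
  show ?thesis
    using s[OF f] s[OF g] s[OF plus_hom[OF f g]] E.F_plus[OF f g] comp_plus_right[OF h[OF f] h[OF g] ten_hom[OF idA u]]
    by simp
qed

lemma bilinearD:
  assumes "day_bilinear T F G H \<gamma>" "A \<in> compacts T" "B \<in> compacts T"
  shows "x \<in> carrier (FOb F A) \<Longrightarrow> (\<lambda>y. \<gamma> A B x y) \<in> hom (FOb G B) (FOb H (A \<odot> B))"
    "y \<in> carrier (FOb G B) \<Longrightarrow> (\<lambda>x. \<gamma> A B x y) \<in> hom (FOb F A) (FOb H (A \<odot> B))"
    "\<lbrakk>A' \<in> compacts T; B' \<in> compacts T; f \<in> Hom T A' A; g \<in> Hom T B' B; x \<in> carrier (FOb F A); y \<in> carrier (FOb G B)\<rbrakk>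
      \<Longrightarrow> \<gamma> A' B' (FMor F f x) (FMor G g y) = FMor H (f \<boxtimes> g) (\<gamma> A B x y)"
  using assms unfolding day_bilinear_def by blast+

lemma bilinear_closed:
  assumes "day_bilinear T F G H \<gamma>" "A \<in> compacts T" "B \<in> compacts T" "x \<in> carrier (FOb F A)" "y \<in> carrier (FOb G B)"
  shows "\<gamma> A B x y \<in> carrier (FOb H (A \<odot> B))"
  using hom_in_carrier[OF bilinearD(1)[OF assms(1-4)] assms(5)] .

text \<open>
  With \<open>F\<close> presented by \<open>g\<close>, with relations \<open>a\<^sub>0\<close>, and \<open>G\<close> by \<open>g'\<close>, with relations \<open>a\<^sub>1\<close>, the relations
  of the tensor product are \<open>a\<^sub>0 \<otimes> B\<^sub>1\<close> and \<open>B\<^sub>0 \<otimes> a\<^sub>1\<close>.  The arrow \<open>w\<close> is constructed so that the arrows it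
  annihilates are exactly those that are generated by these.
\<close>

lemma day_tensor_module:
  assumes pF: "presents F B0 x C0 g" and pG: "presents G B1 y C1 g'"
  obtains A1 a1 l1 W w' l where "A1 \<in> compacts T" "triangle A1 B1 C1 a1 g' l1"
    "triangle (B0 \<odot> A1) (C0 \<odot> B1) W ((g \<boxtimes> Ident T B1) \<cdot> (Ident T B0 \<boxtimes> a1)) w' l"
    "presents (O.img W (B0 \<odot> B1) (w' \<cdot> (g \<boxtimes> Ident T B1))) (B0 \<odot> B1) (w' \<cdot> (g \<boxtimes> Ident T B1)) W (w' \<cdot> (g \<boxtimes> Ident T B1))"
    "is_day_tensor T F G (O.img W (B0 \<odot> B1) (w' \<cdot> (g \<boxtimes> Ident T B1)))"
proof -
  note F = presentsD[OF pF] and G = presentsD[OF pG]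
  note o = compact_ob[OF F(1)] compact_ob[OF F(2)] compact_ob[OF G(1)] compact_ob[OF G(2)]
  obtain A0 a0 l0 where A0: "A0 \<in> compacts T" "triangle A0 B0 C0 a0 g l0" using compact_fibre_ex[OF F(5,2,1)] .
  obtain A1 a1 l1 where A1: "A1 \<in> compacts T" "triangle A1 B1 C1 a1 g' l1" using compact_fibre_ex[OF G(5,2,1)] .
  note a0 = triangle_hom(1)[OF A0(2)] and a1 = triangle_hom(1)[OF A1(2)]
  note id0 = ident_hom[OF o(1)] and id1 = ident_hom[OF o(3)]
  let ?gB = "g \<boxtimes> Ident T B1" and ?Ba = "Ident T B0 \<boxtimes> a1"
  have gB: "?gB \<in> Hom T (B0 \<odot> B1) (C0 \<odot> B1)" using ten_hom[OF F(5) id1] .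
  have Ba: "?Ba \<in> Hom T (B0 \<odot> A1) (B0 \<odot> B1)" using ten_hom[OF id0 a1] .
  note gBa = comp_hom[OF Ba gB]
  have BB: "B0 \<odot> B1 \<in> compacts T" using compact_tensor F(1) G(1) by blast
  obtain W w' l where W: "W \<in> compacts T" "triangle (B0 \<odot> A1) (C0 \<odot> B1) W (?gB \<cdot> ?Ba) w' l"
    using compact_cone_ex[OF gBa compact_tensor[OF F(1) A1(1)] compact_tensor[OF F(2) G(1)]] .
  note w' = triangle_hom(2)[OF W(2)]
  let ?w = "w' \<cdot> ?gB"
  have w: "?w \<in> Hom T (B0 \<odot> B1) W" using comp_hom[OF gB w'] .
  let ?I = "O.img W (B0 \<odot> B1) ?w"
  have pI: "presents ?I (B0 \<odot> B1) ?w W ?w" using img_presents[OF BB W(1) w] .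
  note I = presentsD[OF pI]
  \<comment> \<open>Representatives of elements of \<open>F\<close> and \<open>G\<close> by arrows
    to the generating objects; \<open>k1\<close> and \<open>k2\<close> show that
    \<open>\<beta>\<close> does not depend on them.\<close>
  define sF where "sF A \<xi> = (SOME f. f \<in> Hom T A B0 \<and> \<xi> = FMor F f x)" for A \<xi>
  define sG where "sG B \<upsilon> = (SOME u. u \<in> Hom T B B1 \<and> \<upsilon> = FMor G u y)" for B \<upsilon>
  define \<beta> where "\<beta> A B \<xi> \<upsilon> = ?w \<cdot> (sF A \<xi> \<boxtimes> sG B \<upsilon>)" for A B \<xi> \<upsilon>
  have k1: "?w \<cdot> (f \<boxtimes> u) = ?w \<cdot> (f' \<boxtimes> u)"
    if f: "f \<in> Hom T A B0" "f' \<in> Hom T A B0" "g \<cdot> f = g \<cdot> f'" and u: "u \<in> Hom T B B1" for f f' u A B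
    using comp_assoc[OF ten_hom[OF f(1) u] gB w'] comp_assoc[OF ten_hom[OF f(2) u] gB w']
      ten_comp[OF f(1) F(5) u id1] ten_comp[OF f(2) F(5) u id1] f(3) by simp
  have wBa: "?w \<cdot> ?Ba = ZeroM T (B0 \<odot> A1) W"
    using comp_assoc[OF Ba gB w'] triangle_comp_zero[OF W(2)] by simp
  \<comment> \<open>\<open>u\<close> and \<open>u'\<close> differ by an arrow over
    \<open>a1\<close>, and \<open>?w\<close> annihilates \<open>Ident T B0 \<boxtimes> a1\<close> by
    the choice of \<open>W\<close>.\<close>
  have k2: "?w \<cdot> (f \<boxtimes> u) = ?w \<cdot> (f \<boxtimes> u')"
    if f: "f \<in> Hom T A B0" and u: "u \<in> Hom T B B1" "u' \<in> Hom T B B1" "g' \<cdot> u = g' \<cdot> u'" for f u u' A B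
  proof -
    have "g' \<cdot> (u \<^bold>- u') = ZeroM T B C1"
      using comp_minus[OF u(1,2) G(5)] u(3) minus_self[OF comp_hom[OF u(2) G(5)]] by simp
    then obtain t where t: "t \<in> Hom T B A1" "u \<^bold>- u' = a1 \<cdot> t" using weak_kernel[OF A1(2) minus_hom[OF u(1,2)]] by blast
    have at: "a1 \<cdot> t \<in> Hom T B B1" using comp_hom[OF t(1) a1] .
    have ft: "f \<boxtimes> t \<in> Hom T (A \<odot> B) (B0 \<odot> A1)" using ten_hom[OF f t(1)] .
    have ob: "A \<odot> B \<in> Ob T" using ft hom_objects by blast
    have "f \<boxtimes> (a1 \<cdot> t) = ?Ba \<cdot> (f \<boxtimes> t)" using ten_comp[OF f id0 t(1) a1] ident_comp[OF f] by simp
    then have z: "?w \<cdot> (f \<boxtimes> (a1 \<cdot> t)) = ZeroM T (A \<odot> B) W"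
      using comp_assoc[OF ft Ba w] wBa zero_comp[OF ft compact_ob[OF W(1)]] by simp
    have "f \<boxtimes> u = (f \<boxtimes> (a1 \<cdot> t)) \<^bold>+ (f \<boxtimes> u')"
      using minus_plus[OF u(1,2)] t(2) ten_plus_right[OF f at u(2)] by simp
    then show ?thesis
      using comp_plus_right[OF ten_hom[OF f at] ten_hom[OF f u(2)] w] z zero_plus[OF comp_hom[OF ten_hom[OF f u(2)] w]] by simp
  qed
  have \<beta>: "\<beta> A B (FMor F f x) (FMor G u y) = ?w \<cdot> (f \<boxtimes> u)"
    if AB: "A \<in> compacts T" "B \<in> compacts T" and f: "f \<in> Hom T A B0" and u: "u \<in> Hom T B B1" for A B f u
  proof -
    let ?f = "sF A (FMor F f x)" and ?u = "sG B (FMor G u y)"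
    have f': "?f \<in> Hom T A B0 \<and> FMor F f x = FMor F ?f x" unfolding sF_def by (rule someI[of _ f]) (use f in simp)
    have u': "?u \<in> Hom T B B1 \<and> FMor G u y = FMor G ?u y" unfolding sG_def by (rule someI[of _ u]) (use u in simp)
    have "g \<cdot> f = g \<cdot> ?f" using presents_eq_iff[OF pF AB(1) f, of ?f] f' by simp
    moreover have "g' \<cdot> u = g' \<cdot> ?u" using presents_eq_iff[OF pG AB(2) u, of ?u] u' by simp
    ultimately show ?thesis
      unfolding \<beta>_def using k1[OF f _ _ u, of ?f] k2[OF _ u, of ?f A ?u] f' u' by simp
  qed
  have I_carrier: "?w \<cdot> h \<in> carrier (FOb ?I X)" if "X \<in> compacts T" "h \<in> Hom T X (B0 \<odot> B1)" for X h
    using that BB by (auto simp: O.img_def)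
  have I_mult: "p \<otimes>\<^bsub>FOb ?I X\<^esub> q = p \<^bold>+ q" for p q X by (simp add: O.img_def)
  have FO: "f \<in> Hom Op B0 A" if "A \<in> compacts T" "f \<in> Hom T A B0" for f A using that F(1) by simp
  have GO: "u \<in> Hom Op B1 B" if "B \<in> compacts T" "u \<in> Hom T B B1" for u B using that G(1) by simp
  have bil: "day_bilinear T F G ?I \<beta>"
    unfolding day_bilinear_def
  proof (intro conjI ballI)
    fix A B \<xi> assume AB: "A \<in> compacts T" "B \<in> compacts T" and \<xi>: "\<xi> \<in> carrier (FOb F A)"
    obtain f where f: "f \<in> Hom T A B0" "\<xi> = FMor F f x" using presents_gen[OF pF AB(1) \<xi>] .
    note cAB = compact_tensor[OF AB]
    show "\<beta> A B \<xi> \<in> hom (FOb G B) (FOb ?I (A \<odot> B))"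
    proof (rule homI)
      fix \<upsilon> \<upsilon>' assume \<upsilon>: "\<upsilon> \<in> carrier (FOb G B)" and \<upsilon>': "\<upsilon>' \<in> carrier (FOb G B)"
      obtain u where u: "u \<in> Hom T B B1" "\<upsilon> = FMor G u y" using presents_gen[OF pG AB(2) \<upsilon>] .
      obtain u' where u': "u' \<in> Hom T B B1" "\<upsilon>' = FMor G u' y" using presents_gen[OF pG AB(2) \<upsilon>'] .
      note fu = ten_hom[OF f(1) u(1)] and fu' = ten_hom[OF f(1) u'(1)]
      show "\<beta> A B \<xi> \<upsilon> \<in> carrier (FOb ?I (A \<odot> B))" unfolding f(2) u(2) \<beta>[OF AB f(1) u(1)] using I_carrier[OF cAB fu] .
      have "\<upsilon> \<otimes>\<^bsub>FOb G B\<^esub> \<upsilon>' = FMor G (u \<^bold>+ u') y"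
        using O.ab_plus[OF G(4) GO[OF AB(2) u(1)] GO[OF AB(2) u'(1)] G(6)] u(2) u'(2) by simp
      then show "\<beta> A B \<xi> (\<upsilon> \<otimes>\<^bsub>FOb G B\<^esub> \<upsilon>') = \<beta> A B \<xi> \<upsilon> \<otimes>\<^bsub>FOb ?I (A \<odot> B)\<^esub> \<beta> A B \<xi> \<upsilon>'"
        using \<beta>[OF AB f(1) plus_hom[OF u(1) u'(1)]] \<beta>[OF AB f(1) u(1)] \<beta>[OF AB f(1) u'(1)] f(2) u(2) u'(2)
          ten_plus_right[OF f(1) u(1) u'(1)] comp_plus_right[OF fu fu' w] by (simp add: I_mult)
    qed
  next
    fix A B \<upsilon> assume AB: "A \<in> compacts T" "B \<in> compacts T" and \<upsilon>: "\<upsilon> \<in> carrier (FOb G B)"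
    obtain u where u: "u \<in> Hom T B B1" "\<upsilon> = FMor G u y" using presents_gen[OF pG AB(2) \<upsilon>] .
    note cAB = compact_tensor[OF AB]
    show "(\<lambda>\<xi>. \<beta> A B \<xi> \<upsilon>) \<in> hom (FOb F A) (FOb ?I (A \<odot> B))"
    proof (rule homI)
      fix \<xi> \<xi>' assume \<xi>: "\<xi> \<in> carrier (FOb F A)" and \<xi>': "\<xi>' \<in> carrier (FOb F A)"
      obtain f where f: "f \<in> Hom T A B0" "\<xi> = FMor F f x" using presents_gen[OF pF AB(1) \<xi>] .
      obtain f' where f': "f' \<in> Hom T A B0" "\<xi>' = FMor F f' x" using presents_gen[OF pF AB(1) \<xi>'] .
      note fu = ten_hom[OF f(1) u(1)] and fu' = ten_hom[OF f'(1) u(1)]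
      show "\<beta> A B \<xi> \<upsilon> \<in> carrier (FOb ?I (A \<odot> B))" unfolding f(2) u(2) \<beta>[OF AB f(1) u(1)] using I_carrier[OF cAB fu] .
      have "\<xi> \<otimes>\<^bsub>FOb F A\<^esub> \<xi>' = FMor F (f \<^bold>+ f') x"
        using O.ab_plus[OF F(4) FO[OF AB(1) f(1)] FO[OF AB(1) f'(1)] F(6)] f(2) f'(2) by simp
      then show "\<beta> A B (\<xi> \<otimes>\<^bsub>FOb F A\<^esub> \<xi>') \<upsilon> = \<beta> A B \<xi> \<upsilon> \<otimes>\<^bsub>FOb ?I (A \<odot> B)\<^esub> \<beta> A B \<xi>' \<upsilon>"
        using \<beta>[OF AB plus_hom[OF f(1) f'(1)] u(1)] \<beta>[OF AB f(1) u(1)] \<beta>[OF AB f'(1) u(1)] f(2) u(2) f'(2)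
          ten_plus_left[OF f(1) f'(1) u(1)] comp_plus_right[OF fu fu' w] by (simp add: I_mult)
    qed
  next
    fix A A' B B' f0 g0 \<xi> \<upsilon>
    assume AB: "A \<in> compacts T" "A' \<in> compacts T" "B \<in> compacts T" "B' \<in> compacts T"
      and f0: "f0 \<in> Hom T A' A" and g0: "g0 \<in> Hom T B' B"
      and \<xi>: "\<xi> \<in> carrier (FOb F A)" and \<upsilon>: "\<upsilon> \<in> carrier (FOb G B)"
    obtain f where f: "f \<in> Hom T A B0" "\<xi> = FMor F f x" using presents_gen[OF pF AB(1) \<xi>] .
    obtain u where u: "u \<in> Hom T B B1" "\<upsilon> = FMor G u y" using presents_gen[OF pG AB(3) \<upsilon>] .
    have "FMor F f0 \<xi> = FMor F (f \<cdot> f0) x"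
      using O.ab_comp[OF F(4) FO[OF AB(1) f(1)] _ F(6), of f0 A'] f0 AB f(2) by simp
    moreover have "FMor G g0 \<upsilon> = FMor G (u \<cdot> g0) y"
      using O.ab_comp[OF G(4) GO[OF AB(3) u(1)] _ G(6), of g0 B'] g0 AB u(2) by simp
    ultimately have "\<beta> A' B' (FMor F f0 \<xi>) (FMor G g0 \<upsilon>) = ?w \<cdot> ((f \<cdot> f0) \<boxtimes> (u \<cdot> g0))"
      using \<beta>[OF AB(2,4) comp_hom[OF f0 f(1)] comp_hom[OF g0 u(1)]] by simp
    also have "\<dots> = ?w \<cdot> (f \<boxtimes> u) \<cdot> (f0 \<boxtimes> g0)"
      using ten_comp[OF f0 f(1) g0 u(1)] comp_assoc[OF ten_hom[OF f0 g0] ten_hom[OF f(1) u(1)] w] by simp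
    also have "\<dots> = FMor ?I (f0 \<boxtimes> g0) (\<beta> A B \<xi> \<upsilon>)"
      using \<beta>[OF AB(1,3) f(1) u(1)] f(2) u(2) by (simp add: O.img_def)
    finally show "\<beta> A' B' (FMor F f0 \<xi>) (FMor G g0 \<upsilon>) = FMor ?I (f0 \<boxtimes> g0) (\<beta> A B \<xi> \<upsilon>)" .
  qed
  have \<beta>xy: "\<beta> B0 B1 x y = ?w"
    using \<beta>[OF F(1) G(1) id0 id1] O.ab_ident[OF F(4) _ F(6)] O.ab_ident[OF G(4) _ G(6)] F(1) G(1)
      ten_ident[OF o(1,3)] comp_ident[OF w] by simp
  have day: "is_day_tensor T F G ?I"
    unfolding is_day_tensor_def ModTc_def
  proof (intro conjI exI[of _ \<beta>] ballI allI impI)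
    show "?I \<in> Ob O.M" using I(4) by (simp add: O.M_Ob)
    show "day_bilinear T F G ?I \<beta>" by (rule bil)
    fix K \<gamma> assume K: "K \<in> Ob O.M" and \<gamma>: "day_bilinear T F G K \<gamma>"
    have Ka: "is_abfun Op K" using K by (simp add: O.M_Ob)
    let ?y0 = "\<gamma> B0 B1 x y"
    have y0: "?y0 \<in> carrier (FOb K (B0 \<odot> B1))" using bilinear_closed[OF \<gamma> F(1) G(1) F(6) G(6)] .
    have rel0: "FMor K (a0 \<boxtimes> Ident T B1) ?y0 = \<one>\<^bsub>FOb K (A0 \<odot> B1)\<^esub>"
    proof -
      have "FMor F a0 x = \<one>\<^bsub>FOb F A0\<^esub>"
        using presents_zero_iff[OF pF A0(1) a0] triangle_comp_zero[OF A0(2)] by simp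
      then have "FMor K (a0 \<boxtimes> Ident T B1) ?y0 = \<gamma> A0 B1 \<one>\<^bsub>FOb F A0\<^esub> y"
        using bilinearD(3)[OF \<gamma> F(1) G(1) A0(1) G(1) a0 id1 F(6) G(6)] O.ab_ident[OF G(4) _ G(6)] G(1) by simp
      also have "\<dots> = \<one>\<^bsub>FOb K (A0 \<odot> B1)\<^esub>"
        using hom_one[OF bilinearD(2)[OF \<gamma> A0(1) G(1) G(6)]] O.ab_group[OF F(4), of A0] O.ab_group[OF Ka, of "A0 \<odot> B1"]
          A0(1) compact_tensor[OF A0(1) G(1)] by simp
      finally show ?thesis .
    qed
    have rel1: "FMor K ?Ba ?y0 = \<one>\<^bsub>FOb K (B0 \<odot> A1)\<^esub>"
    proof -
      have "FMor G a1 y = \<one>\<^bsub>FOb G A1\<^esub>"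
        using presents_zero_iff[OF pG A1(1) a1] triangle_comp_zero[OF A1(2)] by simp
      then have "FMor K ?Ba ?y0 = \<gamma> B0 A1 x \<one>\<^bsub>FOb G A1\<^esub>"
        using bilinearD(3)[OF \<gamma> F(1) G(1) F(1) A1(1) id0 a1 F(6) G(6)] O.ab_ident[OF F(4) _ F(6)] F(1) by simp
      also have "\<dots> = \<one>\<^bsub>FOb K (B0 \<odot> A1)\<^esub>"
        using hom_one[OF bilinearD(1)[OF \<gamma> F(1) A1(1) F(6)]] O.ab_group[OF G(4), of A1] O.ab_group[OF Ka, of "B0 \<odot> A1"]
          A1(1) compact_tensor[OF F(1) A1(1)] by simp
      finally show ?thesis .
    qed
    obtain \<phi> where \<phi>: "\<phi> \<in> Hom O.M ?I K" "component \<phi> (B0 \<odot> B1) ?w = ?y0"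
    proof (rule O.pres_arrow_ex[OF I(3) Ka y0])
      fix X h assume h': "h \<in> Hom Op (B0 \<odot> B1) X" "h \<cdot>\<^bsub>Op\<^esub> ?w = ZeroM Op W X"
      note h = Op_HomD(1)[OF h'(1)] and X = Op_HomD(3)[OF h'(1)]
      \<comment> \<open>One weak kernel allows a multiple of \<open>?Ba\<close> to be subtracted
        from \<open>h\<close>; a second one, in the triangle of \<open>g\<close> tensored with
        \<open>B1\<close>, writes the rest over \<open>a0 \<boxtimes> Ident T B1\<close>. These are
        the two relations \<open>rel1\<close> and \<open>rel0\<close> that hold in
        \<open>K\<close>.\<close>
      have "w' \<cdot> (?gB \<cdot> h) = ZeroM T X W" using h'(2) comp_assoc[OF h gB w'] by simp
      then obtain t where t: "t \<in> Hom T X (B0 \<odot> A1)" "?gB \<cdot> h = ?gB \<cdot> ?Ba \<cdot> t"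
        using weak_kernel[OF W(2) comp_hom[OF h gB]] by blast
      note Bt = comp_hom[OF t(1) Ba]
      have "?gB \<cdot> (h \<^bold>- ?Ba \<cdot> t) = ZeroM T X (C0 \<odot> B1)"
        using comp_minus[OF h Bt gB] t(2) comp_assoc[OF t(1) Ba gB] minus_self[OF comp_hom[OF Bt gB]] by simp
      then obtain t' where t': "t' \<in> Hom T X (A0 \<odot> B1)" "h \<^bold>- ?Ba \<cdot> t = (a0 \<boxtimes> Ident T B1) \<cdot> t'"
        using exact_ftr.F_weak_kernel[OF exact_ftr_tensor[OF o(3)] A0(2), of "h \<^bold>- ?Ba \<cdot> t" X] minus_hom[OF h Bt] by auto
      have tO: "t \<in> Hom Op (B0 \<odot> A1) X" "t' \<in> Hom Op (A0 \<odot> B1) X"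
        using t(1) t'(1) X compact_tensor F(1) A1(1) A0(1) G(1) by simp_all
      have aO: "?Ba \<in> Hom Op (B0 \<odot> B1) (B0 \<odot> A1)" "a0 \<boxtimes> Ident T B1 \<in> Hom Op (B0 \<odot> B1) (A0 \<odot> B1)"
        using Ba ten_hom[OF a0 id1] compact_tensor F(1) A1(1) A0(1) G(1) by simp_all
      have e1: "FMor K (?Ba \<cdot> t) ?y0 = \<one>\<^bsub>FOb K X\<^esub>"
        using O.ab_comp[OF Ka aO(1) tO(1) y0] rel1 O.ab_one[OF Ka tO(1)] by simp
      have e2: "FMor K ((a0 \<boxtimes> Ident T B1) \<cdot> t') ?y0 = \<one>\<^bsub>FOb K X\<^esub>"
        using O.ab_comp[OF Ka aO(2) tO(2) y0] rel0 O.ab_one[OF Ka tO(2)] by simp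
      have "FMor K h ?y0 = FMor K ((a0 \<boxtimes> Ident T B1) \<cdot> t') ?y0 \<otimes>\<^bsub>FOb K X\<^esub> FMor K (?Ba \<cdot> t) ?y0"
        using O.ab_plus[OF Ka O.comp_hom[OF aO(2) tO(2)] O.comp_hom[OF aO(1) tO(1)] y0] minus_plus[OF h Bt] t'(2) by simp
      moreover have "group (FOb K X)" using O.ab_group[OF Ka] X by simp
      ultimately show "FMor K h ?y0 = \<one>\<^bsub>FOb K X\<^esub>" using e1 e2 by (simp add: group.is_monoid)
    qed
    show "\<exists>!\<phi>. \<phi> \<in> Hom O.M ?I K \<and> (\<forall>A\<in>compacts T. \<forall>B\<in>compacts T. \<forall>x\<in>carrier (FOb F A). \<forall>y\<in>carrier (FOb G B).
        component \<phi> (A \<odot> B) (\<beta> A B x y) = \<gamma> A B x y)"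
    proof (rule ex1I[of _ \<phi>], intro conjI ballI)
      show "\<phi> \<in> Hom O.M ?I K" by (rule \<phi>(1))
      fix A B \<xi> \<upsilon> assume AB: "A \<in> compacts T" "B \<in> compacts T" and \<xi>: "\<xi> \<in> carrier (FOb F A)" and \<upsilon>: "\<upsilon> \<in> carrier (FOb G B)"
      obtain f where f: "f \<in> Hom T A B0" "\<xi> = FMor F f x" using presents_gen[OF pF AB(1) \<xi>] .
      obtain u where u: "u \<in> Hom T B B1" "\<upsilon> = FMor G u y" using presents_gen[OF pG AB(2) \<upsilon>] .
      have fuO: "f \<boxtimes> u \<in> Hom Op (B0 \<odot> B1) (A \<odot> B)"
        using ten_hom[OF f(1) u(1)] BB compact_tensor[OF AB] by simp
      have "component \<phi> (A \<odot> B) (\<beta> A B \<xi> \<upsilon>) = component \<phi> (A \<odot> B) (FMor ?I (f \<boxtimes> u) ?w)"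
        using \<beta>[OF AB f(1) u(1)] f(2) u(2) by (simp add: O.img_def)
      also have "\<dots> = FMor K (f \<boxtimes> u) ?y0" using O.nat_natural[OF \<phi>(1) fuO I(6)] \<phi>(2) by simp
      also have "\<dots> = \<gamma> A B \<xi> \<upsilon>" using bilinearD(3)[OF \<gamma> F(1) G(1) AB f(1) u(1) F(6) G(6)] f(2) u(2) by simp
      finally show "component \<phi> (A \<odot> B) (\<beta> A B \<xi> \<upsilon>) = \<gamma> A B \<xi> \<upsilon>" .
    next
      fix \<psi> assume \<psi>: "\<psi> \<in> Hom O.M ?I K \<and> (\<forall>A\<in>compacts T. \<forall>B\<in>compacts T. \<forall>x\<in>carrier (FOb F A). \<forall>y\<in>carrier (FOb G B).
        component \<psi> (A \<odot> B) (\<beta> A B x y) = \<gamma> A B x y)"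
      then have "component \<psi> (B0 \<odot> B1) ?w = ?y0" using F(1,6) G(1,6) \<beta>xy by metis
      then show "\<psi> = \<phi>" using O.pres_ext[OF I(3) _ \<phi>(1)] \<psi> \<phi>(2) by simp
    qed
  qed
  show thesis using that[OF A1 W(2) pI day] .
qed

section \<open>Independence of the chosen Day convolution\<close>

lemma presents_iso:
  assumes p: "presents I B x D g" and \<psi>: "\<psi> \<in> Hom O.M I H" and \<phi>: "\<phi> \<in> Hom O.M H I"
    and \<psi>\<phi>: "\<psi> \<cdot>\<^bsub>O.M\<^esub> \<phi> = Ident O.M H" and \<phi>\<psi>: "\<phi> \<cdot>\<^bsub>O.M\<^esub> \<psi> = Ident O.M I"
  shows "presents H B (component \<psi> B x) D g"
  unfolding presents_def O.pres_def
proof (intro conjI ballI allI)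
  note P = presentsD[OF p]
  show "B \<in> compacts T" "D \<in> compacts T" "g \<in> Hom Op D B" using P by simp_all
  show "is_abfun Op H" using O.nat_abfun(2)[OF \<psi>] .
  show "component \<psi> B x \<in> carrier (FOb H B)" using O.nat_closed[OF \<psi> _ P(6)] P(1) by simp
  have inv: "component \<psi> X (component \<phi> X z) = z" if "X \<in> Ob Op" "z \<in> carrier (FOb H X)" for X z
    using O.comp_component[OF \<phi> that, of \<psi>] \<psi>\<phi> O.ident_component[OF that] by simp
  have inv': "component \<phi> X (component \<psi> X z) = z" if "X \<in> Ob Op" "z \<in> carrier (FOb I X)" for X z
    using O.comp_component[OF \<psi> that, of \<phi>] \<phi>\<psi> O.ident_component[OF that] by simp
  fix X
  show "\<exists>f\<in>Hom Op B X. y = FMor H f (component \<psi> B x)" if X: "X \<in> Ob Op" and y: "y \<in> carrier (FOb H X)" for y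
  proof -
    obtain f where f: "f \<in> Hom Op B X" "component \<phi> X y = FMor I f x"
      using O.pres_gen[OF P(3) X O.nat_closed[OF \<phi> X y]] .
    then show ?thesis using inv[OF X y] O.nat_natural[OF \<psi> f(1) P(6)] by metis
  qed
  show "FMor H f (component \<psi> B x) = \<one>\<^bsub>FOb H X\<^esub> \<longleftrightarrow> f \<cdot>\<^bsub>Op\<^esub> g = ZeroM Op D X" if f: "f \<in> Hom Op B X" for f
  proof -
    have X: "X \<in> Ob Op" using f O.hom_objects by blast
    have "FMor H f (component \<psi> B x) = component \<psi> X (FMor I f x)" using O.nat_natural[OF \<psi> f P(6)] by simp
    moreover have "component \<psi> X (FMor I f x) = \<one>\<^bsub>FOb H X\<^esub> \<longleftrightarrow> FMor I f x = \<one>\<^bsub>FOb I X\<^esub>"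
      using inv'[OF X O.ab_closed[OF P(4) f P(6)]] O.nat_one[OF \<phi> X] O.nat_one[OF \<psi> X] by metis
    ultimately show ?thesis using O.presD(4)[OF P(3) f] by simp
  qed
qed

definition universal_bilinear ::
  "('o, 'v) abfun \<Rightarrow> ('o, 'v) abfun \<Rightarrow> ('o, 'v) abfun \<Rightarrow> ('o \<Rightarrow> 'o \<Rightarrow> 'v \<Rightarrow> 'v \<Rightarrow> 'v) \<Rightarrow> bool" where
  "universal_bilinear F G H \<beta> \<longleftrightarrow> (\<forall>K. is_abfun Op K \<longrightarrow> (\<forall>\<gamma>. day_bilinear T F G K \<gamma> \<longrightarrow> (\<exists>!\<phi>. \<phi> \<in> Hom O.M H K \<and>
      (\<forall>A\<in>compacts T. \<forall>B\<in>compacts T. \<forall>x\<in>carrier (FOb F A). \<forall>y\<in>carrier (FOb G B).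
        component \<phi> (A \<odot> B) (\<beta> A B x y) = \<gamma> A B x y))))"

lemma day_tensorE:
  assumes "is_day_tensor T F G H"
  obtains \<beta> where "is_abfun Op H" "day_bilinear T F G H \<beta>" "universal_bilinear F G H \<beta>"
proof -
  have "is_abfun Op H \<and> (\<exists>\<beta>. day_bilinear T F G H \<beta> \<and> universal_bilinear F G H \<beta>)"
    using assms by (simp add: is_day_tensor_def ModTc_def universal_bilinear_def O.M_Ob)
  then show thesis using that by blast
qed

lemma bilinear_component_ident:
  assumes "day_bilinear T F G H \<beta>" "A \<in> compacts T" "B \<in> compacts T" "x \<in> carrier (FOb F A)" "y \<in> carrier (FOb G B)"
  shows "component (Ident O.M H) (A \<odot> B) (\<beta> A B x y) = \<beta> A B x y"
  using O.ident_component[OF _ bilinear_closed[OF assms]] compact_tensor[OF assms(2,3)] by simp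

text \<open>A Serre ideal has to contain every Day convolution, not a chosen one. Two universal
  bilinear families give inverse isomorphisms, along which the presentation built in
  \<open>day_tensor_module\<close> is transported.\<close>

lemma day_tensor_fin_pres:
  assumes F: "F \<in> fin_pres T" and G: "G \<in> fin_pres T" and H: "is_day_tensor T F G H"
  shows "H \<in> fin_pres T"
proof -
  obtain B0 x C0 g where pF: "presents F B0 x C0 g" using fin_pres_presents[OF F] .
  obtain B1 y C1 g' where pG: "presents G B1 y C1 g'" using fin_pres_presents[OF G] .
  obtain I B z C w where pI: "presents I B z C w" and I: "is_day_tensor T F G I"
    using day_tensor_module[OF pF pG] by metis
  obtain \<beta> where Ha: "is_abfun Op H" and \<beta>: "day_bilinear T F G H \<beta>"
    and uH': "universal_bilinear F G H \<beta>"
    by (rule day_tensorE[OF H])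
  note uH = uH'[unfolded universal_bilinear_def, rule_format]
  obtain \<beta>' where Ia: "is_abfun Op I" and \<beta>': "day_bilinear T F G I \<beta>'"
    and uI': "universal_bilinear F G I \<beta>'"
    by (rule day_tensorE[OF I])
  note uI = uI'[unfolded universal_bilinear_def, rule_format]
  obtain \<phi> where \<phi>: "\<phi> \<in> Hom O.M H I" "\<forall>A\<in>compacts T. \<forall>B\<in>compacts T. \<forall>x\<in>carrier (FOb F A). \<forall>y\<in>carrier (FOb G B).
        component \<phi> (A \<odot> B) (\<beta> A B x y) = \<beta>' A B x y"
    using ex1_implies_ex[OF uH[OF Ia \<beta>']] by blast
  obtain \<psi> where \<psi>: "\<psi> \<in> Hom O.M I H" "\<forall>A\<in>compacts T. \<forall>B\<in>compacts T. \<forall>x\<in>carrier (FOb F A). \<forall>y\<in>carrier (FOb G B).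
        component \<psi> (A \<odot> B) (\<beta>' A B x y) = \<beta> A B x y"
    using ex1_implies_ex[OF uI[OF Ha \<beta>]] by blast
  have cc: "component (\<chi> \<cdot>\<^bsub>O.M\<^esub> \<theta>) (A \<odot> B) (\<delta> A B p q) = component \<chi> (A \<odot> B) (component \<theta> (A \<odot> B) (\<delta> A B p q))"
    if "\<theta> \<in> Hom O.M L K" "day_bilinear T F G L \<delta>" "A \<in> compacts T" "B \<in> compacts T" "p \<in> carrier (FOb F A)" "q \<in> carrier (FOb G B)"
    for \<chi> \<theta> L K A B p q \<delta>
    using O.comp_component[OF that(1) _ bilinear_closed[OF that(2-)]] compact_tensor that(3,4) by simp
  have "\<psi> \<cdot>\<^bsub>O.M\<^esub> \<phi> = Ident O.M H"
    using uH[OF Ha \<beta>]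
  proof (rule ex1E)
    fix \<chi> assume u: "\<forall>\<theta>. \<theta> \<in> Hom O.M H H \<and> (\<forall>A\<in>compacts T. \<forall>B\<in>compacts T. \<forall>x\<in>carrier (FOb F A). \<forall>y\<in>carrier (FOb G B).
        component \<theta> (A \<odot> B) (\<beta> A B x y) = \<beta> A B x y) \<longrightarrow> \<theta> = \<chi>"
    have "\<psi> \<cdot>\<^bsub>O.M\<^esub> \<phi> = \<chi>"
      by (rule u[rule_format]) (use O.nat_comp[OF \<phi>(1) \<psi>(1)] cc[OF \<phi>(1) \<beta>] \<phi>(2) \<psi>(2) in simp)
    moreover have "Ident O.M H = \<chi>"
      by (rule u[rule_format]) (use O.nat_ident[OF Ha] bilinear_component_ident[OF \<beta>] in simp)
    ultimately show ?thesis by simp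
  qed
  moreover have "\<phi> \<cdot>\<^bsub>O.M\<^esub> \<psi> = Ident O.M I"
    using uI[OF Ia \<beta>']
  proof (rule ex1E)
    fix \<chi> assume u: "\<forall>\<theta>. \<theta> \<in> Hom O.M I I \<and> (\<forall>A\<in>compacts T. \<forall>B\<in>compacts T. \<forall>x\<in>carrier (FOb F A). \<forall>y\<in>carrier (FOb G B).
        component \<theta> (A \<odot> B) (\<beta>' A B x y) = \<beta>' A B x y) \<longrightarrow> \<theta> = \<chi>"
    have "\<phi> \<cdot>\<^bsub>O.M\<^esub> \<psi> = \<chi>"
      by (rule u[rule_format]) (use O.nat_comp[OF \<psi>(1) \<phi>(1)] cc[OF \<psi>(1) \<beta>'] \<phi>(2) \<psi>(2) in simp)
    moreover have "Ident O.M I = \<chi>"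
      by (rule u[rule_format]) (use O.nat_ident[OF Ia] bilinear_component_ident[OF \<beta>'] in simp)
    ultimately show ?thesis by simp
  qed
  ultimately have "presents H B (component \<psi> B z) C w" using presents_iso[OF pI \<psi>(1) \<phi>(1)] by blast
  then show ?thesis by (rule presents_fin_pres)
qed

text \<open>
  A bilinear map from \<open>F\<close>, \<open>G\<close> to \<open>yoneda T X\<close> with its second argument fixed in \<open>G B\<close> is a map from
  \<open>F\<close> to \<open>yoneda T (dual T B \<odot> X)\<close>, by rigidity of \<open>B\<close>.
\<close>

lemma annihilator_ideal:
  assumes D: "D \<subseteq> Ob T" and closed: "\<And>X Y. \<lbrakk>X \<in> D; Y \<in> Ob T\<rbrakk> \<Longrightarrow> Y \<odot> X \<in> D"
  shows "serre_ideal T (annihilator D)"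
  unfolding serre_ideal_def
proof (intro conjI annihilator_serre D ballI allI impI)
  fix F G H assume F: "F \<in> annihilator D" and G: "G \<in> Ob (modTc T)" and H: "is_day_tensor T F G H"
  have Ff: "F \<in> fin_pres T" using F by (simp add: annihilator_def)
  note Fa = fin_pres_abfun[OF Ff]
  have Gf: "G \<in> fin_pres T" using G by (simp add: modTc_simps)
  obtain \<beta> where Ha: "is_abfun Op H" and \<beta>: "day_bilinear T F G H \<beta>"
    and uH': "universal_bilinear F G H \<beta>"
    by (rule day_tensorE[OF H])
  note uH = uH'[unfolded universal_bilinear_def, rule_format]
  show "H \<in> annihilator D"
    unfolding annihilator_def
  proof (intro CollectI conjI ballI)
    show "H \<in> fin_pres T" using day_tensor_fin_pres[OF Ff Gf H] .
    fix X \<phi> assume XD: "X \<in> D" and \<phi>: "\<phi> \<in> Hom O.M H (yoneda T X)"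
    have X: "X \<in> Ob T" using XD D by blast
    define \<gamma> where "\<gamma> A B x y = component \<phi> (A \<odot> B) (\<beta> A B x y)" for A B x y
    have tens: "A \<odot> B \<in> Ob Op" if "A \<in> compacts T" "B \<in> compacts T" for A B using that compact_tensor by simp
    have \<gamma>h: "\<gamma> A B x y \<in> Hom T (A \<odot> B) X" if "A \<in> compacts T" "B \<in> compacts T" "x \<in> carrier (FOb F A)" "y \<in> carrier (FOb G B)" for A B x y
      using O.nat_closed[OF \<phi> tens[OF that(1,2)] bilinear_closed[OF \<beta> that]] by (simp add: \<gamma>_def)
    have \<gamma>nat: "\<gamma> A' B' (FMor F f x) (FMor G g y) = \<gamma> A B x y \<cdot> (f \<boxtimes> g)"
      if "A \<in> compacts T" "A' \<in> compacts T" "B \<in> compacts T" "B' \<in> compacts T" "f \<in> Hom T A' A" "g \<in> Hom T B' B"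
        "x \<in> carrier (FOb F A)" "y \<in> carrier (FOb G B)" for A A' B B' f g x y
    proof -
      have "f \<boxtimes> g \<in> Hom Op (A \<odot> B) (A' \<odot> B')" using ten_hom[OF that(5,6)] compact_tensor that by simp
      then show ?thesis
        using bilinearD(3)[OF \<beta> that(1,3,2,4-)] O.nat_natural[OF \<phi> _ bilinear_closed[OF \<beta> that(1,3,7,8)]] by (simp add: \<gamma>_def)
    qed
    have \<gamma>add: "\<gamma> A B (x \<otimes>\<^bsub>FOb F A\<^esub> x') y = \<gamma> A B x y \<^bold>+ \<gamma> A B x' y"
      if "A \<in> compacts T" "B \<in> compacts T" "x \<in> carrier (FOb F A)" "x' \<in> carrier (FOb F A)" "y \<in> carrier (FOb G B)" for A B x x' y
      using hom_mult[OF bilinearD(2)[OF \<beta> that(1,2,5)] that(3,4)]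
        O.nat_mult[OF \<phi> tens[OF that(1,2)] bilinear_closed[OF \<beta> that(1,2,3,5)] bilinear_closed[OF \<beta> that(1,2,4,5)]]
      by (simp add: \<gamma>_def)
    have \<gamma>add': "\<gamma> A B x (y \<otimes>\<^bsub>FOb G B\<^esub> y') = \<gamma> A B x y \<^bold>+ \<gamma> A B x y'"
      if "A \<in> compacts T" "B \<in> compacts T" "x \<in> carrier (FOb F A)" "y \<in> carrier (FOb G B)" "y' \<in> carrier (FOb G B)" for A B x y y'
      using hom_mult[OF bilinearD(1)[OF \<beta> that(1,2,3)] that(4,5)]
        O.nat_mult[OF \<phi> tens[OF that(1,2)] bilinear_closed[OF \<beta> that(1,2,3,4)] bilinear_closed[OF \<beta> that(1,2,3,5)]]
      by (simp add: \<gamma>_def)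
    have bil: "day_bilinear T F G (yoneda T X) \<gamma>"
      unfolding day_bilinear_def using \<gamma>h \<gamma>add \<gamma>add' \<gamma>nat by (auto intro!: homI)
    have zero: "\<gamma> A B x y = ZeroM T (A \<odot> B) X"
      if A: "A \<in> compacts T" and B: "B \<in> compacts T" and x: "x \<in> carrier (FOb F A)" and y: "y \<in> carrier (FOb G B)" for A B x y
    proof -
      note Bo = compact_ob[OF B] and idB = compact_hom[OF B]
      let ?Z = "dual T B \<odot> X"
      have ZD: "?Z \<in> D" using closed[OF XD dual_ob[OF Bo]] .
      have Z: "?Z \<in> Ob T" using ZD D by blast
      note de = dual_eval_hom[OF Bo X]
      \<comment> \<open>The transpose of \<open>\<gamma>\<close> along \<open>B\<close>, for fixed
        \<open>y\<close>. It is a map of modules from \<open>F\<close> to \<open>yoneda T ?Z\<close>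
        with \<open>?Z\<close> in \<open>D\<close>, so it vanishes.\<close>
      define tr where "tr A x = (SOME t. t \<in> Hom T A ?Z \<and> dual_eval B X \<cdot> (t \<boxtimes> Ident T B) = \<gamma> A B x y)" for A x
      have tr: "tr A x \<in> Hom T A ?Z \<and> dual_eval B X \<cdot> (tr A x \<boxtimes> Ident T B) = \<gamma> A B x y"
        if "A \<in> compacts T" "x \<in> carrier (FOb F A)" for A x
        unfolding tr_def
        using someI_ex[of "\<lambda>t. t \<in> Hom T A ?Z \<and> dual_eval B X \<cdot> (t \<boxtimes> Ident T B) = \<gamma> A B x y"]
          rigid_adjunct[OF B compact_ob[OF that(1)] X \<gamma>h[OF that(1) B that(2) y]] by blast
      have tr_eq: "tr A x = t" if "A \<in> compacts T" "x \<in> carrier (FOb F A)" "t \<in> Hom T A ?Z"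
        "dual_eval B X \<cdot> (t \<boxtimes> Ident T B) = \<gamma> A B x y" for A x t
        using rigid_adjunct_unique[OF B X, of "tr A x" A t] tr[OF that(1,2)] that(3,4) by simp
      have n: "nat_of_tr \<in> Hom O.M F (yoneda T ?Z)" "component nat_of_tr A x = tr A x"
        if "nat_of_tr = O.nat_of F (yoneda T ?Z) tr" for nat_of_tr
      proof -
        have h: "tr A \<in> hom (FOb F A) (FOb (yoneda T ?Z) A)" if "A \<in> Ob Op" for A
        proof (rule homI)
          have A: "A \<in> compacts T" using that by simp
          fix p q assume p: "p \<in> carrier (FOb F A)" and q: "q \<in> carrier (FOb F A)"
          show "tr A p \<in> carrier (FOb (yoneda T ?Z) A)" using tr[OF A p] by simp
          have tp: "tr A p \<in> Hom T A ?Z" and tq: "tr A q \<in> Hom T A ?Z" using tr[OF A p] tr[OF A q] by simp_all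
          have pq: "p \<otimes>\<^bsub>FOb F A\<^esub> q \<in> carrier (FOb F A)"
            using O.ab_group[OF Fa that] p q by (simp add: Group.group_def monoid.m_closed)
          show "tr A (p \<otimes>\<^bsub>FOb F A\<^esub> q) = tr A p \<otimes>\<^bsub>FOb (yoneda T ?Z) A\<^esub> tr A q"
            using tr_eq[OF A pq plus_hom[OF tp tq]] ten_plus_left[OF tp tq idB]
              comp_plus_right[OF ten_hom[OF tp idB] ten_hom[OF tq idB] de] tr[OF A p] tr[OF A q] \<gamma>add[OF A B p q y] by simp
        qed
        have nat: "tr A' (FMor F f p) = FMor (yoneda T ?Z) f (tr A p)" if "f \<in> Hom Op A A'" "p \<in> carrier (FOb F A)" for A A' f p
        proof -
          note f = Op_HomD[OF that(1)]
          have tp: "tr A p \<in> Hom T A ?Z" using tr[OF f(2) that(2)] by simp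
          have "dual_eval B X \<cdot> ((tr A p \<cdot> f) \<boxtimes> Ident T B) = \<gamma> A B p y \<cdot> (f \<boxtimes> Ident T B)"
            using ten_comp[OF f(1) tp idB idB] comp_ident[OF idB] tr[OF f(2) that(2)]
              comp_assoc[OF ten_hom[OF f(1) idB] ten_hom[OF tp idB] de] by simp
          also have "\<dots> = \<gamma> A' B (FMor F f p) y"
            using \<gamma>nat[OF f(2,3) B B f(1) idB that(2) y] O.ab_ident[OF fin_pres_abfun[OF Gf] _ y] B by simp
          finally show ?thesis
            using tr_eq[OF f(3) O.ab_closed[OF Fa that] comp_hom[OF f(1) tp]] by simp
        qed
        show "nat_of_tr \<in> Hom O.M F (yoneda T ?Z)"
          unfolding that by (rule O.nat_of(1)[OF Fa yoneda_abfun[OF Z]]) (use h nat in auto)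
        show "component nat_of_tr A x = tr A x"
          unfolding that by (rule O.nat_of(2)[OF Fa yoneda_abfun[OF Z]]) (use h nat A x in auto)
      qed
      have "tr A x = ZeroM T A ?Z" using annihilator_zero[OF F ZD n(1)[OF refl] A x] n(2)[OF refl] by simp
      then show ?thesis
        using tr[OF A x] zero_tensor[OF Bo compact_ob[OF A] Z] comp_zero[OF de ten_ob[OF compact_ob[OF A] Bo]] by simp
    qed
    \<comment> \<open>\<open>\<phi>\<close> and the zero arrow induce the same bilinear family
      \<open>\<gamma>\<close>, which is zero, so they agree by universality of
      \<open>\<beta>\<close>.\<close>
    have "\<phi> = O.zero_nat H (yoneda T X)"
      using uH[OF yoneda_abfun[OF X] bil]
    proof (rule ex1E)
      fix \<chi> assume u: "\<forall>\<theta>. \<theta> \<in> Hom O.M H (yoneda T X) \<and> (\<forall>A\<in>compacts T. \<forall>B\<in>compacts T. \<forall>x\<in>carrier (FOb F A). \<forall>y\<in>carrier (FOb G B).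
          component \<theta> (A \<odot> B) (\<beta> A B x y) = \<gamma> A B x y) \<longrightarrow> \<theta> = \<chi>"
      have "\<phi> = \<chi>" by (rule u[rule_format]) (use \<phi> in \<open>simp add: \<gamma>_def\<close>)
      moreover have "O.zero_nat H (yoneda T X) = \<chi>"
        by (rule u[rule_format])
          (use O.zero_nat[OF Ha yoneda_abfun[OF X]] zero bilinear_closed[OF \<beta>] compact_tensor in simp)
      ultimately show ?thesis by simp
    qed
    then show "zero_arr O.M H (yoneda T X) \<phi>" using O.zero_arr_zero_nat[OF Ha yoneda_abfun[OF X]] by simp
  qed
qed

section \<open>Definable subcategories\<close>

lemma trivial_group_iff: "group G \<Longrightarrow> trivial_group G \<longleftrightarrow> (\<forall>x\<in>carrier G. x = \<one>\<^bsub>G\<^esub>)"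
  by (auto simp: trivial_group_def dest: group.is_monoid monoid.one_closed)

lemma pres_trivial_iff:
  assumes p: "V.pres F B x W g" and X: "X \<in> Ob T"
  shows "trivial_group (FOb F X) \<longleftrightarrow> kills X g"
proof -
  note P = V.presD[OF p]
  have "kills X g \<longleftrightarrow> (\<forall>f\<in>Hom T B X. FMor F f x = \<one>\<^bsub>FOb F X\<^esub>)"
    unfolding kills_iff[OF P(2)] using P(4) by blast
  moreover have "(\<forall>f\<in>Hom T B X. FMor F f x = \<one>\<^bsub>FOb F X\<^esub>) \<longleftrightarrow> (\<forall>y\<in>carrier (FOb F X). y = \<one>\<^bsub>FOb F X\<^esub>)"
    using V.pres_gen[OF p X] V.ab_closed[OF P(1) _ P(3)] by metis
  ultimately show ?thesis using trivial_group_iff[OF V.ab_group[OF P(1) X]] by simp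
qed

text \<open>A coherent functor is presented by the fibre \<open>g\<close> of the arrow
  \<open>?a\<close> from \<open>B\<close> to \<open>A\<close> that defines it; fibres of arrows
  between compact objects are compact.\<close>

lemma coherent_kills:
  assumes "coherent T F"
  obtains W B g where "W \<in> compacts T" "B \<in> compacts T" "g \<in> Hom T W B"
    "\<forall>X\<in>Ob T. trivial_group (FOb F X) \<longleftrightarrow> kills X g"
proof -
  obtain A B \<alpha> q where A: "A \<in> compacts T" and B: "B \<in> compacts T"
    and c: "is_cokernel V.M (corep T A) (corep T B) \<alpha> F q"
    using assms unfolding coherent_def by blast
  note rA = corep_rep[OF compact_ob[OF A]] and rB = corep_rep[OF compact_ob[OF B]]
  let ?a = "component \<alpha> A (Ident T A)"
  have \<alpha>: "\<alpha> \<in> Hom V.M (corep T A) (corep T B)" using c by (simp add: is_cokernel_def)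
  have a: "?a \<in> Hom T B A"
    using V.nat_closed[OF \<alpha> compact_ob[OF A], of "Ident T A"] compact_hom[OF A] by (simp add: corep_def)
  obtain W g h where W: "W \<in> compacts T" "triangle W B A g ?a h" using compact_fibre_ex[OF a A B] .
  note g = triangle_hom(1)[OF W(2)]
  have "V.pres F B (component q B (Ident T B)) W g"
  proof (rule V.cokernel_presD[OF c rA rB g])
    fix X f assume f: "f \<in> Hom T B X"
    have X: "X \<in> Ob T" using f hom_objects by blast
    have "(f' \<cdot> ?a) \<cdot> g = ZeroM T W X" if f': "f' \<in> Hom T A X" for f'
      using comp_assoc[OF g a f'] triangle_comp_zero[OF W(2)] comp_zero[OF f' compact_ob[OF W(1)]] by simp
    then show "f \<cdot> g = ZeroM T W X \<longleftrightarrow> (\<exists>f'\<in>Hom T A X. f = f' \<cdot> ?a)"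
      using weak_cokernel[OF W(2) f] by metis
  qed
  then show thesis using that[OF W(1) B g] pres_trivial_iff by blast
qed

lemma kills_coherent:
  assumes W: "W \<in> compacts T" and B: "B \<in> compacts T" and g: "g \<in> Hom T W B"
  obtains F where "coherent T F" "\<forall>X\<in>Ob T. trivial_group (FOb F X) \<longleftrightarrow> kills X g"
proof -
  obtain A a h where A: "A \<in> compacts T" "triangle W B A g a h" using compact_cone_ex[OF g W B] .
  note a = triangle_hom(2)[OF A(2)]
  note rA = corep_rep[OF compact_ob[OF A(1)]] and rB = corep_rep[OF compact_ob[OF B]]
  note I = V.img_pres[OF g]
  obtain \<alpha> where \<alpha>: "\<alpha> \<in> Hom V.M (corep T A) (corep T B)" "component \<alpha> A (Ident T A) = a"
    using V.yoneda_ex[OF rA V.repD(1)[OF rB], of a] a by (auto simp: corep_def)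
  obtain q where q: "q \<in> Hom V.M (corep T B) (V.img W B g)" "component q B (Ident T B) = g"
    using V.yoneda_ex[OF rB V.presD(1)[OF I] V.presD(3)[OF I]] .
  have "is_cokernel V.M (corep T A) (corep T B) \<alpha> (V.img W B g) q"
  proof (rule V.cokernel_presI[OF I rA rB a _ \<alpha> q])
    fix X f assume f: "f \<in> Hom T B X"
    have X: "X \<in> Ob T" using f hom_objects by blast
    have "(f' \<cdot> a) \<cdot> g = ZeroM T W X" if f': "f' \<in> Hom T A X" for f'
      using comp_assoc[OF g a f'] triangle_comp_zero[OF A(2)] comp_zero[OF f' compact_ob[OF W]] by simp
    then show "f \<cdot> g = ZeroM T W X \<longleftrightarrow> (\<exists>f'\<in>Hom T A X. f = f' \<cdot> a)"
      using weak_cokernel[OF A(2) f] by metis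
  qed
  then have "coherent T (V.img W B g)" unfolding coherent_def using A(1) B by blast
  then show thesis using that pres_trivial_iff[OF I] by blast
qed

lemma definable_kills:
  assumes "definable T D"
  obtains \<Gamma> where "\<And>g. g \<in> \<Gamma> \<Longrightarrow> \<exists>W\<in>compacts T. \<exists>B\<in>compacts T. g \<in> Hom T W B"
    "D = {X \<in> Ob T. \<forall>g\<in>\<Gamma>. kills X g}"
proof -
  obtain \<Phi> where \<Phi>: "\<forall>F\<in>\<Phi>. coherent T F" "D = {X \<in> Ob T. \<forall>F\<in>\<Phi>. trivial_group (FOb F X)}"
    using assms unfolding definable_def by blast
  have "\<forall>F\<in>\<Phi>. \<exists>g. (\<exists>W\<in>compacts T. \<exists>B\<in>compacts T. g \<in> Hom T W B) \<and>
      (\<forall>X\<in>Ob T. trivial_group (FOb F X) \<longleftrightarrow> kills X g)"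
    using \<Phi>(1) coherent_kills by metis
  then obtain \<gamma> where \<gamma>: "\<forall>F\<in>\<Phi>. (\<exists>W\<in>compacts T. \<exists>B\<in>compacts T. \<gamma> F \<in> Hom T W B) \<and>
      (\<forall>X\<in>Ob T. trivial_group (FOb F X) \<longleftrightarrow> kills X (\<gamma> F))"
    by (rule bchoice[THEN exE])
  show thesis by (rule that[of "\<gamma> ` \<Phi>"]) (use \<gamma> \<Phi>(2) in auto)
qed

lemma kills_definable:
  assumes small: "small TYPE('v) \<Gamma>" and \<Gamma>: "\<And>g. g \<in> \<Gamma> \<Longrightarrow> \<exists>W\<in>compacts T. \<exists>B\<in>compacts T. g \<in> Hom T W B"
  shows "definable T {X \<in> Ob T. \<forall>g\<in>\<Gamma>. kills X g}"
proof -
  have "\<forall>g\<in>\<Gamma>. \<exists>F. coherent T F \<and> (\<forall>X\<in>Ob T. trivial_group (FOb F X) \<longleftrightarrow> kills X g)"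
    using \<Gamma> kills_coherent by metis
  then obtain \<phi> where \<phi>: "\<forall>g\<in>\<Gamma>. coherent T (\<phi> g) \<and> (\<forall>X\<in>Ob T. trivial_group (FOb (\<phi> g) X) \<longleftrightarrow> kills X g)"
    by (rule bchoice[THEN exE])
  show ?thesis
    unfolding definable_def
    by (rule exI[of _ "\<phi> ` \<Gamma>"]) (use \<phi> small_image[OF small] in auto)
qed

lemma definable_Int:
  assumes "definable T D" "definable T D'"
  shows "definable T (D \<inter> D')"
proof -
  obtain \<Phi> where \<Phi>: "small TYPE('v) \<Phi>" "\<forall>F\<in>\<Phi>. coherent T F" "D = {X \<in> Ob T. \<forall>F\<in>\<Phi>. trivial_group (FOb F X)}"
    using assms(1) unfolding definable_def by blast
  obtain \<Psi> where \<Psi>: "small TYPE('v) \<Psi>" "\<forall>F\<in>\<Psi>. coherent T F" "D' = {X \<in> Ob T. \<forall>F\<in>\<Psi>. trivial_group (FOb F X)}"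
    using assms(2) unfolding definable_def by blast
  show ?thesis
    unfolding definable_def
    by (rule exI[of _ "\<Phi> \<union> \<Psi>"]) (use \<Phi> \<Psi> small_Un[OF \<Phi>(1) \<Psi>(1)] in auto)
qed

lemma definable_of_iff:
  assumes "S \<subseteq> fin_pres T"
  shows "X \<in> definable_of T S \<longleftrightarrow> X \<in> Ob T \<and> (\<forall>F B x D g. F \<in> S \<longrightarrow> presents F B x D g \<longrightarrow> kills X g)"
  unfolding definable_of_def ModTc_def
  using vanish_iff_kills fin_pres_presents assms by (smt (verit) mem_Collect_eq subsetD)

lemma definable_of_kills: "\<lbrakk>X \<in> definable_of T S; F \<in> S; presents F B x D g\<rbrakk> \<Longrightarrow> kills X g"
  unfolding definable_of_def ModTc_def using vanish_iff_kills by blast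

section \<open>Definability and tensor closure of \<open>definable_of\<close>\<close>

lemma cellular_functor_tensor:
  assumes "cells T K" "X \<in> Ob T"
  shows "cellular_functor T K \<lparr>FOb = \<lambda>Y. Y \<odot> X, FMor = \<lambda>f. f \<boxtimes> Ident T X\<rparr>"
  using assms(1) exact_ftr_tensor[OF assms(2)] tensor_coproduct[OF _ assms(2)]
  unfolding cellular_functor_def cellular_functor_axioms_def by auto

text \<open>Cellular approximation, applied to tensoring with \<open>X\<close>; it reduces questions
  about the arbitrary object \<open>Y\<close> to compact ones.\<close>

lemma tensor_factor:
  assumes K: "cells T K" and X: "X \<in> Ob T" and C: "C \<in> compacts T" and Y: "Y \<in> Ob T" and h: "h \<in> Hom T C (Y \<odot> X)"
  obtains A m c where "A \<in> K" "m \<in> Hom T A Y" "c \<in> Hom T C (A \<odot> X)" "h = (m \<boxtimes> Ident T X) \<cdot> c"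
  using cellular_functor.cellular_approximation[OF cellular_functor_tensor[OF K X] C Y, of h] h
    cellular_functor.cellular_def[OF cellular_functor_tensor[OF K X]] by auto

text \<open>Factoring the inverse of \<open>RUnit T C\<close>, an arrow to
  \<open>C \<odot> Unit T\<close>, through \<open>A \<odot> Unit T\<close> splits the cell
  \<open>m\<close>. So up to retracts the compact objects form a small set.\<close>

lemma compact_retract_of_cell:
  assumes K: "cells T K" and C: "C \<in> compacts T"
  obtains A i p where "A \<in> K" "i \<in> Hom T C A" "p \<in> Hom T A C" "p \<cdot> i = Ident T C"
proof -
  let ?U = "Unit T"
  note Co = compact_ob[OF C]
  note r = runit_iso[OF Co]
  obtain A m c where A: "A \<in> K" "m \<in> Hom T A C" "c \<in> Hom T C (A \<odot> ?U)" "inv_arr T (RUnit T C) = (m \<boxtimes> Ident T ?U) \<cdot> c"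
    using tensor_factor[OF K unit_ob C Co inv_arr(1)[OF r]] .
  have Ao: "A \<in> Ob T" using A(2) hom_objects by blast
  note rA = iso_arr_hom[OF runit_iso[OF Ao]]
  have "m \<cdot> (RUnit T A \<cdot> c) = RUnit T C \<cdot> ((m \<boxtimes> Ident T ?U) \<cdot> c)"
    using comp_assoc[OF A(3) rA A(2)] runit_natural[OF A(2)]
      comp_assoc[OF A(3) ten_hom[OF A(2) ident_hom[OF unit_ob]] iso_arr_hom[OF r]] by simp
  also have "\<dots> = Ident T C" using A(4) inv_arr(3)[OF r] by simp
  finally show thesis using that[OF A(1) comp_hom[OF A(3) rA] A(2)] by blast
qed

text \<open>\<open>S\<close> may be a proper class, so a small set of conditions has to be
  extracted. Every arrow \<open>g\<close> of a presentation is a retract of an arrow between objects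
  of \<open>K\<close>, and an object kills the one if and only if it kills the other.\<close>

lemma definable_of_definable:
  assumes S: "S \<subseteq> fin_pres T"
  shows "definable T (definable_of T S)"
proof -
  obtain K where K: "cells T K" using cells_ex by blast
  interpret K: cells T K by fact
  \<comment> \<open>All arrows between objects of \<open>K\<close> that every object of the class
    kills: a saturated choice, small because \<open>K\<close> and the hom sets are.\<close>
  define \<Gamma> where "\<Gamma> = {g. (\<exists>A\<in>K. \<exists>B\<in>K. g \<in> Hom T A B) \<and> (\<forall>X\<in>definable_of T S. kills X g)}"
  have "\<Gamma> \<subseteq> (\<Union>p\<in>K \<times> K. Hom T (fst p) (snd p))" by (auto simp: \<Gamma>_def)
  then have small: "small TYPE('v) \<Gamma>"
    by (rule small_subset[rotated]) (intro small_UN small_Times K.K_small locally_small)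
  have "definable_of T S = {X \<in> Ob T. \<forall>g\<in>\<Gamma>. kills X g}"
  proof (intro Set.equalityI subsetI)
    fix X assume "X \<in> definable_of T S"
    then show "X \<in> {X \<in> Ob T. \<forall>g\<in>\<Gamma>. kills X g}" by (auto simp: \<Gamma>_def definable_of_def)
  next
    fix X assume X: "X \<in> {X \<in> Ob T. \<forall>g\<in>\<Gamma>. kills X g}"
    show "X \<in> definable_of T S"
      unfolding definable_of_iff[OF S]
    proof (intro conjI allI impI)
      show "X \<in> Ob T" using X by simp
      fix F B x D g assume F: "F \<in> S" and p: "presents F B x D g"
      note P = presentsD[OF p]
      obtain A i r where A: "A \<in> K" "i \<in> Hom T B A" "r \<in> Hom T A B" "r \<cdot> i = Ident T B"
        using compact_retract_of_cell[OF K P(1)] .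
      obtain L j q where L: "L \<in> K" "j \<in> Hom T D L" "q \<in> Hom T L D" "q \<cdot> j = Ident T D"
        using compact_retract_of_cell[OF K P(2)] .
      have gr: "g \<cdot> r \<in> Hom T A D" using comp_hom[OF A(3) P(5)] .
      have g': "j \<cdot> (g \<cdot> r) \<in> Hom T A L" using comp_hom[OF gr L(2)] .
      have Ao: "A \<in> Ob T" and Bo: "B \<in> Ob T" using A hom_objects by blast+
      have "kills Y (j \<cdot> (g \<cdot> r))" if Y: "Y \<in> definable_of T S" for Y
        unfolding kills_iff[OF g']
      proof
        fix k assume k: "k \<in> Hom T L Y"
        have Yo: "Y \<in> Ob T" using k hom_objects by blast
        note kj = comp_hom[OF L(2) k]
        have "(k \<cdot> j) \<cdot> g = ZeroM T B Y"
          using definable_of_kills[OF Y F p] kj unfolding kills_iff[OF P(5)] by blast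
        then show "k \<cdot> (j \<cdot> (g \<cdot> r)) = ZeroM T A Y"
          using comp_assoc[OF gr L(2) k] comp_assoc[OF A(3) P(5) kj] zero_comp[OF A(3) Yo] by simp
      qed
      then have "j \<cdot> (g \<cdot> r) \<in> \<Gamma>" using A(1) L(1) g' unfolding \<Gamma>_def by blast
      then have kX: "k \<cdot> (j \<cdot> (g \<cdot> r)) = ZeroM T A X" if "k \<in> Hom T L X" for k
        using X that unfolding kills_iff[OF g', symmetric] by (auto simp: kills_iff[OF g'])
      show "kills X g"
        unfolding kills_iff[OF P(5)]
      proof
        fix k assume k: "k \<in> Hom T D X"
        have Xo: "X \<in> Ob T" using k hom_objects by blast
        note kg = comp_hom[OF P(5) k] and kq = comp_hom[OF L(3) k]
        have "(k \<cdot> q) \<cdot> (j \<cdot> (g \<cdot> r)) = k \<cdot> (g \<cdot> r)"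
          using comp_assoc[OF g' L(3) k] comp_assoc[OF gr L(2,3)] L(4) ident_comp[OF gr] by simp
        then have z: "k \<cdot> (g \<cdot> r) = ZeroM T A X" using kX[OF kq] by simp
        have "k \<cdot> g = (k \<cdot> (g \<cdot> r)) \<cdot> i"
          using comp_assoc[OF A(3) P(5) k] comp_assoc[OF A(2,3) kg] A(4) comp_ident[OF kg] by simp
        then show "k \<cdot> g = ZeroM T B X" using z zero_comp[OF A(2) Xo] by simp
      qed
    qed
  qed
  moreover have "definable T {X \<in> Ob T. \<forall>g\<in>\<Gamma>. kills X g}"
    by (rule kills_definable[OF small]) (use K.K_compact in \<open>auto simp: \<Gamma>_def\<close>)
  ultimately show ?thesis by simp
qed

text \<open>
  An arrow into \<open>Y \<odot> X\<close> factors through \<open>A \<odot> X\<close> with \<open>A\<close> compact, and arrows into \<open>A \<odot> X\<close> are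
  detected by the dual of \<open>A\<close>, tensoring with which preserves \<open>S\<close>.
\<close>

lemma definable_of_tensor:
  assumes S: "serre_ideal T S" and X: "X \<in> definable_of T S" and Y: "Y \<in> Ob T"
  shows "Y \<odot> X \<in> definable_of T S"
proof -
  have Sf: "S \<subseteq> fin_pres T" using S by (simp add: serre_ideal_def serre_def modTc_simps)
  have Xo: "X \<in> Ob T" using X by (simp add: definable_of_def)
  obtain K where K: "cells T K" using cells_ex by blast
  interpret K: cells T K by fact
  show ?thesis
    unfolding definable_of_iff[OF Sf]
  proof (intro conjI allI impI)
    show "Y \<odot> X \<in> Ob T" using ten_ob Y Xo by blast
    fix F B x C g assume F: "F \<in> S" and p: "presents F B x C g"
    note P = presentsD[OF p]
    note Bo = compact_ob[OF P(1)] and Co = compact_ob[OF P(2)]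
    show "kills (Y \<odot> X) g"
      unfolding kills_iff[OF P(5)]
    proof
      fix k assume k: "k \<in> Hom T C (Y \<odot> X)"
      obtain A m c where A: "A \<in> K" "m \<in> Hom T A Y" "c \<in> Hom T C (A \<odot> X)" "k = (m \<boxtimes> Ident T X) \<cdot> c"
        using tensor_factor[OF K Xo P(2) Y k] .
      have Ac: "A \<in> compacts T" using A(1) K.K_compact by blast
      obtain \<eta> where "dual_pair T A \<eta>" using dual_pair_ex[OF Ac] .
      then interpret A: dual_pair T A \<eta> .
      let ?D = "dual T A" and ?U = "Unit T"
      have Dc: "?D \<in> compacts T" using compact_dual[OF Ac] .
      note Do = compact_ob[OF Dc]
      note idD = compact_hom[OF Dc]
      note pD = yoneda_presents[OF Dc]
      \<comment> \<open>\<open>S\<close> contains the Day convolution of \<open>F\<close> with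
        \<open>yoneda T ?D\<close>. In the presentation of \<open>yoneda T ?D\<close> by an
        identity, \<open>a1\<close> is zero, so \<open>k'\<close> factors over \<open>w'\<close>;
        the condition that this Day convolution imposes on \<open>X\<close> is then the stated
        vanishing.\<close>
      have kill: "k' \<cdot> (g \<boxtimes> Ident T ?D) = ZeroM T (B \<odot> ?D) X" if k': "k' \<in> Hom T (C \<odot> ?D) X" for k'
      proof -
        let ?gD = "g \<boxtimes> Ident T ?D"
        obtain A1 a1 l1 W w' l where t1: "A1 \<in> compacts T" "triangle A1 ?D ?D a1 (Ident T ?D) l1"
          and t: "triangle (B \<odot> A1) (C \<odot> ?D) W (?gD \<cdot> (Ident T B \<boxtimes> a1)) w' l"
          and pI: "presents (O.img W (B \<odot> ?D) (w' \<cdot> ?gD)) (B \<odot> ?D) (w' \<cdot> ?gD) W (w' \<cdot> ?gD)"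
          and day: "is_day_tensor T F (yoneda T ?D) (O.img W (B \<odot> ?D) (w' \<cdot> ?gD))"
          by (rule day_tensor_module[OF p pD])
        have "O.img W (B \<odot> ?D) (w' \<cdot> ?gD) \<in> S"
          using S F day yoneda_fin_pres[OF Dc] unfolding serre_ideal_def modTc_simps by blast
        then have kw: "kills X (w' \<cdot> ?gD)" using definable_of_kills[OF X _ pI] by blast
        note a1 = triangle_hom(1)[OF t1(2)] and w' = triangle_hom(2)[OF t]
        have gD: "?gD \<in> Hom T (B \<odot> ?D) (C \<odot> ?D)" using ten_hom[OF P(5) idD] .
        have A1o: "A1 \<in> Ob T" using compact_ob[OF t1(1)] .
        have "a1 = ZeroM T A1 ?D" using triangle_comp_zero[OF t1(2)] ident_comp[OF a1] by simp
        then have "?gD \<cdot> (Ident T B \<boxtimes> a1) = ZeroM T (B \<odot> A1) (C \<odot> ?D)"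
          using tensor_zero[OF Bo A1o Do] comp_zero[OF gD ten_ob[OF Bo A1o]] by simp
        then have "k' \<cdot> (?gD \<cdot> (Ident T B \<boxtimes> a1)) = ZeroM T (B \<odot> A1) X"
          using comp_zero[OF k' ten_ob[OF Bo A1o]] by simp
        then obtain k'' where k'': "k'' \<in> Hom T W X" "k' = k'' \<cdot> w'" using weak_cokernel[OF t k'] by blast
        have "k'' \<cdot> (w' \<cdot> ?gD) = ZeroM T (B \<odot> ?D) X"
          using kw k''(1) unfolding kills_iff[OF comp_hom[OF gD w']] by blast
        then show ?thesis using k''(2) comp_assoc[OF gD w' k''(1)] by simp
      qed
      have Dc1: "Ident T ?D \<boxtimes> c \<in> Hom T (?D \<odot> C) (?D \<odot> (A \<odot> X))" using ten_hom[OF idD A(3)] .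
      have Dg: "Ident T ?D \<boxtimes> g \<in> Hom T (?D \<odot> B) (?D \<odot> C)" using ten_hom[OF idD P(5)] .
      obtain r0 where r0: "r0 \<in> Hom T (?D \<odot> C) ((?D \<odot> A) \<odot> X)" "Assoc T ?D A X \<cdot> r0 = Ident T ?D \<boxtimes> c"
        using A.assoc_lift[OF Do A.ob(1) Xo Dc1] .
      have cg: "c \<cdot> g \<in> Hom T B (A \<odot> X)" using comp_hom[OF P(5) A(3)] .
      note r = comp_hom[OF Dg r0(1)]
      have evX: "Ev T A ?U \<boxtimes> Ident T X \<in> Hom T ((?D \<odot> A) \<odot> X) (?U \<odot> X)" using ten_hom[OF A.ev_hom' ident_hom[OF Xo]] .
      let ?s = "(Ev T A ?U \<boxtimes> Ident T X) \<cdot> r0"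
      have s: "?s \<in> Hom T (?D \<odot> C) (?U \<odot> X)" using comp_hom[OF r0(1) evX] .
      note lX = lunit_iso[OF Xo] and bC = braid_hom[OF Co Do]
      \<comment> \<open>\<open>?k\<close> is the transpose of \<open>c\<close> along the duality of
        \<open>A\<close>. Its vanishing on \<open>g \<boxtimes> Ident T ?D\<close> says that
        \<open>c \<cdot> g\<close> vanishes after evaluation, and \<open>eval_detects_zero\<close>
        removes the evaluation.\<close>
      let ?k = "LUnit T X \<cdot> ?s \<cdot> Braid T C ?D"
      note ls = comp_hom[OF s iso_arr_hom[OF lX]]
      note sDg = comp_hom[OF Dg s]
      have "LUnit T X \<cdot> (?s \<cdot> (Ident T ?D \<boxtimes> g)) \<cdot> Braid T B ?D = ?k \<cdot> (g \<boxtimes> Ident T ?D)"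
        using comp_assoc[OF Dg s iso_arr_hom[OF lX]] comp_assoc[OF braid_hom[OF Bo Do] Dg ls]
          braid_natural[OF P(5) idD] comp_assoc[OF ten_hom[OF P(5) idD] bC ls] by simp
      also have "\<dots> = ZeroM T (B \<odot> ?D) X" using kill[OF comp_hom[OF bC ls]] .
      finally have "LUnit T X \<cdot> (?s \<cdot> (Ident T ?D \<boxtimes> g)) = ZeroM T (?D \<odot> B) X"
        using iso_cancel_right[OF braid_iso[OF Bo Do] comp_hom[OF sDg iso_arr_hom[OF lX]] zero_hom[OF ten_ob[OF Do Bo] Xo]]
          zero_comp[OF braid_hom[OF Bo Do] Xo] by simp
      then have "?s \<cdot> (Ident T ?D \<boxtimes> g) = ZeroM T (?D \<odot> B) (?U \<odot> X)"
        using iso_cancel_left[OF lX sDg zero_hom[OF ten_ob[OF Do Bo] ten_ob[OF unit_ob Xo]]]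
          comp_zero[OF iso_arr_hom[OF lX] ten_ob[OF Do Bo]] by simp
      then have z: "(Ev T A ?U \<boxtimes> Ident T X) \<cdot> (r0 \<cdot> (Ident T ?D \<boxtimes> g)) = ZeroM T (?D \<odot> B) (?U \<odot> X)"
        using comp_assoc[OF Dg r0(1) evX] by simp
      have "Assoc T ?D A X \<cdot> (r0 \<cdot> (Ident T ?D \<boxtimes> g)) = Ident T ?D \<boxtimes> (c \<cdot> g)"
        using comp_assoc[OF Dg r0(1) iso_arr_hom[OF assoc_iso[OF Do A.ob(1) Xo]]] r0(2)
          ten_comp[OF idD idD P(5) A(3)] comp_ident[OF idD] by simp
      then have "c \<cdot> g = ZeroM T B (A \<odot> X)" using A.eval_detects_zero[OF Xo cg r _ z] by blast
      then show "k \<cdot> g = ZeroM T B (Y \<odot> X)"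
        using A(4) comp_assoc[OF P(5) A(3) ten_hom[OF A(2) ident_hom[OF Xo]]]
          comp_zero[OF ten_hom[OF A(2) ident_hom[OF Xo]] Bo] by simp
    qed
  qed
qed

lemma definable_of_closed:
  assumes "serre_ideal T S"
  shows "tensor_closed_definable T (definable_of T S)"
  unfolding tensor_closed_definable_def
  using definable_of_definable[of S] definable_of_tensor[OF assms] assms
  by (auto simp: serre_ideal_def serre_def modTc_simps)

lemma tensor_closed_ob: "tensor_closed_definable T D \<Longrightarrow> D \<subseteq> Ob T"
  by (auto simp: tensor_closed_definable_def definable_def)

lemma definable_of_minimal:
  assumes B: "\<B> \<in> homological_primes T" and D: "tensor_closed_definable T D" "D \<subseteq> definable_of T \<B>"
    and nz: "X \<in> D" "\<not> zero_obj T X"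
  shows "D = definable_of T \<B>"
proof
  have BS: "serre_ideal T \<B>"
    and Bmax: "\<And>S. \<lbrakk>serre_ideal T S; S \<noteq> Ob (modTc T); \<B> \<subseteq> S\<rbrakk> \<Longrightarrow> S = \<B>"
    using B by (auto simp: homological_primes_def)
  have Bf: "\<B> \<subseteq> fin_pres T" using BS by (simp add: serre_ideal_def serre_def modTc_simps)
  note Do = tensor_closed_ob[OF D(1)]
  have id: "serre_ideal T (annihilator D)"
    using annihilator_ideal[OF Do] D(1) by (simp add: tensor_closed_definable_def)
  have sub: "\<B> \<subseteq> annihilator D"
    unfolding annihilator_def using D(2) Bf by (auto simp: definable_of_def ModTc_def)
  obtain K where "cells T K" using cells_ex by blast
  then interpret K: cells T K .
  \<comment> \<open>The reason for properness: a nonzero object receives a nonzero arrow from some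
    compact \<open>A\<close>, and then \<open>yoneda T A\<close> is outside of the
    annihilator.\<close>
  obtain A where A: "A \<in> K" "Hom T A X \<noteq> {ZeroM T A X}" using K.K_generates nz Do by blast
  have Ac: "A \<in> compacts T" using A(1) K.K_compact by blast
  have "yoneda T A \<notin> annihilator D"
  proof
    assume "yoneda T A \<in> annihilator D"
    then have "kills X (Ident T A)" using annihilator_iff[OF Do yoneda_presents[OF Ac]] nz(1) by blast
    then have "f = ZeroM T A X" if "f \<in> Hom T A X" for f
      using that comp_ident[OF that] unfolding kills_iff[OF compact_hom[OF Ac]] by auto
    then show False using A(2) zero_hom[OF compact_ob[OF Ac]] nz(1) Do by blast
  qed
  then have "annihilator D \<noteq> Ob (modTc T)" using yoneda_fin_pres[OF Ac] by (auto simp: modTc_simps)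
  then have eq: "annihilator D = \<B>" using Bmax[OF id _ sub] by blast
  show "D \<subseteq> definable_of T \<B>" by (rule D(2))
  have "definable T D" using D(1) by (simp add: tensor_closed_definable_def)
  then obtain \<Gamma> where \<Gamma>: "\<And>g. g \<in> \<Gamma> \<Longrightarrow> \<exists>W\<in>compacts T. \<exists>B\<in>compacts T. g \<in> Hom T W B"
    "D = {X \<in> Ob T. \<forall>g\<in>\<Gamma>. kills X g}"
    using definable_kills by blast
  show "definable_of T \<B> \<subseteq> D"
  proof
    fix Y assume Y: "Y \<in> definable_of T \<B>"
    have "kills Y g" if g: "g \<in> \<Gamma>" for g
    proof -
      obtain W C where WC: "W \<in> compacts T" "C \<in> compacts T" "g \<in> Hom T W C" using \<Gamma>(1)[OF g] by blast
      \<comment> \<open>A defining condition \<open>g\<close> of \<open>D\<close> is the condition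
        of the module \<open>O.img C W g\<close>, which lies in the annihilator of \<open>D\<close>,
        that is, in \<open>\<B>\<close>.\<close>
      note pI = img_presents[OF WC]
      have "O.img C W g \<in> annihilator D" unfolding annihilator_iff[OF Do pI] using \<Gamma>(2) g by blast
      then show ?thesis using definable_of_kills[OF Y _ pI] eq by blast
    qed
    then show "Y \<in> D" unfolding \<Gamma>(2) using Y by (simp add: definable_of_def)
  qed
qed

end

section \<open>The object attached to a homological prime\<close>

context rigidly_compactly_generated_tt
begin

definition directed_limits :: "('o, 'v) abfun set \<Rightarrow> ('o, 'v) abfun set" where
  "directed_limits S = filtered_colims TYPE('v) O.M S"

lemma directed_limits_contains:
  assumes S: "S \<subseteq> fin_pres T"
  shows "S \<subseteq> directed_limits S"
proof
  fix F assume F: "F \<in> S"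
  then have Fa: "is_abfun Op F" using S fin_pres_abfun by blast
  \<comment> \<open>A filtered category with a single arrow; the constant diagram on it has colimit
    \<open>F\<close>.\<close>
  let ?J = "\<lparr>Ob = {undefined}, Hom = \<lambda>i j. if i = undefined \<and> j = undefined then {undefined} else {},
    Comp = \<lambda>_ _. undefined, Ident = \<lambda>_. undefined\<rparr> :: ('v, 'v) category"
  let ?D = "\<lparr>FOb = \<lambda>_. F, FMor = \<lambda>_. Ident O.M F\<rparr> :: ('v, 'v, ('o, 'v) abfun, ('o, 'v) abnat) ftr"
  note i = O.nat_ident[OF Fa]
  have "category ?J" by unfold_locales (auto split: if_splits)
  then have J: "small_filtered ?J" by (auto simp: small_filtered_def small_finite)
  have ii: "Ident O.M F \<cdot>\<^bsub>O.M\<^esub> Ident O.M F = Ident O.M F" using O.M.ident_comp[OF i] .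
  have D: "is_functor ?J O.M ?D" using i ii Fa by (auto simp: is_functor_def O.M_Ob)
  have "is_colimit ?J O.M ?D F (\<lambda>_. Ident O.M F)"
    unfolding is_colimit_def
  proof (intro conjI allI impI)
    show "is_cocone ?J O.M ?D F (\<lambda>_. Ident O.M F)" using i ii Fa by (auto simp: is_cocone_def O.M_Ob)
    fix Y \<mu> assume "is_cocone ?J O.M ?D Y \<mu>"
    then have m: "\<mu> undefined \<in> Hom O.M F Y" by (simp add: is_cocone_def)
    show "\<exists>!u. u \<in> Hom O.M F Y \<and> (\<forall>j\<in>Ob ?J. u \<cdot>\<^bsub>O.M\<^esub> Ident O.M F = \<mu> j)"
      by (rule ex1I[of _ "\<mu> undefined"]) (use m O.M.comp_ident in auto)
  qed
  then show "F \<in> directed_limits S"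
    unfolding directed_limits_def filtered_colims_def using J D F by force
qed

lemma directed_limits_abfun: "X \<in> directed_limits S \<Longrightarrow> is_abfun Op X"
  by (auto simp: directed_limits_def filtered_colims_def is_colimit_def is_cocone_def O.M_Ob)

text \<open>The union of the images of the colimit cocone is a subfunctor through which the cocone factors.\<close>

lemma directed_limits_element:
  assumes X: "X \<in> directed_limits S" and A: "A \<in> compacts T" and z: "z \<in> carrier (FOb X A)"
  obtains F \<kappa> y where "F \<in> S" "\<kappa> \<in> Hom O.M F X" "y \<in> carrier (FOb F A)" "z = component \<kappa> A y"
proof -
  obtain J :: "('v, 'v) category" and D \<kappa> where J: "small_filtered J" and D: "is_functor J O.M D"
    and DS: "\<forall>j\<in>Ob J. FOb D j \<in> S" and col: "is_colimit J O.M D X \<kappa>"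
    using X unfolding directed_limits_def filtered_colims_def by blast
  have cocone: "is_cocone J O.M D X \<kappa>" using col by (simp add: is_colimit_def)
  then have \<kappa>: "\<And>j. j \<in> Ob J \<Longrightarrow> \<kappa> j \<in> Hom O.M (FOb D j) X"
    and \<kappa>n: "\<And>i j f. f \<in> Hom J i j \<Longrightarrow> \<kappa> j \<cdot>\<^bsub>O.M\<^esub> FMor D f = \<kappa> i"
    by (simp_all add: is_cocone_def)
  interpret J: category J using J by (simp add: small_filtered_def)
  have J0: "Ob J \<noteq> {}" and J2: "\<And>i j. \<lbrakk>i \<in> Ob J; j \<in> Ob J\<rbrakk> \<Longrightarrow> \<exists>k. Hom J i k \<noteq> {} \<and> Hom J j k \<noteq> {}"
    using J by (simp_all add: small_filtered_def)
  have Dm: "FMor D f \<in> Hom O.M (FOb D i) (FOb D j)" if "f \<in> Hom J i j" for f i j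
    using D that by (simp add: is_functor_def)
  note Xa = directed_limits_abfun[OF X]
  define V where "V A = (\<Union>j\<in>Ob J. component (\<kappa> j) A ` carrier (FOb (FOb D j) A))" for A
  have V_I: "component (\<kappa> j) A a \<in> V A" if "j \<in> Ob J" "a \<in> carrier (FOb (FOb D j) A)" for j A a
    using that by (auto simp: V_def)
  have V_E: "\<exists>j a. j \<in> Ob J \<and> a \<in> carrier (FOb (FOb D j) A) \<and> v = component (\<kappa> j) A a" if "v \<in> V A" for v A
    using that by (auto simp: V_def)
  have sub: "subgroup (V A) (FOb X A)" if A: "A \<in> Ob Op" for A
  proof -
    interpret G: group "FOb X A" using O.ab_group[OF Xa A] .
    show ?thesis
    proof (rule G.subgroupI)
      show "V A \<subseteq> carrier (FOb X A)" using O.nat_closed[OF \<kappa> A] by (auto simp: V_def)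
      obtain j where j: "j \<in> Ob J" using J0 by blast
      show "V A \<noteq> {}" using V_I[OF j O.ab_one_closed[OF O.nat_abfun(1)[OF \<kappa>[OF j]] A]] by blast
      show "inv\<^bsub>FOb X A\<^esub> v \<in> V A" if v: "v \<in> V A" for v
      proof -
        obtain j a where ja: "j \<in> Ob J" "a \<in> carrier (FOb (FOb D j) A)" "v = component (\<kappa> j) A a" using V_E[OF v] by blast
        interpret Dj: group "FOb (FOb D j) A" using O.ab_group[OF O.nat_abfun(1)[OF \<kappa>[OF ja(1)]] A] .
        interpret h: group_hom "FOb (FOb D j) A" "FOb X A" "component (\<kappa> j) A"
          using O.nat_hom[OF \<kappa>[OF ja(1)] A] by (simp add: group_hom_def group_hom_axioms_def Dj.is_group G.is_group)
        have "inv\<^bsub>FOb X A\<^esub> v = component (\<kappa> j) A (inv\<^bsub>FOb (FOb D j) A\<^esub> a)" using ja(2,3) by simp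
        then show ?thesis using V_I[OF ja(1) Dj.inv_closed[OF ja(2)]] by simp
      qed
      show "v \<otimes>\<^bsub>FOb X A\<^esub> v' \<in> V A" if v: "v \<in> V A" and v': "v' \<in> V A" for v v'
      proof -
        obtain i a where ia: "i \<in> Ob J" "a \<in> carrier (FOb (FOb D i) A)" "v = component (\<kappa> i) A a" using V_E[OF v] by blast
        obtain j b where jb: "j \<in> Ob J" "b \<in> carrier (FOb (FOb D j) A)" "v' = component (\<kappa> j) A b" using V_E[OF v'] by blast
        \<comment> \<open>Filteredness moves both elements to a common stage, where they can be
          multiplied.\<close>
        obtain k f g where k: "f \<in> Hom J i k" "g \<in> Hom J j k" using J2[OF ia(1) jb(1)] by blast
        have ko: "k \<in> Ob J" using k J.hom_objects by blast
        let ?a = "component (FMor D f) A a" and ?b = "component (FMor D g) A b"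
        have a': "?a \<in> carrier (FOb (FOb D k) A)" using O.nat_closed[OF Dm[OF k(1)] A ia(2)] .
        have b': "?b \<in> carrier (FOb (FOb D k) A)" using O.nat_closed[OF Dm[OF k(2)] A jb(2)] .
        have va: "v = component (\<kappa> k) A ?a"
          using O.comp_component[OF Dm[OF k(1)] A ia(2), of "\<kappa> k"] \<kappa>n[OF k(1)] ia(3) by simp
        have vb: "v' = component (\<kappa> k) A ?b"
          using O.comp_component[OF Dm[OF k(2)] A jb(2), of "\<kappa> k"] \<kappa>n[OF k(2)] jb(3) by simp
        have "?a \<otimes>\<^bsub>FOb (FOb D k) A\<^esub> ?b \<in> carrier (FOb (FOb D k) A)"
          using O.ab_group[OF O.nat_abfun(1)[OF \<kappa>[OF ko]] A] a' b' by (simp add: Group.group_def monoid.m_closed)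
        then show ?thesis using O.nat_mult[OF \<kappa>[OF ko] A a' b'] va vb V_I[OF ko] by metis
      qed
    qed
  qed
  define Y where "Y = \<lparr>FOb = \<lambda>A. (FOb X A)\<lparr>carrier := V A\<rparr>, FMor = FMor X\<rparr>"
  have YS: "carrier (FOb Y A) = V A" "\<one>\<^bsub>FOb Y A\<^esub> = \<one>\<^bsub>FOb X A\<^esub>" "monoid.mult (FOb Y A) = monoid.mult (FOb X A)" "FMor Y = FMor X" for A
    by (simp_all add: Y_def)
  have VX: "v \<in> carrier (FOb X A)" if "A \<in> Ob Op" "v \<in> V A" for v A
    using subgroup.subset[OF sub[OF that(1)]] that(2) by blast
  have act: "FMor X f v \<in> V B" if f: "f \<in> Hom Op A B" and v: "v \<in> V A" for f A B v
  proof -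
    obtain j a where ja: "j \<in> Ob J" "a \<in> carrier (FOb (FOb D j) A)" "v = component (\<kappa> j) A a" using V_E[OF v] by blast
    show ?thesis
      using O.nat_natural[OF \<kappa>[OF ja(1)] f ja(2)] ja(3) V_I[OF ja(1) O.ab_closed[OF O.nat_abfun(1)[OF \<kappa>[OF ja(1)]] f ja(2)]] by simp
  qed
  have Ya: "is_abfun Op Y"
    unfolding is_abfun_def
  proof (intro conjI ballI allI)
    fix A assume A: "A \<in> Ob Op"
    show "comm_group (FOb Y A)"
    proof (rule group.group_comm_groupI)
      show "Group.group (FOb Y A)"
        using subgroup.subgroup_is_group[OF sub[OF A] O.ab_group[OF Xa A]] by (simp add: Y_def)
      show "x \<otimes>\<^bsub>FOb Y A\<^esub> y = y \<otimes>\<^bsub>FOb Y A\<^esub> x" if "x \<in> carrier (FOb Y A)" "y \<in> carrier (FOb Y A)" for x y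
        using comm_monoid.m_comm[OF comm_group.axioms(1)[OF O.ab_comm_group[OF Xa A]] VX[OF A] VX[OF A], of x y] that
        by (simp add: YS)
    qed
    show "small TYPE('v) (carrier (FOb Y A))"
      using small_subset[OF O.ab_small[OF Xa A]] VX[OF A] by (auto simp: YS)
    show "FMor Y (Ident Op A) v = v" if "v \<in> carrier (FOb Y A)" for v
      using O.ab_ident[OF Xa A VX[OF A]] that by (simp add: YS)
  next
    fix A B f assume f: "f \<in> Hom Op A B"
    have A: "A \<in> Ob Op" using f O.hom_objects by blast
    show "FMor Y f \<in> hom (FOb Y A) (FOb Y B)"
      by (rule homI) (use act[OF f] hom_mult[OF O.ab_hom[OF Xa f] VX[OF A] VX[OF A]] in \<open>simp_all add: YS\<close>)
    show "FMor Y (g \<cdot>\<^bsub>Op\<^esub> f) v = FMor Y g (FMor Y f v)" if "g \<in> Hom Op B E" "v \<in> carrier (FOb Y A)" for g E v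
      using O.ab_comp[OF Xa f that(1) VX[OF A]] that(2) by (simp add: YS)
    show "FMor Y (PlusM Op f g) v = FMor Y f v \<otimes>\<^bsub>FOb Y B\<^esub> FMor Y g v" if "g \<in> Hom Op A B" "v \<in> carrier (FOb Y A)" for g v
      using O.ab_plus[OF Xa f that(1) VX[OF A]] that(2) by (simp add: YS)
  qed
  define \<mu> where "\<mu> j = O.nat_of (FOb D j) Y (component (\<kappa> j))" for j
  have \<mu>h: "component (\<kappa> j) A \<in> hom (FOb (FOb D j) A) (FOb Y A)" if "j \<in> Ob J" "A \<in> Ob Op" for j A
    by (rule homI) (use V_I[OF that(1)] O.nat_mult[OF \<kappa>[OF that(1)] that(2)] in \<open>simp_all add: YS\<close>)
  have \<mu>: "\<mu> j \<in> Hom O.M (FOb D j) Y" if "j \<in> Ob J" for j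
    unfolding \<mu>_def
    by (rule O.nat_of(1)[OF O.nat_abfun(1)[OF \<kappa>[OF that]] Ya \<mu>h[OF that]]) (use O.nat_natural[OF \<kappa>[OF that]] in \<open>simp_all add: YS(4)\<close>)
  have \<mu>c: "component (\<mu> j) A a = component (\<kappa> j) A a" if "j \<in> Ob J" "A \<in> Ob Op" "a \<in> carrier (FOb (FOb D j) A)" for j A a
    unfolding \<mu>_def
    by (rule O.nat_of(2)[OF O.nat_abfun(1)[OF \<kappa>[OF that(1)]] Ya \<mu>h[OF that(1)]])
      (use O.nat_natural[OF \<kappa>[OF that(1)]] that in \<open>simp_all add: YS(4)\<close>)
  have "is_cocone J O.M D Y \<mu>"
    unfolding is_cocone_def
  proof (intro conjI ballI allI)
    show "Y \<in> Ob O.M" using Ya by (simp add: O.M_Ob)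
    show "\<mu> j \<in> Hom O.M (FOb D j) Y" if "j \<in> Ob J" for j using \<mu>[OF that] .
    fix i j f assume f: "f \<in> Hom J i j"
    have ij: "i \<in> Ob J" "j \<in> Ob J" using f J.hom_objects by blast+
    show "\<mu> j \<cdot>\<^bsub>O.M\<^esub> FMor D f = \<mu> i"
    proof (rule O.nat_ext[OF O.nat_comp[OF Dm[OF f] \<mu>[OF ij(2)]] \<mu>[OF ij(1)]])
      fix A a assume A: "A \<in> Ob Op" and a: "a \<in> carrier (FOb (FOb D i) A)"
      show "component (\<mu> j \<cdot>\<^bsub>O.M\<^esub> FMor D f) A a = component (\<mu> i) A a"
        using O.comp_component[OF Dm[OF f] A a, of "\<mu> j"] O.comp_component[OF Dm[OF f] A a, of "\<kappa> j"] \<kappa>n[OF f]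
          \<mu>c[OF ij(2) A O.nat_closed[OF Dm[OF f] A a]] \<mu>c[OF ij(1) A a] by simp
    qed
  qed
  then obtain u where u: "u \<in> Hom O.M X Y" "\<forall>j\<in>Ob J. u \<cdot>\<^bsub>O.M\<^esub> \<kappa> j = \<mu> j"
    using col unfolding is_colimit_def by blast
  define \<iota> where "\<iota> = O.nat_of Y X (\<lambda>A v. v)"
  have ih: "(\<lambda>v. v) \<in> hom (FOb Y A) (FOb X A)" if "A \<in> Ob Op" for A
    by (rule homI) (use VX[OF that] in \<open>simp_all add: YS\<close>)
  have \<iota>: "\<iota> \<in> Hom O.M Y X"
    unfolding \<iota>_def by (rule O.nat_of(1)[OF Ya Xa ih]) (simp_all add: YS)
  have \<iota>c: "component \<iota> A v = v" if "A \<in> Ob Op" "v \<in> carrier (FOb Y A)" for A v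
    unfolding \<iota>_def by (rule O.nat_of(2)[OF Ya Xa ih]) (use that in \<open>simp_all add: YS\<close>)
  have iu: "(\<iota> \<cdot>\<^bsub>O.M\<^esub> u) \<cdot>\<^bsub>O.M\<^esub> \<kappa> j = \<kappa> j" if j: "j \<in> Ob J" for j
  proof (rule O.nat_ext[OF O.nat_comp[OF \<kappa>[OF j] O.nat_comp[OF u(1) \<iota>]] \<kappa>[OF j]])
    fix A a assume A: "A \<in> Ob Op" and a: "a \<in> carrier (FOb (FOb D j) A)"
    have "component (u \<cdot>\<^bsub>O.M\<^esub> \<kappa> j) A a = component (\<kappa> j) A a" using u(2) j \<mu>c[OF j A a] by simp
    then show "component (\<iota> \<cdot>\<^bsub>O.M\<^esub> u \<cdot>\<^bsub>O.M\<^esub> \<kappa> j) A a = component (\<kappa> j) A a"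
      using O.comp_component[OF \<kappa>[OF j] A a] O.comp_component[OF u(1) A O.nat_closed[OF \<kappa>[OF j] A a]]
        \<iota>c[OF A] V_I[OF j a] by (simp add: YS(1))
  qed
  \<comment> \<open>The composite of \<open>u\<close> and \<open>\<iota>\<close> is compatible with
    the cocone, so it is the identity of \<open>X\<close>; every element of \<open>X\<close> then
    lies in the subfunctor.\<close>
  have "\<exists>!v. v \<in> Hom O.M X X \<and> (\<forall>j\<in>Ob J. v \<cdot>\<^bsub>O.M\<^esub> \<kappa> j = \<kappa> j)"
    using col cocone unfolding is_colimit_def by blast
  then have "\<iota> \<cdot>\<^bsub>O.M\<^esub> u = Ident O.M X"
    using O.nat_comp[OF u(1) \<iota>] O.nat_ident[OF Xa] iu O.M.ident_comp[OF \<kappa>] by metis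
  then have "component \<iota> A (component u A z) = z"
    using O.comp_component[OF u(1) _ z, of \<iota>] O.ident_component[OF _ z] A by simp
  moreover have uz: "component u A z \<in> carrier (FOb Y A)" using O.nat_closed[OF u(1) _ z] A by simp
  ultimately have "z \<in> V A" using \<iota>c[OF _ uz] A by (simp add: YS(1))
  then obtain j a where ja: "j \<in> Ob J" "a \<in> carrier (FOb (FOb D j) A)" "z = component (\<kappa> j) A a" using V_E by blast
  show thesis using that[OF _ \<kappa>[OF ja(1)] ja(2,3)] DS ja(1) by blast
qed

subsection \<open>The unit lies outside of a proper Serre ideal\<close>

text \<open>A bilinear family out of \<open>yoneda T (Unit T)\<close> is determined by its values at
  the identity of the unit, and \<open>LUnit\<close> removes the tensor factor. In consequence a
  Serre ideal that contains the unit contains every finitely presented module.\<close>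

lemma unit_day_tensor:
  assumes G: "is_abfun Op G"
  shows "is_day_tensor T (yoneda T (Unit T)) G G"
proof -
  let ?U = "Unit T"
  note U = unit_ob and Uc = unit_compact and idU = ident_hom[OF unit_ob]
  define \<beta> where "\<beta> A B x = FMor G (LUnit T B \<cdot> (x \<boxtimes> Ident T B))" for A B :: 'o and x
  have lx: "LUnit T B \<cdot> (x \<boxtimes> Ident T B) \<in> Hom T (A \<odot> B) B" if "x \<in> Hom T A ?U" "B \<in> compacts T" for x A B
    using comp_hom[OF ten_hom[OF that(1) compact_hom[OF that(2)]] iso_arr_hom[OF lunit_iso[OF compact_ob[OF that(2)]]]] .
  have lxO: "LUnit T B \<cdot> (x \<boxtimes> Ident T B) \<in> Hom Op B (A \<odot> B)" if "A \<in> compacts T" "x \<in> Hom T A ?U" "B \<in> compacts T" for x A B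
    using lx[OF that(2,3)] compact_tensor that by simp
  have bil: "day_bilinear T (yoneda T ?U) G G \<beta>"
    unfolding day_bilinear_def
  proof (intro conjI ballI)
    fix A B x assume AB: "A \<in> compacts T" "B \<in> compacts T" and x: "x \<in> carrier (FOb (yoneda T ?U) A)"
    show "\<beta> A B x \<in> hom (FOb G B) (FOb G (A \<odot> B))"
      unfolding \<beta>_def using O.ab_hom[OF G lxO[OF AB(1) _ AB(2)]] x by simp
  next
    fix A B y assume AB: "A \<in> compacts T" "B \<in> compacts T" and y: "y \<in> carrier (FOb G B)"
    show "(\<lambda>x. \<beta> A B x y) \<in> hom (FOb (yoneda T ?U) A) (FOb G (A \<odot> B))"
    proof (rule homI)
      fix x x' assume "x \<in> carrier (FOb (yoneda T ?U) A)" "x' \<in> carrier (FOb (yoneda T ?U) A)"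
      then have x: "x \<in> Hom T A ?U" "x' \<in> Hom T A ?U" by simp_all
      show "\<beta> A B x y \<in> carrier (FOb G (A \<odot> B))"
        unfolding \<beta>_def using O.ab_closed[OF G lxO[OF AB(1) x(1) AB(2)] y] .
      have "LUnit T B \<cdot> ((x \<^bold>+ x') \<boxtimes> Ident T B) = LUnit T B \<cdot> (x \<boxtimes> Ident T B) \<^bold>+ LUnit T B \<cdot> (x' \<boxtimes> Ident T B)"
        using ten_plus_left[OF x compact_hom[OF AB(2)]]
          comp_plus_right[OF ten_hom[OF x(1) compact_hom[OF AB(2)]] ten_hom[OF x(2) compact_hom[OF AB(2)]]
            iso_arr_hom[OF lunit_iso[OF compact_ob[OF AB(2)]]]] by simp
      then show "\<beta> A B (x \<otimes>\<^bsub>FOb (yoneda T ?U) A\<^esub> x') y = \<beta> A B x y \<otimes>\<^bsub>FOb G (A \<odot> B)\<^esub> \<beta> A B x' y"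
        unfolding \<beta>_def using O.ab_plus[OF G lxO[OF AB(1) x(1) AB(2)] lxO[OF AB(1) x(2) AB(2)] y] by simp
    qed
  next
    fix A A' B B' f g x y
    assume AB: "A \<in> compacts T" "A' \<in> compacts T" "B \<in> compacts T" "B' \<in> compacts T"
      and f: "f \<in> Hom T A' A" and g: "g \<in> Hom T B' B" and x': "x \<in> carrier (FOb (yoneda T ?U) A)" and y: "y \<in> carrier (FOb G B)"
    have x: "x \<in> Hom T A ?U" using x' by simp
    note xf = comp_hom[OF f x]
    note idB = compact_hom[OF AB(3)] and idB' = compact_hom[OF AB(4)]
    note l = iso_arr_hom[OF lunit_iso[OF compact_ob[OF AB(3)]]] and l' = iso_arr_hom[OF lunit_iso[OF compact_ob[OF AB(4)]]]
    have "g \<cdot> (LUnit T B' \<cdot> ((x \<cdot> f) \<boxtimes> Ident T B')) = LUnit T B \<cdot> ((Ident T ?U \<boxtimes> g) \<cdot> ((x \<cdot> f) \<boxtimes> Ident T B'))"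
      using comp_assoc[OF ten_hom[OF xf idB'] l' g] lunit_natural[OF g] comp_assoc[OF ten_hom[OF xf idB'] ten_hom[OF idU g] l] by simp
    also have "(Ident T ?U \<boxtimes> g) \<cdot> ((x \<cdot> f) \<boxtimes> Ident T B') = (x \<boxtimes> Ident T B) \<cdot> (f \<boxtimes> g)"
      using ten_comp[OF xf idU idB' g] ten_comp[OF f x g idB] ident_comp[OF xf] comp_ident[OF g] ident_comp[OF g] by simp
    finally have e: "g \<cdot> (LUnit T B' \<cdot> ((x \<cdot> f) \<boxtimes> Ident T B')) = (LUnit T B \<cdot> (x \<boxtimes> Ident T B)) \<cdot> (f \<boxtimes> g)"
      using comp_assoc[OF ten_hom[OF f g] ten_hom[OF x idB] l] by simp
    have gO: "g \<in> Hom Op B B'" and fgO: "f \<boxtimes> g \<in> Hom Op (A \<odot> B) (A' \<odot> B')"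
      using g ten_hom[OF f g] AB compact_tensor by simp_all
    show "\<beta> A' B' (FMor (yoneda T ?U) f x) (FMor G g y) = FMor G (f \<boxtimes> g) (\<beta> A B x y)"
      unfolding \<beta>_def
      using O.ab_comp[OF G gO lxO[OF AB(2) xf AB(4)] y] O.ab_comp[OF G lxO[OF AB(1) x AB(3)] fgO y] e by simp
  qed
  show ?thesis
    unfolding is_day_tensor_def ModTc_def
  proof (intro conjI exI[of _ \<beta>] ballI allI impI)
    show "G \<in> Ob O.M" using G by (simp add: O.M_Ob)
    show "day_bilinear T (yoneda T ?U) G G \<beta>" by (rule bil)
    fix K \<gamma> assume K: "K \<in> Ob O.M" and \<gamma>: "day_bilinear T (yoneda T ?U) G K \<gamma>"
    have Ka: "is_abfun Op K" using K by (simp add: O.M_Ob)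
    have idc: "Ident T ?U \<in> carrier (FOb (yoneda T ?U) ?U)" using idU by simp
    let ?l = "\<lambda>B. inv_arr T (LUnit T B)"
    define \<eta> where "\<eta> B y = FMor K (?l B) (\<gamma> ?U B (Ident T ?U) y)" for B y
    have lO: "?l B \<in> Hom Op (?U \<odot> B) B" if "B \<in> compacts T" for B
      using inv_arr(1)[OF lunit_iso[OF compact_ob[OF that]]] that compact_tensor[OF Uc that] by simp
    have hom: "\<eta> B \<in> hom (FOb G B) (FOb K B)" if "B \<in> Ob Op" for B
    proof -
      have B: "B \<in> compacts T" using that by simp
      have "FMor K (?l B) \<circ> \<gamma> ?U B (Ident T ?U) \<in> hom (FOb G B) (FOb K B)"
        using Group.hom_compose[OF bilinearD(1)[OF \<gamma> Uc B idc] O.ab_hom[OF Ka lO[OF B]]] .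
      then show ?thesis by (simp add: \<eta>_def[abs_def] o_def)
    qed
    have nat: "\<eta> B' (FMor G h y) = FMor K h (\<eta> B y)" if h': "h \<in> Hom Op B B'" and y: "y \<in> carrier (FOb G B)" for B B' h y
    proof -
      note h = Op_HomD[OF h']
      note c = bilinear_closed[OF \<gamma> Uc h(2) idc y]
      have Uh: "Ident T ?U \<boxtimes> h \<in> Hom Op (?U \<odot> B) (?U \<odot> B')" using ten_hom[OF idU h(1)] compact_tensor Uc h by simp
      have "(Ident T ?U \<boxtimes> h) \<cdot> ?l B' = ?l B \<cdot> h"
        by (rule inv_natural[OF lunit_iso[OF compact_ob[OF h(3)]] lunit_iso[OF compact_ob[OF h(2)]] ten_hom[OF idU h(1)] h(1)
              lunit_natural[OF h(1)]])
      moreover have "\<gamma> ?U B' (Ident T ?U) (FMor G h y) = FMor K (Ident T ?U \<boxtimes> h) (\<gamma> ?U B (Ident T ?U) y)"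
        using bilinearD(3)[OF \<gamma> Uc h(2) Uc h(3) idU h(1) idc y] comp_ident[OF idU] by simp
      ultimately show ?thesis
        unfolding \<eta>_def using O.ab_comp[OF Ka Uh lO[OF h(3)] c] O.ab_comp[OF Ka lO[OF h(2)] h' c] by simp
    qed
    let ?\<phi> = "O.nat_of G K \<eta>"
    have \<phi>: "?\<phi> \<in> Hom O.M G K" by (rule O.nat_of(1)[OF G Ka]) (use hom nat in auto)
    have \<phi>c: "component ?\<phi> B y = \<eta> B y" if "B \<in> compacts T" "y \<in> carrier (FOb G B)" for B y
      by (rule O.nat_of(2)[OF G Ka]) (use hom nat that in auto)
    show "\<exists>!\<phi>. \<phi> \<in> Hom O.M G K \<and> (\<forall>A\<in>compacts T. \<forall>B\<in>compacts T. \<forall>x\<in>carrier (FOb (yoneda T ?U) A). \<forall>y\<in>carrier (FOb G B).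
        component \<phi> (A \<odot> B) (\<beta> A B x y) = \<gamma> A B x y)"
    proof (rule ex1I[of _ ?\<phi>], intro conjI ballI)
      show "?\<phi> \<in> Hom O.M G K" by (rule \<phi>)
      fix A B x y assume AB: "A \<in> compacts T" "B \<in> compacts T" and x': "x \<in> carrier (FOb (yoneda T ?U) A)" and y: "y \<in> carrier (FOb G B)"
      have x: "x \<in> Hom T A ?U" using x' by simp
      note idB = compact_hom[OF AB(2)]
      note L = lunit_iso[OF compact_ob[OF AB(2)]]
      note c = bilinear_closed[OF \<gamma> Uc AB(2) idc y]
      have "component ?\<phi> (A \<odot> B) (\<beta> A B x y) = FMor K (LUnit T B \<cdot> (x \<boxtimes> Ident T B)) (\<eta> B y)"
        unfolding \<beta>_def using O.nat_natural[OF \<phi> lxO[OF AB(1) x AB(2)] y] \<phi>c[OF AB(2) y] by simp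
      also have "\<dots> = FMor K (?l B \<cdot> (LUnit T B \<cdot> (x \<boxtimes> Ident T B))) (\<gamma> ?U B (Ident T ?U) y)"
        unfolding \<eta>_def using O.ab_comp[OF Ka lO[OF AB(2)] lxO[OF AB(1) x AB(2)] c] by simp
      also have "?l B \<cdot> (LUnit T B \<cdot> (x \<boxtimes> Ident T B)) = x \<boxtimes> Ident T B"
        using inv_cancel(1)[OF L, of "x \<boxtimes> Ident T B"] ten_hom[OF x idB] by (simp add: hom_char)
      also have "FMor K (x \<boxtimes> Ident T B) (\<gamma> ?U B (Ident T ?U) y) = \<gamma> A B x y"
        using bilinearD(3)[OF \<gamma> Uc AB(2) AB x idB idc y] ident_comp[OF x] O.ab_ident[OF G _ y] AB(2) by simp
      finally show "component ?\<phi> (A \<odot> B) (\<beta> A B x y) = \<gamma> A B x y" .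
    next
      fix \<psi> assume \<psi>: "\<psi> \<in> Hom O.M G K \<and> (\<forall>A\<in>compacts T. \<forall>B\<in>compacts T. \<forall>x\<in>carrier (FOb (yoneda T ?U) A). \<forall>y\<in>carrier (FOb G B).
        component \<psi> (A \<odot> B) (\<beta> A B x y) = \<gamma> A B x y)"
      show "\<psi> = ?\<phi>"
      proof (rule O.nat_ext[OF _ \<phi>])
        show "\<psi> \<in> Hom O.M G K" using \<psi> by blast
        fix B y assume B': "B \<in> Ob Op" and y: "y \<in> carrier (FOb G B)"
        have B: "B \<in> compacts T" using B' by simp
        note L = lunit_iso[OF compact_ob[OF B]]
        have LO: "LUnit T B \<in> Hom Op B (?U \<odot> B)" using iso_arr_hom[OF L] B compact_tensor[OF Uc B] by simp
        have psi: "\<psi> \<in> Hom O.M G K" using \<psi> by blast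
        have "\<beta> ?U B (Ident T ?U) y = FMor G (LUnit T B) y"
          unfolding \<beta>_def using ten_ident[OF U compact_ob[OF B]] comp_ident[OF iso_arr_hom[OF L]] by simp
        then have "FMor K (LUnit T B) (component \<psi> B y) = \<gamma> ?U B (Ident T ?U) y"
          using \<psi> Uc B idc y O.nat_natural[OF psi LO y] by metis
        then have "\<eta> B y = FMor K (LUnit T B \<cdot> ?l B) (component \<psi> B y)"
          unfolding \<eta>_def using O.ab_comp[OF Ka LO lO[OF B] O.nat_closed[OF psi B' y]] by simp
        also have "\<dots> = component \<psi> B y"
          using inv_arr(3)[OF L] O.ab_ident[OF Ka B' O.nat_closed[OF psi B' y]] by simp
        finally show "component \<psi> B y = component ?\<phi> B y" using \<phi>c[OF B y] by simp
      qed
    qed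
  qed
qed

text \<open>For any \<open>F\<close> in \<open>S\<close> the sequence from \<open>Z\<close> through
  \<open>F\<close> to \<open>F\<close>, with the identity as second arrow, is exact.\<close>

lemma serre_zero:
  assumes S: "serre (modTc T) S" and Z: "Z \<in> fin_pres T" "zero_obj O.M Z"
  shows "Z \<in> S"
proof -
  obtain F where F: "F \<in> S" using S by (auto simp: serre_def)
  then have Ff: "F \<in> fin_pres T" using S by (auto simp: serre_def modTc_simps)
  note Fa = fin_pres_abfun[OF Ff] and Za = fin_pres_abfun[OF Z(1)]
  note zo = Z(2)[unfolded O.zero_obj_M]
  note i = O.nat_ident[OF Fa] and zf = O.zero_nat(1)[OF Za Fa]
  have im: "Ident O.M F \<in> Hom (modTc T) F F" using modTc_HomI[OF Ff Ff i] .
  have zm: "O.zero_nat Z F \<in> Hom (modTc T) Z F" using modTc_HomI[OF Z(1) Ff zf] .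
  have iz: "\<phi> \<cdot>\<^bsub>O.M\<^esub> O.zero_nat Z F = O.zero_nat Z X" if \<phi>: "\<phi> \<in> Hom O.M F X" for \<phi> X
    by (rule O.nat_ext[OF O.nat_comp[OF zf \<phi>] O.zero_nat(1)[OF Za O.nat_abfun(2)[OF \<phi>]]])
      (use O.comp_component[OF zf] O.zero_nat(2)[OF Za Fa] O.nat_one[OF \<phi>] O.zero_nat(2)[OF Za O.nat_abfun(2)[OF \<phi>]] in simp)
  have zz: "zero_arr (modTc T) Z X (\<phi> \<cdot>\<^bsub>O.M\<^esub> O.zero_nat Z F)" if \<phi>: "\<phi> \<in> Hom (modTc T) F X" for \<phi> X
    unfolding iz[OF modTc_HomD(1)[OF \<phi>]]
    using zero_arr_modTc[OF modTc_HomI[OF Z(1) modTc_HomD(3)[OF \<phi>]]] O.zero_nat(1)[OF Za fin_pres_abfun[OF modTc_HomD(3)[OF \<phi>]]]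
      O.zero_arr_zero_nat[OF Za fin_pres_abfun[OF modTc_HomD(3)[OF \<phi>]]] by simp
  have "short_exact (modTc T) Z (O.zero_nat Z F) F (Ident O.M F) F"
    unfolding short_exact_def is_kernel_def is_cokernel_def modTc_simps(3)
  proof (intro conjI allI ballI impI)
    fix X \<phi> assume \<phi>: "\<phi> \<in> Hom (modTc T) X F" and z: "zero_arr (modTc T) X F (Ident O.M F \<cdot>\<^bsub>O.M\<^esub> \<phi>)"
    note X = modTc_HomD[OF \<phi>]
    have "zero_arr O.M X F \<phi>" using z O.M.ident_comp[OF X(1)] zero_arr_modTc[OF \<phi>] by simp
    then have \<phi>0: "\<phi> = O.zero_nat X F" using O.zero_arr_eq[OF X(1)] by blast
    note Xa = fin_pres_abfun[OF X(2)]
    note zx = O.zero_nat(1)[OF Xa Za]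
    have "O.zero_nat Z F \<cdot>\<^bsub>O.M\<^esub> O.zero_nat X Z = \<phi>"
      unfolding \<phi>0 by (rule O.nat_ext[OF O.nat_comp[OF zx zf] O.zero_nat(1)[OF Xa Fa]])
        (use O.comp_component[OF zx] O.zero_nat(2)[OF Za Fa] O.nat_closed[OF zx] O.zero_nat(2)[OF Xa Fa] in simp)
    moreover have "u = O.zero_nat X Z" if u: "u \<in> Hom (modTc T) X Z" for u
      by (rule O.nat_ext[OF modTc_HomD(1)[OF u] zx])
        (use O.nat_closed[OF modTc_HomD(1)[OF u]] zo O.zero_nat(2)[OF Xa Za] in auto)
    ultimately show "\<exists>!u. u \<in> Hom (modTc T) X Z \<and> O.zero_nat Z F \<cdot>\<^bsub>O.M\<^esub> u = \<phi>"
      using modTc_HomI[OF X(2) Z(1) zx] by blast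
  next
    fix X \<phi> assume \<phi>: "\<phi> \<in> Hom (modTc T) F X"
    show "\<exists>!u. u \<in> Hom (modTc T) F X \<and> u \<cdot>\<^bsub>O.M\<^esub> Ident O.M F = \<phi>"
    proof (rule ex1I[of _ \<phi>])
      show "\<phi> \<in> Hom (modTc T) F X \<and> \<phi> \<cdot>\<^bsub>O.M\<^esub> Ident O.M F = \<phi>"
        using \<phi> O.M.comp_ident[OF modTc_HomD(1)[OF \<phi>]] by (rule conjI)
      show "u = \<phi>" if "u \<in> Hom (modTc T) F X \<and> u \<cdot>\<^bsub>O.M\<^esub> Ident O.M F = \<phi>" for u
        using that O.M.comp_ident[OF modTc_HomD(1)[OF conjunct1[OF that]]] by metis
    qed
  qed (use im zm zz[OF im] in simp_all)
  then show ?thesis using S F unfolding serre_def by blast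
qed

text \<open>A retract is a subobject: \<open>s\<close> is the kernel of its cokernel, the module
  built by \<open>cokernel_module\<close>, and \<open>S\<close> is closed under subobjects.\<close>

lemma serre_retract:
  assumes S: "serre (modTc T) S" and F: "F \<in> S" and A: "A \<in> compacts T"
    and s: "s \<in> Hom O.M (yoneda T A) F" and r: "r \<in> Hom O.M F (yoneda T A)" and rs: "r \<cdot>\<^bsub>O.M\<^esub> s = Ident O.M (yoneda T A)"
  shows "yoneda T A \<in> S"
proof -
  let ?y = "yoneda T A"
  have Ff: "F \<in> fin_pres T" using S F by (auto simp: serre_def modTc_simps)
  note yf = yoneda_fin_pres[OF A]
  note ya = fin_pres_abfun[OF yf] and Fa = fin_pres_abfun[OF Ff]
  obtain B x C g where pF: "presents F B x C g" using fin_pres_presents[OF Ff] .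
  note P = presentsD[OF pF]
  obtain E w \<rho> where pI: "presents (O.img E B w) B w E w" and \<rho>: "\<rho> \<in> Hom O.M F (O.img E B w)" "component \<rho> B x = w"
    and \<rho>s: "\<forall>X z. X \<in> compacts T \<longrightarrow> z \<in> carrier (FOb ?y X) \<longrightarrow>
      component \<rho> X (component s X z) = \<one>\<^bsub>FOb (O.img E B w) X\<^esub>"
    and im: "\<forall>X f. X \<in> compacts T \<longrightarrow> f \<in> Hom T X B \<longrightarrow> w \<cdot> f = ZeroM T X E \<longrightarrow>
      (\<exists>z\<in>carrier (FOb ?y X). FMor F f x = component s X z)"
    by (rule cokernel_module[OF yoneda_presents[OF A] pF s])
  let ?I = "O.img E B w"
  note If = presents_fin_pres[OF pI] and I = presentsD[OF pI]
  have sm: "s \<in> Hom (modTc T) ?y F" using modTc_HomI[OF yf Ff s] .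
  have \<rho>m: "\<rho> \<in> Hom (modTc T) F ?I" using modTc_HomI[OF Ff If \<rho>(1)] .
  have kz: "component \<rho> X z = \<one>\<^bsub>FOb ?I X\<^esub> \<Longrightarrow> \<exists>v\<in>carrier (FOb ?y X). z = component s X v"
    if X: "X \<in> compacts T" and z: "z \<in> carrier (FOb F X)" for X z
  proof -
    assume \<rho>z: "component \<rho> X z = \<one>\<^bsub>FOb ?I X\<^esub>"
    obtain f where f: "f \<in> Hom T X B" "z = FMor F f x" using presents_gen[OF pF X z] .
    have "component \<rho> X z = w \<cdot> f"
      using O.nat_natural[OF \<rho>(1), of f B X x] f X P(1,6) \<rho>(2) by (simp add: O.img_def)
    then have "w \<cdot> f = ZeroM T X E" using \<rho>z by (simp add: O.img_def)
    then show "\<exists>v\<in>carrier (FOb ?y X). z = component s X v" using im X f by auto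
  qed
  have zero: "zero_arr (modTc T) ?y ?I (\<rho> \<cdot>\<^bsub>O.M\<^esub> s)"
    unfolding vanish_arr[OF modTc_comp[OF sm \<rho>m]] using O.comp_component[OF s] \<rho>s by simp
  have "short_exact (modTc T) ?y s F \<rho> ?I"
    unfolding short_exact_def is_kernel_def is_cokernel_def modTc_simps(3)
  proof (intro conjI allI ballI impI)
    fix X \<phi> assume \<phi>: "\<phi> \<in> Hom (modTc T) X F" and z: "zero_arr (modTc T) X ?I (\<rho> \<cdot>\<^bsub>O.M\<^esub> \<phi>)"
    note X = modTc_HomD[OF \<phi>]
    have u: "r \<cdot>\<^bsub>O.M\<^esub> \<phi> \<in> Hom O.M X ?y" using O.nat_comp[OF X(1) r] .
    have rsv: "component r Y (component s Y v) = v" if "Y \<in> Ob Op" "v \<in> carrier (FOb ?y Y)" for Y v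
      using O.comp_component[OF s that, of r] rs O.ident_component[OF that] by simp
    have "s \<cdot>\<^bsub>O.M\<^esub> (r \<cdot>\<^bsub>O.M\<^esub> \<phi>) = \<phi>"
    proof (rule O.nat_ext[OF O.nat_comp[OF u s] X(1)])
      fix Y y assume Y: "Y \<in> Ob Op" and y: "y \<in> carrier (FOb X Y)"
      have Yc: "Y \<in> compacts T" using Y by simp
      have "component \<rho> Y (component \<phi> Y y) = \<one>\<^bsub>FOb ?I Y\<^esub>"
        using z[unfolded vanish_arr[OF modTc_comp[OF \<phi> \<rho>m]]] O.comp_component[OF X(1) Y y, of \<rho>] Yc y by simp
      then obtain v where v: "v \<in> carrier (FOb ?y Y)" "component \<phi> Y y = component s Y v"
        using kz[OF Yc O.nat_closed[OF X(1) Y y]] by blast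
      show "component (s \<cdot>\<^bsub>O.M\<^esub> (r \<cdot>\<^bsub>O.M\<^esub> \<phi>)) Y y = component \<phi> Y y"
        using O.comp_component[OF u Y y, of s] O.comp_component[OF X(1) Y y, of r] v rsv[OF Y v(1)] by simp
    qed
    moreover have "v = r \<cdot>\<^bsub>O.M\<^esub> \<phi>" if v: "v \<in> Hom (modTc T) X ?y" "s \<cdot>\<^bsub>O.M\<^esub> v = \<phi>" for v
      using O.M.comp_assoc[OF modTc_HomD(1)[OF v(1)] s r] v(2) rs O.M.ident_comp[OF modTc_HomD(1)[OF v(1)]] by simp
    ultimately show "\<exists>!u. u \<in> Hom (modTc T) X ?y \<and> s \<cdot>\<^bsub>O.M\<^esub> u = \<phi>"
      using modTc_HomI[OF X(2) yf u] by blast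
  next
    fix X \<psi> assume \<psi>: "\<psi> \<in> Hom (modTc T) F X" and z: "zero_arr (modTc T) ?y X (\<psi> \<cdot>\<^bsub>O.M\<^esub> s)"
    note X = modTc_HomD[OF \<psi>]
    note Xa = fin_pres_abfun[OF X(3)]
    obtain u where u: "u \<in> Hom O.M ?I X" "component u B w = component \<psi> B x"
    proof (rule O.pres_arrow_ex[OF I(3) Xa O.nat_closed[OF X(1) _ P(6)]])
      show "B \<in> Ob Op" using P(1) by simp
      fix Y f assume f: "f \<in> Hom Op B Y" and wf: "f \<cdot>\<^bsub>Op\<^esub> w = ZeroM Op E Y"
      note f' = Op_HomD[OF f]
      obtain v where v: "v \<in> carrier (FOb ?y Y)" "FMor F f x = component s Y v" using im f'(1,3) wf by auto
      have "FMor X f (component \<psi> B x) = component (\<psi> \<cdot>\<^bsub>O.M\<^esub> s) Y v"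
        using O.nat_natural[OF X(1) f P(6)] v(2) O.comp_component[OF s _ v(1), of \<psi>] f'(3) by simp
      then show "FMor X f (component \<psi> B x) = \<one>\<^bsub>FOb X Y\<^esub>"
        using z[unfolded vanish_arr[OF modTc_comp[OF sm \<psi>]]] v(1) f'(3) by simp
    qed (use that in blast)
    have eq: "v \<cdot>\<^bsub>O.M\<^esub> \<rho> = \<psi> \<longleftrightarrow> component v B w = component \<psi> B x" if v: "v \<in> Hom O.M ?I X" for v
    proof -
      have "component (v \<cdot>\<^bsub>O.M\<^esub> \<rho>) B x = component v B w"
        using O.comp_component[OF \<rho>(1) _ P(6), of v] P(1) \<rho>(2) by simp
      then show ?thesis using O.pres_ext[OF P(3) O.nat_comp[OF \<rho>(1) v] X(1)] by auto
    qed
    show "\<exists>!u. u \<in> Hom (modTc T) ?I X \<and> u \<cdot>\<^bsub>O.M\<^esub> \<rho> = \<psi>"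
    proof (rule ex1I[of _ u])
      show "u \<in> Hom (modTc T) ?I X \<and> u \<cdot>\<^bsub>O.M\<^esub> \<rho> = \<psi>" using modTc_HomI[OF If X(3) u(1)] eq[OF u(1)] u(2) by simp
      fix v assume v: "v \<in> Hom (modTc T) ?I X \<and> v \<cdot>\<^bsub>O.M\<^esub> \<rho> = \<psi>"
      then have vM: "v \<in> Hom O.M ?I X" using modTc_HomD(1) by blast
      show "v = u" using O.pres_ext[OF I(3) vM u(1)] eq[OF vM] v u(2) by simp
    qed
  qed (use sm \<rho>m zero in simp_all)
  then show ?thesis using S F unfolding serre_def by blast
qed

lemma unit_not_retract_of_limit:
  assumes S: "serre_ideal T S" "S \<noteq> Ob (modTc T)"
    and Q: "Q \<in> directed_limits S" and q: "q \<in> Hom O.M (yoneda T (Unit T)) Q" and v: "v \<in> Hom O.M Q (yoneda T (Unit T))"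
  shows "v \<cdot>\<^bsub>O.M\<^esub> q \<noteq> Ident O.M (yoneda T (Unit T))"
proof
  let ?U = "Unit T" and ?y = "yoneda T (Unit T)"
  assume vq: "v \<cdot>\<^bsub>O.M\<^esub> q = Ident O.M ?y"
  note Uc = unit_compact
  have idc: "Ident T ?U \<in> carrier (FOb ?y ?U)" using ident_hom[OF unit_ob] by simp
  have UO: "?U \<in> Ob Op" using Uc by simp
  have Ss: "serre (modTc T) S" using S(1) by (simp add: serre_ideal_def)
  \<comment> \<open>This is finite presentation of the unit at work: \<open>q\<close> amounts to one
    element of \<open>Q\<close> at the unit object, and that element already comes from some
    \<open>F\<close> in \<open>S\<close>.\<close>
  obtain F \<kappa> y where F: "F \<in> S" "\<kappa> \<in> Hom O.M F Q" "y \<in> carrier (FOb F ?U)" "component q ?U (Ident T ?U) = component \<kappa> ?U y"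
    using directed_limits_element[OF Q Uc O.nat_closed[OF q UO idc]] by metis
  have Ff: "F \<in> fin_pres T" using Ss F(1) by (auto simp: serre_def modTc_simps)
  obtain s where s: "s \<in> Hom (modTc T) ?y F" "component s ?U (Ident T ?U) = y" using element_arrow[OF Ff Uc F(3)] .
  note sM = modTc_HomD(1)[OF s(1)]
  have r: "v \<cdot>\<^bsub>O.M\<^esub> \<kappa> \<in> Hom O.M F ?y" using O.nat_comp[OF F(2) v] .
  have "(v \<cdot>\<^bsub>O.M\<^esub> \<kappa>) \<cdot>\<^bsub>O.M\<^esub> s = Ident O.M ?y"
  proof (rule O.pres_ext[OF presentsD(3)[OF yoneda_presents[OF Uc]] O.nat_comp[OF sM r] O.nat_ident[OF yoneda_abfun[OF unit_ob]]])
    have "component (v \<cdot>\<^bsub>O.M\<^esub> \<kappa> \<cdot>\<^bsub>O.M\<^esub> s) ?U (Ident T ?U) = component v ?U (component \<kappa> ?U y)"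
      using O.comp_component[OF sM UO idc] O.comp_component[OF F(2) UO F(3)] s(2) by simp
    also have "\<dots> = component (Ident O.M ?y) ?U (Ident T ?U)"
      using O.comp_component[OF q UO idc, of v] vq F(4) by simp
    finally show "component (v \<cdot>\<^bsub>O.M\<^esub> \<kappa> \<cdot>\<^bsub>O.M\<^esub> s) ?U (Ident T ?U) = component (Ident O.M ?y) ?U (Ident T ?U)" .
  qed
  then have yS: "?y \<in> S" using serre_retract[OF Ss F(1) Uc sM r] by blast
  have "G \<in> S" if "G \<in> Ob (modTc T)" for G
    using S(1) yS that unit_day_tensor[OF fin_pres_abfun, of G] unfolding serre_ideal_def modTc_simps by blast
  then show False using S(2) Ss by (auto simp: serre_def)
qed

subsection \<open>The Gabriel quotient\<close>

text \<open>
  Two roofs with common codomain are related as soon as their composites with arrows from a zero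
  object are inverted; this suffices to identify the arrows out of objects of \<open>L\<close>, and no calculus of
  fractions is needed.
\<close>

lemma zero_arrow_inverted:
  assumes Z: "zero_obj O.M Z" "Z \<in> L" and F: "F \<in> L" and s: "s \<in> Hom O.M Z F"
  shows "s \<in> iso_modulo O.M L"
proof -
  note Za = O.nat_abfun(1)[OF s] and Fa = O.nat_abfun(2)[OF s]
  note iZ = O.nat_ident[OF Za] and iF = O.nat_ident[OF Fa]
  have zs: "zero_arr O.M Z X f" if "f \<in> Hom O.M Z X" for f X
    unfolding O.zero_arr_M[OF that] using Z(1)[unfolded O.zero_obj_M] O.nat_one[OF that] by auto
  have uniq: "f = g" if "f \<in> Hom O.M X Z" "g \<in> Hom O.M X Z" for f g X
    using Z(1) O.nat_abfun(1)[OF that(1)] that unfolding zero_obj_def O.M_Ob by blast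
  have "is_kernel O.M Z (Ident O.M Z) Z F s"
    unfolding is_kernel_def
    using iZ s zs[OF O.nat_comp[OF iZ s]] uniq O.M.ident_comp by blast
  moreover have "is_cokernel O.M Z F s F (Ident O.M F)"
    unfolding is_cokernel_def
  proof (intro conjI allI ballI impI)
    fix X g assume g: "g \<in> Hom O.M F X"
    show "\<exists>!u. u \<in> Hom O.M F X \<and> u \<cdot>\<^bsub>O.M\<^esub> Ident O.M F = g"
      by (rule ex1I[of _ g]) (use g O.M.comp_ident in auto)
  qed (use s iF zs[OF O.nat_comp[OF s iF]] in auto)
  ultimately show ?thesis unfolding iso_modulo_def using Z(2) F by blast
qed

text \<open>Kernel and cokernel of an identity are zero objects, and \<open>iso_modulo\<close> asks
  for some choice of them in \<open>L\<close>.\<close>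

lemma ident_inverted:
  assumes Z: "zero_obj O.M Z" "Z \<in> L" and F: "is_abfun Op F"
  shows "Ident O.M F \<in> iso_modulo O.M L"
proof -
  have Za: "is_abfun Op Z" using Z(1) by (simp add: O.zero_obj_M)
  note iF = O.nat_ident[OF F] and a = O.zero_nat(1)[OF Za F] and b = O.zero_nat(1)[OF F Za]
  have uniq: "f = g" if "f \<in> Hom O.M X Z" "g \<in> Hom O.M X Z" for f g X
    using Z(1) O.nat_abfun(1)[OF that(1)] that unfolding zero_obj_def O.M_Ob by blast
  have uniq': "f = g" if "f \<in> Hom O.M Z X" "g \<in> Hom O.M Z X" for f g X
    using Z(1) O.nat_abfun(2)[OF that(1)] that unfolding zero_obj_def O.M_Ob by blast
  have "is_kernel O.M Z (O.zero_nat Z F) F F (Ident O.M F)"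
    unfolding is_kernel_def
  proof (intro conjI allI ballI impI)
    show "zero_arr O.M Z F (Ident O.M F \<cdot>\<^bsub>O.M\<^esub> O.zero_nat Z F)"
      using O.M.ident_comp[OF a] O.zero_arr_zero_nat[OF Za F] by simp
    fix X g assume g: "g \<in> Hom O.M X F" and z: "zero_arr O.M X F (Ident O.M F \<cdot>\<^bsub>O.M\<^esub> g)"
    note Xa = O.nat_abfun(1)[OF g]
    note c = O.zero_nat(1)[OF Xa Za]
    have "g = O.zero_nat X F" using z O.M.ident_comp[OF g] O.zero_arr_eq[OF g] by simp
    then have "O.zero_nat Z F \<cdot>\<^bsub>O.M\<^esub> O.zero_nat X Z = g"
      using O.nat_ext[OF O.nat_comp[OF c a] g] O.comp_component[OF c] O.zero_nat(2)[OF Za F] O.nat_closed[OF c] O.zero_nat(2)[OF Xa F]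
      by simp
    then show "\<exists>!u. u \<in> Hom O.M X Z \<and> O.zero_nat Z F \<cdot>\<^bsub>O.M\<^esub> u = g" using c uniq by blast
  qed (use a iF in auto)
  moreover have "is_cokernel O.M F F (Ident O.M F) Z (O.zero_nat F Z)"
    unfolding is_cokernel_def
  proof (intro conjI allI ballI impI)
    show "zero_arr O.M F Z (O.zero_nat F Z \<cdot>\<^bsub>O.M\<^esub> Ident O.M F)"
      using O.M.comp_ident[OF b] O.zero_arr_zero_nat[OF F Za] by simp
    fix X g assume g: "g \<in> Hom O.M F X" and z: "zero_arr O.M F X (g \<cdot>\<^bsub>O.M\<^esub> Ident O.M F)"
    note Xa = O.nat_abfun(2)[OF g]
    note c = O.zero_nat(1)[OF Za Xa]
    have "g = O.zero_nat F X" using z O.M.comp_ident[OF g] O.zero_arr_eq[OF g] by simp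
    then have "O.zero_nat Z X \<cdot>\<^bsub>O.M\<^esub> O.zero_nat F Z = g"
      using O.nat_ext[OF O.nat_comp[OF b c] g] O.comp_component[OF b] O.zero_nat(2)[OF Za Xa] O.nat_closed[OF b] O.zero_nat(2)[OF F Xa]
      by simp
    then show "\<exists>!u. u \<in> Hom O.M Z X \<and> u \<cdot>\<^bsub>O.M\<^esub> O.zero_nat F Z = g" using c uniq' by blast
  qed (use b iF in auto)
  ultimately show ?thesis unfolding iso_modulo_def using Z(2) by blast
qed

lemma roof_relI:
  assumes "(s, f) \<in> roofs O.M W X Y" "(s', f') \<in> roofs O.M W X Y" "s \<in> Hom O.M A X" "s' \<in> Hom O.M A' X"
    and "u \<in> Hom O.M P A" "u' \<in> Hom O.M P A'" "s \<cdot>\<^bsub>O.M\<^esub> u \<in> W"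
    and "s \<cdot>\<^bsub>O.M\<^esub> u = s' \<cdot>\<^bsub>O.M\<^esub> u'" "f \<cdot>\<^bsub>O.M\<^esub> u = f' \<cdot>\<^bsub>O.M\<^esub> u'"
  shows "((s, f), (s', f')) \<in> roof_rel O.M W X Y"
proof -
  have "\<exists>P. \<exists>u\<in>Hom O.M P (dom_of O.M s). \<exists>u'\<in>Hom O.M P (dom_of O.M s').
    s \<cdot>\<^bsub>O.M\<^esub> u \<in> W \<and> s \<cdot>\<^bsub>O.M\<^esub> u = s' \<cdot>\<^bsub>O.M\<^esub> u' \<and> f \<cdot>\<^bsub>O.M\<^esub> u = f' \<cdot>\<^bsub>O.M\<^esub> u'"
    unfolding O.M.dom_of_eq[OF assms(3)] O.M.dom_of_eq[OF assms(4)] using assms(5-9) by blast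
  then show ?thesis using assms(1,2) unfolding roof_rel_def by simp
qed

lemma roof_refl:
  assumes "r \<in> roofs O.M W X Y"
  shows "(r, r) \<in> roof_rel O.M W X Y"
proof -
  obtain s f Z where r: "r = (s, f)" "s \<in> Hom O.M Z X" "s \<in> W" "f \<in> Hom O.M Z Y"
    using assms by (auto simp: roofs_def)
  have i: "Ident O.M Z \<in> Hom O.M Z Z" using O.nat_ident[OF O.nat_abfun(1)[OF r(2)]] .
  show ?thesis
    using roof_relI[OF assms[unfolded r(1)] assms[unfolded r(1)] r(2) r(2) i i] r(1,3) O.M.comp_ident[OF r(2)] by simp
qed

lemma roof_total_of_limit:
  assumes Z: "zero_obj O.M Z" "Z \<in> L" and F: "F \<in> L"
    and r: "r \<in> roofs O.M (iso_modulo O.M L) F Y" "r' \<in> roofs O.M (iso_modulo O.M L) F Y"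
  shows "(r, r') \<in> roof_rel O.M (iso_modulo O.M L) F Y"
proof -
  obtain s f A where s: "r = (s, f)" "s \<in> Hom O.M A F" "f \<in> Hom O.M A Y" using r(1) by (auto simp: roofs_def)
  obtain s' f' A' where s': "r' = (s', f')" "s' \<in> Hom O.M A' F" "f' \<in> Hom O.M A' Y" using r(2) by (auto simp: roofs_def)
  have Za: "is_abfun Op Z" using Z(1) by (simp add: O.zero_obj_M)
  note u = O.zero_nat(1)[OF Za O.nat_abfun(1)[OF s(2)]] and u' = O.zero_nat(1)[OF Za O.nat_abfun(1)[OF s'(2)]]
  have uniq: "f = g" if "f \<in> Hom O.M Z X" "g \<in> Hom O.M Z X" for f g X
    using Z(1) O.nat_abfun(2)[OF that(1)] that unfolding zero_obj_def O.M_Ob by blast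
  have "s \<cdot>\<^bsub>O.M\<^esub> O.zero_nat Z A \<in> iso_modulo O.M L"
    using zero_arrow_inverted[OF Z F O.nat_comp[OF u s(2)]] .
  moreover have "s \<cdot>\<^bsub>O.M\<^esub> O.zero_nat Z A = s' \<cdot>\<^bsub>O.M\<^esub> O.zero_nat Z A'"
    using uniq[OF O.nat_comp[OF u s(2)] O.nat_comp[OF u' s'(2)]] .
  moreover have "f \<cdot>\<^bsub>O.M\<^esub> O.zero_nat Z A = f' \<cdot>\<^bsub>O.M\<^esub> O.zero_nat Z A'"
    using uniq[OF O.nat_comp[OF u s(3)] O.nat_comp[OF u' s'(3)]] .
  ultimately show ?thesis
    unfolding s(1) s'(1) by (rule roof_relI[OF r[unfolded s(1) s'(1)] s(2) s'(2) u u'])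
qed

lemma quotient_Hom:
  "Hom (gabriel_quotient O.M L) X Y = (if is_abfun Op X \<and> is_abfun Op Y
    then {(X, Y, \<phi>) | \<phi>. \<phi> \<in> roofs O.M (iso_modulo O.M L) X Y // roof_rel O.M (iso_modulo O.M L) X Y} else {})"
  by (simp add: gabriel_quotient_def fractions_def O.M_Ob)

text \<open>Totality stands in for symmetry and transitivity of \<open>roof_rel\<close>, which are
  not established.\<close>

lemma roof_class_UNIV:
  assumes "\<And>r r'. \<lbrakk>r \<in> roofs O.M W X Y; r' \<in> roofs O.M W X Y\<rbrakk> \<Longrightarrow> (r, r') \<in> roof_rel O.M W X Y"
    and "c \<in> roofs O.M W X Y // roof_rel O.M W X Y"
  shows "c = roofs O.M W X Y"
proof -
  obtain r where r: "r \<in> roofs O.M W X Y" "c = roof_rel O.M W X Y `` {r}" using assms(2) by (auto elim: quotientE)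
  moreover have "roof_rel O.M W X Y `` {r} \<subseteq> roofs O.M W X Y" by (auto simp: roof_rel_def)
  ultimately show ?thesis using assms(1)[OF r(1)] by auto
qed

text \<open>
  If all arrows from \<open>X\<close> to \<open>J\<close> in the quotient coincide, then an arrow from \<open>X\<close> to \<open>J\<close> equalizes the
  identity and the zero arrow of \<open>X\<close>.
\<close>

lemma quotient_monic_nonzero:
  assumes Z: "zero_obj O.M Z" "Z \<in> L"
    and mono: "monic (gabriel_quotient O.M L) X J i"
    and uniq: "\<And>f g. \<lbrakk>f \<in> Hom (gabriel_quotient O.M L) X J; g \<in> Hom (gabriel_quotient O.M L) X J\<rbrakk> \<Longrightarrow> f = g"
  obtains Q q v where "Q \<in> L" "q \<in> Hom O.M X Q" "v \<in> Hom O.M Q X" "v \<cdot>\<^bsub>O.M\<^esub> q = Ident O.M X"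
proof -
  let ?C = "gabriel_quotient O.M L" and ?W = "iso_modulo O.M L"
  have i: "i \<in> Hom ?C X J" using mono by (simp add: monic_def)
  then obtain \<psi> where Xa: "is_abfun Op X" and Ja: "is_abfun Op J" and \<psi>: "i = (X, J, \<psi>)"
    "\<psi> \<in> roofs O.M ?W X J // roof_rel O.M ?W X J"
    unfolding quotient_Hom by (auto split: if_splits)
  have cls: "(Y, Y', roof_rel O.M ?W Y Y' `` {r}) \<in> Hom ?C Y Y'"
    if "is_abfun Op Y" "is_abfun Op Y'" "r \<in> roofs O.M ?W Y Y'" for Y Y' r
    unfolding quotient_Hom using that by (auto intro: quotientI)
  \<comment> \<open>The arrows given by two roofs are equal by assumption; with reflexivity,
    equality of the classes relates the roofs themselves.\<close>
  have total: "(r, r') \<in> roof_rel O.M ?W X J" if r: "r \<in> roofs O.M ?W X J" "r' \<in> roofs O.M ?W X J" for r r'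
  proof -
    have "roof_rel O.M ?W X J `` {r} = roof_rel O.M ?W X J `` {r'}"
      using uniq[OF cls[OF Xa Ja r(1)] cls[OF Xa Ja r(2)]] by simp
    then show ?thesis using roof_refl[OF r(2)] by blast
  qed
  have \<psi>_all: "\<psi> = roofs O.M ?W X J" using roof_class_UNIV[OF total \<psi>(2)] .
  obtain r where "r \<in> roofs O.M ?W X J" using \<psi>(2) by (rule quotientE)
  then obtain t k A where tk: "(t, k) \<in> \<psi>" "t \<in> Hom O.M A X" "t \<in> ?W" "k \<in> Hom O.M A J"
    unfolding \<psi>_all roofs_def by blast
  note Aa = O.nat_abfun(1)[OF tk(2)]
  note idX = O.nat_ident[OF Xa] and idA = O.nat_ident[OF Aa]
  have idW: "Ident O.M X \<in> ?W" using ident_inverted[OF Z Xa] .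
  let ?o = "O.zero_nat X X"
  note o = O.zero_nat(1)[OF Xa Xa]
  have rid: "(Ident O.M X, Ident O.M X) \<in> roofs O.M ?W X X" using idX idW by (auto simp: roofs_def)
  have ro: "(Ident O.M X, ?o) \<in> roofs O.M ?W X X" using idX idW o by (auto simp: roofs_def)
  let ?c = "\<lambda>f. (X, X, roof_rel O.M ?W X X `` {(Ident O.M X, f)})"
  \<comment> \<open>Composition in the quotient collects the roofs related to some composite. As all
    roofs from \<open>X\<close> to \<open>J\<close> are related, a single composite, given by
    \<open>t'\<close> and \<open>f'\<close>, yields all of them.\<close>
  have comp: "Comp ?C i (?c f) = (X, J, roofs O.M ?W X J)"
    if f: "f \<in> Hom O.M X X" "(Ident O.M X, f) \<in> roofs O.M ?W X X" and P: "t' \<in> Hom O.M P X" "f' \<in> Hom O.M P A" "t' \<in> ?W"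
      "f \<cdot>\<^bsub>O.M\<^esub> t' = t \<cdot>\<^bsub>O.M\<^esub> f'" for f P t' f'
  proof -
    have "{r. \<exists>(s, f)\<in>roof_rel O.M ?W X X `` {(Ident O.M X, f)}. \<exists>(t, g)\<in>\<psi>.
       \<exists>P. \<exists>t'\<in>Hom O.M P (dom_of O.M f). \<exists>f'\<in>Hom O.M P (dom_of O.M g).
         t' \<in> ?W \<and> f \<cdot>\<^bsub>O.M\<^esub> t' = t \<cdot>\<^bsub>O.M\<^esub> f' \<and> (r, (s \<cdot>\<^bsub>O.M\<^esub> t', g \<cdot>\<^bsub>O.M\<^esub> f')) \<in> roof_rel O.M ?W X J}
      = roofs O.M ?W X J" (is "?S = _")
    proof
      show "?S \<subseteq> roofs O.M ?W X J" by (auto simp: roof_rel_def)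
      show "roofs O.M ?W X J \<subseteq> ?S"
      proof
        fix r assume r: "r \<in> roofs O.M ?W X J"
        have "(Ident O.M X \<cdot>\<^bsub>O.M\<^esub> t', k \<cdot>\<^bsub>O.M\<^esub> f') \<in> roofs O.M ?W X J"
          using O.M.ident_comp[OF P(1)] P O.nat_comp[OF P(2) tk(4)] by (auto simp: roofs_def)
        then have "(r, (Ident O.M X \<cdot>\<^bsub>O.M\<^esub> t', k \<cdot>\<^bsub>O.M\<^esub> f')) \<in> roof_rel O.M ?W X J" using total[OF r] by blast
        moreover have m: "(Ident O.M X, f) \<in> roof_rel O.M ?W X X `` {(Ident O.M X, f)}" using roof_refl[OF f(2)] by blast
        ultimately have "\<exists>P. \<exists>t'\<in>Hom O.M P (dom_of O.M f). \<exists>f'\<in>Hom O.M P (dom_of O.M k). t' \<in> ?W \<and>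
          f \<cdot>\<^bsub>O.M\<^esub> t' = t \<cdot>\<^bsub>O.M\<^esub> f' \<and> (r, (Ident O.M X \<cdot>\<^bsub>O.M\<^esub> t', k \<cdot>\<^bsub>O.M\<^esub> f')) \<in> roof_rel O.M ?W X J"
          unfolding O.M.dom_of_eq[OF f(1)] O.M.dom_of_eq[OF tk(4)] using P by blast
        then have "\<exists>(t, g)\<in>\<psi>. \<exists>P. \<exists>t'\<in>Hom O.M P (dom_of O.M f). \<exists>f'\<in>Hom O.M P (dom_of O.M g). t' \<in> ?W \<and>
          f \<cdot>\<^bsub>O.M\<^esub> t' = t \<cdot>\<^bsub>O.M\<^esub> f' \<and> (r, (Ident O.M X \<cdot>\<^bsub>O.M\<^esub> t', g \<cdot>\<^bsub>O.M\<^esub> f')) \<in> roof_rel O.M ?W X J"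
          using tk(1) by (rule_tac bexI[of _ "(t, k)"]) simp_all
        then show "r \<in> ?S" using m by (intro CollectI, rule_tac bexI[of _ "(Ident O.M X, f)"]) simp_all
      qed
    qed
    then show ?thesis unfolding \<psi>(1) gabriel_quotient_def fractions_def by simp
  qed
  have "Comp ?C i (?c (Ident O.M X)) = (X, J, roofs O.M ?W X J)"
    by (rule comp[OF idX rid tk(2) idA tk(3)]) (use O.M.ident_comp[OF tk(2)] O.M.comp_ident[OF tk(2)] in simp)
  moreover have "Comp ?C i (?c ?o) = (X, J, roofs O.M ?W X J)"
  proof (rule comp[OF o ro idX O.zero_nat(1)[OF Xa Aa] idW])
    have "t \<cdot>\<^bsub>O.M\<^esub> O.zero_nat X A = ?o"
      by (rule O.nat_ext[OF O.nat_comp[OF O.zero_nat(1)[OF Xa Aa] tk(2)] o])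
        (use O.comp_component[OF O.zero_nat(1)[OF Xa Aa]] O.zero_nat(2)[OF Xa Aa] O.zero_nat(2)[OF Xa Xa] O.nat_one[OF tk(2)] in simp)
    then show "?o \<cdot>\<^bsub>O.M\<^esub> Ident O.M X = t \<cdot>\<^bsub>O.M\<^esub> O.zero_nat X A" using O.M.comp_ident[OF o] by simp
  qed
  ultimately have "?c (Ident O.M X) = ?c ?o"
    using mono cls[OF Xa Xa rid] cls[OF Xa Xa ro] unfolding monic_def by metis
  \<comment> \<open>As \<open>i\<close> is monic, the identity and the zero arrow of
    \<open>X\<close> have the same image in the quotient. Unfolding the relation gives an inverted
    arrow \<open>u\<close> that is zero; its cokernel \<open>Q\<close> can be taken in
    \<open>L\<close>, and the identity of \<open>X\<close> factors over \<open>q\<close>.\<close>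
  then have "((Ident O.M X, ?o), (Ident O.M X, Ident O.M X)) \<in> roof_rel O.M ?W X X"
    using roof_refl[OF rid] by auto
  then obtain P u u' where u: "u \<in> Hom O.M P X" "u' \<in> Hom O.M P X" "Ident O.M X \<cdot>\<^bsub>O.M\<^esub> u \<in> ?W"
    "Ident O.M X \<cdot>\<^bsub>O.M\<^esub> u = Ident O.M X \<cdot>\<^bsub>O.M\<^esub> u'" "?o \<cdot>\<^bsub>O.M\<^esub> u = Ident O.M X \<cdot>\<^bsub>O.M\<^esub> u'"
    unfolding roof_rel_def using O.M.dom_of_eq[OF idX] by auto
  have uW: "u \<in> ?W" using u(3) O.M.ident_comp[OF u(1)] by simp
  have u0: "u = ?o \<cdot>\<^bsub>O.M\<^esub> u" using u(4,5) O.M.ident_comp[OF u(1)] by simp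
  have uz: "zero_arr O.M P X u"
    unfolding O.zero_arr_M[OF u(1)]
    using O.comp_component[OF u(1), of _ _ ?o] u0 O.zero_nat(2)[OF Xa Xa] O.nat_closed[OF u(1)] by metis
  obtain A' B' Q q where Q: "is_cokernel O.M A' B' u Q q" "Q \<in> L" using uW unfolding iso_modulo_def by blast
  have "A' = P" "B' = X" using Q(1) u(1) O.M.hom_disjoint unfolding is_cokernel_def by blast+
  then have cok: "is_cokernel O.M P X u Q q" using Q(1) by simp
  have q: "q \<in> Hom O.M X Q" using cok by (simp add: is_cokernel_def)
  have "zero_arr O.M P X (Ident O.M X \<cdot>\<^bsub>O.M\<^esub> u)" using uz O.M.ident_comp[OF u(1)] by simp
  then obtain v where "v \<in> Hom O.M Q X" "v \<cdot>\<^bsub>O.M\<^esub> q = Ident O.M X"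
    using cok idX unfolding is_cokernel_def by blast
  then show thesis using that[OF Q(2) q] by blast
qed

lemma E_object_properties:
  assumes B: "\<B> \<in> homological_primes T" and E: "is_E_object T \<B> E"
  shows "E \<in> definable_of T \<B>" "\<not> zero_obj T E"
proof -
  let ?L = "directed_limits \<B>" and ?y = "yoneda T (Unit T)"
  let ?C = "gabriel_quotient O.M ?L" and ?W = "iso_modulo O.M ?L"
  have BS: "serre_ideal T \<B>" "\<B> \<noteq> Ob (modTc T)" using B by (auto simp: homological_primes_def)
  have Bs: "serre (modTc T) \<B>" using BS(1) by (simp add: serre_ideal_def)
  then have Bf: "\<B> \<subseteq> fin_pres T" by (simp add: serre_def modTc_simps)
  have Eo: "E \<in> Ob T" using E by (simp add: is_E_object_def pure_injective_def)
  obtain R J where adj: "is_right_adjoint O.M ?C (gabriel_localisation O.M ?L) R"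
    and hull: "injective_hull ?C (FOb (gabriel_localisation O.M ?L) ?y) J"
    and iso: "isomorphic O.M (yoneda T E) (FOb R J)"
    using E unfolding is_E_object_def Let_def ModTc_def directed_limits_def by blast
  have Q: "FOb (gabriel_localisation O.M ?L) X = X" for X
    by (simp add: gabriel_localisation_def fractions_ftr_def)
  have Jo: "J \<in> Ob ?C" using hull by (simp add: injective_hull_def injective_obj_def)
  obtain i where mono: "monic ?C ?y J i" using hull Q by (auto simp: injective_hull_def essential_monic_def)
  obtain \<Phi> where \<Phi>: "\<And>X. X \<in> Ob O.M \<Longrightarrow> bij_betw (\<Phi> X J) (Hom ?C X J) (Hom O.M X (FOb R J))"
    using adj Jo unfolding is_right_adjoint_def Q by blast
  obtain e where e: "iso_arr O.M (yoneda T E) (FOb R J) e" using iso by (auto simp: isomorphic_def)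
  note eh = O.M.iso_arr_hom[OF e]
  note RJ = O.nat_abfun(2)[OF eh] and ya = yoneda_abfun[OF Eo]
  obtain Z where Z: "Z \<in> compacts T" "zero_obj O.M (yoneda T Z)" by (rule zero_module)
  have ZL: "yoneda T Z \<in> ?L"
    using serre_zero[OF Bs yoneda_fin_pres[OF Z(1)] Z(2)] directed_limits_contains[OF Bf] by blast
  \<comment> \<open>Arrows from \<open>F\<close> to \<open>yoneda T E\<close> correspond by
    adjunction to arrows from \<open>F\<close> to \<open>J\<close> in the quotient, and there any
    two of them coincide because \<open>F\<close> is in \<open>?L\<close>; so each equals the zero
    arrow.\<close>
  have van: "\<phi> = O.zero_nat F (yoneda T E)" if F: "F \<in> \<B>" and \<phi>: "\<phi> \<in> Hom O.M F (yoneda T E)" for F \<phi>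
  proof -
    note Fa = O.nat_abfun(1)[OF \<phi>]
    have FL: "F \<in> ?L" using F directed_limits_contains[OF Bf] by blast
    have one: "f = g" if "f \<in> Hom ?C F J" "g \<in> Hom ?C F J" for f g
    proof -
      have "c = roofs O.M ?W F J" if "c \<in> roofs O.M ?W F J // roof_rel O.M ?W F J" for c
        by (rule roof_class_UNIV[OF _ that]) (rule roof_total_of_limit[OF Z(2) ZL FL])
      then show ?thesis using that unfolding quotient_Hom by (auto split: if_splits)
    qed
    have bij: "bij_betw (\<Phi> F J) (Hom ?C F J) (Hom O.M F (FOb R J))" using \<Phi> Fa by (simp add: O.M_Ob)
    have z: "O.zero_nat F (yoneda T E) \<in> Hom O.M F (yoneda T E)" using O.zero_nat(1)[OF Fa ya] .
    have im: "e \<cdot>\<^bsub>O.M\<^esub> \<phi> \<in> \<Phi> F J ` Hom ?C F J" "e \<cdot>\<^bsub>O.M\<^esub> O.zero_nat F (yoneda T E) \<in> \<Phi> F J ` Hom ?C F J"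
      using bij O.nat_comp[OF \<phi> eh] O.nat_comp[OF z eh] by (auto simp: bij_betw_def)
    have one': "a = b" if ab: "a \<in> \<Phi> F J ` Hom ?C F J" "b \<in> \<Phi> F J ` Hom ?C F J" for a b
    proof -
      obtain f g where "f \<in> Hom ?C F J" "a = \<Phi> F J f" "g \<in> Hom ?C F J" "b = \<Phi> F J g" using ab by (elim imageE)
      then show ?thesis using one[of f g] by simp
    qed
    have "e \<cdot>\<^bsub>O.M\<^esub> \<phi> = e \<cdot>\<^bsub>O.M\<^esub> O.zero_nat F (yoneda T E)" using one'[OF im] .
    then show ?thesis using O.M.iso_cancel_left[OF e \<phi> z] by blast
  qed
  have "zero_arr O.M F (yoneda T E) \<phi>" if "F \<in> \<B>" "\<phi> \<in> Hom O.M F (yoneda T E)" for F \<phi>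
    unfolding van[OF that] using O.zero_arr_zero_nat[OF O.nat_abfun(1)[OF that(2)] ya] .
  then show "E \<in> definable_of T \<B>"
    unfolding definable_of_def ModTc_def using Eo by simp
  show "\<not> zero_obj T E"
  proof
    assume Ez: "zero_obj T E"
    have zE: "f = g" if "f \<in> Hom O.M X (yoneda T E)" "g \<in> Hom O.M X (yoneda T E)" for f g X
    proof (rule O.nat_ext[OF that])
      fix A x assume A: "A \<in> Ob Op" and x: "x \<in> carrier (FOb X A)"
      show "component f A x = component g A x"
        using O.nat_closed[OF that(1) A x] O.nat_closed[OF that(2) A x] zero_obj_hom(1)[OF Ez] by (metis hom_grp_simps(1) yoneda_simps(1))
    qed
    have zR: "f = g" if f: "f \<in> Hom O.M ?y (FOb R J)" and g: "g \<in> Hom O.M ?y (FOb R J)" for f g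
    proof -
      note e' = O.M.inv_arr[OF e]
      have "inv_arr O.M e \<cdot>\<^bsub>O.M\<^esub> f = inv_arr O.M e \<cdot>\<^bsub>O.M\<^esub> g" using zE[OF O.nat_comp[OF f e'(1)] O.nat_comp[OF g e'(1)]] .
      then show ?thesis using O.M.iso_cancel_left[OF e'(4) f g] by blast
    qed
    have bij: "bij_betw (\<Phi> ?y J) (Hom ?C ?y J) (Hom O.M ?y (FOb R J))"
      using \<Phi> yoneda_abfun[OF unit_ob] by (simp add: O.M_Ob)
    have one: "f = g" if fg: "f \<in> Hom ?C ?y J" "g \<in> Hom ?C ?y J" for f g
      using inj_onD[OF bij_betw_imp_inj_on[OF bij] zR fg] bij_betwE[OF bij] fg by blast
    obtain Q q v where Q: "Q \<in> ?L" "q \<in> Hom O.M ?y Q" "v \<in> Hom O.M Q ?y" "v \<cdot>\<^bsub>O.M\<^esub> q = Ident O.M ?y"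
      using quotient_monic_nonzero[OF Z(2) ZL mono one] .
    then show False using unit_not_retract_of_limit[OF BS Q(1-3)] by blast
  qed
qed

theorem Def_tensor_E_object:
  assumes B: "\<B> \<in> homological_primes T" and E: "is_E_object T \<B> E"
  shows "Def_tensor T E = definable_of T \<B>" "simple_tensor_closed_definable T (definable_of T \<B>)"
proof -
  note EB = E_object_properties[OF B E]
  have BS: "serre_ideal T \<B>" using B by (simp add: homological_primes_def)
  have tc: "tensor_closed_definable T (definable_of T \<B>)" using definable_of_closed[OF BS] .
  show "Def_tensor T E = definable_of T \<B>"
    unfolding Def_tensor_def
  proof (rule Set.equalityI)
    show "tensor_closed_definable T hull {E} \<subseteq> definable_of T \<B>"
      by (rule hull_minimal) (use EB(1) tc in auto)
    show "definable_of T \<B> \<subseteq> tensor_closed_definable T hull {E}"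
      unfolding hull_def
    proof (rule Inter_greatest)
      fix D assume "D \<in> {t. tensor_closed_definable T t \<and> {E} \<subseteq> t}"
      then have D: "tensor_closed_definable T D" "E \<in> D" by auto
      \<comment> \<open>Minimality speaks of subcategories of \<open>definable_of T \<B>\<close>, so
        \<open>D\<close> is intersected with it; the intersection contains the nonzero object
        \<open>E\<close>.\<close>
      have "tensor_closed_definable T (D \<inter> definable_of T \<B>)"
        using D(1) tc definable_Int by (auto simp: tensor_closed_definable_def)
      then have "D \<inter> definable_of T \<B> = definable_of T \<B>"
        using definable_of_minimal[OF B _ _ _ EB(2)] D(2) EB(1) by blast
      then show "definable_of T \<B> \<subseteq> D" by blast
    qed
  qed
  show "simple_tensor_closed_definable T (definable_of T \<B>)"
    unfolding simple_tensor_closed_definable_def using tc definable_of_minimal[OF B] by blast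
qed

end

theorem proposition4p4:
  fixes T :: "('o, 'v::universe, 'z) tt_cat_scheme"
    and \<B> :: "('o, 'v) abfun set"
    and E :: 'o
  assumes "rigidly_compactly_generated_tt T"
    and "\<B> \<in> homological_primes T"
    and "is_E_object T \<B> E"
  shows "Def_tensor T E = definable_of T \<B> \<and>
         simple_tensor_closed_definable T (Def_tensor T E)"
  using rigidly_compactly_generated_tt.Def_tensor_E_object[OF assms] by simp

end
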